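(* Let $m,n\ge1$ be fixed integers independent of $N$. Consider the contracting square-hexagon lattice $\mathcal R(\Omega,\check a)$ consisting of $2N+1$ rows of vertices, with edge weights $x_i,y_i>0$ assigned periodically with period $n$, i.e. $x_i=x_j$ and $y_i=y_j$ whenever $(i-j)\bmod n=0$ (and $a_i=a_j$ whenever $(i-j)\bmod n=0$), where $x_1>x_2>\cdots>x_n>0$. Assume that the boundary partition is $$(\lambda_1,(m-1)(N-2),(m-1)(N-3),\ldots,(m-1),0),\qquad \lambda_1\ge (m-1)(N-2),$$ with $\lambda_1=\alpha_1N+O(1)$, where $\alpha_1>1$ is a fixed number independent of $N$. For $\kappa\in(0,1)$, let $\mathbf m^\kappa$ be the weak limit, as $N\to\infty$, of the counting measure of the partition corresponding to the random dimer configuration at level $\kappa$ (the bottom boundary being at level $0$ and the top boundary at level $1$). Then for every positive integer $p$, $$\int_{\mathbb R}x^p\,\mathbf m^\kappa(dx)=\frac{1}{2(p+1)\pi\mathbf i}\oint_{C_{x_1,\ldots,x_n}}\frac{dz}{z}\left(zQ_\kappa'(z)+\sum_{j=1}^n\frac{z}{n(z-x_j)}\right)^{p+1},$$ where $\mathbf i^2=-1$, $C_{x_1,\ldots,x_n}$ is a simple, closed, positively oriented contour containing only the poles $x_1,\ldots,x_n$ of the integrand and no other singularities, and $$Q_\kappa'(z)=\frac{1}{n(1-\kappa)}\sum_{1\le j\le n}\left(\frac{mz^{m-1}}{z^m-x_j^m}-\frac{1}{z-x_j}\right)+\frac{\kappa}{n(1-\kappa)}\sum_{i\in\{1,2,\ldots,n\}\cap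 I_2}\frac{y_i}{1+y_iz}.$$
   Context: Square-hexagon lattice. Let $\check a=(a_i)$ be a sequence with entries in $\{0,1\}$. The square-hexagon lattice $SH(\check a)$ is the bipartite plane graph whose vertices lie on horizontal rows numbered from bottom to top; odd-numbered rows consist of white vertices and even-numbered rows of black vertices, each row being equally spaced with spacing $1$. Each black vertex of row $2s$ is adjacent to two white vertices of row $2s+1$ (its nearest upper-left and upper-right vertices, at horizontal distance $1/2$). If $a_s=1$, each white vertex of row $2s-1$ is adjacent to exactly one black vertex of row $2s$ (directly above it); if $a_s=0$, each white vertex of row $2s-1$ is adjacent to two black vertices of row $2s$ (its nearest upper-left and upper-right vertices, at horizontal distance $1/2$). Weights. Each NE-SW edge joining row $2s$ to row $2s+1$ has weight $x_s>0$; each NE-SW edge joining row $2s-1$ to row $2s$ (when $a_s=0$) has weight $y_s>0$; all other edges have weight $1$. Contracting lattice. Let $1=\Omega_1<\Omega_2<\cdots<\Omega_N$ be integers. The graph $\mathcal R(\Omega,\check a)$ is the subgraph of $SH(\check a)$ with rows $1,\ldots,2N+1$ as follows: row $1$ (the bottom boundary) consists of the white vertices of row $1$ of $SH(\check a)$ with horizontal coordinates $\Omega_1-\frac12,\ldots,\Omega_N-\frac12$; for $s=1,\ldots,N$, row $2s$ consists of the black vertices of row $2s$ of $SH(\check a)$ adjacent to at least one vertex of row $2s-1$ of $SH(\check a)$ lying between (inclusively) the leftmost and rightmost vertices of row $2s-1$ of $\mathcal R(\Omega,\check a)$; row $2s+1$ consists of the white vertices of row $2s+1$ of $SH(\check a)$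 adjacent to two vertices of row $2s$ of $\mathcal R(\Omega,\check a)$. The boundary partition is $\lambda=(\Omega_N-N,\Omega_{N-1}-(N-1),\ldots,\Omega_1-1)$. The set $I_2$ is the set of indices $i\in\{1,\ldots,N\}$ with $a_i=0$, i.e. such that vertices of row $2i-1$ are connected to two vertices of row $2i$. Dimer model. A dimer configuration (perfect matching) is a set of edges such that each vertex is incident to exactly one of them; it is chosen with probability proportional to the product of the weights of its edges. In a dimer configuration, for $0\le s<N$, exactly $M=N-s$ white vertices of row $2s+1$ are matched with vertices of row $2s+2$. Numbering the vertices of row $2s+1$ from left to right by $1,2,\ldots$ (for $s=0$, using the numbers $\Omega_i$), let $q_1<\cdots<q_M$ be the numbers of these vertices; the corresponding partition is $\mu=(q_M-M,\ldots,q_1-1)$. The counting measure of a partition $\mu=(\mu_1\ge\cdots\ge\mu_M\ge 0)$ is $\frac1M\sum_{i=1}^M\delta_{(\mu_i+M-i)/M}$. The counting measure at level $\kappa$ is that of the random partition $\mu$ at row $2\lfloor\kappa N\rfloor+1$; $\mathbf m^\kappa$ is the deterministic measure which is the limit in probability, in the weak topology, of these random measures as $N\to\infty$. *)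

theory Defs
  imports
    "HOL-Probability.Probability"
    "HOL-Complex_Analysis.Complex_Analysis"
    "HOL-Library.Landau_Symbols"
begin

text \<open>
  A vertex \<open>(r, u)\<close> lies on row \<open>r\<close> at horizontal coordinate \<open>u / 2\<close>. An edge is the pair
  (lower endpoint, upper endpoint). The sequences \<open>a\<close>, \<open>x\<close>, \<open>y\<close> are indexed from \<open>1\<close>;
  their value at \<open>0\<close> is never used.
\<close>

type_synonym vertex = "nat \<times> int"
type_synonym edge = "vertex \<times> vertex"

text \<open>
  The vertices of row \<open>r\<close> are the \<open>(r, u)\<close> with \<open>u\<close> congruent to \<open>row_shift a r\<close> modulo \<open>2\<close>. Row \<open>1\<close>
  has coordinates in \<open>1/2 + \<int>\<close>; passing to the next row shifts by \<open>1/2\<close>, except from row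
  \<open>2 s - 1\<close> to row \<open>2 s\<close> when \<open>a\<^sub>s = 1\<close>. There is no row \<open>0\<close>.
\<close>

fun row_shift :: "(nat \<Rightarrow> nat) \<Rightarrow> nat \<Rightarrow> nat" where
  "row_shift a 0 = 0"
| "row_shift a (Suc 0) = 1"
| "row_shift a (Suc (Suc r)) =
     (if even r \<and> a (Suc (Suc r) div 2) = 1 then row_shift a (Suc r) else row_shift a (Suc r) + 1)"

definition SH_row :: "(nat \<Rightarrow> nat) \<Rightarrow> nat \<Rightarrow> int set" where
  "SH_row a r = {u. even (u - int (row_shift a r))}"

definition SH_edges :: "(nat \<Rightarrow> nat) \<Rightarrow> edge set" where
  "SH_edges a = {((r, u), (Suc r, v)) | r u v.
     1 \<le> r \<and> u \<in> SH_row a r \<and> v \<in> SH_row a (Suc r) \<and>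
     (if odd r \<and> a (Suc r div 2) = 1 then v = u else \<bar>v - u\<bar> = 1)}"

text \<open>An edge runs NE-SW iff its upper endpoint lies to the right of its lower one.\<close>

fun edge_weight :: "(nat \<Rightarrow> real) \<Rightarrow> (nat \<Rightarrow> real) \<Rightarrow> edge \<Rightarrow> real" where
  "edge_weight x y ((r, u), (r', v)) =
     (if v = u + 1 then (if even r then x (r div 2) else y (Suc r div 2)) else 1)"

fun R_row :: "nat \<Rightarrow> (nat \<Rightarrow> nat) \<Rightarrow> (nat \<Rightarrow> nat) \<Rightarrow> nat \<Rightarrow> int set" where
  "R_row N \<Omega> a 0 = {}"
| "R_row N \<Omega> a (Suc 0) = {2 * int (\<Omega> i) - 1 | i. i \<in> {1..N}}"
| "R_row N \<Omega> a (Suc (Suc r)) =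
     (if even r
      then {v. \<exists>u. ((Suc r, u), (Suc (Suc r), v)) \<in> SH_edges a \<and>
              (\<exists>l \<in> R_row N \<Omega> a (Suc r). \<exists>h \<in> R_row N \<Omega> a (Suc r). l \<le> u \<and> u \<le> h)}
      else {v. \<exists>u \<in> R_row N \<Omega> a (Suc r). \<exists>u' \<in> R_row N \<Omega> a (Suc r). u \<noteq> u' \<and>
              ((Suc r, u), (Suc (Suc r), v)) \<in> SH_edges a \<and>
              ((Suc r, u'), (Suc (Suc r), v)) \<in> SH_edges a})"

definition R_vertices :: "nat \<Rightarrow> (nat \<Rightarrow> nat) \<Rightarrow> (nat \<Rightarrow> nat) \<Rightarrow> vertex set" where
  "R_vertices N \<Omega> a = {(r, u). 1 \<le> r \<and> r \<le> 2 * N + 1 \<and> u \<in> R_row N \<Omega> a r}"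

definition R_edges :: "nat \<Rightarrow> (nat \<Rightarrow> nat) \<Rightarrow> (nat \<Rightarrow> nat) \<Rightarrow> edge set" where
  "R_edges N \<Omega> a = {e \<in> SH_edges a. fst e \<in> R_vertices N \<Omega> a \<and> snd e \<in> R_vertices N \<Omega> a}"

definition boundary_partition :: "nat \<Rightarrow> (nat \<Rightarrow> nat) \<Rightarrow> nat list" where
  "boundary_partition N \<Omega> = map (\<lambda>j. \<Omega> j - j) (rev [1..<N + 1])"

definition dimer_configs :: "nat \<Rightarrow> (nat \<Rightarrow> nat) \<Rightarrow> (nat \<Rightarrow> nat) \<Rightarrow> edge set set" where
  "dimer_configs N \<Omega> a = {D. D \<subseteq> R_edges N \<Omega> a \<and>
     (\<forall>v \<in> R_vertices N \<Omega> a. \<exists>!e. e \<in> D \<and> (fst e = v \<or> snd e = v))}"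

definition dimer_weight :: "(nat \<Rightarrow> real) \<Rightarrow> (nat \<Rightarrow> real) \<Rightarrow> edge set \<Rightarrow> real" where
  "dimer_weight x y D = (\<Prod>e \<in> D. edge_weight x y e)"

definition dimer_measure ::
  "nat \<Rightarrow> (nat \<Rightarrow> nat) \<Rightarrow> (nat \<Rightarrow> nat) \<Rightarrow> (nat \<Rightarrow> real) \<Rightarrow> (nat \<Rightarrow> real) \<Rightarrow> edge set measure" where
  "dimer_measure N \<Omega> a x y =
     point_measure (dimer_configs N \<Omega> a)
       (\<lambda>D. ennreal (dimer_weight x y D / (\<Sum>D' \<in> dimer_configs N \<Omega> a. dimer_weight x y D')))"

text \<open>On row \<open>1\<close> (\<open>s = 0\<close>) the vertex at coordinate \<open>\<Omega>\<^sub>i - 1/2\<close> carries the number \<open>\<Omega>\<^sub>i\<close>.\<close>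

definition vertex_number ::
  "nat \<Rightarrow> (nat \<Rightarrow> nat) \<Rightarrow> (nat \<Rightarrow> nat) \<Rightarrow> nat \<Rightarrow> int \<Rightarrow> nat" where
  "vertex_number N \<Omega> a s u =
     (if s = 0 then nat ((u + 1) div 2) else card {w \<in> R_row N \<Omega> a (2 * s + 1). w \<le> u})"

text \<open>The partition at row \<open>2 s + 1\<close>, largest part first; the list \<open>q\<close> is indexed from \<open>0\<close>.\<close>

definition level_partition ::
  "nat \<Rightarrow> (nat \<Rightarrow> nat) \<Rightarrow> (nat \<Rightarrow> nat) \<Rightarrow> nat \<Rightarrow> edge set \<Rightarrow> nat list" where
  "level_partition N \<Omega> a s D =
     (let q = sorted_list_of_set
                (vertex_number N \<Omega> a s ` {u. \<exists>v. ((2 * s + 1, u), (2 * s + 2, v)) \<in> D})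
      in rev (map (\<lambda>i. q ! i - Suc i) [0..<length q]))"

definition counting_measure :: "nat list \<Rightarrow> real measure" where
  "counting_measure \<mu> =
     distr (uniform_count_measure {1..length \<mu>}) borel
       (\<lambda>i. (real (\<mu> ! (i - 1)) + real (length \<mu>) - real i) / real (length \<mu>))"

text \<open>
  Convergence in probability, for the weak topology, of random measures \<open>X N\<close> (defined on the
  probability spaces \<open>P N\<close>) to a deterministic measure \<open>\<mu>\<close>. It suffices to test each bounded
  continuous function separately, since finite intersections of the corresponding sets
  form a neighbourhood base of \<open>\<mu>\<close>.
\<close>

definition weak_limit_in_prob ::
  "(nat \<Rightarrow> 'c measure) \<Rightarrow> (nat \<Rightarrow> 'c \<Rightarrow> real measure) \<Rightarrow> real measure \<Rightarrow> bool" where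
  "weak_limit_in_prob P X \<mu> \<longleftrightarrow> real_distribution \<mu> \<and>
     (\<forall>f :: real \<Rightarrow> real. continuous_on UNIV f \<and> bounded (range f) \<longrightarrow>
       (\<forall>\<epsilon> > 0. (\<lambda>N. measure (P N)
           {D \<in> space (P N). \<bar>integral\<^sup>L (X N D) f - integral\<^sup>L \<mu> f\<bar> > \<epsilon>}) \<longlonglongrightarrow> 0))"

definition level_limit_measure ::
  "(nat \<Rightarrow> nat \<Rightarrow> nat) \<Rightarrow> (nat \<Rightarrow> nat) \<Rightarrow> (nat \<Rightarrow> real) \<Rightarrow> (nat \<Rightarrow> real) \<Rightarrow> real \<Rightarrow> real measure \<Rightarrow> bool"
  where
  "level_limit_measure \<Omega> a x y \<kappa> \<mu> \<longleftrightarrow>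
     weak_limit_in_prob
       (\<lambda>N. dimer_measure N (\<Omega> N) a x y)
       (\<lambda>N D. counting_measure (level_partition N (\<Omega> N) a (nat \<lfloor>\<kappa> * real N\<rfloor>) D)) \<mu>"

definition Q_deriv ::
  "nat \<Rightarrow> nat \<Rightarrow> (nat \<Rightarrow> nat) \<Rightarrow> (nat \<Rightarrow> real) \<Rightarrow> (nat \<Rightarrow> real) \<Rightarrow> real \<Rightarrow> complex \<Rightarrow> complex" where
  "Q_deriv m n a x y \<kappa> z =
     1 / (of_nat n * (1 - of_real \<kappa>)) *
       (\<Sum>j = 1..n. of_nat m * z ^ (m - 1) / (z ^ m - of_real (x j) ^ m) - 1 / (z - of_real (x j)))
     + of_real \<kappa> / (of_nat n * (1 - of_real \<kappa>)) *
       (\<Sum>i \<in> {i \<in> {1..n}. a i = 0}. of_real (y i) / (1 + of_real (y i) * z))"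

definition moment_integrand ::
  "nat \<Rightarrow> nat \<Rightarrow> (nat \<Rightarrow> nat) \<Rightarrow> (nat \<Rightarrow> real) \<Rightarrow> (nat \<Rightarrow> real) \<Rightarrow> real \<Rightarrow> nat \<Rightarrow> complex \<Rightarrow> complex"
  where
  "moment_integrand m n a x y \<kappa> p z =
     1 / z * (z * Q_deriv m n a x y \<kappa> z
              + (\<Sum>j = 1..n. z / (of_nat n * (z - of_real (x j))))) ^ (p + 1)"

definition x_poles :: "nat \<Rightarrow> (nat \<Rightarrow> real) \<Rightarrow> complex set" where
  "x_poles n x = {of_real (x j) | j. j \<in> {1..n}}"

text \<open>
  The singularities of the integrand other than \<open>x\<^sub>1, \<dots>, x\<^sub>n\<close>. The origin is not among them:
  the bracket vanishes there, so \<open>1 / z\<close> creates no singularity (the integrand equals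
  \<open>z ^ p\<close> times a function regular at \<open>0\<close>, with \<open>p \<ge> 1\<close>).
\<close>

definition other_poles ::
  "nat \<Rightarrow> nat \<Rightarrow> (nat \<Rightarrow> nat) \<Rightarrow> (nat \<Rightarrow> real) \<Rightarrow> (nat \<Rightarrow> real) \<Rightarrow> complex set" where
  "other_poles m n a x y =
     ({z. \<exists>j \<in> {1..n}. z ^ m = of_real (x j) ^ m} - x_poles n x)
     \<union> {- 1 / of_real (y i) | i. i \<in> {1..n} \<and> a i = 0}"

definition positive_contour_around :: "(real \<Rightarrow> complex) \<Rightarrow> complex set \<Rightarrow> complex set \<Rightarrow> bool" where
  "positive_contour_around \<gamma> A B \<longleftrightarrow>
     valid_path \<gamma> \<and> simple_path \<gamma> \<and> pathfinish \<gamma> = pathstart \<gamma> \<and>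
     (\<forall>z \<in> inside (path_image \<gamma>). winding_number \<gamma> z = 1) \<and>
     A \<subseteq> inside (path_image \<gamma>) \<and> B \<subseteq> outside (path_image \<gamma>)"

end

theory Submission
  imports Defs "HOL-Real_Asymp.Real_Asymp"
begin

text \<open>
  Reading the dimers row by row turns the law of the level-\<open>s\<close> set \<open>A\<close> of matched white vertices into
  a generating function \<open>\<Psi>\<close> built from alternants: dilating one variable by \<open>q\<close> multiplies the weight of a
  configuration by \<open>q ^ l\<close> summed over \<open>l \<in> A\<close>. For the staircase boundary with one free row, the
  alternant is a Vandermonde determinant in the \<open>m\<close>-th powers times a divided difference \<open>Phi\<close> of
  \<open>(1 - u) powr (- \<sigma>)\<close>, whose expansion has positive coefficients; Euler's relation then shows that one
  more node changes \<open>Phi\<close> by a bounded factor only. Hence, with \<open>q = exp (t / M)\<close>, the first two moments of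
  \<open>(\<Sum>l\<in>A. q ^ l) / M\<close> are contour integrals around \<open>x\<^sub>1, \<dots>, x\<^sub>n\<close> in which \<open>Phi\<close> disappears in the limit:
  the mean tends to \<open>L(t)\<close>, the sum of the integrals of \<open>exp (t F(z)) / (2 \<pi> i t z)\<close>, and, using two
  nested contours, the second moment tends to \<open>L(t)\<^sup>2\<close>. So the exponential moments concentrate, which
  gives the limit measure, and comparing the Taylor coefficients of \<open>t L(t)\<close> gives its moments. The
  computation needs distinct weights; these are obtained by a perturbation that is removed at the end.
\<close>

section \<open>Alternants\<close>

text \<open>Alternants take the place of Schur functions so that nothing is divided by a Vandermonde
  determinant before the weights are known to be distinct. The sum of all dilations of one variable
  acts diagonally on alternants of monomials, so exponential moments are exact at finite size. The
  obstacle is \<open>Phi\<close>, a divided difference at \<open>N\<close> nodes whose own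
  asymptotics are out of sight. It enters only through quotients: a dilation moves one node by an
  amount of order \<open>1 / N\<close>, so \<open>Phi\<close> changes by that amount times the
  quotient of \<open>Phi\<close> with one further node by \<open>Phi\<close>. A uniform bound of
  this quotient settles the matter, and positivity of the coefficients reduces complex nodes to real
  ones. So the free row leaves no trace in the limit. The choice \<open>t > 0\<close>, that is
  \<open>q > 1\<close>, keeps the dilated nodes inside \<open>[0, 1)\<close>. Integer
  \<open>t\<close> determine the limit measure, since polynomials in \<open>exp v\<close> are dense
  on a compact interval; all \<open>t > 0\<close> enter when power series are compared.\<close>

fun lap :: "((real => real) list => real) => real => (real => real) list => (real => real) list => real" where
  "lap F x pre [] = 0"
| "lap F x pre (\<phi> # \<psi>s) = \<phi> x * F (pre @ \<psi>s) - lap F x (pre @ [\<phi>]) \<psi>s"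

text \<open>For lists of equal length this is the determinant with rows \<open>us\<close> and
  columns \<open>\<phi>s\<close>, expanded along the first row; \<open>pre\<close> in
  \<open>lap\<close> collects the columns already passed. The recursive form turns every column
  operation into an induction on lists.\<close>

fun alt :: "real list => (real => real) list => real" where
  "alt [] \<phi>s = 1"
| "alt (x # us) \<phi>s = lap (alt us) x [] \<phi>s"

lemma lap_add_aux:
  assumes "!!A B. length A + length B + 1 = n ==> F (A @ h # B) = F (A @ f # B) + c * F (A @ g # B)"
    and "length A + length B + length \<psi>s = n"
  shows "lap F x (A @ h # B) \<psi>s = lap F x (A @ f # B) \<psi>s + c * lap F x (A @ g # B) \<psi>s"
  using assms(2)
proof (induction \<psi>s arbitrary: B)
  case (Cons \<psi> \<psi>s)
  have "F (A @ h # (B @ \<psi>s)) = F (A @ f # (B @ \<psi>s)) + c * F (A @ g # (B @ \<psi>s))" using Cons.prems by (intro assms(1)) auto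
  moreover have "lap F x (A @ h # (B @ [\<psi>])) \<psi>s = lap F x (A @ f # (B @ [\<psi>])) \<psi>s + c * lap F x (A @ g # (B @ [\<psi>])) \<psi>s"
    using Cons.prems by (intro Cons.IH) auto
  ultimately show ?case by (simp add: algebra_simps)
qed simp

text \<open>Multilinearity passes from the minors \<open>F\<close> to the expansion. There are two
  phases, before and after the column \<open>h\<close> is passed; in the second one \<open>h\<close>
  lies in the prefix, which is \<open>lap_add_aux\<close>.\<close>

lemma lap_add:
  assumes F: "!!A B. length A + length B + 1 = n ==> F (A @ h # B) = F (A @ f # B) + c * F (A @ g # B)"
    and h: "h = (%z. f z + c * g z)"
    and "length pre + length \<phi>s + length \<psi>s = n"
  shows "lap F x pre (\<phi>s @ h # \<psi>s) = lap F x pre (\<phi>s @ f # \<psi>s) + c * lap F x pre (\<phi>s @ g # \<psi>s)"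
  using assms(3)
proof (induction \<phi>s arbitrary: pre)
  case Nil
  have "lap F x (pre @ h # []) \<psi>s = lap F x (pre @ f # []) \<psi>s + c * lap F x (pre @ g # []) \<psi>s"
    using Nil by (intro lap_add_aux[where n = n] F) auto
  then show ?case by (simp add: h algebra_simps)
next
  case (Cons \<phi> \<phi>s)
  have "F (pre @ (\<phi>s @ h # \<psi>s)) = F (pre @ (\<phi>s @ f # \<psi>s)) + c * F (pre @ (\<phi>s @ g # \<psi>s))"
    using Cons.prems F[of "pre @ \<phi>s" \<psi>s] by auto
  moreover have "lap F x (pre @ [\<phi>]) (\<phi>s @ h # \<psi>s) =
      lap F x (pre @ [\<phi>]) (\<phi>s @ f # \<psi>s) + c * lap F x (pre @ [\<phi>]) (\<phi>s @ g # \<psi>s)" using Cons.prems by (intro Cons.IH) auto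
  ultimately show ?case by (simp add: algebra_simps)
qed

lemma alt_add:
  assumes "length \<phi>s + length \<psi>s + 1 = length us" and "h = (%z. f z + c * g z)"
  shows "alt us (\<phi>s @ h # \<psi>s) = alt us (\<phi>s @ f # \<psi>s) + c * alt us (\<phi>s @ g # \<psi>s)"
  using assms(1)
proof (induction us arbitrary: \<phi>s \<psi>s)
  case (Cons x us)
  show ?case unfolding alt.simps using Cons.prems by (intro lap_add[where n = "length us"] Cons.IH assms(2)) auto
qed simp

lemma lap_twice_aux:
  assumes "!!A B. length A + length B + 2 = n ==> F (A @ f # f # B) = 0"
    and "length A + length B + length \<psi>s + 1 = n"
  shows "lap F x (A @ f # f # B) \<psi>s = 0"
  using assms(2)
proof (induction \<psi>s arbitrary: B)
  case (Cons \<psi> \<psi>s)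
  have "F (A @ f # f # (B @ \<psi>s)) = 0" using Cons.prems by (intro assms(1)) auto
  moreover have "lap F x (A @ f # f # (B @ [\<psi>])) \<psi>s = 0" using Cons.prems by (intro Cons.IH) auto
  ultimately show ?case by simp
qed simp

text \<open>The two terms that delete one of the twin columns have the same minor and opposite
  signs; in all other terms the twins survive in the minor.\<close>

lemma lap_twice:
  assumes F: "!!A B. length A + length B + 2 = n ==> F (A @ f # f # B) = 0"
    and "length pre + length \<phi>s + length \<psi>s + 1 = n"
  shows "lap F x pre (\<phi>s @ f # f # \<psi>s) = 0"
  using assms(2)
proof (induction \<phi>s arbitrary: pre)
  case Nil
  then show ?case using lap_twice_aux[of n F f pre "[]" \<psi>s x] F by auto
next
  case (Cons \<phi> \<phi>s)
  have "F (pre @ (\<phi>s @ f # f # \<psi>s)) = 0" using Cons.prems F[of "pre @ \<phi>s" \<psi>s] by auto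
  moreover have "lap F x (pre @ [\<phi>]) (\<phi>s @ f # f # \<psi>s) = 0" using Cons.prems by (intro Cons.IH) auto
  ultimately show ?case by simp
qed

lemma alt_twice:
  assumes "length \<phi>s + length \<psi>s + 2 = length us"
  shows "alt us (\<phi>s @ f # f # \<psi>s) = 0"
  using assms
proof (induction us arbitrary: \<phi>s \<psi>s)
  case (Cons x us)
  show ?case unfolding alt.simps using Cons.prems by (intro lap_twice[where n = "length us"] Cons.IH) auto
qed simp

lemma lap_vanishing: "\<forall>\<psi>\<in>set \<psi>s. \<psi> x = 0 ==> lap F x pre \<psi>s = 0" by (induction \<psi>s arbitrary: pre) auto

lemma lap_single:
  assumes "\<forall>\<psi>\<in>set \<psi>s. \<psi> x = 0" "\<forall>\<psi>\<in>set \<phi>s. \<psi> x = 0"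
  shows "lap F x pre (\<phi>s @ g # \<psi>s) = (- 1) ^ length \<phi>s * g x * F (pre @ \<phi>s @ \<psi>s)"
  using assms(2) by (induction \<phi>s arbitrary: pre) (auto simp: lap_vanishing[OF assms(1)])

lemma lap_scale:
  assumes "!!cs. F (map (%\<psi> z. w z * \<psi> z) cs) = W * F cs"
  shows "lap F x (map (%\<psi> z. w z * \<psi> z) pre) (map (%\<psi> z. w z * \<psi> z) cs) = w x * W * lap F x pre cs"
proof (induction cs arbitrary: pre)
  case (Cons c cs)
  show ?case using Cons.IH[of "pre @ [c]"] assms[of "pre @ cs"] by (simp add: algebra_simps)
qed simp

lemma alt_scale: "alt us (map (%\<psi> z. w z * \<psi> z) cs) = (\<Prod>u\<leftarrow>us. w u) * alt us cs"
proof (induction us arbitrary: cs)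
  case (Cons x us)
  show ?case using lap_scale[of "alt us" w "\<Prod>u\<leftarrow>us. w u" x "[]" cs] Cons.IH by simp
qed simp

definition mons :: "nat list => (real => real) list" where
  "mons ls = map (%l z. z ^ l) ls"

lemma mons_simps [simp]: "mons [] = []" "mons (l # ls) = (%z. z ^ l) # mons ls"
  "mons (ls @ ks) = mons ls @ mons ks" "length (mons ls) = length ls" by (auto simp: mons_def)

lemma lap_shift:
  assumes "!!ks. length ks = n ==> (\<Sum>i<n. G i (mons ks)) = (\<Sum>k\<leftarrow>ks. q ^ k) * F (mons ks)"
    and "length pre + length ls = Suc n"
  shows "lap F (q * x) (mons pre) (mons ls) + (\<Sum>i<n. lap (G i) x (mons pre) (mons ls))
      = (\<Sum>k\<leftarrow>pre @ ls. q ^ k) * lap F x (mons pre) (mons ls)" using assms(2)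
proof (induction ls arbitrary: pre)
  case (Cons l ls)
  have "(\<Sum>i<n. lap (G i) x (mons pre) (mons (l # ls)))
     = x ^ l * (\<Sum>i<n. G i (mons (pre @ ls))) - (\<Sum>i<n. lap (G i) x (mons (pre @ [l])) (mons ls))"
    by (simp add: sum_subtractf sum_distrib_left)
  also have "(\<Sum>i<n. G i (mons (pre @ ls))) = (\<Sum>k\<leftarrow>pre @ ls. q ^ k) * F (mons (pre @ ls))" using Cons.prems by (intro assms) auto
  finally have *: "(\<Sum>i<n. lap (G i) x (mons pre) (mons (l # ls)))
     = x ^ l * ((\<Sum>k\<leftarrow>pre @ ls. q ^ k) * F (mons (pre @ ls)))
       - (\<Sum>i<n. lap (G i) x (mons (pre @ [l])) (mons ls))" .
  show ?case unfolding * using Cons.IH[of "pre @ [l]"] Cons.prems by (simp add: algebra_simps)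
qed simp

text \<open>A dilation of one point multiplies its entry in the column of exponent \<open>l\<close>
  by \<open>q ^ l\<close>. Each term of the determinant pairs points with exponents bijectively, so
  summing over the points produces the same factor for every term: the sum of dilations is diagonal
  on alternants of monomials.\<close>

lemma alt_shift:
  assumes "length us = length ls"
  shows "(\<Sum>i<length us. alt (us[i := q * us ! i]) (mons ls)) = (\<Sum>l\<leftarrow>ls. q ^ l) * alt us (mons ls)"
  using assms
proof (induction us arbitrary: ls)
  case (Cons x us)
  have "lap (alt us) (q * x) (mons []) (mons ls) +
      (\<Sum>i<length us. lap (alt (us[i := q * us ! i])) x (mons []) (mons ls))
      = (\<Sum>k\<leftarrow>[] @ ls. q ^ k) * lap (alt us) x (mons []) (mons ls)"
  proof (intro lap_shift)
    show "(\<Sum>i<length us. alt (us[i := q * us ! i]) (mons ks)) = (\<Sum>k\<leftarrow>ks. q ^ k) * alt us (mons ks)"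
      if "length ks = length us" for ks using that by (intro Cons.IH) simp
  qed (use Cons.prems in simp)
  then show ?case by (simp add: sum.lessThan_Suc_shift del: sum.lessThan_Suc)
qed simp

lemma lap_cong:
  assumes "!!cs ds. list_all2 (%f g. \<forall>u\<in>S. f u = g u) cs ds ==> F cs = F ds" and "x \<in> S"
    and "list_all2 (%f g. \<forall>u\<in>S. f u = g u) pre pre'"
    and "list_all2 (%f g. \<forall>u\<in>S. f u = g u) cs ds"
  shows "lap F x pre cs = lap F x pre' ds"
  using assms(4,3)
proof (induction cs ds arbitrary: pre pre' rule: list_all2_induct)
  case (Cons c cs d ds)
  have "F (pre @ cs) = F (pre' @ ds)" using Cons by (intro assms(1) list_all2_appendI)
  moreover have "lap F x (pre @ [c]) cs = lap F x (pre' @ [d]) ds" using Cons by (intro Cons.IH list_all2_appendI) auto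
  ultimately show ?case using Cons assms(2) by simp
qed simp

text \<open>Column identities are required at the points of \<open>us\<close> only. Below they come
  from power series and real powers, which are controlled on a restricted set of points.\<close>

lemma alt_cong:
  assumes "list_all2 (%f g. \<forall>u\<in>S. f u = g u) cs ds" and "set us \<subseteq> S"
  shows "alt us cs = alt us ds"
  using assms
proof (induction us arbitrary: cs ds)
  case (Cons x us)
  then show ?case by (auto intro!: lap_cong[where S = S])
qed simp

lemma alt_column_op:
  assumes "length A + length B + 2 = length us"
  shows "alt us (A @ (%z. f z + c * g z) # g # B) = alt us (A @ f # g # B)"
    and "alt us (A @ g # (%z. f z + c * g z) # B) = alt us (A @ g # f # B)"
proof -
  show "alt us (A @ (%z. f z + c * g z) # g # B) = alt us (A @ f # g # B)"
    using assms by (subst alt_add[OF _ refl]) (auto simp: alt_twice)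
  have "alt us ((A @ [g]) @ (%z. f z + c * g z) # B) = alt us ((A @ [g]) @ f # B) + c * alt us ((A @ [g]) @ g # B)"
    using assms by (intro alt_add[OF _ refl]) auto
  moreover have "alt us (A @ g # g # B) = 0" using assms by (intro alt_twice) auto
  ultimately show "alt us (A @ g # (%z. f z + c * g z) # B) = alt us (A @ g # f # B)" by simp
qed

definition pows :: "(real => real) => nat => (real => real) list" where
  "pows \<tau> r = map (%k z. \<tau> z ^ k) (rev [0..<r])"

lemma pows_Suc: "pows \<tau> (Suc r) = (%z. \<tau> z ^ r) # pows \<tau> r" by (simp add: pows_def)

lemma pows_0: "pows \<tau> 0 = []" by (simp add: pows_def)

lemma length_pows [simp]: "length (pows \<tau> r) = r" by (simp add: pows_def)

text \<open>Each power is diminished by \<open>c\<close> times its right neighbour. Undoing this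
  from the right keeps the neighbour in use intact. With \<open>c\<close> the value of
  \<open>\<tau>\<close> at a point, every column of the block except the constant one vanishes
  there.\<close>

lemma alt_pows_op:
  assumes "length A + length B + Suc r = length us"
  shows "alt us (A @ map (%\<psi> z. (\<tau> z - c) * \<psi> z) (pows \<tau> r) @ (%z. 1) # B) = alt us (A @ pows \<tau> (Suc r) @ B)"
  using assms
proof (induction r arbitrary: A)
  case 0
  then show ?case by (simp add: pows_Suc pows_0)
next
  case (Suc r)
  let ?h = "%z. \<tau> z ^ Suc r + (- c) * \<tau> z ^ r"
  have "(%z. (\<tau> z - c) * \<tau> z ^ r) = ?h" by (auto simp: algebra_simps)
  then have "alt us (A @ map (%\<psi> z. (\<tau> z - c) * \<psi> z) (pows \<tau> (Suc r)) @ (%z. 1) # B)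
      = alt us ((A @ [?h]) @ map (%\<psi> z. (\<tau> z - c) * \<psi> z) (pows \<tau> r) @ (%z. 1) # B)" by (simp add: pows_Suc)
  also have "... = alt us ((A @ [?h]) @ pows \<tau> (Suc r) @ B)" using Suc by (intro Suc.IH) auto
  also have "... = alt us (A @ ?h # (%z. \<tau> z ^ r) # pows \<tau> r @ B)" by (simp add: pows_Suc)
  also have "... = alt us (A @ (%z. \<tau> z ^ Suc r) # (%z. \<tau> z ^ r) # pows \<tau> r @ B)" using Suc.prems by (intro alt_column_op) auto
  finally show ?case by (simp add: pows_Suc)
qed

section \<open>Vandermonde products and divided differences\<close>

fun vdm :: "real list => real" where
  "vdm [] = 1"
| "vdm (x # xs) = (\<Prod>y\<leftarrow>xs. y - x) * vdm xs"

text \<open>This is \<open>c ^ r\<close> times the sign \<open>(- 1) ^ (r * (r - 1) div 2)\<close>,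
  collected from \<open>r\<close> Laplace expansions along a row whose one surviving entry stands
  behind the remaining power columns.\<close>

fun vdm_sign :: "nat => real => real" where
  "vdm_sign 0 c = 1"
| "vdm_sign (Suc r) c = (- 1) ^ r * c * vdm_sign r c"

lemma vdm_sign_nonzero: "c ~= 0 ==> vdm_sign r c ~= 0" by (induction r) auto

text \<open>Subtracting from each column a multiple of its neighbour makes all columns but one vanish at
  the first point; the remaining ones acquire the factor \<open>\<tau> z - \<tau> x\<close>.\<close>

lemma alt_divided_difference:
  fixes P :: "real list => real"
  assumes dd: "!!a b l. set (a # b # l) \<subseteq> S ==> P (a # l) - P (b # l) = c * (a - b) * P (a # b # l)"
    and sym: "!!l l'. mset l = mset l' ==> P l = P l'"
    and "length us = Suc r" and "set (map \<tau> us) \<subseteq> S" and "set ns \<subseteq> S"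
  shows "alt us (pows \<tau> r @ [%z. P (\<tau> z # ns)]) = vdm_sign r c * vdm (map \<tau> us) * P (map \<tau> us @ ns)"
  using assms(3-)
proof (induction us arbitrary: r ns)
  case (Cons x us)
  show ?case
  proof (cases r)
    case 0
    then show ?thesis using Cons by (simp add: pows_0)
  next
    case (Suc r')
    have us: "length us = Suc r'" using Cons Suc by simp
    let ?P = "%z. P (\<tau> z # ns)"
    have "alt (x # us) (pows \<tau> r @ [?P]) = alt (x # us) (pows \<tau> (Suc r') @ [?P])" by (simp add: Suc)
    also have "... = alt (x # us) ([] @ map (%\<psi> z. (\<tau> z - \<tau> x) * \<psi> z) (pows \<tau> r') @ (%z. 1) # [?P])"
      using us by (subst alt_pows_op) (auto simp: pows_Suc pows_0)
    also have "... = alt (x # us) (map (%\<psi> z. (\<tau> z - \<tau> x) * \<psi> z) (pows \<tau> r') @ (%z. 1) # [%z. ?P z + (- ?P x) * 1])"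
      using us by (subst alt_column_op(2)) auto
    also have "... = (- 1) ^ r' * alt us (map (%\<psi> z. (\<tau> z - \<tau> x) * \<psi> z) (pows \<tau> r') @ [%z. ?P z + (- ?P x) * 1])"
      by (simp, subst lap_single) auto
    \<comment> \<open>The divided difference rule makes the last column a multiple of
      \<open>\<tau> z - \<tau> x\<close> as well, with \<open>\<tau> x\<close> absorbed as a new
      node. The rule is available on \<open>S\<close> only, hence the comparison of values at
      \<open>us\<close>.\<close>
    also have "alt us (map (%\<psi> z. (\<tau> z - \<tau> x) * \<psi> z) (pows \<tau> r') @ [%z. ?P z + (- ?P x) * 1])
       = alt us (map (%\<psi> z. (\<tau> z - \<tau> x) * \<psi> z) (pows \<tau> r') @ [%z. 0 + c * ((\<tau> z - \<tau> x) * P (\<tau> z # \<tau> x # ns))])"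
    proof (rule alt_cong)
      have "?P z + - ?P x * 1 = 0 + c * ((\<tau> z - \<tau> x) * P (\<tau> z # \<tau> x # ns))" if "z \<in> set us" for z
        using dd[of "\<tau> z" "\<tau> x" ns] that Cons.prems by auto
      then show "list_all2 (%f g. \<forall>u\<in>set us. f u = g u)
       (map (%\<psi> z. (\<tau> z - \<tau> x) * \<psi> z) (pows \<tau> r') @ [%z. ?P z + - ?P x * 1])
       (map (%\<psi> z. (\<tau> z - \<tau> x) * \<psi> z) (pows \<tau> r') @ [%z. 0 + c * ((\<tau> z - \<tau> x) * P (\<tau> z # \<tau> x # ns))])"
        by (intro list_all2_appendI list.rel_refl) auto
    qed auto
    also have "... = c * alt us (map (%\<psi> z. (\<tau> z - \<tau> x) * \<psi> z) (pows \<tau> r' @ [%z. P (\<tau> z # \<tau> x # ns)]))"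
    proof -
      have "(%z. (0::real)) = (%z. 0 * (1::real) + 0 * 1)" by simp
      have zero: "alt us (map (%\<psi> z. (\<tau> z - \<tau> x) * \<psi> z) (pows \<tau> r') @ [%z. 0]) = 0"
        using alt_add[of "map (%\<psi> z. (\<tau> z - \<tau> x) * \<psi> z) (pows \<tau> r')" "[]" us "%z. 0" "%z. 0" 1 "%z. 0"] us by auto
      show ?thesis using us by (subst alt_add[OF _ refl]) (auto simp: zero)
    qed
    also have "alt us (map (%\<psi> z. (\<tau> z - \<tau> x) * \<psi> z) (pows \<tau> r' @ [%z. P (\<tau> z # \<tau> x # ns)]))
        = (\<Prod>u\<leftarrow>us. \<tau> u - \<tau> x) * alt us (pows \<tau> r' @ [%z. P (\<tau> z # \<tau> x # ns)])" by (rule alt_scale)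
    also have "alt us (pows \<tau> r' @ [%z. P (\<tau> z # \<tau> x # ns)])
        = vdm_sign r' c * vdm (map \<tau> us) * P (map \<tau> us @ \<tau> x # ns)" using Cons us by (intro Cons.IH) auto
    also have "P (map \<tau> us @ \<tau> x # ns) = P (map \<tau> (x # us) @ ns)" by (rule sym) auto
    finally show ?thesis by (simp add: Suc o_def)
  qed
qed simp

section \<open>Sums over injections: the two kinds of lattice rows\<close>

definition inj_funs :: "'a set => ('a => 'b set) => ('a => 'b) set" where
  "inj_funs A S = {e \<in> PiE A S. inj_on e A}"

lemma finite_inj_funs: "finite A ==> (!!a. a \<in> A ==> finite (S a)) ==> finite (inj_funs A S)"
  unfolding inj_funs_def by (rule finite_subset[OF _ finite_PiE[of A S]]) auto

text \<open>The value at the new element is chosen last, among those that the others leave;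
  extensionality makes updating and restricting mutually inverse.\<close>

lemma sum_inj_funs_insert:
  assumes "a \<notin> A" "finite A" "!!k. k \<in> insert a A ==> finite (S k)"
  shows "(\<Sum>e\<in>inj_funs (insert a A) S. f e) = (\<Sum>e\<in>inj_funs A S. \<Sum>j\<in>S a - e ` A. f (e(a := j)))"
proof -
  have "(\<Sum>e\<in>inj_funs A S. \<Sum>j\<in>S a - e ` A. f (e(a := j))) =
     (\<Sum>(e, j)\<in>(SIGMA e:inj_funs A S. S a - e ` A). f (e(a := j)))" using assms by (intro sum.Sigma) (auto intro!: finite_inj_funs)
  also have "... = (\<Sum>e\<in>inj_funs (insert a A) S. f e)"
  proof (rule sum.reindex_bij_witness[where i = "%e. (e(a := undefined), e a)" and j = "%(e, j). e(a := j)"], goal_cases)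
    case (1 p)
    then show ?case using assms(1) by (auto simp: inj_funs_def PiE_def extensional_def)
  next
    case (2 p)
    then obtain e j where p: "p = (e, j)" "e \<in> inj_funs A S" "j \<in> S a" "j \<notin> e ` A" by auto
    have "e(a := j) \<in> PiE (insert a A) S" using p by (auto simp: inj_funs_def PiE_def extensional_def Pi_def)
    moreover have "inj_on (e(a := j)) (insert a A)" using p assms(1) by (auto simp: inj_funs_def inj_on_def)
    ultimately show ?case using p by (simp add: inj_funs_def)
  next
    case (3 e)
    then show ?case by simp
  next
    case (4 e)
    then have e: "e \<in> PiE (insert a A) S" "inj_on e (insert a A)" by (auto simp: inj_funs_def)
    have "e(a := undefined) \<in> PiE A S" using e assms(1) by (auto simp: PiE_def extensional_def Pi_def)
    moreover have "inj_on (e(a := undefined)) A" using e(2) assms(1) by (auto simp: inj_on_def)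
    moreover have "e a \<notin> (e(a := undefined)) ` A" using e(2) assms(1) by (auto simp: inj_on_def)
    moreover have "e a \<in> S a" using e by auto
    ultimately show ?case by (auto simp: inj_funs_def)
  qed auto
  finally show ?thesis ..
qed

abbreviation slist :: "nat set => nat list" where
  "slist \<equiv> sorted_list_of_set"

lemma slist_insert_max:
  assumes "finite A" "!!a. a \<in> A ==> a < w"
  shows "slist (insert w A) = slist A @ [w]"
proof -
  have "w \<notin> A" using assms(2) by blast
  then have "slist (insert w A) = insort w (slist A)" using assms by simp
  also have "... = slist A @ [w]" using assms by (intro sorted_insort_is_snoc) (auto simp: less_imp_le)
  finally show ?thesis .
qed

lemma prod_fun_upd_insert:
  "a \<notin> A ==> finite A ==> (\<Prod>k\<in>insert a A. c k ((e(a := j)) k)) = c a j * (\<Prod>k\<in>A. c k (e k))"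
proof -
  assume "a \<notin> A" "finite A"
  moreover from this have "(\<Prod>k\<in>A. c k ((e(a := j)) k)) = (\<Prod>k\<in>A. c k (e k))" by (intro prod.cong) auto
  ultimately show ?thesis by simp
qed

text \<open>Injectivity costs nothing: the only possible collision, \<open>k - 1\<close> and
  \<open>k\<close> both going to \<open>k\<close>, would produce two equal adjacent columns. Once it
  is dropped, the sum is multilinear and the column of \<open>k\<close> becomes
  \<open>z ^ k + y * z ^ Suc k\<close>. The columns \<open>\<phi>s\<close> on the right hold the
  larger elements, which are treated before the smaller ones.\<close>

lemma alt_up_step:
  fixes y :: real
  assumes "finite A" "card A + length \<phi>s = length us"
  shows "(\<Sum>e\<in>inj_funs A (%k. {k, Suc k}). (\<Prod>k\<in>A. if e k = Suc k then y else 1) * alt us (mons (slist (e ` A)) @ \<phi>s))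
     = alt us (map (%\<psi> z. (1 + y * z) * \<psi> z) (mons (slist A)) @ \<phi>s)" using assms
proof (induction A arbitrary: \<phi>s rule: finite_linorder_max_induct)
  case empty
  then show ?case by (simp add: inj_funs_def)
next
  case (insert k A)
  have k: "k \<notin> A" using insert by blast
  let ?wt = "%A e. \<Prod>k\<in>A. if e k = Suc k then y else (1::real)"
  have len: "length (slist A) + length \<phi>s + 1 = length us" using insert k by simp
  have inner: "(\<Sum>j\<in>{k, Suc k} - e ` A. ?wt (insert k A) (e(k := j)) * alt us (mons (slist ((e(k := j)) ` insert k A)) @ \<phi>s))
    = ?wt A e * (alt us (mons (slist (e ` A)) @ (%z. z ^ k) # \<phi>s) + y * alt us (mons (slist (e ` A)) @ (%z. z ^ Suc k) # \<phi>s))"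
    if e: "e \<in> inj_funs A (%k. {k, Suc k})" for e
  proof -
    have le: "j <= k" if "j \<in> e ` A" for j using that e insert.hyps by (fastforce simp: inj_funs_def PiE_def Pi_def)
    have ce: "card (e ` A) = card A" using e by (auto simp: inj_funs_def card_image)
    have upd: "(e(k := j)) ` insert k A = insert j (e ` A)" for j using k by auto
    have wt: "?wt (insert k A) (e(k := j)) = (if j = Suc k then y else 1) * ?wt A e" for j
      using prod_fun_upd_insert[of k A "%k j. if j = Suc k then y else 1" e j] k insert.hyps by simp
    have S: "slist (insert (Suc k) (e ` A)) = slist (e ` A) @ [Suc k]"
      using le insert.hyps by (intro slist_insert_max) (auto simp: le_imp_less_Suc)
    have nS: "Suc k \<notin> e ` A" using le by force
    show ?thesis
    \<comment> \<open>If \<open>k\<close> is taken, the forbidden choice \<open>k\<close> would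
      repeat a column; it may be added as a zero term, and both cases give the same formula.\<close>
    proof (cases "k \<in> e ` A")
      case True
      have "slist (e ` A) = slist (insert k (e ` A - {k}))" using True by (simp add: insert_absorb)
      also have "... = slist (e ` A - {k}) @ [k]"
        using le insert.hyps by (intro slist_insert_max) (auto simp: order.strict_iff_order)
      finally have sl: "slist (e ` A) = slist (e ` A - {k}) @ [k]" .
      have "length (slist (e ` A)) + length \<phi>s + 1 = length us" using len ce insert.hyps by simp
      then have "alt us (mons (slist (e ` A)) @ (%z. z ^ k) # \<phi>s) = 0" unfolding sl by (simp, intro alt_twice) auto
      moreover have "{k, Suc k} - e ` A = {Suc k}" using True nS by auto
      ultimately show ?thesis by (simp add: upd wt S del: fun_upd_apply image_insert)
    next
      case False
      have "slist (insert k (e ` A)) = slist (e ` A) @ [k]"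
        using le False insert.hyps by (intro slist_insert_max) (auto simp: order.strict_iff_order)
      moreover have "{k, Suc k} - e ` A = {k, Suc k}" using False nS by auto
      ultimately show ?thesis by (simp add: upd wt S algebra_simps del: fun_upd_apply image_insert)
    qed
  qed
  have "(\<Sum>e\<in>inj_funs (insert k A) (%k. {k, Suc k}). ?wt (insert k A) e * alt us (mons (slist (e ` insert k A)) @ \<phi>s))
    = (\<Sum>e\<in>inj_funs A (%k. {k, Suc k}). \<Sum>j\<in>{k, Suc k} - e ` A.
       ?wt (insert k A) (e(k := j)) * alt us (mons (slist ((e(k := j)) ` insert k A)) @ \<phi>s))"
    using k insert.hyps by (intro sum_inj_funs_insert) auto
  also have "... = (\<Sum>e\<in>inj_funs A (%k. {k, Suc k}).
      ?wt A e * alt us (mons (slist (e ` A)) @ (%z. z ^ k) # \<phi>s))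
     + y * (\<Sum>e\<in>inj_funs A (%k. {k, Suc k}). ?wt A e * alt us (mons (slist (e ` A)) @ (%z. z ^ Suc k) # \<phi>s))"
    unfolding sum_distrib_left sum.distrib[symmetric] by (intro sum.cong refl, subst inner) (simp_all add: algebra_simps)
  also have "... = alt us (map (%\<psi> z. (1 + y * z) * \<psi> z) (mons (slist A)) @ (%z. z ^ k) # \<phi>s)
      + y * alt us (map (%\<psi> z. (1 + y * z) * \<psi> z) (mons (slist A)) @ (%z. z ^ Suc k) # \<phi>s)"
    using insert.IH[of "(%z. z ^ k) # \<phi>s"] insert.IH[of "(%z. z ^ Suc k) # \<phi>s"] len by simp
  also have "... = alt us (map (%\<psi> z. (1 + y * z) * \<psi> z) (mons (slist A)) @ (%z. (1 + y * z) * z ^ k) # \<phi>s)"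
    using len by (intro alt_add[symmetric]) (auto simp: algebra_simps)
  also have "... = alt us (map (%\<psi> z. (1 + y * z) * \<psi> z) (mons (slist (insert k A))) @ \<phi>s)"
    using slist_insert_max[of A k] insert.hyps by simp
  finally show ?case .
qed

corollary alt_up:
  fixes y :: real
  assumes "finite A" "card A = length us"
  shows "(\<Sum>e\<in>inj_funs A (%k. {k, Suc k}). (\<Prod>k\<in>A. if e k = Suc k then y else 1) * alt us (mons (slist (e ` A))))
     = (\<Prod>u\<leftarrow>us. 1 + y * u) * alt us (mons (slist A))" using alt_up_step[of A "[]" us y] assms by (simp add: alt_scale)

text \<open>The branching rule of Schur functions in alternant form. The identity
  \<open>z ^ w = (z - x) * z ^ (w - 1) + x * z ^ (w - 1)\<close> splits the top column: the first
  term says that position \<open>w - 1\<close> of the row above stays free, the second that it is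
  occupied with weight \<open>x\<close>. Columns with the factor \<open>z - x\<close> vanish at
  \<open>x\<close>, so at the bottom of the induction the row of \<open>x\<close> disappears and the
  product of the \<open>u - x\<close> is left over.\<close>

lemma alt_down_step:
  fixes x :: real
  assumes "B \<subseteq> {..<w}" "1 <= w" "card B + length \<phi>s = Suc (length us)"
  defines "S \<equiv> %k. {j. j = k \<or> Suc j = k}"
  shows "(\<Sum>e\<in>{e \<in> inj_funs ({..<w} - B) S. w - 1 \<notin> e ` ({..<w} - B)}.
       (\<Prod>k\<in>{..<w} - B. if e k = k then x else 1) * alt us (mons (slist ({..<w - 1} - e ` ({..<w} - B))) @ \<phi>s))
      * (\<Prod>u\<leftarrow>us. u - x)
     = alt (x # us) (mons (slist B) @ map (%\<psi> z. (z - x) * \<psi> z) \<phi>s)" using assms(2,1,3)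
proof (induction w arbitrary: B \<phi>s rule: dec_induct)
  case base
  have S0: "S 0 = {0}" by (auto simp: S_def)
  from base(1) consider "B = {}" | "B = {0}" by (auto simp: lessThan_Suc)
  then show ?case
  proof cases
    case 1
    have "alt (x # us) (map (%\<psi> z. (z - x) * \<psi> z) \<phi>s) = 0" by (simp, rule lap_vanishing) auto
    moreover have "{e \<in> inj_funs ({..<1} - B) S. 1 - 1 \<notin> e ` ({..<1} - B)} = {}"
      using 1 by (auto simp: inj_funs_def S0 PiE_def Pi_def lessThan_Suc)
    ultimately show ?thesis using 1 by (simp only: sum.empty) simp
  next
    case 2
    have "alt (x # us) ([] @ (%z. 1) # map (%\<psi> z. (z - x) * \<psi> z) \<phi>s) = alt us (map (%\<psi> z. (z - x) * \<psi> z) \<phi>s)"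
      by (simp only: alt.simps, subst lap_single) auto
    also have "... = (\<Prod>u\<leftarrow>us. u - x) * alt us \<phi>s" by (rule alt_scale)
    finally show ?thesis using 2 by (simp add: lessThan_Suc inj_funs_def)
  qed
next
  case (step w)
  have finS: "finite (S k)" for k by (rule finite_subset[of _ "{..k}"]) (auto simp: S_def)
  have le: "e i <= i" if "e \<in> inj_funs A S" "i \<in> A" for e i A using that by (fastforce simp: inj_funs_def S_def PiE_def Pi_def)
  let ?wt = "%A e. \<Prod>k\<in>A. if e k = k then x else (1::real)"
  let ?mul = "map (%\<psi> z. (z - x) * \<psi> z)"
  have wt: "?wt (insert k A) (e(k := j)) = (if j = k then x else 1) * ?wt A e" if "k \<notin> A" "finite A" for k A e j
    using prod_fun_upd_insert[of k A "%k j. if j = k then x else 1" e j] that by simp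
  define f where "f = (%A W \<phi>s e. ?wt A e * alt us (mons (slist ({..<W} - e ` A)) @ \<phi>s))"
  have fupd: "f (insert k A) W \<phi>s (e(k := j)) = (if j = k then x else 1) * (?wt A e *
       alt us (mons (slist ({..<W} - insert j (e ` A))) @ \<phi>s))" if "k \<notin> A" "finite A" for k A W \<phi>s e j
  proof -
    have "(e(k := j)) ` insert k A = insert j (e ` A)" using that by auto
    then show ?thesis unfolding f_def wt[OF that] by (simp only: mult.assoc)
  qed
  have IH: "(\<Sum>e\<in>{e \<in> inj_funs ({..<w} - B) S. w - 1 \<notin> e ` ({..<w} - B)}. f ({..<w} - B) (w - 1) \<phi>s e) * (\<Prod>u\<leftarrow>us. u - x)
     = alt (x # us) (mons (slist B) @ ?mul \<phi>s)" if "B \<subseteq> {..<w}" "card B + length \<phi>s = Suc (length us)" for B \<phi>s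
    using step.IH[of B \<phi>s] that unfolding f_def by blast
  show ?case
  proof (cases "w \<in> B")
    \<comment> \<open>The target \<open>w\<close> is excluded, so \<open>w\<close> has to go to
      \<open>w - 1\<close>, which the others must leave free.\<close>
    case False
    define D where "D = {..<w} - B"
    have Bw: "B \<subseteq> {..<w}" using False step.prems by (auto simp: lessThan_Suc)
    have dom: "{..<Suc w} - B = insert w D" and wD: "w \<notin> D" "finite D" using False by (auto simp: D_def lessThan_Suc)
    have img: "i < w" if "e \<in> inj_funs D S" "i \<in> e ` D" for e i using le[OF that(1)] that(2) by (fastforce simp: D_def)
    have "(\<Sum>e\<in>{e \<in> inj_funs (insert w D) S. w \<notin> e ` insert w D}. f (insert w D) w \<phi>s e)
      = (\<Sum>e\<in>inj_funs (insert w D) S. if w \<notin> e ` insert w D then f (insert w D) w \<phi>s e else 0)"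
      using wD finS by (intro sum.inter_filter) (auto intro!: finite_inj_funs)
    also have "... = (\<Sum>e\<in>inj_funs D S. \<Sum>j\<in>S w - e ` D.
        if w \<notin> (e(w := j)) ` insert w D then f (insert w D) w \<phi>s (e(w := j)) else 0)"
      using wD finS by (intro sum_inj_funs_insert) auto
    also have "... = (\<Sum>e\<in>inj_funs D S. if w - 1 \<notin> e ` D then f D (w - 1) \<phi>s e else 0)"
    proof (rule sum.cong)
      fix e assume e: "e \<in> inj_funs D S"
      have upd: "(e(w := j)) ` insert w D = insert j (e ` D)" for j using wD by auto
      have Sw: "S w = {w, w - 1}" using step.hyps by (auto simp: S_def)
      have ww: "w - 1 ~= w" "{..<w} - insert (w - 1) (e ` D) = {..<w - 1} - e ` D" using step.hyps by auto
      have wi: "w \<notin> e ` D" using img[OF e] by blast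
      show "(\<Sum>j\<in>S w - e ` D. if w \<notin> (e(w := j)) ` insert w D then f (insert w D) w \<phi>s (e(w := j)) else 0)
          = (if w - 1 \<notin> e ` D then f D (w - 1) \<phi>s e else 0)"
      proof (cases "w - 1 \<in> e ` D")
        case True
        then have "S w - e ` D = {w}" using wi ww by (auto simp: Sw)
        then show ?thesis using True by simp
      next
        case F: False
        then have "S w - e ` D = {w, w - 1}" using wi ww by (auto simp: Sw)
        moreover have "f (insert w D) w \<phi>s (e(w := w - 1)) = f D (w - 1) \<phi>s e" unfolding fupd[OF wD] using ww by (simp add: f_def)
        ultimately show ?thesis using F ww wi by (simp add: upd del: fun_upd_apply image_insert)
      qed
    qed simp
    also have "... = (\<Sum>e\<in>{e \<in> inj_funs D S. w - 1 \<notin> e ` D}. f D (w - 1) \<phi>s e)"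
      using wD finS by (intro sum.inter_filter[symmetric]) (auto intro!: finite_inj_funs)
    finally show ?thesis using IH[OF Bw step.prems(2)] unfolding dom f_def D_def[symmetric] by simp
  next
    case True
    define B0 where "B0 = B - {w}"
    have B: "B = insert w B0" "w \<notin> B0" "B0 \<subseteq> {..<w}" "finite B0"
      using True step.prems by (auto simp: B0_def lessThan_Suc intro: finite_subset)
    define D where "D = {..<w} - B0"
    have dom: "{..<Suc w} - B = D" and wD: "finite D" using True by (auto simp: D_def B0_def lessThan_Suc)
    have img: "i < w" if "e \<in> inj_funs D S" "i \<in> e ` D" for e i using le[OF that(1)] that(2) by (fastforce simp: D_def)
    have card: "card B0 + length \<phi>s = length us" using step.prems B by simp
    have slB: "slist B = slist B0 @ [w]" unfolding B(1) using B by (intro slist_insert_max) auto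
    have "{e \<in> inj_funs D S. w \<notin> e ` D} = inj_funs D S" using img by blast
    then have "(\<Sum>e\<in>{e \<in> inj_funs D S. w \<notin> e ` D}. f D w \<phi>s e) = (\<Sum>e\<in>inj_funs D S. f D w \<phi>s e)" by simp
    also have "... = (\<Sum>e\<in>inj_funs D S. if w - 1 \<notin> e ` D then f D w \<phi>s e else 0)
       + (\<Sum>e\<in>inj_funs D S. if w - 1 \<in> e ` D then f D w \<phi>s e else 0)" unfolding sum.distrib[symmetric] by (intro sum.cong) auto
    also have "(\<Sum>e\<in>inj_funs D S. if w - 1 \<notin> e ` D then f D w \<phi>s e else 0)
      = (\<Sum>e\<in>{e \<in> inj_funs D S. w - 1 \<notin> e ` D}. f D w \<phi>s e)"
      using wD finS by (intro sum.inter_filter[symmetric]) (auto intro!: finite_inj_funs)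
    also have "... = (\<Sum>e\<in>{e \<in> inj_funs D S. w - 1 \<notin> e ` D}. f D (w - 1) ((%z. z ^ (w - 1)) # \<phi>s) e)"
    proof (rule sum.cong)
      fix e assume e: "e \<in> {e \<in> inj_funs D S. w - 1 \<notin> e ` D}"
      have "{..<w} - e ` D = insert (w - 1) ({..<w - 1} - e ` D)" using e step.hyps by auto
      then have "slist ({..<w} - e ` D) = slist ({..<w - 1} - e ` D) @ [w - 1]" by (simp only:) (intro slist_insert_max, auto)
      then show "f D w \<phi>s e = f D (w - 1) ((%z. z ^ (w - 1)) # \<phi>s) e" by (simp add: f_def)
    qed simp
    finally have split: "(\<Sum>e\<in>{e \<in> inj_funs D S. w \<notin> e ` D}. f D w \<phi>s e) * (\<Prod>u\<leftarrow>us. u - x)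
       = alt (x # us) (mons (slist B0) @ ?mul ((%z. z ^ (w - 1)) # \<phi>s))
        + (\<Sum>e\<in>inj_funs D S. if w - 1 \<in> e ` D then f D w \<phi>s e else 0) * (\<Prod>u\<leftarrow>us. u - x)"
      using IH[of B0 "(%z. z ^ (w - 1)) # \<phi>s"] B card unfolding D_def[symmetric] by (simp add: algebra_simps)
    \<comment> \<open>Here \<open>w - 1\<close> is occupied, and only the element
      \<open>w - 1\<close> itself can occupy it, with weight \<open>x\<close>. If
      \<open>w - 1\<close> belongs to \<open>B0\<close>, this is impossible, and the right-hand side
      vanishes because of two equal columns.\<close>
    have second: "(\<Sum>e\<in>inj_funs D S. if w - 1 \<in> e ` D then f D w \<phi>s e else 0) * (\<Prod>u\<leftarrow>us. u - x)
       = x * alt (x # us) (mons (slist B0) @ (%z. z ^ (w - 1)) # ?mul \<phi>s)"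
    proof (cases "w - 1 \<in> B0")
      case T: True
      have "w - 1 \<notin> e ` D" if "e \<in> inj_funs D S" for e
      proof
        assume "w - 1 \<in> e ` D"
        then obtain k where k: "k \<in> D" "e k = w - 1" by auto
        moreover have "k < w" "k ~= w - 1" using k T by (auto simp: D_def)
        ultimately show False using le[OF that, of k] by linarith
      qed
      then have "(\<Sum>e\<in>inj_funs D S. if w - 1 \<in> e ` D then f D w \<phi>s e else 0) = 0" by (intro sum.neutral) auto
      moreover have "slist B0 = slist (B0 - {w - 1}) @ [w - 1]"
      proof -
        have "slist (insert (w - 1) (B0 - {w - 1})) = slist (B0 - {w - 1}) @ [w - 1]"
          using B by (intro slist_insert_max) fastforce+
        then show ?thesis using T by (simp add: insert_absorb)
      qed
      moreover have "alt (x # us) (mons (slist (B0 - {w - 1})) @ (%z. z ^ (w - 1)) # (%z. z ^ (w - 1)) # ?mul \<phi>s) = 0"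
      proof -
        have "card (B0 - {w - 1}) + 1 = card B0" using T B(4) by (metis Suc_eq_plus1 card_Suc_Diff1)
        then show ?thesis using card by (intro alt_twice) auto
      qed
      ultimately show ?thesis by simp
    next
      case F: False
      define D' where "D' = {..<w - 1} - B0"
      have D: "D = insert (w - 1) D'" "w - 1 \<notin> D'" "finite D'" "D' = {..<w} - insert (w - 1) B0"
        using F step.hyps by (auto simp: D_def D'_def)
      have img': "i < w - 1" if "e \<in> inj_funs D' S" "i \<in> e ` D'" for e i using le[OF that(1)] that(2) by (fastforce simp: D'_def)
      have "(\<Sum>e\<in>inj_funs D S. if w - 1 \<in> e ` D then f D w \<phi>s e else 0)
        = (\<Sum>e\<in>inj_funs D' S. \<Sum>j\<in>S (w - 1) - e ` D'.
            if w - 1 \<in> (e(w - 1 := j)) ` D then f D w \<phi>s (e(w - 1 := j)) else 0)"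
        using D finS unfolding D(1) by (intro sum_inj_funs_insert) auto
      also have "... = (\<Sum>e\<in>inj_funs D' S. x * f D' (w - 1) \<phi>s e)"
      proof (rule sum.cong)
        fix e assume e: "e \<in> inj_funs D' S"
        have ni: "w - 1 \<notin> e ` D'" using img'[OF e] by blast
        have upd: "(e(w - 1 := j)) ` D = insert j (e ` D')" for j using D by auto
        have "(\<Sum>j\<in>S (w - 1) - e ` D'. if w - 1 \<in> (e(w - 1 := j)) ` D then f D w \<phi>s (e(w - 1 := j)) else 0)
           = (\<Sum>j\<in>{w - 1}. f D w \<phi>s (e(w - 1 := j)))"
        proof -
          have eq: "w - 1 \<in> (e(w - 1 := j)) ` D \<longleftrightarrow> w - 1 = j" for j unfolding upd using ni by auto
          have "w - 1 \<in> S (w - 1) - e ` D'" using ni by (auto simp: S_def)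
          then show ?thesis unfolding eq using finS by (subst sum.delta') auto
        qed
        also have "... = x * f D' (w - 1) \<phi>s e"
        proof -
          have "{..<w} - insert (w - 1) (e ` D') = {..<w - 1} - e ` D'" using step.hyps by auto
          then show ?thesis using fupd[OF D(2,3), of w \<phi>s e "w - 1"] unfolding D(1) by (simp add: f_def del: fun_upd_apply)
        qed
        finally show "(\<Sum>j\<in>S (w - 1) - e ` D'. if w - 1 \<in> (e(w - 1 := j)) ` D then f D w \<phi>s (e(w - 1 := j)) else 0)
           = x * f D' (w - 1) \<phi>s e" .
      qed simp
      also have "... = x * (\<Sum>e\<in>{e \<in> inj_funs D' S. w - 1 \<notin> e ` D'}. f D' (w - 1) \<phi>s e)"
      proof -
        have "{e \<in> inj_funs D' S. w - 1 \<notin> e ` D'} = inj_funs D' S" using img' by blast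
        then show ?thesis by (simp add: sum_distrib_left)
      qed
      finally have "(\<Sum>e\<in>inj_funs D S. if w - 1 \<in> e ` D then f D w \<phi>s e else 0) * (\<Prod>u\<leftarrow>us. u - x)
        = x * alt (x # us) (mons (slist (insert (w - 1) B0)) @ ?mul \<phi>s)"
        using IH[of "insert (w - 1) B0" \<phi>s] B F card step.hyps unfolding D(4)[symmetric] by simp
      moreover have "slist (insert (w - 1) B0) = slist B0 @ [w - 1]"
        using B F by (intro slist_insert_max) (auto simp: subset_iff less_Suc_eq nat_less_le)
      ultimately show ?thesis by simp
    qed
    \<comment> \<open>The two cases for position \<open>w - 1\<close> recombine to the column of
      exponent \<open>w\<close>.\<close>
    have "(%z::real. z ^ w) = (%z. (z - x) * z ^ (w - 1) + x * z ^ (w - 1))"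
    proof
      fix z :: real
      show "z ^ w = (z - x) * z ^ (w - 1) + x * z ^ (w - 1)" using step.hyps by (cases w) (auto simp: algebra_simps)
    qed
    then have "alt (x # us) (mons (slist B) @ ?mul \<phi>s) =
        alt (x # us) (mons (slist B0) @ (%z. (z - x) * z ^ (w - 1)) # ?mul \<phi>s)
        + x * alt (x # us) (mons (slist B0) @ (%z. z ^ (w - 1)) # ?mul \<phi>s)"
      using alt_add[of "mons (slist B0)" "?mul \<phi>s" "x # us" _ "%z. (z - x) * z ^ (w - 1)" x "%z. z ^ (w - 1)", OF _ refl] card
      by (simp add: slB del: alt.simps)
    then show ?thesis using split second unfolding dom f_def by simp
  qed
qed

text \<open>That the row above is shorter by one is now expressed by the neighbour sets instead of a
  condition on the whole image, which is the form in which the lattice supplies it.\<close>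

corollary alt_down:
  fixes x :: real
  assumes "B \<subseteq> {..<w}" "1 <= w" "card B = Suc (length us)"
  shows "(\<Sum>e\<in>inj_funs ({..<w} - B) (%k. {j. (j = k \<or> Suc j = k) \<and> Suc j < w}).
       (\<Prod>k\<in>{..<w} - B. if e k = k then x else 1) * alt us (mons (slist ({..<w - 1} - e ` ({..<w} - B)))))
      * (\<Prod>u\<leftarrow>us. u - x)
     = alt (x # us) (mons (slist B))"
proof -
  have "inj_funs ({..<w} - B) (%k. {j. (j = k \<or> Suc j = k) \<and> Suc j < w}) =
      {e \<in> inj_funs ({..<w} - B) (%k. {j. j = k \<or> Suc j = k}). w - 1 \<notin> e ` ({..<w} - B)}"
  proof (intro set_eqI iffI)
    fix e assume e: "e \<in> inj_funs ({..<w} - B) (%k. {j. (j = k \<or> Suc j = k) \<and> Suc j < w})"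
    then have "Suc (e k) < w" if "k \<in> {..<w} - B" for k using that by (auto simp: inj_funs_def PiE_def Pi_def)
    then have "w - 1 \<notin> e ` ({..<w} - B)" by fastforce
    then show "e \<in> {e \<in> inj_funs ({..<w} - B) (%k. {j. j = k \<or> Suc j = k}). w - 1 \<notin> e ` ({..<w} - B)}"
      using e by (auto simp: inj_funs_def PiE_def Pi_def)
  next
    fix e assume e: "e \<in> {e \<in> inj_funs ({..<w} - B) (%k. {j. j = k \<or> Suc j = k}). w - 1 \<notin> e ` ({..<w} - B)}"
    have "Suc (e k) < w" if k: "k \<in> {..<w} - B" for k
    proof -
      have "e k = k \<or> Suc (e k) = k" using e k by (auto simp: inj_funs_def PiE_def Pi_def)
      moreover have "e k ~= w - 1" using e k by force
      ultimately show ?thesis using k by auto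
    qed
    then show "e \<in> inj_funs ({..<w} - B) (%k. {j. (j = k \<or> Suc j = k) \<and> Suc j < w})"
      using e by (auto simp: inj_funs_def PiE_def Pi_def)
  qed
  then show ?thesis using alt_down_step[of B w "[]" us x] assms by simp
qed

section \<open>Dimer configurations as layered matchings\<close>

text \<open>The triple \<open>(i, k, j)\<close> stands for the edge from the \<open>k\<close>-th vertex of row \<open>i\<close> to the
  \<open>j\<close>-th vertex of row \<open>i + 1\<close>.\<close>

locale layers =
  fixes V :: "nat => nat set" and adj :: "nat => nat => nat => bool" and wt :: "nat \<times> nat \<times> nat => real"
  assumes finV: "finite (V i)"
begin

definition links :: "nat => (nat \<times> nat \<times> nat) set" where
  "links R = {(i, k, j). 1 <= i \<and> i < R \<and> k \<in> V i \<and> j \<in> V (Suc i) \<and> adj i k j}"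

text \<open>Partial matchings of the first \<open>R\<close> rows: a vertex below row
  \<open>R\<close> is matched exactly once, while a vertex of row \<open>R\<close> may still be free
  and then has to be matched upwards by a later layer.\<close>

definition configs :: "nat => (nat \<times> nat \<times> nat) set set" where
  "configs R = {D. D \<subseteq> links R \<and>
     (\<forall>i k. 1 <= i \<and> i < R \<and> k \<in> V i --> (\<exists>k'. (i - 1, k', k) \<in> D) ~= (\<exists>j. (i, k, j) \<in> D)) \<and>
     (\<forall>i k j j'. (i, k, j) \<in> D \<and> (i, k, j') \<in> D --> j = j') \<and>
     (\<forall>i k k' j. (i, k, j) \<in> D \<and> (i, k', j) \<in> D --> k = k')}"

definition free :: "nat => (nat \<times> nat \<times> nat) set => nat set" where
  "free R D = {k \<in> V R. \<not> (\<exists>k'. (R - 1, k', k) \<in> D)}"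

definition graph :: "nat => nat set => (nat => nat) => (nat \<times> nat \<times> nat) set" where
  "graph R A d = (%k. (R, k, d k)) ` A"

definition ups :: "nat => (nat \<times> nat \<times> nat) set => nat set" where
  "ups R D = {k. \<exists>j. (R, k, j) \<in> D}"

definition nbrs :: "nat => nat => nat set" where
  "nbrs R k = {j \<in> V (Suc R). adj R k j}"

definition weight :: "(nat \<times> nat \<times> nat) set => real" where
  "weight D = (\<Prod>e\<in>D. wt e)"

text \<open>The transfer operator of row \<open>R\<close>: the free set \<open>A\<close> chooses its
  partners in the next row, and the vertices not chosen form the next free set.\<close>

definition step :: "nat => (nat set => real) => nat set => real" where
  "step R g A = (\<Sum>d\<in>inj_funs A (nbrs R). (\<Prod>k\<in>A. wt (R, k, d k)) * g (V (Suc R) - d ` A))"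

lemma finite_links: "finite (links R)"
proof -
  have "links R \<subseteq> (SIGMA i:{..R}. V i \<times> V (Suc i))" by (auto simp: links_def)
  then show ?thesis by (rule finite_subset) (intro finite_SigmaI finite_cartesian_product finV finite_atMost)
qed

lemma finite_configs: "finite (configs R)" by (rule finite_subset[of _ "Pow (links R)"]) (auto simp: configs_def finite_links)

lemma configD:
  assumes "D \<in> configs R"
  shows "(i, k, j) \<in> D ==> 1 <= i \<and> i < R \<and> k \<in> V i \<and> j \<in> V (Suc i) \<and> adj i k j"
    and "1 <= i ==> i < R ==> k \<in> V i ==> (\<exists>k'. (i - 1, k', k) \<in> D) \<longleftrightarrow> \<not> (\<exists>j. (i, k, j) \<in> D)"
    and "(i, k, j) \<in> D ==> (i, k, j') \<in> D ==> j = j'"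
    and "(i, k, j) \<in> D ==> (i, k', j) \<in> D ==> k = k'"
proof -
  show "(i, k, j) \<in> D ==> 1 <= i \<and> i < R \<and> k \<in> V i \<and> j \<in> V (Suc i) \<and> adj i k j" using assms by (auto simp: configs_def links_def)
  show "1 <= i ==> i < R ==> k \<in> V i ==> (\<exists>k'. (i - 1, k', k) \<in> D) \<longleftrightarrow> \<not> (\<exists>j. (i, k, j) \<in> D)"
    using assms unfolding configs_def mem_Collect_eq by meson
  show "(i, k, j) \<in> D ==> (i, k, j') \<in> D ==> j = j'" using assms unfolding configs_def mem_Collect_eq by meson
  show "(i, k, j) \<in> D ==> (i, k', j) \<in> D ==> k = k'" using assms unfolding configs_def mem_Collect_eq by meson
qed

lemma config_row: "D \<in> configs R ==> (i, k, j) \<in> D ==> 1 <= i \<and> i < R" by (auto simp: configs_def links_def)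

lemma config_finite: "D \<in> configs R ==> finite D" by (auto simp: configs_def intro: finite_subset[OF _ finite_links])

lemma graph_iff: "(i, k, j) \<in> graph R A d \<longleftrightarrow> i = R \<and> k \<in> A \<and> j = d k" by (auto simp: graph_def)

lemma inj_funs_nbrsD:
  assumes "d \<in> inj_funs A (nbrs R)" "k \<in> A"
  shows "d k \<in> V (Suc R)" "adj R k (d k)"
  using assms by (auto simp: inj_funs_def nbrs_def PiE_def Pi_def)

lemma extend_config:
  assumes D: "D \<in> configs R" and R: "1 <= R" and d: "d \<in> inj_funs (free R D) (nbrs R)"
  shows "D \<union> graph R (free R D) d \<in> configs (Suc R)"
proof -
  let ?G = "graph R (free R D) d"
  have "D \<union> ?G \<subseteq> links (Suc R)"
  proof
    fix e assume e: "e \<in> D \<union> ?G"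
    obtain i k j where ikj: "e = (i, k, j)" by (cases e) auto
    show "e \<in> links (Suc R)"
    proof (cases "e \<in> D")
      case True
      then show ?thesis using configD(1)[OF D, of i k j] by (auto simp: links_def ikj)
    next
      case False
      then show ?thesis using e R inj_funs_nbrsD[OF d, of k] by (auto simp: links_def ikj graph_iff free_def)
    qed
  qed
  moreover have "(\<exists>k'. (i - 1, k', k) \<in> D \<union> ?G) ~= (\<exists>j. (i, k, j) \<in> D \<union> ?G)"
    if i: "1 <= i" "i < Suc R" "k \<in> V i" for i k
  proof (cases "i = R")
    case True
    have "(\<exists>k'. (i - 1, k', k) \<in> D \<union> ?G) \<longleftrightarrow> k \<notin> free R D" using i True by (auto simp: graph_iff free_def)
    moreover have "(\<exists>j. (i, k, j) \<in> D \<union> ?G) \<longleftrightarrow> k \<in> free R D" using config_row[OF D, of i k] True by (auto simp: graph_iff)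
    ultimately show ?thesis by blast
  next
    case False
    then show ?thesis using configD(2)[OF D, of i k] i by (auto simp: graph_iff)
  qed
  moreover have "j = j'" if "(i, k, j) \<in> D \<union> ?G" "(i, k, j') \<in> D \<union> ?G" for i k j j'
    using that configD(3)[OF D, of i k j j'] config_row[OF D, of i k j] config_row[OF D, of i k j'] by (auto simp: graph_iff)
  moreover have "k = k'" if "(i, k, j) \<in> D \<union> ?G" "(i, k', j) \<in> D \<union> ?G" for i k k' j
    using that configD(4)[OF D, of i k j k'] config_row[OF D, of i k j] config_row[OF D, of i k' j] d
    by (auto simp: graph_iff inj_funs_def inj_on_def)
  ultimately show ?thesis unfolding configs_def by blast
qed

lemma free_extend:
  assumes "D \<in> configs R"
  shows "free (Suc R) (D \<union> graph R (free R D) d) = V (Suc R) - d ` free R D"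
  using config_row[OF assms, of R] by (auto simp: free_def[of "Suc R"] graph_iff)

lemma ups_extend:
  assumes "D \<in> configs R"
  shows "ups R (D \<union> graph R (free R D) d) = free R D"
    and "r < R ==> ups r (D \<union> graph R (free R D) d) = ups r D"
  using config_row[OF assms, of R] by (auto simp: ups_def graph_iff)

text \<open>Cutting off the top layer inverts \<open>extend_config\<close>: the vertices of row
  \<open>R\<close> matched upwards are those left free from below, and the layer is the graph of an
  injection on them.\<close>

lemma restrict_config:
  assumes D: "D \<in> configs (Suc R)" and R: "1 <= R"
  defines "D0 \<equiv> {e \<in> D. fst e < R}"
  shows "D0 \<in> configs R"
    and "free R D0 = ups R D"
    and "(\<lambda>k\<in>ups R D. THE j. (R, k, j) \<in> D) \<in> inj_funs (ups R D) (nbrs R)"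
    and "D0 \<union> graph R (ups R D) (\<lambda>k\<in>ups R D. THE j. (R, k, j) \<in> D) = D"
proof -
  have D0: "(i, k, j) \<in> D0 \<longleftrightarrow> (i, k, j) \<in> D \<and> i < R" for i k j by (auto simp: D0_def)
  have "D0 \<subseteq> links R" using D by (auto simp: D0_def links_def configs_def)
  moreover have "(\<exists>k'. (i - 1, k', k) \<in> D0) ~= (\<exists>j. (i, k, j) \<in> D0)" if "1 <= i" "i < R" "k \<in> V i" for i k
    using configD(2)[OF D, of i k] that by (auto simp: D0)
  moreover have "j = j'" if "(i, k, j) \<in> D0" "(i, k, j') \<in> D0" for i k j j'
    using that configD(3)[OF D, of i k j j'] by (auto simp: D0)
  moreover have "k = k'" if "(i, k, j) \<in> D0" "(i, k', j) \<in> D0" for i k k' j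
    using that configD(4)[OF D, of i k j k'] by (auto simp: D0)
  ultimately show "D0 \<in> configs R" unfolding configs_def by blast
  have ex: "(\<exists>k'. (R - 1, k', k) \<in> D0) \<longleftrightarrow> (\<exists>k'. (R - 1, k', k) \<in> D)" for k using R by (auto simp: D0)
  show "free R D0 = ups R D"
  proof (intro set_eqI)
    fix k
    show "k \<in> free R D0 \<longleftrightarrow> k \<in> ups R D"
      using configD(2)[OF D, of R k] configD(1)[OF D, of R k] R unfolding free_def ex ups_def by auto
  qed
  define d where "d = (\<lambda>k\<in>ups R D. THE j. (R, k, j) \<in> D)"
  have d: "(R, k, j) \<in> D \<longleftrightarrow> k \<in> ups R D \<and> j = d k" for k j
  proof
    assume "(R, k, j) \<in> D"
    then show "k \<in> ups R D \<and> j = d k" using configD(3)[OF D, of R k] by (auto simp: ups_def d_def intro!: the_equality[symmetric])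
  next
    assume k: "k \<in> ups R D \<and> j = d k"
    then obtain j' where j': "(R, k, j') \<in> D" by (auto simp: ups_def)
    then have "d k = j'" using k configD(3)[OF D, of R k] by (auto simp: d_def intro!: the_equality)
    then show "(R, k, j) \<in> D" using k j' by simp
  qed
  have "inj_on d (ups R D)" using configD(4)[OF D, of R] d by (metis inj_onI)
  moreover have "d \<in> PiE (ups R D) (nbrs R)"
  proof
    fix k assume "k \<in> ups R D"
    then show "d k \<in> nbrs R k" using d[of k "d k"] configD(1)[OF D, of R k "d k"] by (simp add: nbrs_def)
  qed (simp add: d_def)
  ultimately show "(\<lambda>k\<in>ups R D. THE j. (R, k, j) \<in> D) \<in> inj_funs (ups R D) (nbrs R)" by (simp add: inj_funs_def d_def)
  show "D0 \<union> graph R (ups R D) (\<lambda>k\<in>ups R D. THE j. (R, k, j) \<in> D) = D"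
  proof (intro set_eqI)
    fix e :: "nat \<times> nat \<times> nat"
    obtain i k j where e: "e = (i, k, j)" by (cases e) auto
    show "e \<in> D0 \<union> graph R (ups R D) (\<lambda>k\<in>ups R D. THE j. (R, k, j) \<in> D) \<longleftrightarrow> e \<in> D" unfolding e d_def[symmetric] Un_iff D0 graph_iff
      using configD(1)[OF D, of i k j] d[of k j] by (auto simp: less_Suc_eq)
  qed
qed

lemma finite_nbrs: "finite (nbrs R k)" using finV by (simp add: nbrs_def)

lemma finite_free: "finite (free R D)" using finV by (simp add: free_def)

lemma sum_configs_Suc:
  assumes R: "1 <= R"
  shows "(\<Sum>D\<in>configs (Suc R). F D) = (\<Sum>D\<in>configs R. \<Sum>d\<in>inj_funs (free R D) (nbrs R). F (D \<union> graph R (free R D) d))"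
proof -
  have "(\<Sum>D\<in>configs R. \<Sum>d\<in>inj_funs (free R D) (nbrs R). F (D \<union> graph R (free R D) d))
     = (\<Sum>(D, d)\<in>(SIGMA D:configs R. inj_funs (free R D) (nbrs R)). F (D \<union> graph R (free R D) d))"
    by (intro sum.Sigma finite_configs ballI finite_inj_funs finite_free finite_nbrs)
  also have "... = (\<Sum>D\<in>configs (Suc R). F D)"
  proof (rule sum.reindex_bij_witness[where j = "%(D, d). D \<union> graph R (free R D) d" and
        i = "%D. ({e \<in> D. fst e < R}, \<lambda>k\<in>ups R D. THE j. (R, k, j) \<in> D)"], goal_cases)
    case (1 p)
    then obtain D d where p: "p = (D, d)" "D \<in> configs R" "d \<in> inj_funs (free R D) (nbrs R)" by auto
    let ?D' = "D \<union> graph R (free R D) d"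
    have a: "{e \<in> ?D'. fst e < R} = D"
    proof (intro set_eqI)
      fix e :: "nat \<times> nat \<times> nat"
      obtain i k j where e: "e = (i, k, j)" by (cases e) auto
      show "e \<in> {e \<in> ?D'. fst e < R} \<longleftrightarrow> e \<in> D" using config_row[OF p(2), of i k j] by (auto simp: e graph_iff)
    qed
    have "(\<lambda>k\<in>free R D. THE j. (R, k, j) \<in> ?D') = d"
    proof
      fix k
      show "(\<lambda>k\<in>free R D. THE j. (R, k, j) \<in> ?D') k = d k"
      proof (cases "k \<in> free R D")
        case True
        have "(R, k, j) \<in> ?D' \<longleftrightarrow> j = d k" for j using True config_row[OF p(2), of R k j] by (auto simp: graph_iff)
        then show ?thesis using True by simp
      next
        case False
        then show ?thesis using p(3) by (auto simp: inj_funs_def PiE_def extensional_def)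
      qed
    qed
    then show ?case using a by (simp add: p ups_extend[OF p(2)])
  next
    case (2 p)
    then show ?case using extend_config[OF _ R] by auto
  next
    case (3 D)
    then show ?case using restrict_config[OF _ R, of D] by simp
  next
    case (4 D)
    then show ?case using restrict_config[OF _ R, of D] by simp
  qed auto
  finally show ?thesis ..
qed

lemma weight_extend:
  assumes "D \<in> configs R"
  shows "weight (D \<union> graph R (free R D) d) = weight D * (\<Prod>k\<in>free R D. wt (R, k, d k))"
proof -
  have "D \<inter> graph R (free R D) d = {}" using config_row[OF assms, of R] by (auto simp: graph_def)
  moreover have "inj_on (%k. (R, k, d k)) (free R D)" by (auto simp: inj_on_def)
  ultimately show ?thesis unfolding weight_def using config_finite[OF assms]
    by (subst prod.union_disjoint) (auto simp: graph_def finite_free prod.reindex)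
qed

text \<open>\<open>H\<close> carries a quantity that is already decided in the lower rows, so the
  transfer operator acts on \<open>g\<close> alone.\<close>

lemma sum_configs_step:
  assumes R: "1 <= R"
    and H: "!!D d. D \<in> configs R ==> d \<in> inj_funs (free R D) (nbrs R) ==> H' (D \<union> graph R (free R D) d) = H D"
  shows "(\<Sum>D\<in>configs (Suc R). weight D * H' D * g (free (Suc R) D)) = (\<Sum>D\<in>configs R. weight D * H D * step R g (free R D))"
  unfolding sum_configs_Suc[OF R]
proof (rule sum.cong)
  fix D assume D: "D \<in> configs R"
  show "(\<Sum>d\<in>inj_funs (free R D) (nbrs R). weight (D \<union> graph R (free R D) d) *
       H' (D \<union> graph R (free R D) d) * g (free (Suc R) (D \<union> graph R (free R D) d)))
     = weight D * H D * step R g (free R D)" unfolding step_def sum_distrib_left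
    by (intro sum.cong refl) (simp add: weight_extend[OF D] free_extend[OF D] H[OF D])
qed simp

lemma card_free_Suc:
  assumes D: "D \<in> configs (Suc R)" and R: "1 <= R"
  obtains D0 where "D0 \<in> configs R" "card (free (Suc R) D) + card (free R D0) = card (V (Suc R))"
proof
  define D0 where "D0 = {e \<in> D. fst e < R}"
  define d where "d = (\<lambda>k\<in>ups R D. THE j. (R, k, j) \<in> D)"
  note r = restrict_config[OF D R, folded D0_def d_def]
  show "D0 \<in> configs R" by (rule r)
  have "free (Suc R) D = V (Suc R) - d ` free R D0" using free_extend[OF r(1), of d] r by simp
  moreover have "d ` free R D0 \<subseteq> V (Suc R)" using r(2,3) inj_funs_nbrsD by auto
  moreover have "card (d ` free R D0) = card (free R D0)" using r(2,3) by (auto simp: inj_funs_def intro: card_image)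
  ultimately show "card (free (Suc R) D) + card (free R D0) = card (V (Suc R))"
    using finV[of "Suc R"] card_mono[of "V (Suc R)" "d ` free R D0"] by (simp add: card_Diff_subset finite_free)
qed

end

section \<open>Coordinates on the contracting lattice\<close>

fun base :: "(nat => nat) => nat => int" where
  "base a 0 = 0"
| "base a (Suc 0) = 1"
| "base a (Suc (Suc r)) = (if even r
     then (if a (Suc (Suc r) div 2) = 1 then base a (Suc r) else base a (Suc r) - 1)
     else base a (Suc r) + 1)"

text \<open>In row \<open>1\<close> the gaps between the chosen vertices are counted as well,
  because the next row depends on the extreme vertices only; from row \<open>2\<close> on the rows
  are full intervals.\<close>

fun width :: "nat => (nat => nat) => nat => nat" where
  "width w a 0 = 0"
| "width w a (Suc 0) = w"
| "width w a (Suc (Suc r)) = (if even r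
     then (if a (Suc (Suc r) div 2) = 1 then width w a (Suc r) else width w a (Suc r) + 1)
     else width w a (Suc r) - 1)"

definition pos :: "(nat => nat) => nat => nat => int" where
  "pos a r k = base a r + 2 * int k"

definition nbr :: "(nat => nat) => nat => nat => nat => bool" where
  "nbr a r k j = (if odd r then if a (Suc r div 2) = 1 then j = k else j = k \<or> j = Suc k
     else j = k \<or> Suc j = k)"

text \<open>NE-SW edges are those with \<open>j = Suc k\<close> above a white row with two
  neighbours, but those with \<open>j = k\<close> above a black row: the left end of the rows moves
  to the left in the first case and to the right in the second.\<close>

definition lwt :: "(nat => nat) => (nat => real) => (nat => real) => nat \<times> nat \<times> nat => real" where
  "lwt a x y = (%(r, k, j). if odd r
      then if a (Suc r div 2) ~= 1 \<and> j = Suc k then y (Suc r div 2) else 1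
      else if j = k then x (r div 2) else 1)"

definition link_edge :: "(nat => nat) => nat \<times> nat \<times> nat => edge" where
  "link_edge a = (%(r, k, j). ((r, pos a r k), (Suc r, pos a (Suc r) j)))"

lemma inj_link_edge: "inj (link_edge a)" by (auto simp: inj_def link_edge_def pos_def)

lemma base_Suc:
  "1 <= r ==> base a (Suc r) =
     (if odd r then if a (Suc r div 2) = 1 then base a r else base a r - 1 else base a r + 1)" by (cases r) auto

lemma row_shift_Suc:
  "1 <= r ==> row_shift a (Suc r) =
     (if odd r \<and> a (Suc r div 2) = 1 then row_shift a r else row_shift a r + 1)" by (cases r) auto

lemma width_Suc:
  "1 <= r ==> width w a (Suc r) =
     (if odd r then if a (Suc r div 2) = 1 then width w a r else width w a r + 1 else width w a r - 1)" by (cases r) auto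

lemma even_base: "1 <= r ==> even (base a r - int (row_shift a r))"
  by (induction r rule: dec_induct) (auto simp: base_Suc row_shift_Suc)

lemma SH_row_iff: "1 <= r ==> u \<in> SH_row a r \<longleftrightarrow> even (u - base a r)" using even_base[of r a] by (auto simp: SH_row_def)

lemma pos_in_SH_row: "1 <= r ==> pos a r k \<in> SH_row a r" by (simp add: SH_row_iff pos_def)

lemma SH_edges_iff:
  "((r, u), (r', v)) \<in> SH_edges a \<longleftrightarrow> 1 <= r \<and> r' = Suc r \<and> u \<in> SH_row a r \<and>
     (if odd r \<and> a (Suc r div 2) = 1 then v = u else v = u - 1 \<or> v = u + 1)"
  (is "?L \<longleftrightarrow> ?R")
proof
  assume ?L
  then show ?R by (auto simp: SH_edges_def split: if_splits)
next
  assume R: ?R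
  then have "v \<in> SH_row a (Suc r)" by (auto simp: SH_row_def row_shift_Suc split: if_splits)
  then show ?L using R by (auto simp: SH_edges_def split: if_splits)
qed

lemma link_edge_in_SH_edges:
  assumes "1 <= r"
  shows "link_edge a (r, k, j) \<in> SH_edges a \<longleftrightarrow> nbr a r k j"
  using assms pos_in_SH_row[OF assms, of a k] by (auto simp: link_edge_def SH_edges_iff nbr_def pos_def base_Suc)

lemma edge_weight_link_edge:
  assumes "1 <= r" "nbr a r k j"
  shows "edge_weight x y (link_edge a (r, k, j)) = lwt a x y (r, k, j)"
  using assms by (auto simp: link_edge_def nbr_def lwt_def pos_def base_Suc split: if_splits)

locale contracting =
  fixes N :: nat and \<Omega> :: "nat => nat" and a :: "nat => nat"
  assumes N: "2 <= N" and \<Omega>1: "\<Omega> 1 = 1" and mono: "strict_mono_on {1..N} \<Omega>"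
begin

definition V :: "nat => nat set" where
  "V r = (if r = 1 then (%i. \<Omega> i - 1) ` {1..N} else {..<width (\<Omega> N) a r})"

lemma \<Omega>_ge: "1 <= i ==> i <= N ==> i <= \<Omega> i"
proof (induction i rule: dec_induct)
  case (step i)
  then have "\<Omega> i < \<Omega> (Suc i)" using mono by (auto simp: strict_mono_on_def)
  then show ?case using step by auto
qed (use \<Omega>1 in simp)

lemma \<Omega>_le: "1 <= i ==> i <= N ==> \<Omega> i <= \<Omega> N" using mono by (cases "i = N") (auto simp: strict_mono_on_def intro!: less_imp_le)

lemma V1_subset: "V 1 \<subseteq> {..<width (\<Omega> N) a 1}"
proof
  fix k assume "k \<in> V 1"
  then obtain i where i: "i \<in> {1..N}" "k = \<Omega> i - 1" by (auto simp: V_def)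
  have "\<Omega> i <= \<Omega> N" "1 <= \<Omega> i" using i \<Omega>_le[of i] \<Omega>_ge[of i] by auto
  then have "k < \<Omega> N" using i by linarith
  then show "k \<in> {..<width (\<Omega> N) a 1}" by simp
qed

lemma V_subset: "V r \<subseteq> {..<width (\<Omega> N) a r}" using V1_subset by (auto simp: V_def)

lemma inj_\<Omega>: "inj_on (%i. \<Omega> i - 1) {1..N}"
proof (rule inj_onI)
  fix i j assume ij: "i \<in> {1..N}" "j \<in> {1..N}" "\<Omega> i - 1 = \<Omega> j - 1"
  then have "\<Omega> i = \<Omega> j" using \<Omega>_ge[of i] \<Omega>_ge[of j] by auto
  then show "i = j" using ij inj_onD[OF strict_mono_on_imp_inj_on[OF mono]] by blast
qed

lemma card_V1: "card (V 1) = N" using card_image[OF inj_\<Omega>] by (simp add: V_def)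

text \<open>Two consecutive rows lose at most one position, and row \<open>1\<close> has at least
  \<open>N\<close> of them. This keeps the truncated subtraction in \<open>width\<close> honest up
  to the top row.\<close>

lemma width_odd_ge: "s <= N ==> N - s <= width (\<Omega> N) a (2 * s + 1)"
proof (induction s)
  case 0
  then show ?case using \<Omega>_ge[of N] N by auto
next
  case (Suc s)
  then show ?case by auto
qed

lemma width_pos: "1 <= r ==> r <= 2 * N ==> 1 <= width (\<Omega> N) a r"
proof (cases "odd r")
  case True
  then obtain s where s: "r = 2 * s + 1" by (auto elim: oddE)
  assume "r <= 2 * N"
  then show ?thesis using width_odd_ge[of s] s by auto
next
  case False
  assume r: "1 <= r" "r <= 2 * N"
  define s where "s = r div 2 - 1"
  have s: "r = Suc (2 * s + 1)" using False r unfolding s_def by presburger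
  have "1 <= width (\<Omega> N) a (2 * s + 1)" using width_odd_ge[of s] s r by auto
  then show ?thesis unfolding s using width_Suc[of "2 * s + 1" "\<Omega> N" a] by auto
qed

lemma V_ends: "1 <= r ==> r <= 2 * N ==> 0 \<in> V r \<and> width (\<Omega> N) a r - 1 \<in> V r"
proof (cases "r = 1")
  case True
  have "\<Omega> 1 - 1 \<in> V 1" "\<Omega> N - 1 \<in> V 1" using N by (auto simp: V_def)
  then show ?thesis using True \<Omega>1 by simp
next
  case False
  assume "1 <= r" "r <= 2 * N"
  then show ?thesis using width_pos[of r] False by (auto simp: V_def)
qed

lemma R_row_eq: "1 <= r ==> r <= 2 * N + 1 ==> R_row N \<Omega> a r = pos a r ` V r"
proof (induction r rule: dec_induct)
  case base
  have "2 * int (\<Omega> i) - 1 = pos a 1 (\<Omega> i - 1)" if "i \<in> {1..N}" for i using \<Omega>_ge[of i] that by (auto simp: pos_def of_nat_diff)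
  then have "(%i. 2 * int (\<Omega> i) - 1) ` {1..N} = (%i. pos a 1 (\<Omega> i - 1)) ` {1..N}" by (intro image_cong refl)
  moreover have "R_row N \<Omega> a 1 = (%i. 2 * int (\<Omega> i) - 1) ` {1..N}" by auto
  moreover have "pos a 1 ` V 1 = (%i. pos a 1 (\<Omega> i - 1)) ` {1..N}" by (simp add: V_def image_image)
  ultimately show ?case by argo
next
  case (step r)
  note row = step.IH[OF Suc_leD[OF step.prems]]
  let ?w = "width (\<Omega> N) a r"
  have r: "1 <= r" "r <= 2 * N" using step by auto
  have V: "V (Suc r) = {..<width (\<Omega> N) a (Suc r)}" using r by (simp add: V_def)
  obtain r' where r': "r = Suc r'" using r by (cases r) auto
  show ?case
  proof (cases "odd r")
    case True
    have ends: "pos a r 0 \<in> R_row N \<Omega> a r" "pos a r (?w - 1) \<in> R_row N \<Omega> a r" using V_ends[OF r] row by auto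
    \<comment> \<open>Only the two extreme vertices of the row count, and both ends of the index
      interval are occupied; so the gaps of row \<open>1\<close> are invisible from above.\<close>
    have between: "(\<exists>l\<in>R_row N \<Omega> a r. \<exists>h\<in>R_row N \<Omega> a r. l <= u \<and> u <= h) \<and> u \<in> SH_row a r
       \<longleftrightarrow> (\<exists>k<?w. u = pos a r k)" for u
    proof
      assume L: "(\<exists>l\<in>R_row N \<Omega> a r. \<exists>h\<in>R_row N \<Omega> a r. l <= u \<and> u <= h) \<and> u \<in> SH_row a r"
      then obtain k k' where k: "k \<in> V r" "k' \<in> V r" "pos a r k <= u" "u <= pos a r k'" unfolding row by auto
      have "even (u - base a r)" using L SH_row_iff[of r u a] r by blast
      then obtain c where c: "u - base a r = 2 * c" by (rule evenE)
      have "0 <= c" "c <= int k'" using k c by (auto simp: pos_def)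
      moreover have "k' < ?w" using k V_subset by auto
      ultimately show "\<exists>k<?w. u = pos a r k" using c by (intro exI[of _ "nat c"]) (auto simp: pos_def)
    next
      assume "\<exists>k<?w. u = pos a r k"
      then obtain k where "k < ?w" "u = pos a r k" by auto
      then show "(\<exists>l\<in>R_row N \<Omega> a r. \<exists>h\<in>R_row N \<Omega> a r. l <= u \<and> u <= h) \<and> u \<in> SH_row a r"
        using ends pos_in_SH_row[OF r(1)] by (intro conjI bexI[OF _ ends(1)] bexI[OF _ ends(2)]) (auto simp: pos_def)
    qed
    have "R_row N \<Omega> a (Suc r) = {v. \<exists>u. ((r, u), (Suc r, v)) \<in> SH_edges a \<and>
              (\<exists>l \<in> R_row N \<Omega> a r. \<exists>h \<in> R_row N \<Omega> a r. l <= u \<and> u <= h)}"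
    proof -
      have ev: "even r'" using True r' by simp
      show ?thesis unfolding r' R_row.simps(3) if_P[OF ev] ..
    qed
    also have "... = {v. \<exists>k<?w. ((r, pos a r k), (Suc r, v)) \<in> SH_edges a}"
    proof -
      have "((r, u), (Suc r, v)) \<in> SH_edges a \<and> (\<exists>l \<in> R_row N \<Omega> a r. \<exists>h \<in> R_row N \<Omega> a r. l <= u \<and> u <= h)
        \<longleftrightarrow> ((r, u), (Suc r, v)) \<in> SH_edges a \<and> (\<exists>k<?w. u = pos a r k)" for u v
      proof -
        have "((r, u), (Suc r, v)) \<in> SH_edges a ==> u \<in> SH_row a r" using SH_edges_iff[of r u "Suc r" v a] by simp
        then show ?thesis using between[of u] by argo
      qed
      then show ?thesis by (simp only:) auto
    qed
    also have "... = pos a (Suc r) ` V (Suc r)"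
    proof (cases "a (Suc r div 2) = 1")
      case T: True
      then have "((r, pos a r k), (Suc r, v)) \<in> SH_edges a \<longleftrightarrow> v = pos a (Suc r) k" for k v
        using True r pos_in_SH_row[OF r(1), of a k] by (auto simp: SH_edges_iff pos_def base_Suc)
      then show ?thesis using True T r by (auto simp: V width_Suc)
    next
      case F: False
      then have *: "((r, pos a r k), (Suc r, v)) \<in> SH_edges a \<longleftrightarrow> v = pos a (Suc r) k \<or> v = pos a (Suc r) (Suc k)" for k v
        using True r pos_in_SH_row[OF r(1), of a k] by (auto simp: SH_edges_iff pos_def base_Suc)
      have w: "width (\<Omega> N) a (Suc r) = Suc ?w" using True F r by (simp add: width_Suc)
      show ?thesis
      proof (intro set_eqI iffI)
        fix v assume "v \<in> {v. \<exists>k<?w. ((r, pos a r k), (Suc r, v)) \<in> SH_edges a}"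
        then show "v \<in> pos a (Suc r) ` V (Suc r)" by (auto simp: * V w)
      next
        fix v assume "v \<in> pos a (Suc r) ` V (Suc r)"
        then obtain j where j: "j < Suc ?w" "v = pos a (Suc r) j" by (auto simp: V w)
        have "\<exists>k<?w. j = k \<or> j = Suc k" using j width_pos[OF r] by (cases j) auto
        then show "v \<in> {v. \<exists>k<?w. ((r, pos a r k), (Suc r, v)) \<in> SH_edges a}" using j by (auto simp: *)
      qed
    qed
    finally show ?thesis .
  next
    case False
    then have Vr: "V r = {..<?w}" by (auto simp: V_def)
    have nb: "((r, u), (Suc r, v)) \<in> SH_edges a \<longleftrightarrow> v = u - 1 \<or> v = u + 1" if "u \<in> R_row N \<Omega> a r" for u v
      using that False r pos_in_SH_row[OF r(1), of a] by (auto simp: SH_edges_iff row)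
    have "R_row N \<Omega> a (Suc r) = {v. \<exists>u \<in> R_row N \<Omega> a r. \<exists>u' \<in> R_row N \<Omega> a r. u ~= u' \<and>
              ((r, u), (Suc r, v)) \<in> SH_edges a \<and> ((r, u'), (Suc r, v)) \<in> SH_edges a}"
    proof -
      have ev: "\<not> even r'" using False r' by simp
      show ?thesis unfolding r' R_row.simps(3) if_not_P[OF ev] ..
    qed
    also have "... = {v. v - 1 \<in> R_row N \<Omega> a r \<and> v + 1 \<in> R_row N \<Omega> a r}"
    proof (intro set_eqI iffI)
      fix v assume "v \<in> {v. \<exists>u \<in> R_row N \<Omega> a r. \<exists>u' \<in> R_row N \<Omega> a r. u ~= u' \<and>
              ((r, u), (Suc r, v)) \<in> SH_edges a \<and> ((r, u'), (Suc r, v)) \<in> SH_edges a}"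
      then obtain u u' where u: "u \<in> R_row N \<Omega> a r" "u' \<in> R_row N \<Omega> a r" "u ~= u'"
          "((r, u), (Suc r, v)) \<in> SH_edges a" "((r, u'), (Suc r, v)) \<in> SH_edges a" by blast
      then have "v = u - 1 \<or> v = u + 1" "v = u' - 1 \<or> v = u' + 1" using nb by auto
      then show "v \<in> {v. v - 1 \<in> R_row N \<Omega> a r \<and> v + 1 \<in> R_row N \<Omega> a r}" using u by auto
    next
      fix v assume "v \<in> {v. v - 1 \<in> R_row N \<Omega> a r \<and> v + 1 \<in> R_row N \<Omega> a r}"
      then have m: "v - 1 \<in> R_row N \<Omega> a r" "v + 1 \<in> R_row N \<Omega> a r" by auto
      have "((r, v - 1), (Suc r, v)) \<in> SH_edges a" "((r, v + 1), (Suc r, v)) \<in> SH_edges a"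
        unfolding nb[OF m(1)] nb[OF m(2)] by auto
      then show "v \<in> {v. \<exists>u \<in> R_row N \<Omega> a r. \<exists>u' \<in> R_row N \<Omega> a r. u ~= u' \<and>
              ((r, u), (Suc r, v)) \<in> SH_edges a \<and> ((r, u'), (Suc r, v)) \<in> SH_edges a}"
        by (intro CollectI bexI[OF _ m(1)] bexI[OF _ m(2)]) auto
    qed
    also have "... = pos a (Suc r) ` V (Suc r)"
    proof (intro set_eqI iffI)
      fix v assume "v \<in> {v. v - 1 \<in> R_row N \<Omega> a r \<and> v + 1 \<in> R_row N \<Omega> a r}"
      then obtain k k' where k: "k < ?w" "k' < ?w" "v - 1 = pos a r k" "v + 1 = pos a r k'" by (auto simp: row Vr)
      then have "k' = Suc k" by (auto simp: pos_def)
      then show "v \<in> pos a (Suc r) ` V (Suc r)"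
        using k False r by (intro image_eqI[of _ _ k]) (auto simp: V width_Suc base_Suc pos_def)
    next
      fix v assume "v \<in> pos a (Suc r) ` V (Suc r)"
      then obtain k where k: "k < ?w - 1" "v = pos a (Suc r) k" using False r by (auto simp: V width_Suc)
      then have "v - 1 = pos a r k" "v + 1 = pos a r (Suc k)" using False r by (auto simp: pos_def base_Suc)
      then show "v \<in> {v. v - 1 \<in> R_row N \<Omega> a r \<and> v + 1 \<in> R_row N \<Omega> a r}" using k by (auto simp: row Vr)
    qed
    finally show ?thesis .
  qed
qed

end

section \<open>Identification of dimer configurations with layered matchings\<close>

locale weighted_contracting = contracting N \<Omega> a for N \<Omega> a +
  fixes x y :: "nat => real"
begin

sublocale layers V "nbr a" "lwt a x y" by unfold_locales (auto simp: V_def)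

lemma R_vertices_iff: "(r, u) \<in> R_vertices N \<Omega> a \<longleftrightarrow> 1 <= r \<and> r <= 2 * N + 1 \<and> u \<in> pos a r ` V r"
  using R_row_eq[of r] by (auto simp: R_vertices_def)

lemma R_edges_eq: "R_edges N \<Omega> a = link_edge a ` links (2 * N + 1)"
proof (intro set_eqI iffI)
  fix e assume e: "e \<in> R_edges N \<Omega> a"
  obtain r u r' v where ruv: "e = ((r, u), (r', v))" by (cases e) auto
  have r': "r' = Suc r" "1 <= r" using e by (auto simp: R_edges_def ruv SH_edges_iff)
  have "(r, u) \<in> R_vertices N \<Omega> a" "(Suc r, v) \<in> R_vertices N \<Omega> a" using e by (auto simp: R_edges_def ruv r')
  then obtain k j where k: "k \<in> V r" "u = pos a r k" and j: "j \<in> V (Suc r)" "v = pos a (Suc r) j" and "r < 2 * N + 1"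
    unfolding R_vertices_iff by auto
  moreover have "nbr a r k j" using e link_edge_in_SH_edges[of r a k j] r' k j by (simp add: R_edges_def ruv link_edge_def)
  ultimately have "(r, k, j) \<in> links (2 * N + 1)" using r' by (simp add: links_def)
  moreover have "e = link_edge a (r, k, j)" by (simp add: ruv r' k j link_edge_def)
  ultimately show "e \<in> link_edge a ` links (2 * N + 1)" by blast
next
  fix e assume "e \<in> link_edge a ` links (2 * N + 1)"
  then obtain r k j where e: "e = link_edge a (r, k, j)" and l: "1 <= r" "r < 2 * N + 1" "k \<in> V r" "j \<in> V (Suc r)" "nbr a r k j"
    by (auto simp: links_def)
  have "e \<in> SH_edges a" using link_edge_in_SH_edges[of r a k j] l by (simp add: e)
  moreover have "fst e \<in> R_vertices N \<Omega> a" "snd e \<in> R_vertices N \<Omega> a" using l by (auto simp: e link_edge_def R_vertices_iff)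
  ultimately show "e \<in> R_edges N \<Omega> a" by (simp add: R_edges_def)
qed

lemma configs_1: "configs 1 = {{}}" by (auto simp: configs_def links_def)

text \<open>A layer matches as many vertices of the next row as were free before, so the sizes of
  the free sets follow from the widths. The even case is stated additively to stay clear of
  truncated subtraction.\<close>

lemma card_free:
  assumes "1 <= R"
  shows "R <= 2 * N + 1 ==> D \<in> configs R ==>
    (if odd R then card (free R D) + R div 2 = N else card (free R D) + N + 1 = width (\<Omega> N) a R + R div 2)" using assms
proof (induction R arbitrary: D rule: dec_induct)
  case base
  then show ?case using card_V1 by (auto simp: configs_1[simplified] free_def)
next
  case (step R)
  obtain D0 where D0: "D0 \<in> configs R" "card (free (Suc R) D) + card (free R D0) = card (V (Suc R))"
    using card_free_Suc[OF step.prems(2)] step.hyps by auto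
  have V: "card (V (Suc R)) = width (\<Omega> N) a (Suc R)" using step.hyps by (simp add: V_def)
  have R: "1 <= R" using step.hyps by simp
  show ?case
  proof (cases "odd R")
    case True
    then show ?thesis using step.IH[OF _ D0(1)] step.prems D0(2) V by auto
  next
    case False
    then have "width (\<Omega> N) a (Suc R) + 1 = width (\<Omega> N) a R" using width_pos[of R] width_Suc[OF R, of "\<Omega> N" a] step by auto
    moreover have "card (free R D0) + N + 1 = width (\<Omega> N) a R + R div 2" using step.IH[OF _ D0(1)] step.prems False by auto
    moreover have "Suc R div 2 = R div 2" using False by presburger
    ultimately show ?thesis using False D0(2) V by (simp only: even_Suc if_True if_False simp_thms)
  qed
qed

lemma card_free_odd: "s <= N ==> D \<in> configs (2 * s + 1) ==> card (free (2 * s + 1) D) = N - s"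
  using card_free[of "2 * s + 1" D] by auto

text \<open>\<open>configs\<close> imposes nothing on its last row; the count forces that row to be
  saturated, which makes the layered matchings perfect.\<close>

lemma free_top: "D \<in> configs (2 * N + 1) ==> free (2 * N + 1) D = {}" using card_free_odd[of N D] finite_free by simp

lemma incident_iff:
  assumes "1 <= r"
  shows "t \<in> D \<and> (fst (link_edge a t) = (r, pos a r k) \<or> snd (link_edge a t) = (r, pos a r k)) \<longleftrightarrow>
     (\<exists>j. t = (r, k, j) \<and> (r, k, j) \<in> D) \<or> (\<exists>k'. t = (r - 1, k', k) \<and> (r - 1, k', k) \<in> D)"
  using assms by (cases t) (auto simp: link_edge_def pos_def)

text \<open>Unique incidence at a vertex splits into an exclusive choice between up and down and
  uniqueness on either side; these are the conditions that can be verified one layer at a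
  time.\<close>

lemma unique_incident_iff:
  assumes D: "D \<subseteq> links (2 * N + 1)" and r: "1 <= r"
  shows "(\<exists>!e. e \<in> link_edge a ` D \<and> (fst e = (r, pos a r k) \<or> snd e = (r, pos a r k))) \<longleftrightarrow>
    ((\<exists>k'. (r - 1, k', k) \<in> D) ~= (\<exists>j. (r, k, j) \<in> D)) \<and>
    (\<forall>j j'. (r, k, j) \<in> D \<and> (r, k, j') \<in> D --> j = j') \<and>
    (\<forall>k' k''. (r - 1, k', k) \<in> D \<and> (r - 1, k'', k) \<in> D --> k' = k'')"
proof -
  have "(\<exists>!e. e \<in> link_edge a ` D \<and> (fst e = (r, pos a r k) \<or> snd e = (r, pos a r k))) \<longleftrightarrow>
     (\<exists>!t. t \<in> D \<and> (fst (link_edge a t) = (r, pos a r k) \<or> snd (link_edge a t) = (r, pos a r k)))"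
    (is "(\<exists>!e. ?P e) \<longleftrightarrow> (\<exists>!t. ?Q t)")
  proof
    assume "\<exists>!e. ?P e"
    then obtain e where e: "?P e" "!!e'. ?P e' ==> e' = e" by blast
    then obtain t where t: "t \<in> D" "e = link_edge a t" by blast
    show "\<exists>!t. ?Q t"
    proof (rule ex1I[of _ t])
      show "?Q t" using e(1) t by simp
      fix t' assume "?Q t'"
      then have "link_edge a t' = link_edge a t" using e(2)[of "link_edge a t'"] t by simp
      then show "t' = t" by (rule injD[OF inj_link_edge])
    qed
  next
    assume "\<exists>!t. ?Q t"
    then obtain t where t: "?Q t" "!!t'. ?Q t' ==> t' = t" by blast
    show "\<exists>!e. ?P e"
    proof (rule ex1I[of _ "link_edge a t"])
      show "?P (link_edge a t)" using t(1) by simp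
      fix e assume e: "?P e"
      then obtain t' where "t' \<in> D" "e = link_edge a t'" by blast
      then show "e = link_edge a t" using t(2)[of t'] e by simp
    qed
  qed
  also have "... \<longleftrightarrow> (\<exists>!t. (\<exists>j. t = (r, k, j) \<and> (r, k, j) \<in> D) \<or> (\<exists>k'. t = (r - 1, k', k) \<and> (r - 1, k', k) \<in> D))"
    unfolding incident_iff[OF r] ..
  also have "... \<longleftrightarrow> ((\<exists>k'. (r - 1, k', k) \<in> D) ~= (\<exists>j. (r, k, j) \<in> D)) \<and>
    (\<forall>j j'. (r, k, j) \<in> D \<and> (r, k, j') \<in> D --> j = j') \<and>
    (\<forall>k' k''. (r - 1, k', k) \<in> D \<and> (r - 1, k'', k) \<in> D --> k' = k'')" (is "(\<exists>!t. ?S t) \<longleftrightarrow> ?R")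
  proof
    assume "\<exists>!t. ?S t"
    then obtain t where t: "?S t" "!!t'. ?S t' ==> t' = t" by blast
    have 1: "t = (r, k, j)" if "(r, k, j) \<in> D" for j using t(2) that by blast
    have 2: "t = (r - 1, k', k)" if "(r - 1, k', k) \<in> D" for k' using t(2) that by blast
    have ne: "(r, k, j) ~= (r - 1, k', k)" for j k' using r by auto
    show ?R
    proof (intro conjI allI impI)
      show "(\<exists>k'. (r - 1, k', k) \<in> D) ~= (\<exists>j. (r, k, j) \<in> D)"
      proof -
        have "False" if "(r - 1, k', k) \<in> D" "(r, k, j) \<in> D" for k' j using 1[OF that(2)] 2[OF that(1)] ne[of j k'] by simp
        moreover have "(\<exists>k'. (r - 1, k', k) \<in> D) \<or> (\<exists>j. (r, k, j) \<in> D)" using t(1) by auto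
        ultimately show ?thesis by auto
      qed
    next
      fix j j' assume "(r, k, j) \<in> D \<and> (r, k, j') \<in> D"
      then show "j = j'" using 1[of j] 1[of j'] by simp
    next
      fix j j' assume "(r - 1, j, k) \<in> D \<and> (r - 1, j', k) \<in> D"
      then show "j = j'" using 2[of j] 2[of j'] by simp
    qed
  next
    assume R: ?R
    show "\<exists>!t. ?S t"
    proof (cases "\<exists>j. (r, k, j) \<in> D")
      case True
      then obtain j where j: "(r, k, j) \<in> D" by blast
      show ?thesis
      proof (rule ex1I[of _ "(r, k, j)"])
        show "?S (r, k, j)" using j by simp
        fix t assume t: "?S t"
        have "\<not> (\<exists>k'. (r - 1, k', k) \<in> D)" using R True by argo
        then obtain j' where "t = (r, k, j')" "(r, k, j') \<in> D" using t by blast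
        then show "t = (r, k, j)" using R j by simp
      qed
    next
      case False
      then have "\<exists>k'. (r - 1, k', k) \<in> D" using R by argo
      then obtain k' where k': "(r - 1, k', k) \<in> D" ..
      show ?thesis
      proof (rule ex1I[of _ "(r - 1, k', k)"])
        show "?S (r - 1, k', k)" using k' by simp
        fix t assume t: "?S t"
        then obtain k'' where "t = (r - 1, k'', k)" "(r - 1, k'', k) \<in> D" using False by blast
        then show "t = (r - 1, k', k)" using R k' by simp
      qed
    qed
  qed
  finally show ?thesis .
qed

lemma link_edge_config_iff:
  assumes D: "D \<subseteq> links (2 * N + 1)"
  shows "link_edge a ` D \<in> dimer_configs N \<Omega> a \<longleftrightarrow> D \<in> configs (2 * N + 1)"
proof
  assume L: "link_edge a ` D \<in> dimer_configs N \<Omega> a"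
  have all: "((\<exists>k'. (r - 1, k', k) \<in> D) ~= (\<exists>j. (r, k, j) \<in> D)) \<and>
    (\<forall>j j'. (r, k, j) \<in> D \<and> (r, k, j') \<in> D --> j = j') \<and>
    (\<forall>k' k''. (r - 1, k', k) \<in> D \<and> (r - 1, k'', k) \<in> D --> k' = k'')"
    if "1 <= r" "r <= 2 * N + 1" "k \<in> V r" for r k
  proof -
    have "(r, pos a r k) \<in> R_vertices N \<Omega> a" using that by (simp add: R_vertices_iff)
    then show ?thesis using L unique_incident_iff[OF D that(1), of k] by (simp add: dimer_configs_def)
  qed
  have lk: "1 <= i \<and> i < 2 * N + 1 \<and> k \<in> V i \<and> j \<in> V (Suc i)" if "(i, k, j) \<in> D" for i k j using that D by (auto simp: links_def)
  show "D \<in> configs (2 * N + 1)" unfolding configs_def mem_Collect_eq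
  proof (intro conjI D allI impI)
    fix i k assume "1 <= i \<and> i < 2 * N + 1 \<and> k \<in> V i"
    then show "(\<exists>k'. (i - 1, k', k) \<in> D) ~= (\<exists>j. (i, k, j) \<in> D)" using all[of i k] by simp
  next
    fix i k j j' assume "(i, k, j) \<in> D \<and> (i, k, j') \<in> D"
    then show "j = j'" using all[of i k] lk[of i k j] by auto
  next
    fix i k k' j assume "(i, k, j) \<in> D \<and> (i, k', j) \<in> D"
    then show "k = k'" using all[of "Suc i" j] lk[of i k j] by auto
  qed
next
  assume R: "D \<in> configs (2 * N + 1)"
  have top: "\<exists>k'. (2 * N, k', k) \<in> D" if "k \<in> V (2 * N + 1)" for k using free_top[OF R] that by (auto simp: free_def)
  show "link_edge a ` D \<in> dimer_configs N \<Omega> a" unfolding dimer_configs_def mem_Collect_eq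
  proof (intro conjI ballI)
    show "link_edge a ` D \<subseteq> R_edges N \<Omega> a" using D by (auto simp: R_edges_eq)
    fix v assume v: "v \<in> R_vertices N \<Omega> a"
    obtain r u where ru: "v = (r, u)" by (cases v)
    then obtain k where k: "1 <= r" "r <= 2 * N + 1" "k \<in> V r" "u = pos a r k" using v by (auto simp: R_vertices_iff)
    show "\<exists>!e. e \<in> link_edge a ` D \<and> (fst e = v \<or> snd e = v)" unfolding ru k(4) unique_incident_iff[OF D k(1), of k]
    proof (intro conjI allI impI)
      show "(\<exists>k'. (r - 1, k', k) \<in> D) ~= (\<exists>j. (r, k, j) \<in> D)"
      proof (cases "r = 2 * N + 1")
        case True
        then show ?thesis using top[of k] k config_row[OF R, of r k] by auto
      next
        case False
        then show ?thesis using configD(2)[OF R, of r k] k by auto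
      qed
      show "j = j'" if "(r, k, j) \<in> D \<and> (r, k, j') \<in> D" for j j' using configD(3)[OF R, of r k j j'] that by simp
      show "k' = k''" if "(r - 1, k', k) \<in> D \<and> (r - 1, k'', k) \<in> D" for k' k''
        using configD(4)[OF R, of "r - 1" k' k k''] that by simp
    qed
  qed
qed

lemma bij_betw_link_edge: "bij_betw ((`) (link_edge a)) (configs (2 * N + 1)) (dimer_configs N \<Omega> a)" unfolding bij_betw_def
proof
  show "inj_on ((`) (link_edge a)) (configs (2 * N + 1))"
    using inj_link_edge[of a] by (auto intro!: inj_onI dest: inj_image_eq_iff[THEN iffD1])
  show "(`) (link_edge a) ` configs (2 * N + 1) = dimer_configs N \<Omega> a"
  proof (intro set_eqI iffI)
    fix D' assume D': "D' \<in> dimer_configs N \<Omega> a"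
    then have "D' \<subseteq> link_edge a ` links (2 * N + 1)" by (auto simp: dimer_configs_def R_edges_eq)
    then obtain D where D: "D \<subseteq> links (2 * N + 1)" "D' = link_edge a ` D" by (auto simp: subset_image_iff)
    then show "D' \<in> (`) (link_edge a) ` configs (2 * N + 1)" using link_edge_config_iff[OF D(1)] D' by auto
  next
    fix D' assume "D' \<in> (`) (link_edge a) ` configs (2 * N + 1)"
    then obtain D where D: "D \<in> configs (2 * N + 1)" "D' = link_edge a ` D" by auto
    moreover have "D \<subseteq> links (2 * N + 1)" using D by (auto simp: configs_def)
    ultimately show "D' \<in> dimer_configs N \<Omega> a" using link_edge_config_iff by simp
  qed
qed

lemma dimer_weight_link_edge:
  assumes "D \<in> configs R"
  shows "dimer_weight x y (link_edge a ` D) = weight D"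
proof -
  have "(\<Prod>e\<in>link_edge a ` D. edge_weight x y e) = (\<Prod>t\<in>D. edge_weight x y (link_edge a t))"
    using inj_link_edge[of a] by (subst prod.reindex) (auto simp: inj_on_def inj_def)
  also have "... = (\<Prod>t\<in>D. lwt a x y t)"
  proof (rule prod.cong)
    fix t assume "t \<in> D"
    then show "edge_weight x y (link_edge a t) = lwt a x y t"
      using configD(1)[OF assms] edge_weight_link_edge[of "fst t" a "fst (snd t)" "snd (snd t)"] by (cases t) auto
  qed simp
  finally show ?thesis by (simp add: dimer_weight_def weight_def)
qed

lemma sum_dimers: "(\<Sum>D\<in>dimer_configs N \<Omega> a. dimer_weight x y D * F D)
    = (\<Sum>D\<in>configs (2 * N + 1). weight D * F (link_edge a ` D))"
  using sum.reindex_bij_betw[OF bij_betw_link_edge, of "%D. dimer_weight x y D * F D"]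
  by (simp add: dimer_weight_link_edge cong: sum.cong)

text \<open>On row \<open>2 s + 1\<close> a position \<open>k\<close> is one less than the vertex number.\<close>

lemma level_set_link_edge:
  assumes D: "D \<in> configs (2 * N + 1)" and s: "1 <= s" "s < N"
  shows "vertex_number N \<Omega> a s ` {u. \<exists>v. ((2 * s + 1, u), (2 * s + 2, v)) \<in> link_edge a ` D} = Suc ` ups (2 * s + 1) D"
proof -
  have "{u. \<exists>v. ((2 * s + 1, u), (2 * s + 2, v)) \<in> link_edge a ` D} = pos a (2 * s + 1) ` ups (2 * s + 1) D"
    by (force simp: ups_def link_edge_def image_iff)
  moreover have "vertex_number N \<Omega> a s (pos a (2 * s + 1) k) = Suc k" if k: "k \<in> ups (2 * s + 1) D" for k
  proof -
    have kV: "k \<in> V (2 * s + 1)" using k configD(1)[OF D, of "2 * s + 1" k] by (auto simp: ups_def)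
    have "{w \<in> R_row N \<Omega> a (2 * s + 1). w <= pos a (2 * s + 1) k} = pos a (2 * s + 1) ` {..k}"
      using kV s by (subst R_row_eq) (auto simp: V_def pos_def)
    moreover have "inj_on (pos a (2 * s + 1)) {..k}" by (auto simp: inj_on_def pos_def)
    ultimately show ?thesis using s by (simp add: vertex_number_def card_image)
  qed
  ultimately show ?thesis by (simp add: image_image cong: image_cong_simp)
qed

end

section \<open>The alternating generating function of a level\<close>

lemma inj_funs_cong: "(!!k. k \<in> A ==> S k = T k) ==> inj_funs A S = inj_funs A T"
  unfolding inj_funs_def using PiE_cong[of A S T] by simp

context weighted_contracting
begin

definition row_factor :: "nat => real list => real" where
  "row_factor t us = (if a t = 1 then 1 else \<Prod>u\<leftarrow>us. 1 + y t * u)"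

definition alt_set :: "real list => nat set => real" where
  "alt_set us A = alt us (mons (slist A))"

text \<open>Free white vertices go up. The alternant is attached to the black vertices they hit, the
  complement of the free black set, because the next row is governed by that set.\<close>

lemma step_odd:
  assumes A: "A \<subseteq> {..<width (\<Omega> N) a (2 * t + 1)}" and us: "card A = length us"
  shows "step (2 * t + 1) (%C. alt_set us (V (2 * t + 2) - C)) A = row_factor (Suc t) us * alt_set us A"
proof -
  have finA: "finite A" using A by (rule finite_subset) simp
  have V: "V (2 * t + 2) = {..<width (\<Omega> N) a (2 * t + 2)}" by (simp add: V_def)
  have w: "width (\<Omega> N) a (2 * t + 2) = (if a (Suc t) = 1 then width (\<Omega> N) a (2 * t + 1) else width (\<Omega> N) a (2 * t + 1) + 1)"
    using width_Suc[of "2 * t + 1" "\<Omega> N" a] by simp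
  have sub: "d ` A \<subseteq> V (2 * t + 2)" if "d \<in> inj_funs A (nbrs (2 * t + 1))" for d
    using that inj_funs_nbrsD(1)[of d A "2 * t + 1"] by auto
  have st: "step (2 * t + 1) (%C. alt_set us (V (2 * t + 2) - C)) A
      = (\<Sum>d\<in>inj_funs A (nbrs (2 * t + 1)). (\<Prod>k\<in>A. lwt a x y (2 * t + 1, k, d k)) * alt_set us (d ` A))" unfolding step_def
  proof (intro sum.cong refl)
    fix d assume "d \<in> inj_funs A (nbrs (2 * t + 1))"
    from double_diff[OF sub[OF this] order_refl]
    show "(\<Prod>k\<in>A. lwt a x y (2 * t + 1, k, d k)) * alt_set us (V (2 * t + 2) - (V (Suc (2 * t + 1)) - d ` A))
       = (\<Prod>k\<in>A. lwt a x y (2 * t + 1, k, d k)) * alt_set us (d ` A)" by simp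
  qed
  show ?thesis
  proof (cases "a (Suc t) = 1")
    case True
    have "nbrs (2 * t + 1) k = {k}" if "k \<in> A" for k using that A True V w by (auto simp: nbrs_def nbr_def)
    then have S: "inj_funs A (nbrs (2 * t + 1)) = inj_funs A (%k. {k})" by (rule inj_funs_cong)
    have "inj_funs A (%k. {k}) = {restrict id A}"
      by (auto simp: inj_funs_def PiE_def extensional_def restrict_def Pi_def fun_eq_iff inj_on_def)
    then show ?thesis unfolding st S by (simp add: lwt_def row_factor_def True)
  next
    case False
    have "nbrs (2 * t + 1) k = {k, Suc k}" if "k \<in> A" for k using that A False V w by (auto simp: nbrs_def nbr_def)
    then have S: "inj_funs A (nbrs (2 * t + 1)) = inj_funs A (%k. {k, Suc k})" by (rule inj_funs_cong)
    have "lwt a x y (2 * t + 1, k, j) = (if j = Suc k then y (Suc t) else 1)" for k j using False by (auto simp: lwt_def)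
    moreover have "row_factor (Suc t) us = (\<Prod>u\<leftarrow>us. 1 + y (Suc t) * u)" using False by (auto simp: row_factor_def)
    ultimately show ?thesis unfolding st S unfolding alt_set_def using alt_up[OF finA us, of "y (Suc t)"] by (simp only:)
  qed
qed

text \<open>\<open>B\<close> consists of the black vertices matched from below; the others go up,
  and the white vertices they miss are the next free set.\<close>

lemma step_even:
  assumes B: "B \<subseteq> V (2 * t + 2)" and t: "t < N" and us: "card B = Suc (length us)"
  shows "step (2 * t + 2) (alt_set us) (V (2 * t + 2) - B) * (\<Prod>u\<leftarrow>us. u - x (Suc t)) = alt_set (x (Suc t) # us) B"
proof -
  let ?w = "width (\<Omega> N) a (2 * t + 2)"
  have V: "V (2 * t + 2) = {..<?w}" by (simp add: V_def)
  have w: "1 <= ?w" using width_pos[of "2 * t + 2"] t by simp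
  have V': "V (Suc (2 * t + 2)) = {..<?w - 1}" by (auto simp: V_def)
  have S: "inj_funs ({..<?w} - B) (nbrs (2 * t + 2))
      = inj_funs ({..<?w} - B) (%k. {j. (j = k \<or> Suc j = k) \<and> Suc j < ?w})"
    unfolding nbrs_def V' by (rule inj_funs_cong) (auto simp: nbr_def)
  show ?thesis
  proof -
    have "lwt a x y (2 * t + 2, k, j) = (if j = k then x (Suc t) else 1)" for k j by (auto simp: lwt_def)
    then show ?thesis unfolding step_def V V' S unfolding alt_set_def
      using alt_down[of B ?w us "x (Suc t)"] B w us by (simp only: V)
  qed
qed

lemma step_cong:
  assumes "!!d. d \<in> inj_funs A (nbrs R) ==> g (V (Suc R) - d ` A) = h (V (Suc R) - d ` A)"
  shows "step R g A = step R h A"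
  unfolding step_def using assms by (intro sum.cong) auto

lemma step_scale: "step R (%A. c * g A) A = c * step R g A" unfolding step_def by (simp add: sum_distrib_left algebra_simps)

lemma double_step:
  assumes A: "A \<subseteq> {..<width (\<Omega> N) a (2 * t + 1)}" and t: "t < N" and us: "card A = Suc (length us)"
  shows "step (2 * t + 1) (step (2 * t + 2) (alt_set us)) A * (\<Prod>u\<leftarrow>us. u - x (Suc t))
     = row_factor (Suc t) (x (Suc t) # us) * alt_set (x (Suc t) # us) A"
proof -
  have "step (2 * t + 1) (step (2 * t + 2) (alt_set us)) A * (\<Prod>u\<leftarrow>us. u - x (Suc t))
     = step (2 * t + 1) (%C. (\<Prod>u\<leftarrow>us. u - x (Suc t)) * step (2 * t + 2) (alt_set us) C) A" by (simp add: step_scale)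
  also have "... = step (2 * t + 1) (%C. alt_set (x (Suc t) # us) (V (2 * t + 2) - C)) A"
  proof (rule step_cong)
    fix d assume d: "d \<in> inj_funs A (nbrs (2 * t + 1))"
    have sub: "d ` A \<subseteq> V (2 * t + 2)" using inj_funs_nbrsD(1)[OF d] by auto
    have "card (d ` A) = Suc (length us)" using d us by (simp add: inj_funs_def card_image)
    from step_even[OF sub t this] double_diff[OF sub order_refl]
    show "(\<Prod>u\<leftarrow>us. u - x (Suc t)) * step (2 * t + 2) (alt_set us) (V (Suc (2 * t + 1)) - d ` A) =
         alt_set (x (Suc t) # us) (V (2 * t + 2) - (V (Suc (2 * t + 1)) - d ` A))" by (simp add: mult.commute)
  qed
  also have "... = row_factor (Suc t) (x (Suc t) # us) * alt_set (x (Suc t) # us) A" using us by (intro step_odd A) simp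
  finally show ?thesis .
qed

definition level_sum :: "((nat \<times> nat \<times> nat) set => real) => nat => real list => real" where
  "level_sum H t us = (\<Sum>D\<in>configs (2 * t + 1). weight D * H D * alt_set us (free (2 * t + 1) D))"

lemma free_subset: "free R D \<subseteq> {..<width (\<Omega> N) a R}" using V_subset by (auto simp: free_def)

text \<open>Read downwards, two rows are traded for one further variable, the weight
  \<open>x (Suc t)\<close>. The product on the left remains a factor because \<open>us\<close> is
  arbitrary and may contain that weight.\<close>

lemma level_sum_Suc:
  assumes t: "t < N" and us: "length us = N - Suc t"
    and H1: "!!D d. D \<in> configs (2 * t + 1) ==> d \<in> inj_funs (free (2 * t + 1) D) (nbrs (2 * t + 1)) ==>
        H1 (D \<union> graph (2 * t + 1) (free (2 * t + 1) D) d) = H D"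
    and H2: "!!D d. D \<in> configs (2 * t + 2) ==> d \<in> inj_funs (free (2 * t + 2) D) (nbrs (2 * t + 2)) ==>
        H2 (D \<union> graph (2 * t + 2) (free (2 * t + 2) D) d) = H1 D"
  shows "level_sum H2 (Suc t) us * (\<Prod>u\<leftarrow>us. u - x (Suc t))
     = row_factor (Suc t) (x (Suc t) # us) * level_sum H t (x (Suc t) # us)"
proof -
  have "level_sum H2 (Suc t) us = (\<Sum>D\<in>configs (Suc (2 * t + 2)). weight D * H2 D * alt_set us (free (Suc (2 * t + 2)) D))"
    by (simp add: level_sum_def)
  also have "... = (\<Sum>D\<in>configs (Suc (2 * t + 1)). weight D * H1 D * step (2 * t + 2) (alt_set us) (free (Suc (2 * t + 1)) D))"
    using sum_configs_step[of "2 * t + 2" H2 H1 "alt_set us"] H2 by simp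
  also have "... = (\<Sum>D\<in>configs (2 * t + 1). weight D * H D * step (2 * t + 1) (step (2 * t + 2) (alt_set us)) (free (2 * t + 1) D))"
    using H1 by (intro sum_configs_step) auto
  finally have "level_sum H2 (Suc t) us * (\<Prod>u\<leftarrow>us. u - x (Suc t)) =
      (\<Sum>D\<in>configs (2 * t + 1). weight D * H D * (step (2 * t + 1) (step (2 * t + 2) (alt_set us)) (free (2 * t + 1) D) * (\<Prod>u\<leftarrow>us. u - x (Suc t))))"
    by (simp add: sum_distrib_right mult.assoc)
  also have "... = (\<Sum>D\<in>configs (2 * t + 1). weight D * H D * (row_factor (Suc t) (x (Suc t) # us) * alt_set (x (Suc t) # us) (free (2 * t + 1) D)))"
  proof (intro sum.cong refl)
    fix D assume "D \<in> configs (2 * t + 1)"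
    then have "card (free (2 * t + 1) D) = Suc (length us)" using card_free_odd[of t D] t us by simp
    from double_step[OF free_subset t this]
    show "weight D * H D * (step (2 * t + 1) (step (2 * t + 2) (alt_set us)) (free (2 * t + 1) D) * (\<Prod>u\<leftarrow>us. u - x (Suc t)))
      = weight D * H D * (row_factor (Suc t) (x (Suc t) # us) * alt_set (x (Suc t) # us) (free (2 * t + 1) D))" by (simp only:)
  qed
  also have "... = row_factor (Suc t) (x (Suc t) # us) * level_sum H t (x (Suc t) # us)"
    by (simp add: level_sum_def sum_distrib_left algebra_simps)
  finally show ?thesis .
qed

lemma row_factor_Cons: "row_factor i (u # us) = row_factor i [u] * row_factor i us" by (simp add: row_factor_def)

text \<open>Descending to row \<open>1\<close> turns all weights below the level into variables;
  there only the empty configuration is left, and the boundary alternant appears. Keeping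
  \<open>us\<close> arbitrary is what later permits dilations.\<close>

lemma level_sum_below:
  assumes inj: "inj_on x {1..N}" and pos: "!!i. i \<in> {1..N} ==> 0 < x i \<and> 0 < y i"
  shows "s <= N ==> \<exists>K. K ~= 0 \<and> (\<forall>us. length us = N - s -->
    level_sum (%_. 1) s us * (\<Prod>i\<in>{1..s}. \<Prod>u\<leftarrow>us. u - x i)
    = K * (\<Prod>i\<in>{1..s}. row_factor i us) * alt_set (map x [1..<Suc s] @ us) (V 1))"
proof (induction s)
  case 0
  have "level_sum (%_. 1) 0 us = alt_set us (V 1)" for us by (simp add: level_sum_def configs_1[simplified] weight_def free_def)
  then show ?case by (intro exI[of _ 1]) simp
next
  case (Suc s)
  then obtain K where K: "K ~= 0" "!!us. length us = N - s ==>
    level_sum (%_. 1) s us * (\<Prod>i\<in>{1..s}. \<Prod>u\<leftarrow>us. u - x i)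
    = K * (\<Prod>i\<in>{1..s}. row_factor i us) * alt_set (map x [1..<Suc s] @ us) (V 1)" by auto
  let ?x = "x (Suc s)"
  define E where "E = (\<Prod>i\<in>{1..s}. ?x - x i)"
  define F where "F = (\<Prod>i\<in>{1..Suc s}. row_factor i [?x])"
  \<comment> \<open>Distinct weights make the factor that is divided out invertible.\<close>
  have E: "E ~= 0" unfolding E_def using inj Suc.prems by (auto dest: inj_onD)
  have "row_factor i [?x] ~= 0" if "i \<in> {1..Suc s}" for i
  proof -
    have "0 < y i" "0 < ?x" using pos that Suc.prems by auto
    then have "0 < 1 + y i * ?x" by (simp add: add_pos_pos)
    then show ?thesis by (auto simp: row_factor_def)
  qed
  then have F: "F ~= 0" by (simp add: F_def)
  show ?case
  proof (intro exI[of _ "K * F / E"] conjI allI impI)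
    show "K * F / E ~= 0" using K E F by simp
    fix us :: "real list" assume us: "length us = N - Suc s"
    define P where "P = (\<Prod>i\<in>{1..s}. \<Prod>u\<leftarrow>us. u - x i)"
    have 1: "level_sum (%_. 1) (Suc s) us * (\<Prod>u\<leftarrow>us. u - ?x)
      = row_factor (Suc s) (?x # us) * level_sum (%_. 1) s (?x # us)" using us Suc.prems by (intro level_sum_Suc) auto
    have 2: "level_sum (%_. 1) s (?x # us) * (E * P)
      = K * (\<Prod>i\<in>{1..s}. row_factor i (?x # us)) * alt_set (map x [1..<Suc s] @ ?x # us) (V 1)"
      using K(2)[of "?x # us"] us Suc.prems by (simp add: E_def P_def prod.distrib)
    have 3: "(\<Prod>i\<in>{1..Suc s}. row_factor i (?x # us)) = F * (\<Prod>i\<in>{1..Suc s}. row_factor i us)"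
      unfolding F_def prod.distrib[symmetric] by (intro prod.cong refl row_factor_Cons)
    have "level_sum (%_. 1) (Suc s) us * (\<Prod>i\<in>{1..Suc s}. \<Prod>u\<leftarrow>us. u - x i) * E
       = (level_sum (%_. 1) (Suc s) us * (\<Prod>u\<leftarrow>us. u - ?x)) * (E * P)" by (simp add: P_def algebra_simps)
    also have "... = row_factor (Suc s) (?x # us) * (level_sum (%_. 1) s (?x # us) * (E * P))"
      unfolding 1 by (simp only: mult.assoc)
    also have "... = K * (\<Prod>i\<in>{1..Suc s}. row_factor i (?x # us)) * alt_set (map x [1..<Suc s] @ ?x # us) (V 1)"
      unfolding 2 by (simp add: algebra_simps)
    also have "... = K * F * (\<Prod>i\<in>{1..Suc s}. row_factor i us) * alt_set (map x [1..<Suc (Suc s)] @ us) (V 1)" unfolding 3 by simp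
    finally show "level_sum (%_. 1) (Suc s) us * (\<Prod>i\<in>{1..Suc s}. \<Prod>u\<leftarrow>us. u - x i)
       = K * F / E * (\<Prod>i\<in>{1..Suc s}. row_factor i us) * alt_set (map x [1..<Suc (Suc s)] @ us) (V 1)"
      using E by (simp add: field_simps)
  qed
qed

text \<open>Before the next layer is added, the level set is visible as the free set; afterwards it
  is recorded as the set of vertices matched upwards.\<close>

definition observe :: "(nat set => real) => nat => nat => (nat \<times> nat \<times> nat) set => real" where
  "observe g s R D = (if R = 2 * s + 1 then g (free R D) else g (ups (2 * s + 1) D))"

text \<open>Above the level the observable is frozen, and each descent merely adds the next weight
  as a variable. The factor \<open>c\<close> is the same for all \<open>g\<close>, so it cancels in
  averages.\<close>

lemma level_sum_above:
  assumes inj: "inj_on x {1..N}" and pos: "!!i. i \<in> {1..N} ==> 0 < x i \<and> 0 < y i" and s: "s < N"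
  shows "\<exists>c. c ~= 0 \<and> (\<forall>g. level_sum (observe g s (2 * N + 1)) N [] =
     c * level_sum (observe g s (2 * s + 1)) s (map x [Suc s..<Suc N]))"
proof -
  have "t <= N ==> s <= t ==> \<exists>c. c ~= 0 \<and> (\<forall>g. level_sum (observe g s (2 * N + 1)) N [] =
     c * level_sum (observe g s (2 * t + 1)) t (map x [Suc t..<Suc N]))" for t
  proof (induction t rule: inc_induct)
    case base
    then show ?case by (intro exI[of _ 1]) simp
  next
    case (step t)
    then obtain c where c: "c ~= 0" "!!g. level_sum (observe g s (2 * N + 1)) N [] =
     c * level_sum (observe g s (2 * Suc t + 1)) (Suc t) (map x [Suc (Suc t)..<Suc N])" by auto
    define us where "us = map x [Suc (Suc t)..<Suc N]"
    define x' where "x' = x (Suc t)"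
    have cons: "map x [Suc t..<Suc N] = x' # us"
    proof -
      have "[Suc t..<Suc N] = Suc t # [Suc (Suc t)..<Suc N]" using step.hyps by (intro upt_conv_Cons) simp
      then show ?thesis by (simp only: us_def x'_def list.map)
    qed
    have P: "(\<Prod>u\<leftarrow>us. u - x') ~= 0"
    proof -
      have "x j ~= x'" if "j \<in> {Suc (Suc t)..<Suc N}" for j
        using inj_onD[OF inj, of j "Suc t"] that step.hyps by (auto simp: x'_def)
      then show ?thesis by (auto simp: us_def prod_list_zero_iff simp del: upt_Suc)
    qed
    have F: "row_factor (Suc t) (x' # us) ~= 0"
    proof -
      have "0 < 1 + y (Suc t) * u" if u: "u \<in> set (x' # us)" for u
      proof -
        have "u \<in> x ` {1..N}" using u step.hyps by (auto simp: us_def x'_def simp del: upt_Suc)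
        then have "0 < u" using pos by auto
        moreover have "0 < y (Suc t)" using pos[of "Suc t"] step.hyps by auto
        ultimately show ?thesis by (simp add: add_pos_pos)
      qed
      then have "1 + y (Suc t) * u ~= 0" if "u \<in> set (x' # us)" for u using that by fastforce
      then show ?thesis by (auto simp: row_factor_def prod_list_zero_iff)
    qed
    have eq: "level_sum (observe g s (2 * Suc t + 1)) (Suc t) us * (\<Prod>u\<leftarrow>us. u - x')
       = row_factor (Suc t) (x' # us) * level_sum (observe g s (2 * t + 1)) t (x' # us)" for g unfolding x'_def
    proof (rule level_sum_Suc)
      show "t < N" using step.hyps by simp
      show "length us = N - Suc t" by (simp add: us_def del: upt_Suc)
      show "(%D. g (ups (2 * s + 1) D)) (D \<union> graph (2 * t + 1) (free (2 * t + 1) D) d) = observe g s (2 * t + 1) D"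
        if "D \<in> configs (2 * t + 1)" for D d using ups_extend[OF that] step.prems by (auto simp: observe_def)
      show "observe g s (2 * Suc t + 1) (D \<union> graph (2 * t + 2) (free (2 * t + 2) D) d) = g (ups (2 * s + 1) D)"
        if "D \<in> configs (2 * t + 2)" for D d using ups_extend(2)[OF that, of "2 * s + 1"] step.prems by (auto simp: observe_def)
    qed
    show ?case
    proof (intro exI[of _ "c * row_factor (Suc t) (x' # us) / (\<Prod>u\<leftarrow>us. u - x')"] conjI allI)
      show "c * row_factor (Suc t) (x' # us) / (\<Prod>u\<leftarrow>us. u - x') ~= 0" using c P F by simp
      fix g
      have "level_sum (observe g s (2 * Suc t + 1)) (Suc t) us
        = row_factor (Suc t) (x' # us) * level_sum (observe g s (2 * t + 1)) t (x' # us) / (\<Prod>u\<leftarrow>us. u - x')"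
        using eq[of g] P by (simp add: field_simps)
      then show "level_sum (observe g s (2 * N + 1)) N [] = c * row_factor (Suc t) (x' # us) / (\<Prod>u\<leftarrow>us. u - x')
         * level_sum (observe g s (2 * t + 1)) t (map x [Suc t..<Suc N])" unfolding cons c(2)[of g] us_def[symmetric] by simp
    qed
  qed
  from this[of s] s show ?thesis by simp
qed

lemma level_sum_shift:
  assumes s: "s <= N" and us: "length us = N - s"
  shows "level_sum (%D. H D * (\<Sum>l\<in>free (2 * s + 1) D. q ^ l)) s us
     = (\<Sum>i<length us. level_sum H s (us[i := q * us ! i]))"
proof -
  have "(\<Sum>i<length us. level_sum H s (us[i := q * us ! i])) =
     (\<Sum>D\<in>configs (2 * s + 1). weight D * H D * (\<Sum>i<length us. alt_set (us[i := q * us ! i]) (free (2 * s + 1) D)))"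
    unfolding level_sum_def by (subst sum.swap) (simp add: sum_distrib_left)
  also have "... = (\<Sum>D\<in>configs (2 * s + 1). weight D * (H D * (\<Sum>l\<in>free (2 * s + 1) D. q ^ l)) * alt_set us (free (2 * s + 1) D))"
  proof (intro sum.cong refl)
    fix D assume D: "D \<in> configs (2 * s + 1)"
    have "(\<Sum>i<length us. alt_set (us[i := q * us ! i]) (free (2 * s + 1) D))
      = (\<Sum>l\<leftarrow>slist (free (2 * s + 1) D). q ^ l) * alt_set us (free (2 * s + 1) D)"
      unfolding alt_set_def using card_free_odd[OF s D] us finite_free by (intro alt_shift) simp
    also have "(\<Sum>l\<leftarrow>slist (free (2 * s + 1) D). q ^ l) = (\<Sum>l\<in>free (2 * s + 1) D. q ^ l)"
      by (subst sum_list_distinct_conv_sum_set) (simp_all add: finite_free)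
    finally show "weight D * H D * (\<Sum>i<length us. alt_set (us[i := q * us ! i]) (free (2 * s + 1) D)) =
       weight D * (H D * (\<Sum>l\<in>free (2 * s + 1) D. q ^ l)) * alt_set us (free (2 * s + 1) D)" by (simp add: mult_ac)
  qed
  finally show ?thesis by (simp add: level_sum_def)
qed

text \<open>\<open>\<Psi>\<close> is the alternating version of the Schur generating function at level \<open>s\<close>.\<close>

theorem dimer_sums:
  assumes inj: "inj_on x {1..N}" and pos: "!!i. i \<in> {1..N} ==> 0 < x i \<and> 0 < y i" and s: "1 <= s" "s < N"
  obtains c K \<Psi> where "c ~= 0" "K ~= 0"
    and "!!us. length us = N - s ==> \<Psi> us * (\<Prod>i\<in>{1..s}. \<Prod>u\<leftarrow>us. u - x i)
        = K * (\<Prod>i\<in>{1..s}. row_factor i us) * alt_set (map x [1..<Suc s] @ us) (V 1)"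
    and "(\<Sum>D\<in>configs (2 * N + 1). weight D) = c * \<Psi> (map x [Suc s..<Suc N])"
    and "!!q. (\<Sum>D\<in>configs (2 * N + 1). weight D * (\<Sum>l\<in>ups (2 * s + 1) D. q ^ l))
       = c * (\<Sum>i<N - s. \<Psi> ((map x [Suc s..<Suc N])[i := q * map x [Suc s..<Suc N] ! i]))"
    and "!!q. (\<Sum>D\<in>configs (2 * N + 1). weight D * (\<Sum>l\<in>ups (2 * s + 1) D. q ^ l)\<^sup>2)
       = c * (\<Sum>i<N - s. \<Sum>k<N - s. let us = (map x [Suc s..<Suc N])[i := q * map x [Suc s..<Suc N] ! i]
             in \<Psi> (us[k := q * us ! k]))"
proof -
  define \<Psi> where "\<Psi> = level_sum (%_. 1) s"
  define us where "us = map x [Suc s..<Suc N]"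
  have us: "length us = N - s" by (simp add: us_def del: upt_Suc)
  have sN: "s <= N" using s by simp
  obtain K where K: "K ~= 0" "\<forall>us. length us = N - s -->
    level_sum (%_. 1) s us * (\<Prod>i\<in>{1..s}. \<Prod>u\<leftarrow>us. u - x i)
    = K * (\<Prod>i\<in>{1..s}. row_factor i us) * alt_set (map x [1..<Suc s] @ us) (V 1)" using level_sum_below[OF inj pos sN] by blast
  obtain c where c: "c ~= 0" "!!g. level_sum (observe g s (2 * N + 1)) N [] =
     c * level_sum (observe g s (2 * s + 1)) s us" using level_sum_above[OF inj pos s(2)] unfolding us_def by blast
  have top: "(\<Sum>D\<in>configs (2 * N + 1). weight D * g (ups (2 * s + 1) D)) = c * level_sum (%D. g (free (2 * s + 1) D)) s us" for g
    using c(2)[of g] s by (simp add: level_sum_def observe_def alt_set_def)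
  have 1: "(\<Sum>D\<in>configs (2 * N + 1). weight D) = c * \<Psi> us" using top[of "%_. 1"] by (simp add: \<Psi>_def)
  have 2: "(\<Sum>D\<in>configs (2 * N + 1). weight D * (\<Sum>l\<in>ups (2 * s + 1) D. q ^ l))
       = c * (\<Sum>i<N - s. \<Psi> (us[i := q * us ! i]))" for q
    using top[of "%A. \<Sum>l\<in>A. q ^ l"] level_sum_shift[OF sN us, of "%_. 1" q] by (simp add: \<Psi>_def us)
  have 3: "(\<Sum>D\<in>configs (2 * N + 1). weight D * (\<Sum>l\<in>ups (2 * s + 1) D. q ^ l)\<^sup>2)
       = c * (\<Sum>i<N - s. \<Sum>k<N - s. let us' = us[i := q * us ! i] in \<Psi> (us'[k := q * us' ! k]))" for q
  proof -
    \<comment> \<open>The square arises from applying the sum of dilations twice, the second time to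
      every variable list produced by the first.\<close>
    have "level_sum (%D. (\<Sum>l\<in>free (2 * s + 1) D. q ^ l)\<^sup>2) s us
      = (\<Sum>i<length us. level_sum (%D. \<Sum>l\<in>free (2 * s + 1) D. q ^ l) s (us[i := q * us ! i]))"
      using level_sum_shift[OF sN us, of "%D. \<Sum>l\<in>free (2 * s + 1) D. q ^ l" q] by (simp add: power2_eq_square)
    also have "... = (\<Sum>i<length us. \<Sum>k<length us. let us' = us[i := q * us ! i] in \<Psi> (us'[k := q * us' ! k]))"
      unfolding \<Psi>_def Let_def using level_sum_shift[OF sN, of "us[i := q * us ! i]" "%_. 1" q for i] us
      by (intro sum.cong refl) simp
    finally show ?thesis using top[of "%A. (\<Sum>l\<in>A. q ^ l)\<^sup>2"] us by simp
  qed
  show thesis by (rule that[OF c(1) K(1), of \<Psi>]) (use K(2) 1 2 3 in \<open>auto simp: \<Psi>_def us_def\<close>)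
qed

lemma ups_eq_free:
  assumes "D \<in> configs R" "1 <= r" "r < R"
  shows "\<exists>D0\<in>configs r. ups r D = free r D0"
  using assms(3,1)
proof (induction R arbitrary: D)
  case (Suc R)
  have R: "1 <= R" using Suc.prems assms(2) by simp
  define D0 where "D0 = {e \<in> D. fst e < R}"
  have D0: "D0 \<in> configs R" "free R D0 = ups R D" using restrict_config(1,2)[OF Suc.prems(2) R] by (auto simp: D0_def)
  show ?case
  proof (cases "r = R")
    case True
    then show ?thesis using D0 by auto
  next
    case False
    moreover from this have "ups r D0 = ups r D" using Suc.prems by (auto simp: ups_def D0_def)
    ultimately show ?thesis using Suc.IH[OF _ D0(1)] Suc.prems by auto
  qed
qed simp

lemma card_ups:
  assumes "D \<in> configs (2 * N + 1)" "s < N"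
  shows "card (ups (2 * s + 1) D) = N - s"
  using ups_eq_free[OF assms(1), of "2 * s + 1"] card_free_odd[of s] assms(2) by auto

lemma ups_bound:
  assumes "D \<in> configs (2 * N + 1)" "l \<in> ups (2 * s + 1) D"
  shows "l < \<Omega> N + N"
proof -
  have le: "width (\<Omega> N) a R <= \<Omega> N + R div 2" if "1 <= R" for R using that by (induction R rule: dec_induct) (auto simp: width_Suc)
  obtain j where "(2 * s + 1, l, j) \<in> D" using assms(2) by (auto simp: ups_def)
  then have "l \<in> V (2 * s + 1)" "s < N" using configD(1)[OF assms(1), of "2 * s + 1" l j] by auto
  then show ?thesis using V_subset[of "2 * s + 1"] le[of "2 * s + 1"] by auto
qed

text \<open>Adding \<open>M - i\<close> to the \<open>i\<close>-th part gives back a vertex number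
  minus one. So the counting measure is uniform on the rescaled positions
  \<open>l / M\<close>.\<close>

lemma integral_counting_measure:
  fixes f :: "real => real"
  assumes D: "D \<in> configs (2 * N + 1)" and s: "1 <= s" "s < N" and f: "f \<in> borel_measurable borel"
  shows "integral\<^sup>L (counting_measure (level_partition N \<Omega> a s (link_edge a ` D))) f
     = (\<Sum>l\<in>ups (2 * s + 1) D. f (real l / real (N - s))) / real (N - s)"
proof -
  define U where "U = ups (2 * s + 1) D"
  define q where "q = slist (Suc ` U)"
  define M where "M = N - s"
  have "U \<subseteq> V (2 * s + 1)" using configD(1)[OF D] by (auto simp: ups_def U_def)
  then have finU: "finite U" using finV by (rule finite_subset)
  have len: "length q = M" using finU card_ups[OF D s(2)] by (simp add: q_def card_image M_def U_def)
  have M: "0 < M" using s by (simp add: M_def)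
  have lp: "level_partition N \<Omega> a s (link_edge a ` D) = rev (map (%i. q ! i - Suc i) [0..<M])"
    unfolding level_partition_def level_set_link_edge[OF D s] U_def[symmetric] q_def[symmetric] Let_def len ..
  have q: "sorted_wrt (<) q" "set q = Suc ` U" using finU by (auto simp: q_def)
  \<comment> \<open>Vertex numbers start at \<open>1\<close> and increase strictly, so the
    subtraction that defines the parts is not truncated.\<close>
  have ge: "Suc i <= q ! i" if "i < M" for i using that
  proof (induction i)
    case 0
    then have "q ! 0 \<in> set q" using len M nth_mem by blast
    then show ?case using q by auto
  next
    case (Suc i)
    then have "q ! i < q ! Suc i" using q(1) len by (auto simp: sorted_wrt_iff_nth_less)
    then show ?case using Suc by auto
  qed
  have val: "(real (rev (map (%i. q ! i - Suc i) [0..<M]) ! (i - 1)) + real M - real i) / real M = real (q ! (M - i) - 1) / real M"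
    if "i \<in> {1..M}" for i
  proof -
    have "rev (map (%i. q ! i - Suc i) [0..<M]) ! (i - 1) = q ! (M - i) - Suc (M - i)"
    proof -
      have "M - Suc (i - 1) = M - i" "i - 1 < M" "M - i < M" using that by auto
      then show ?thesis by (simp add: rev_nth)
    qed
    then show ?thesis using ge[of "M - i"] that by (simp add: of_nat_diff)
  qed
  have "integral\<^sup>L (counting_measure (level_partition N \<Omega> a s (link_edge a ` D))) f
    = (\<integral>i. f ((real (rev (map (%i. q ! i - Suc i) [0..<M]) ! (i - 1)) + real M - real i) / real M) \<partial>uniform_count_measure {1..M})"
    unfolding counting_measure_def lp by (subst integral_distr) (use f in auto)
  also have "... = (\<Sum>i\<in>{1..M}. f ((real (rev (map (%i. q ! i - Suc i) [0..<M]) ! (i - 1)) + real M - real i) / real M)) / real M"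
    by (subst integral_uniform_count_measure) (auto simp: sum_divide_distrib)
  also have "(\<Sum>i\<in>{1..M}. f ((real (rev (map (%i. q ! i - Suc i) [0..<M]) ! (i - 1)) + real M - real i) / real M))
     = (\<Sum>i\<in>{1..M}. f (real (q ! (M - i) - 1) / real M))" by (intro sum.cong refl) (simp only: val)
  also have "... = (\<Sum>i<M. f (real (q ! i - 1) / real M))"
    by (rule sum.reindex_bij_witness[where i = "%i. M - i" and j = "%i. M - i"]) auto
  also have "... = (\<Sum>v\<leftarrow>q. f (real (v - 1) / real M))" by (simp add: sum_list_sum_nth len atLeast0LessThan)
  also have "... = (\<Sum>v\<in>Suc ` U. f (real (v - 1) / real M))" using finU by (subst sum_list_distinct_conv_sum_set) (auto simp: q_def)
  also have "... = (\<Sum>l\<in>U. f (real l / real M))" by (subst sum.reindex) auto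
  finally show ?thesis by (simp add: U_def M_def)
qed

end

section \<open>Divided differences of a power function\<close>

definition geo :: "'a::field => 'a fps" where
  "geo a = Abs_fps (%n. a ^ n)"

definition hgf :: "'a::field list => 'a fps" where
  "hgf l = (\<Prod>a\<leftarrow>l. geo a)"

text \<open>The complete homogeneous symmetric polynomial of degree \<open>k\<close> in the nodes.
  Its generating series makes symmetry evident and reduces the identities below to manipulations of
  geometric series.\<close>

definition hsym :: "'a::field list => nat => 'a" where
  "hsym l k = fps_nth (hgf l) k"

lemma geo_eq: "(1 - fps_const a * fps_X) * geo a = 1"
proof (rule fps_ext)
  fix k
  show "fps_nth ((1 - fps_const a * fps_X) * geo a) k = fps_nth 1 k"
    by (cases k) (auto simp: geo_def left_diff_distrib mult.assoc)
qed

lemma geo_expand: "geo a = 1 + fps_const a * fps_X * geo a" using geo_eq[of a] by (simp add: left_diff_distrib diff_eq_eq)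

lemma geo_diff: "geo a - geo b = fps_const (a - b) * fps_X * geo a * geo b"
proof -
  have "geo a - geo b = geo a * ((1 - fps_const b * fps_X) * geo b) - ((1 - fps_const a * fps_X) * geo a) * geo b"
    by (simp only: geo_eq) simp
  also have "... = (fps_const a - fps_const b) * fps_X * geo a * geo b" by (simp add: algebra_simps del: fps_const_sub)
  finally show ?thesis by simp
qed

lemma geo_deriv: "fps_deriv (geo a) = fps_const a * geo a * geo a"
proof -
  let ?p = "1 - fps_const a * fps_X"
  have "fps_deriv (?p * geo a) = 0" by (simp add: geo_eq)
  then have "?p * fps_deriv (geo a) = fps_const a * geo a" by (simp add: algebra_simps)
  then have "geo a * (?p * fps_deriv (geo a)) = geo a * (fps_const a * geo a)" by simp
  then have "(?p * geo a) * fps_deriv (geo a) = fps_const a * geo a * geo a" by (simp add: mult_ac)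
  then show ?thesis by (simp only: geo_eq) simp
qed

lemma hgf_Cons: "hgf (a # l) = geo a * hgf l" by (simp add: hgf_def)

lemma hgf_deriv: "fps_deriv (hgf l) = (\<Sum>a\<leftarrow>l. fps_const a * geo a) * hgf l"
proof (induction l)
  case (Cons b l)
  then show ?case by (simp add: hgf_Cons geo_deriv algebra_simps)
qed (simp add: hgf_def)

lemma hgf_mset: "mset l = mset l' ==> hgf l = hgf l'" unfolding hgf_def prod_mset_prod_list[symmetric] mset_map by simp

lemma hsym_0 [simp]: "hsym l 0 = 1" by (induction l) (simp_all add: hsym_def hgf_def geo_def)

lemma hsym_Cons: "hsym (a # l) k = (\<Sum>i\<le>k. a ^ i * hsym l (k - i))"
  by (simp add: hsym_def hgf_Cons fps_mult_nth geo_def atLeast0AtMost)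

lemma hsym_Nil: "hsym [] k = (if k = 0 then 1 else 0)" by (simp add: hsym_def hgf_def)

lemma hsym_single: "hsym [a] k = a ^ k" by (simp add: hsym_def hgf_def geo_def)

text \<open>The divided difference rule for a single power: \<open>hsym\<close> of \<open>n\<close>
  nodes in degree \<open>k\<close> is the divided difference of the power
  \<open>k + n - 1\<close>.\<close>

lemma hsym_diff: "hsym (a # l) (Suc k) - hsym (b # l) (Suc k) = (a - b) * hsym (a # b # l) k"
proof -
  have "hgf (a # l) - hgf (b # l) = (geo a - geo b) * hgf l" by (simp add: hgf_Cons left_diff_distrib)
  also have "... = fps_const (a - b) * (fps_X * hgf (a # b # l))" by (simp add: geo_diff hgf_Cons mult_ac)
  finally have "fps_nth (hgf (a # l) - hgf (b # l)) (Suc k) = fps_nth (fps_const (a - b) * (fps_X * hgf (a # b # l))) (Suc k)"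
    by simp
  then show ?thesis by (simp add: hsym_def)
qed

lemma sum_list_fps_nth: "fps_nth (\<Sum>a\<leftarrow>l. f a) k = (\<Sum>a\<leftarrow>l. fps_nth (f a) k)" by (induction l) auto

lemma sum_list_mult_hgf: "(\<Sum>a\<leftarrow>ns. hgf (a # l)) = (\<Sum>a\<leftarrow>ns. geo a) * hgf l" by (induction ns) (auto simp: hgf_Cons algebra_simps)

text \<open>Repeating a node multiplies the series by one more geometric factor, and the logarithmic
  derivative of the series is the sum of such factors with coefficients \<open>a\<close>.\<close>

lemma hsym_sum_linear: "(\<Sum>a\<leftarrow>l. a * hsym (a # l) k) = of_nat (Suc k) * hsym l (Suc k)"
proof -
  have "(\<Sum>a\<leftarrow>ns. fps_const a * hgf (a # l)) = (\<Sum>a\<leftarrow>ns. fps_const a * geo a) * hgf l" for ns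
    by (induction ns) (auto simp: hgf_Cons algebra_simps)
  from arg_cong[OF this[of l], of "%f. fps_nth f k"]
  have "(\<Sum>a\<leftarrow>l. a * hsym (a # l) k) = fps_nth (fps_deriv (hgf l)) k" by (simp add: hgf_deriv sum_list_fps_nth hsym_def)
  then show ?thesis by (simp add: hsym_def)
qed

lemma hsym_sum: "(\<Sum>a\<leftarrow>l. hsym (a # l) k) = of_nat (length l + k) * hsym l k"
proof -
  have "(\<Sum>a\<leftarrow>ns. geo a) = of_nat (length ns) + fps_X * (\<Sum>a\<leftarrow>ns. fps_const a * geo a)" for ns :: "'a list"
  proof (induction ns)
    case (Cons b ns)
    then show ?case using geo_expand[of b] by (simp add: algebra_simps)
  qed simp
  then have "(\<Sum>a\<leftarrow>l. hgf (a # l)) = of_nat (length l) * hgf l + fps_X * fps_deriv (hgf l)"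
    by (simp add: sum_list_mult_hgf hgf_deriv algebra_simps)
  from arg_cong[OF this, of "%f. fps_nth f k"]
  have "(\<Sum>a\<leftarrow>l. hsym (a # l) k) = of_nat (length l) * hsym l k + of_nat k * hsym l k"
    by (cases k) (simp_all add: sum_list_fps_nth hsym_def fps_of_nat[symmetric] del: of_nat_Suc)
  then show ?thesis by (simp add: algebra_simps)
qed

lemma hsym_nonneg: "(!!a. a \<in> set l ==> 0 <= (a::real)) ==> 0 <= hsym l k"
  by (induction l arbitrary: k) (auto simp: hsym_Nil hsym_Cons intro!: sum_nonneg)

lemma norm_hsym_le: "norm (hsym l k) <= hsym (map norm l) k" for l :: "'a::real_normed_field list"
proof (induction l arbitrary: k)
  case (Cons a l)
  have "norm (hsym (a # l) k) <= (\<Sum>i\<le>k. norm (a ^ i * hsym l (k - i)))" unfolding hsym_Cons by (rule norm_sum)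
  also have "... <= (\<Sum>i\<le>k. norm a ^ i * hsym (map norm l) (k - i))"
    by (intro sum_mono) (simp add: norm_mult norm_power mult_left_mono Cons.IH)
  finally show ?case by (simp add: hsym_Cons)
qed (simp add: hsym_Nil)

lemma hsym_of_real: "hsym (map of_real l) k = (of_real (hsym l k) :: 'a::real_normed_field)"
  by (induction l arbitrary: k) (simp_all add: hsym_Nil hsym_Cons)

text \<open>The growth is \<open>R ^ k\<close> up to a polynomial in \<open>k\<close> whose degree
  depends on the number of nodes; any larger rate \<open>S\<close> absorbs the polynomial.\<close>

lemma hsym_bound:
  fixes R S :: real
  assumes "0 <= R" "R < S" and "!!a. a \<in> set l ==> 0 <= a \<and> a <= R"
  shows "hsym l k <= (S / (S - R)) ^ length l * S ^ k"
  using assms(3)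
proof (induction l arbitrary: k)
  case Nil
  then show ?case using assms by (simp add: hsym_Nil)
next
  case (Cons a l)
  let ?K = "(S / (S - R)) ^ length l"
  have K: "0 <= ?K" using assms by simp
  have "hsym (a # l) k <= (\<Sum>i\<le>k. R ^ i * (?K * S ^ (k - i)))" unfolding hsym_Cons using Cons assms
    by (intro sum_mono mult_mono power_mono) (auto intro!: hsym_nonneg)
  also have "... = ?K * S ^ k * (\<Sum>i\<le>k. (R / S) ^ i)" unfolding sum_distrib_left using assms
    by (intro sum.cong refl) (simp add: power_divide power_diff)
  also have "(\<Sum>i\<le>k. (R / S) ^ i) <= 1 / (1 - R / S)"
  proof -
    have "(\<Sum>i\<le>k. (R / S) ^ i) = (1 - (R / S) ^ Suc k) / (1 - R / S)" using assms by (subst sum_gp0) auto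
    also have "... <= 1 / (1 - R / S)" using assms by (intro divide_right_mono) auto
    finally show ?thesis .
  qed
  also have "1 / (1 - R / S) = S / (S - R)" using assms by (simp add: field_simps)
  finally show ?case using K assms by (simp add: mult_left_mono mult_ac)
qed

text \<open>The Taylor coefficients of \<open>(1 - z) powr (- \<sigma>)\<close>; they are positive
  for \<open>\<sigma> > 0\<close>.\<close>

definition binc :: "real => nat => real" where
  "binc \<sigma> k = pochhammer \<sigma> k / fact k"

lemma binc_pos: "0 < \<sigma> ==> 0 < binc \<sigma> k" by (simp add: binc_def pochhammer_pos)

lemma binc_Suc: "real (Suc k) * binc \<sigma> (Suc k) = (\<sigma> + real k) * binc \<sigma> k" by (simp add: binc_def pochhammer_Suc del: of_nat_Suc)

lemma binc_sums:
  assumes "\<bar>z\<bar> < 1"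
  shows "(%k. binc \<sigma> k * z ^ k) sums ((1 - z) powr (- \<sigma>))"
proof -
  have "binc \<sigma> k * z ^ k = ((- \<sigma>) gchoose k) * (- z) ^ k" for k
    by (simp add: binc_def gbinomial_pochhammer power_minus[of z] mult_ac)
  then show ?thesis using gen_binomial_real[of "- z" "- \<sigma>"] assms by simp
qed

text \<open>Expanding \<open>(1 - u) powr (- \<sigma>)\<close> in powers of \<open>u\<close> shows that \<open>Phi \<sigma> l\<close> is its divided difference at
  the nodes \<open>l\<close>. The series form makes the positivity of all coefficients visible.\<close>

definition Phi :: "real => 'a::{real_normed_field, banach} list => 'a" where
  "Phi \<sigma> l = (\<Sum>k. of_real (binc \<sigma> (k + length l - 1)) * hsym l k)"

lemma Phi_summable_real:
  assumes "0 < \<sigma>" "!!a. a \<in> set l ==> 0 <= a \<and> a < (1::real)"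
  shows "summable (%k. binc \<sigma> (k + d) * hsym l k)"
proof -
  obtain R where R: "0 <= R" "R < 1" "!!a. a \<in> set l ==> a <= R"
  proof (cases "l = []")
    case False
    then show thesis using assms(2) that[of "Max (set l)"] Max_in[of "set l"] by (force intro: Max_ge)
  qed (use that[of 0] in simp)
  \<comment> \<open>Two radii between the nodes and \<open>1\<close>: \<open>S\<close> leaves room
    for the growth of \<open>hsym\<close>, \<open>T\<close> for that of \<open>binc\<close>.\<close>
  define S T where "S = (R + 1) / 2" and "T = (S + 1) / 2"
  have ST: "0 < S" "R < S" "S < T" "T < 1" using R by (auto simp: S_def T_def)
  have "(%k. binc \<sigma> k * T ^ k) \<longlonglongrightarrow> 0" using binc_sums[of T \<sigma>] ST R by (intro summable_LIMSEQ_zero) (auto simp: sums_iff)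
  then obtain C where C: "!!k. \<bar>binc \<sigma> k * T ^ k\<bar> <= C"
    using Bseq_def[of "%k. binc \<sigma> k * T ^ k"] convergent_imp_Bseq convergentI by (metis real_norm_def)
  have bc: "binc \<sigma> (k + d) <= C / T ^ d * (1 / T) ^ k" for k using C[of "k + d"] ST by (simp add: power_add field_simps abs_le_iff)
  have "summable (%k. C / T ^ d * (S / (S - R)) ^ length l * (S / T) ^ k)"
    using ST by (intro summable_mult summable_geometric) auto
  then show ?thesis
  proof (rule summable_comparison_test'[where N = 0])
    fix k
    have "norm (binc \<sigma> (k + d) * hsym l k) = binc \<sigma> (k + d) * hsym l k"
      using binc_pos[OF assms(1)] hsym_nonneg[of l k] assms(2) by (simp add: less_imp_le)
    also have "... <= (C / T ^ d * (1 / T) ^ k) * ((S / (S - R)) ^ length l * S ^ k)"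
      using bc[of k] hsym_bound[of R S l k] R ST assms binc_pos[OF assms(1), of "k + d"] hsym_nonneg[of l k]
      by (intro mult_mono) auto
    also have "... = C / T ^ d * (S / (S - R)) ^ length l * (S / T) ^ k" by (simp add: power_divide mult_ac)
    finally show "norm (binc \<sigma> (k + d) * hsym l k) <= C / T ^ d * (S / (S - R)) ^ length l * (S / T) ^ k" .
  qed
qed

lemma Phi_summable_norm:
  fixes l :: "'a::{real_normed_field, banach} list"
  assumes "0 < \<sigma>" "!!a. a \<in> set l ==> norm a < 1"
  shows "summable (%k. norm (of_real (binc \<sigma> (k + d)) * hsym l k))"
proof (rule summable_comparison_test'[where N = 0])
  show "summable (%k. binc \<sigma> (k + d) * hsym (map norm l) k)" using assms by (intro Phi_summable_real) auto
  show "norm (norm (of_real (binc \<sigma> (k + d)) * hsym l k)) <= binc \<sigma> (k + d) * hsym (map norm l) k" for k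
    using binc_pos[OF assms(1), of "k + d"] by (simp add: norm_mult mult_left_mono norm_hsym_le)
qed

lemma Phi_summable:
  fixes l :: "'a::{real_normed_field, banach} list"
  assumes "0 < \<sigma>" "!!a. a \<in> set l ==> norm a < 1"
  shows "summable (%k. of_real (binc \<sigma> (k + d)) * hsym l k)"
  using Phi_summable_norm[OF assms] by (rule summable_norm_cancel)

lemma Phi_mset:
  assumes "mset l = mset l'"
  shows "Phi \<sigma> l = Phi \<sigma> l'"
  unfolding Phi_def hsym_def hgf_mset[OF assms] mset_eq_length[OF assms] ..

text \<open>Termwise \<open>hsym_diff\<close>. The terms of degree \<open>0\<close> cancel, and the
  resulting shift of the summation index is matched by the extra node in
  \<open>k + length l - 1\<close>.\<close>

lemma Phi_diff:
  fixes l :: "'a::{real_normed_field, banach} list"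
  assumes "0 < \<sigma>" "!!c. c \<in> set (a # b # l) ==> norm c < 1"
  shows "Phi \<sigma> (a # l) - Phi \<sigma> (b # l) = (a - b) * Phi \<sigma> (a # b # l)"
proof -
  let ?f = "%k. of_real (binc \<sigma> (k + length l)) * (hsym (a # l) k - hsym (b # l) k)"
  have s: "summable (%k. of_real (binc \<sigma> (k + length l)) * hsym (a # l) k)"
     "summable (%k. of_real (binc \<sigma> (k + length l)) * hsym (b # l) k)" using assms by (intro Phi_summable; force)+
  have "Phi \<sigma> (a # l) - Phi \<sigma> (b # l) = (\<Sum>k. ?f k)" using suminf_diff[OF s] by (simp add: Phi_def right_diff_distrib)
  also have "... = (\<Sum>k. ?f (Suc k)) + ?f 0"
    using summable_diff[OF s] by (subst suminf_split_head) (simp_all add: right_diff_distrib)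
  also have "... = (\<Sum>k. (a - b) * (of_real (binc \<sigma> (k + Suc (length l))) * hsym (a # b # l) k))" by (simp add: hsym_diff mult_ac)
  also have "... = (a - b) * Phi \<sigma> (a # b # l)" using Phi_summable[OF assms(1), of "a # b # l" "Suc (length l)"] assms(2)
    by (subst suminf_mult) (auto simp: Phi_def)
  finally show ?thesis .
qed

lemma Phi_single: "\<bar>a\<bar> < 1 ==> Phi \<sigma> [a] = (1 - a) powr (- \<sigma>)" using binc_sums[of a \<sigma>] by (simp add: Phi_def hsym_single sums_iff)

lemma Phi_of_real:
  assumes "0 < \<sigma>" "!!a. a \<in> set l ==> \<bar>a\<bar> < 1" "l ~= []"
  shows "Phi \<sigma> (map of_real l) = (of_real (Phi \<sigma> l) :: 'a::{real_normed_field, banach})"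
proof -
  obtain d where d: "length l = Suc d" using assms(3) by (cases l) auto
  have "summable (%k. of_real (binc \<sigma> (k + d)) * hsym l k)" using assms by (intro Phi_summable) auto
  then show ?thesis unfolding Phi_def hsym_of_real by (subst suminf_of_real) (simp_all add: d)
qed

lemma Phi_pos:
  assumes "0 < \<sigma>" "!!a. a \<in> set l ==> 0 <= a \<and> a < (1::real)" "l ~= []"
  shows "0 < Phi \<sigma> l"
proof -
  obtain d where d: "length l = Suc d" using assms(3) by (cases l) auto
  have "0 <= hsym l k" for k using assms(2) by (intro hsym_nonneg) auto
  then have nonneg: "0 <= binc \<sigma> (k + d) * hsym l k" for k
    using binc_pos[OF assms(1)] by (intro mult_nonneg_nonneg) (auto intro: less_imp_le)
  have "0 < (\<Sum>k. binc \<sigma> (k + d) * hsym l k)" using Phi_summable_real[OF assms(1,2), of l d] nonneg binc_pos[OF assms(1)]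
    by (intro suminf_pos2[where i = 0]) auto
  then show ?thesis by (simp add: Phi_def d)
qed

lemma norm_Phi_le:
  fixes l :: "'a::{real_normed_field, banach} list"
  assumes "0 < \<sigma>" "!!a. a \<in> set l ==> norm a < 1" "l ~= []"
  shows "norm (Phi \<sigma> l) <= Phi \<sigma> (map norm l)"
proof -
  obtain d where d: "length l = Suc d" using assms(3) by (cases l) auto
  have "norm (Phi \<sigma> l) <= (\<Sum>k. norm (of_real (binc \<sigma> (k + d)) * hsym l k))"
    unfolding Phi_def d using summable_norm[OF Phi_summable_norm[OF assms(1,2), of l d]] by simp
  also have "... <= (\<Sum>k. binc \<sigma> (k + d) * hsym (map norm l) k)"
  proof (intro suminf_le Phi_summable_norm Phi_summable_real assms(1))
    fix k show "norm (of_real (binc \<sigma> (k + d)) * hsym l k) <= binc \<sigma> (k + d) * hsym (map norm l) k"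
      using binc_pos[OF assms(1), of "k + d"] by (simp add: norm_mult mult_left_mono norm_hsym_le)
  qed (use assms(2) in auto)
  finally show ?thesis by (simp add: Phi_def d)
qed

lemma Phi_mono_Cons:
  assumes "0 < \<sigma>" "0 <= a" "a <= b" "b < 1" "!!a. a \<in> set l ==> 0 <= a \<and> a < (1::real)"
  shows "Phi \<sigma> (a # l) <= Phi \<sigma> (b # l)"
proof -
  have "Phi \<sigma> (b # l) - Phi \<sigma> (a # l) = (b - a) * Phi \<sigma> (b # a # l)"
    using assms by (intro Phi_diff[where a = b and b = a and l = l]) auto
  moreover have "0 < Phi \<sigma> (b # a # l)" using assms by (intro Phi_pos) auto
  moreover from this have "0 <= (b - a) * Phi \<sigma> (b # a # l)" using assms(3) by (intro mult_nonneg_nonneg) auto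
  ultimately show ?thesis by linarith
qed

text \<open>Repeating the node \<open>a\<close> differentiates in it, and the divided difference of
  \<open>(1 - u) powr (- \<sigma>)\<close> is homogeneous of degree
  \<open>1 - \<sigma> - length l\<close> in the quantities \<open>1 - a\<close>. This is Euler's
  relation, proved on the level of coefficients.\<close>

lemma Phi_euler:
  assumes "0 < \<sigma>" "!!a. a \<in> set l ==> 0 <= a \<and> a < (1::real)" "l ~= []"
  shows "(\<Sum>a\<leftarrow>l. (1 - a) * Phi \<sigma> (a # l)) = (\<sigma> - 1 + real (length l)) * Phi \<sigma> l"
proof -
  obtain d where d: "length l = Suc d" using assms(3) by (cases l) auto
  have sm: "summable (%k. binc \<sigma> (k + e) * hsym (a # l) k)" if "a \<in> set l" for a e
    using assms that by (intro Phi_summable_real) auto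
  have "(\<Sum>a\<leftarrow>ns. (1 - a) * Phi \<sigma> (a # l)) = (\<Sum>k. binc \<sigma> (k + Suc d) * (\<Sum>a\<leftarrow>ns. (1 - a) * hsym (a # l) k)) \<and>
     summable (%k. binc \<sigma> (k + Suc d) * (\<Sum>a\<leftarrow>ns. (1 - a) * hsym (a # l) k))" if "set ns \<subseteq> set l" for ns using that
  proof (induction ns)
    case (Cons b ns)
    have "(1 - b) * Phi \<sigma> (b # l) = (\<Sum>k. (1 - b) * (binc \<sigma> (k + Suc d) * hsym (b # l) k))"
      using sm[of b "Suc d"] Cons.prems by (subst suminf_mult) (auto simp: Phi_def d)
    moreover have s1: "summable (%k. (1 - b) * (binc \<sigma> (k + Suc d) * hsym (b # l) k))"
      using sm[of b "Suc d"] Cons.prems by (intro summable_mult) auto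
    ultimately show ?case using Cons suminf_add[OF s1, of "%k. binc \<sigma> (k + Suc d) * (\<Sum>a\<leftarrow>ns. (1 - a) * hsym (a # l) k)"]
        summable_add[OF s1, of "%k. binc \<sigma> (k + Suc d) * (\<Sum>a\<leftarrow>ns. (1 - a) * hsym (a # l) k)"] by (simp add: algebra_simps)
  qed simp
  from this[of l] have eq: "(\<Sum>a\<leftarrow>l. (1 - a) * Phi \<sigma> (a # l)) = (\<Sum>k. binc \<sigma> (k + Suc d) * (\<Sum>a\<leftarrow>l. (1 - a) * hsym (a # l) k))" by simp
  define f where "f = (%k. real k * binc \<sigma> (k + d) * hsym l k)"
  define g where "g = (%k. (\<sigma> + real d) * (binc \<sigma> (k + d) * hsym l k))"
  \<comment> \<open>The two sum rules for \<open>hsym\<close> and the recursion of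
    \<open>binc\<close> leave the desired term \<open>g k\<close> and a telescoping difference,
    whose boundary term tends to \<open>0\<close>.\<close>
  have diff_term: "binc \<sigma> (k + Suc d) * (\<Sum>a\<leftarrow>l. (1 - a) * hsym (a # l) k) = g k - (f (Suc k) - f k)" for k
  proof -
    have "(\<Sum>a\<leftarrow>l. (1 - a) * hsym (a # l) k) = (\<Sum>a\<leftarrow>l. hsym (a # l) k) - (\<Sum>a\<leftarrow>l. a * hsym (a # l) k)"
      by (simp add: left_diff_distrib sum_list_subtractf)
    also have "... = real (Suc (k + d)) * hsym l k - real (Suc k) * hsym l (Suc k)" by (simp only: hsym_sum hsym_sum_linear d) simp
    finally have E: "(\<Sum>a\<leftarrow>l. (1 - a) * hsym (a # l) k) = real (Suc (k + d)) * hsym l k - real (Suc k) * hsym l (Suc k)" .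
    have "binc \<sigma> (k + Suc d) * (\<Sum>a\<leftarrow>l. (1 - a) * hsym (a # l) k)
       = (real (Suc (k + d)) * binc \<sigma> (Suc (k + d))) * hsym l k - f (Suc k)" unfolding E by (simp add: f_def algebra_simps)
    then show ?thesis unfolding binc_Suc by (simp add: f_def g_def algebra_simps)
  qed
  have sg: "summable g" unfolding g_def using assms by (intro summable_mult Phi_summable_real) auto
  have f0: "f \<longlonglongrightarrow> 0"
  proof -
    have "f (Suc k) = binc \<sigma> (k + Suc d) * (\<Sum>a\<leftarrow>l. a * hsym (a # l) k)" for k
      by (simp only: hsym_sum_linear) (simp add: f_def mult_ac)
    moreover have "summable (%k. binc \<sigma> (k + Suc d) * (\<Sum>a\<leftarrow>ns. a * hsym (a # l) k))" if "set ns \<subseteq> set l" for ns using that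
    proof (induction ns)
      case (Cons b ns)
      have "summable (%k. b * (binc \<sigma> (k + Suc d) * hsym (b # l) k))"
        using sm[of b "Suc d"] Cons.prems by (intro summable_mult) auto
      then show ?case using Cons summable_add[of "%k. b * (binc \<sigma> (k + Suc d) * hsym (b # l) k)"
            "%k. binc \<sigma> (k + Suc d) * (\<Sum>a\<leftarrow>ns. a * hsym (a # l) k)"] by (simp add: algebra_simps)
    qed simp
    ultimately have "summable (%k. f (Suc k))" by simp
    then show ?thesis by (intro summable_LIMSEQ_zero) (simp only: summable_Suc_iff)
  qed
  have "(%k. f (Suc k) - f k) sums (0 - f 0)" using f0 by (rule telescope_sums)
  then have "(%k. g k - (f (Suc k) - f k)) sums (suminf g - (0 - f 0))" by (rule sums_diff[OF summable_sums[OF sg]])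
  then have "(\<Sum>a\<leftarrow>l. (1 - a) * Phi \<sigma> (a # l)) = suminf g" unfolding eq diff_term by (simp add: sums_iff f_def)
  also have "... = (\<sigma> + real d) * Phi \<sigma> l"
    unfolding g_def using assms by (subst suminf_mult) (auto simp: Phi_def d intro!: Phi_summable_real)
  finally show ?thesis by (simp add: d)
qed

lemma Phi_Cons_bound:
  fixes l :: "complex list"
  assumes "0 < \<sigma>" "norm z <= R" "R < 1" "!!a. a \<in> set l ==> norm a < 1"
  shows "norm (Phi \<sigma> (z # l)) <= Phi \<sigma> (R # map norm l)"
proof -
  have "norm (Phi \<sigma> (z # l)) <= Phi \<sigma> (map norm (z # l))" using assms by (intro norm_Phi_le) auto
  also have "... <= Phi \<sigma> (R # map norm l)" using assms by (simp, intro Phi_mono_Cons) auto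
  finally show ?thesis .
qed

text \<open>The difference quotient in one node is \<open>Phi\<close> with two nodes, so
  differentiability reduces to continuity, and continuity to boundedness of \<open>Phi\<close> with
  one further node. The bound comes from a real node that dominates.\<close>

lemma Phi_holomorphic:
  fixes l :: "complex list"
  assumes \<sigma>: "0 < \<sigma>" and l: "!!a. a \<in> set l ==> norm a < 1"
  shows "(%z. Phi \<sigma> (z # l)) holomorphic_on ball 0 1"
proof -
  have cont: "isCont (%z. Phi \<sigma> (z # ns)) w" if ns: "!!a. a \<in> set ns ==> norm a < 1" and w: "norm w < 1" for ns and w :: complex
  proof -
    define R where "R = (norm w + 1) / 2"
    have R: "norm w < R" "R < 1" using w by (auto simp: R_def)
    define B where "B = Phi \<sigma> (R # norm w # map norm ns)"
    have "(%z. Phi \<sigma> (z # ns) - Phi \<sigma> (w # ns)) \<midarrow>w\<rightarrow> 0"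
    proof (rule Lim_null_comparison)
      have "\<forall>\<^sub>F z in at w. norm z < R" using R by (intro order_tendstoD(2)[of norm "norm w"] tendsto_intros)
      then show "\<forall>\<^sub>F z in at w. norm (Phi \<sigma> (z # ns) - Phi \<sigma> (w # ns)) <= norm (z - w) * B"
      proof eventually_elim
        case (elim z)
        have "Phi \<sigma> (z # ns) - Phi \<sigma> (w # ns) = (z - w) * Phi \<sigma> (z # w # ns)" using elim R w ns \<sigma> by (intro Phi_diff) auto
        moreover have "norm (Phi \<sigma> (z # w # ns)) <= B"
        proof -
          have "norm a < 1" if "a \<in> set (w # ns)" for a using that w ns by auto
          then show ?thesis using Phi_Cons_bound[where l = "w # ns", OF \<sigma> less_imp_le[OF elim] R(2)] by (simp add: B_def)
        qed
        ultimately show ?case by (simp add: norm_mult mult_left_mono)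
      qed
      have "((%z. norm (z - w) * B) \<longlongrightarrow> norm (w - w) * B) (at w)" by (intro tendsto_intros)
      then show "((%z. norm (z - w) * B) \<longlongrightarrow> 0) (at w)" by simp
    qed
    then show ?thesis by (simp add: isCont_def LIM_zero_iff)
  qed
  have "((%z. Phi \<sigma> (z # l)) has_field_derivative Phi \<sigma> (w # w # l)) (at w)" if w: "norm w < 1" for w
  proof -
    have "(%z. Phi \<sigma> (z # w # l)) \<midarrow>w\<rightarrow> Phi \<sigma> (w # w # l)" using cont[of "w # l" w] w l by (auto simp: isCont_def)
    moreover have "\<forall>\<^sub>F z in at w. Phi \<sigma> (z # w # l) = (Phi \<sigma> (z # l) - Phi \<sigma> (w # l)) / (z - w)"
    proof -
      have "\<forall>\<^sub>F z in at w. norm z < 1" using w by (intro order_tendstoD(2)[of norm "norm w"] tendsto_intros)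
      then show ?thesis using eventually_neq_at_within[of w w UNIV]
      proof eventually_elim
        case (elim z)
        have "Phi \<sigma> (z # l) - Phi \<sigma> (w # l) = (z - w) * Phi \<sigma> (z # w # l)" using elim w l \<sigma> by (intro Phi_diff) auto
        then show ?case using elim by simp
      qed
    qed
    ultimately show ?thesis unfolding has_field_derivative_iff by (rule Lim_transform_eventually)
  qed
  then show ?thesis unfolding holomorphic_on_open[OF open_ball] by (meson mem_ball_0)
qed

text \<open>By Euler's relation, a definite fraction of the nodes lying above \<open>e\<close> makes the insertion
  of a further node near \<open>e\<close> change \<open>Phi\<close> at most by a constant factor.\<close>

lemma Phi_insert_le:
  fixes l :: "real list"
  assumes \<sigma>: "0 < \<sigma>" and l: "!!a. a \<in> set l ==> 0 <= a \<and> a < 1"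
    and e: "0 <= e" "e <= e'" "e' < 1"
    and p: "0 < p" "p <= length (filter (%a. e <= a \<and> a <= e') l)"
    and C: "\<sigma> - 1 + real (length l) <= C * (real p * (1 - e'))"
  shows "Phi \<sigma> (e # l) <= C * Phi \<sigma> l"
proof -
  have ne: "l ~= []" using p by auto
  have e1: "e < 1" using e by simp
  have pos: "0 < Phi \<sigma> (b # l)" if "0 <= b" "b < 1" for b using that l \<sigma> by (intro Phi_pos) auto
  \<comment> \<open>All summands of Euler's relation are nonnegative. Those with a node between
    \<open>e\<close> and \<open>e'\<close> are bounded below because \<open>Phi\<close> increases
    with the inserted node.\<close>
  have "real (length (filter (%a. e <= a \<and> a <= e') ns)) * ((1 - e') * Phi \<sigma> (e # l)) <= (\<Sum>a\<leftarrow>ns. (1 - a) * Phi \<sigma> (a # l))"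
    if "set ns \<subseteq> set l" for ns using that
  proof (induction ns)
    case (Cons b ns)
    have b: "0 <= b" "b < 1" using l Cons.prems by auto
    have *: "0 <= (1 - b) * Phi \<sigma> (b # l)" using pos[OF b] b by simp
    have "(1 - e') * Phi \<sigma> (e # l) <= (1 - b) * Phi \<sigma> (b # l)" if "e <= b" "b <= e'"
      using that b e e1 l \<sigma> pos[of e] by (intro mult_mono Phi_mono_Cons) (auto intro: less_imp_le)
    then show ?case using Cons * by (auto simp: algebra_simps)
  qed simp
  from this[of l] have "real (length (filter (%a. e <= a \<and> a <= e') l)) * ((1 - e') * Phi \<sigma> (e # l)) <= (\<sigma> - 1 + real (length l)) * Phi \<sigma> l"
    using Phi_euler[OF \<sigma> l ne] by simp
  moreover have "real p * ((1 - e') * Phi \<sigma> (e # l)) <= real (length (filter (%a. e <= a \<and> a <= e') l)) * ((1 - e') * Phi \<sigma> (e # l))"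
    using p e pos[of e] by (intro mult_right_mono mult_nonneg_nonneg) (auto intro: less_imp_le)
  moreover have "(\<sigma> - 1 + real (length l)) * Phi \<sigma> l <= C * (real p * (1 - e')) * Phi \<sigma> l"
    using C Phi_pos[OF \<sigma> l ne] by (intro mult_right_mono) auto
  ultimately have "(real p * (1 - e')) * Phi \<sigma> (e # l) <= (real p * (1 - e')) * (C * Phi \<sigma> l)" by (simp add: mult_ac)
  moreover have "0 < real p * (1 - e')" using p e by simp
  ultimately show ?thesis by (simp only: mult_le_cancel_left_pos)
qed

text \<open>The inserted node is moved from \<open>e\<close> up to \<open>R\<close>. The change is
  \<open>R - e\<close> times \<open>Phi\<close> with both nodes, which the bound at \<open>e\<close>
  reduces to half of the quantity to be estimated; it is absorbed on the left, at the price of a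
  factor \<open>2\<close>.\<close>

lemma Phi_insert_le':
  fixes l :: "real list"
  assumes \<sigma>: "0 < \<sigma>" and l: "!!a. a \<in> set l ==> 0 <= a \<and> a < 1"
    and e: "0 <= e" "e <= e'" "e' < 1" and R: "e <= R" "R < 1" "(R - e) * C <= 1 / 2"
    and p: "0 < p" "p <= length (filter (%a. e <= a \<and> a <= e') l)"
    and C: "\<sigma> + real (length l) <= C * (real p * (1 - e'))"
  shows "Phi \<sigma> (R # l) <= 2 * C * Phi \<sigma> l"
proof -
  have pR: "0 < Phi \<sigma> (R # l)" using e R l \<sigma> by (intro Phi_pos) auto
  have "Phi \<sigma> (e # R # l) <= C * Phi \<sigma> (R # l)"
  proof (rule Phi_insert_le[OF \<sigma> _ e p(1)])
    show "p <= length (filter (%a. e <= a \<and> a <= e') (R # l))" using p by auto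
    show "\<sigma> - 1 + real (length (R # l)) <= C * (real p * (1 - e'))" using C by simp
    show "0 <= a \<and> a < 1" if "a \<in> set (R # l)" for a using that e R l by auto
  qed
  then have "(R - e) * Phi \<sigma> (R # e # l) <= (R - e) * (C * Phi \<sigma> (R # l))"
    using R Phi_mset[of "R # e # l" "e # R # l" \<sigma>] by (intro mult_left_mono) auto
  also have "... <= 1 / 2 * Phi \<sigma> (R # l)" using mult_right_mono[OF R(3) less_imp_le[OF pR]] by (simp add: mult_ac)
  finally have "(R - e) * Phi \<sigma> (R # e # l) <= 1 / 2 * Phi \<sigma> (R # l)" .
  moreover have "Phi \<sigma> (R # l) - Phi \<sigma> (e # l) = (R - e) * Phi \<sigma> (R # e # l)" using e R l \<sigma> by (intro Phi_diff) auto
  moreover have "Phi \<sigma> (e # l) <= C * Phi \<sigma> l" by (rule Phi_insert_le[OF \<sigma> l e p]) (use C in auto)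
  ultimately show ?thesis by linarith
qed

section \<open>The staircase boundary\<close>

lemma prod_list_update: "i < length vs ==> (\<Prod>y\<leftarrow>vs[i := w]. f y) * f (vs ! i) = (\<Prod>y\<leftarrow>vs. f y) * (f w :: real)"
  by (induction vs arbitrary: i) (auto split: nat.split simp: mult_ac)

lemma prod_list_swap: "(\<Prod>i\<in>A. \<Prod>u\<leftarrow>us. f i u) = (\<Prod>u\<leftarrow>us. \<Prod>i\<in>A. (f i u :: real))" by (induction us) (simp_all add: prod.distrib)

lemma vdm_append: "vdm (as @ bs) = vdm as * (\<Prod>b\<leftarrow>bs. \<Prod>a\<leftarrow>as. b - a) * vdm bs"
proof (induction as)
  case (Cons a as)
  have "(\<Prod>b\<leftarrow>bs. \<Prod>a\<leftarrow>a # as. b - a) = (\<Prod>b\<leftarrow>bs. b - a) * (\<Prod>b\<leftarrow>bs. \<Prod>a\<leftarrow>as. b - a)" by (induction bs) (auto simp: mult_ac)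
  then show ?case using Cons by (simp add: mult_ac)
qed (simp add: map_replicate_const)

lemma vdm_nonzero: "distinct vs ==> vdm vs ~= 0" by (induction vs) (auto simp: prod_list_zero_iff)

text \<open>Only factors containing entry \<open>i\<close> change. Ordered differences are replaced
  by differences with \<open>vs ! i\<close> in front; the signs agree on both sides.\<close>

lemma vdm_update:
  "i < length vs ==> vdm (vs[i := w]) * (\<Prod>j\<in>{..<length vs} - {i}. vs ! i - vs ! j)
     = vdm vs * (\<Prod>j\<in>{..<length vs} - {i}. w - vs ! j)"
proof (induction vs arbitrary: i)
  case (Cons v vs)
  show ?case
  proof (cases i)
    case 0
    have eq: "(\<Prod>j\<in>{..<length (v # vs)} - {0}. z - (v # vs) ! j) = (\<Prod>y\<leftarrow>vs. z - y)" for z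
    proof -
      have "(\<Prod>j\<in>{..<length (v # vs)} - {0}. z - (v # vs) ! j) = (\<Prod>j<length vs. z - vs ! j)"
        by (rule prod.reindex_bij_witness[where i = Suc and j = "%j. j - 1"]) auto
      then show ?thesis by (simp add: prod.list_conv_set_nth atLeast0LessThan)
    qed
    have sg: "(\<Prod>y\<leftarrow>vs. y - z) = (- 1) ^ length vs * (\<Prod>y\<leftarrow>vs. z - y)" for z by (induction vs) (auto simp: algebra_simps)
    show ?thesis unfolding 0 eq by (simp add: sg mult_ac)
  next
    case (Suc i')
    then have i': "i' < length vs" using Cons.prems by simp
    have eq: "(\<Prod>j\<in>{..<length (v # vs)} - {Suc i'}. z - (v # vs) ! j) = (z - v) * (\<Prod>j\<in>{..<length vs} - {i'}. z - vs ! j)" for z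
    proof -
      have "{..<length (v # vs)} - {Suc i'} = insert 0 (Suc ` ({..<length vs} - {i'}))" by (auto simp: lessThan_Suc_eq_insert_0)
      then show ?thesis by (simp add: prod.reindex)
    qed
    have "vdm ((v # vs)[Suc i' := w]) * ((vs ! i' - v) * (\<Prod>j\<in>{..<length vs} - {i'}. vs ! i' - vs ! j))
      = ((\<Prod>y\<leftarrow>vs[i' := w]. y - v) * (vs ! i' - v)) * (vdm (vs[i' := w]) * (\<Prod>j\<in>{..<length vs} - {i'}. vs ! i' - vs ! j))"
      by (simp add: mult_ac)
    also have "... = ((\<Prod>y\<leftarrow>vs. y - v) * (w - v)) * (vdm vs * (\<Prod>j\<in>{..<length vs} - {i'}. w - vs ! j))"
      by (simp only: prod_list_update[OF i', of "%y. y - v" w] Cons.IH[OF i'])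
    finally show ?thesis unfolding Suc eq by (simp add: mult_ac)
  qed
qed simp

lemma vdm_inverse:
  assumes "!!v. v \<in> set vs ==> v ~= 0"
  shows "vdm (map (%v. 1 / v) vs) = (\<Prod>i<length vs. (- 1) ^ i) * (\<Prod>v\<leftarrow>vs. (1 / v) ^ (length vs - 1)) * vdm vs"
  using assms
proof (induction vs)
  case (Cons v vs)
  have 1: "(\<Prod>y\<leftarrow>ws. 1 / y - 1 / v) = (- 1) ^ length ws * (1 / v) ^ length ws * (\<Prod>y\<leftarrow>ws. 1 / y) * (\<Prod>y\<leftarrow>ws. y - v)"
    if "!!w. w \<in> set ws ==> w ~= 0" for ws using that
  proof (induction ws)
    case (Cons w ws)
    have "1 / w - 1 / v = - (1 / v) * (1 / w) * (w - v)"
      using Cons.prems \<open>!!w. w \<in> set (v # vs) ==> w ~= 0\<close> by (simp add: field_simps)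
    then show ?case using Cons by (simp add: mult_ac)
  qed simp
  have 2: "(\<Prod>y\<leftarrow>vs. 1 / y) * (\<Prod>y\<leftarrow>vs. (1 / y) ^ (length vs - 1)) = (\<Prod>y\<leftarrow>vs. (1 / y) ^ length vs)"
  proof (cases "length vs")
    case (Suc n)
    have "(\<Prod>y\<leftarrow>ws. 1 / y) * (\<Prod>y\<leftarrow>ws. (1 / y) ^ n) = (\<Prod>y\<leftarrow>ws. (1 / y) ^ Suc n)" for ws :: "real list"
      by (induction ws) (auto simp: mult_ac)
    then show ?thesis by (simp add: Suc)
  qed simp
  have "vdm (map (%v. 1 / v) (v # vs)) = (\<Prod>y\<leftarrow>vs. 1 / y - 1 / v) * vdm (map (%v. 1 / v) vs)" by (simp add: o_def)
  also have "... = ((- 1) ^ length vs * (1 / v) ^ length vs * (\<Prod>y\<leftarrow>vs. 1 / y) * (\<Prod>y\<leftarrow>vs. y - v)) *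
      ((\<Prod>i<length vs. (- 1) ^ i) * (\<Prod>v\<leftarrow>vs. (1 / v) ^ (length vs - 1)) * vdm vs)" using Cons by (simp add: 1)
  also have "... = ((- 1) ^ length vs * (\<Prod>i<length vs. (- 1) ^ i)) * ((1 / v) ^ length vs * ((\<Prod>y\<leftarrow>vs. 1 / y) * (\<Prod>v\<leftarrow>vs. (1 / v) ^ (length vs - 1))))
      * ((\<Prod>y\<leftarrow>vs. y - v) * vdm vs)" by (simp only: mult_ac)
  also have "... = (\<Prod>i<length (v # vs). (- 1) ^ i) * (\<Prod>z\<leftarrow>v # vs. (1 / z) ^ (length (v # vs) - 1)) * vdm (v # vs)"
    unfolding 2 by (simp add: mult_ac)
  finally show ?case .
qed simp

text \<open>In the nodes \<open>1 - 1 / (T u ^ m)\<close> the alternant of the staircase becomes a divided difference; \<open>T\<close> is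
  chosen so large that they all lie in \<open>[0, 1)\<close>.\<close>

definition eta :: "real => nat => real => real" where
  "eta T m u = 1 - 1 / (T * u ^ m)"

locale staircase = contracting +
  fixes m l1 :: nat and T :: real
  assumes m: "1 <= m" and T: "0 < T"
    and \<Omega>_low: "!!i. 1 <= i ==> i < N ==> \<Omega> i = Suc (m * (i - 1))"
    and \<Omega>_top: "\<Omega> N = Suc l1" and l1: "m * (N - 2) < l1"
begin

text \<open>In the variable \<open>u ^ m\<close> the top exponent exceeds the highest power of the
  staircase by this real number, since \<open>l1\<close> may fail to be a multiple of
  \<open>m\<close>.\<close>

definition sg :: real where
  "sg = real (l1 - m * (N - 2)) / real m"

lemma sg_pos: "0 < sg"
proof -
  have "0 < real (l1 - m * (N - 2))" using l1 by (simp only: of_nat_0_less_iff zero_less_diff)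
  then show ?thesis using m by (simp add: sg_def del: of_nat_diff)
qed

lemma slist_V1: "slist (V 1) = map (%k. m * k) [0..<N - 1] @ [l1]"
proof -
  have "V 1 = insert l1 ((%k. m * k) ` {..<N - 1})"
  proof -
    have "{1..N} = insert N (Suc ` {..<N - 1})" using N unfolding image_Suc_lessThan by auto
    moreover have "(%i. \<Omega> i - 1) ` Suc ` {..<N - 1} = (%k. m * k) ` {..<N - 1}"
      unfolding image_image using \<Omega>_low by (intro image_cong) auto
    ultimately show ?thesis using \<Omega>_top by (simp add: V_def)
  qed
  moreover have "k < l1" if k: "k \<in> (%k. m * k) ` {..<N - 1}" for k
  proof -
    obtain j where j: "j < N - 1" "k = m * j" using k by auto
    then have "j <= N - 2" by linarith
    then have "k <= m * (N - 2)" using j by simp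
    then show ?thesis using l1 by simp
  qed
  ultimately have "slist (V 1) = slist ((%k. m * k) ` {..<N - 1}) @ [l1]"
    using slist_insert_max[of "(%k. m * k) ` {..<N - 1}" l1] by simp
  moreover have "slist ((%k. m * k) ` {..<N - 1}) = map (%k. m * k) [0..<N - 1]"
  proof (rule sorted_list_of_set_unique[THEN iffD1])
    show "sorted_wrt (<) (map (%k. m * k) [0..<N - 1]) \<and> set (map (%k. m * k) [0..<N - 1]) = (%k. m * k) ` {..<N - 1}
      \<and> length (map (%k. m * k) [0..<N - 1]) = card ((%k. m * k) ` {..<N - 1})"
      using m by (auto simp: sorted_wrt_map sorted_wrt_iff_nth_less card_image inj_on_def)
  qed simp
  ultimately show ?thesis by simp
qed

text \<open>Pulling \<open>u ^ (m * (N - 2))\<close> out of every column leaves the decreasing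
  powers of \<open>1 / u ^ m\<close> and one column \<open>(u ^ m) powr sg\<close>. In the node
  \<open>eta T m u\<close> the latter is \<open>(1 - eta T m u) powr (- sg)\<close> up to a power of
  \<open>T\<close>, so the alternant is a divided difference; \<open>c = - 1 / T\<close> accounts
  for the affine change of nodes.\<close>

lemma alt_closed:
  assumes "length us = N" and u: "!!u. u \<in> set us ==> 0 < u \<and> 1 < T * u ^ m"
  shows "alt us (mons (slist (V 1))) = T powr (- sg) * vdm_sign (N - 1) (- 1 / T) * (\<Prod>u\<leftarrow>us. u ^ (m * (N - 2)))
     * vdm (map (%u. 1 / u ^ m) us) * Phi sg (map (eta T m) us)"
proof -
  define \<tau> where "\<tau> = (%u::real. 1 / u ^ m)"
  define P where "P = (%l. T powr (- sg) * Phi sg (map (%t. 1 - t / T) l))"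
  define S where "S = {t. 0 < t \<and> t < T}"
  have \<tau>S: "\<tau> u \<in> S" if "u \<in> set us" for u using u[OF that] T by (auto simp: S_def \<tau>_def field_simps)
  have "list_all2 (%f g. \<forall>u\<in>set us. f u = g u) (mons (slist (V 1)))
      (map (%\<psi> z. z ^ (m * (N - 2)) * \<psi> z) (pows \<tau> (N - 1) @ [%z. P [\<tau> z]]))" unfolding slist_V1 mons_simps map_append
  proof (rule list_all2_appendI)
    show "list_all2 (%f g. \<forall>u\<in>set us. f u = g u) (mons (map (%k. m * k) [0..<N - 1]))
      (map (%\<psi> z. z ^ (m * (N - 2)) * \<psi> z) (pows \<tau> (N - 1)))"
    proof (rule list_all2_all_nthI)
      fix i assume "i < length (mons (map (%k. m * k) [0..<N - 1]))"
      then have i: "i < N - 1" by simp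
      have "z ^ (m * i) = z ^ (m * (N - 2)) * \<tau> z ^ (N - 2 - i)" if "z \<in> set us" for z
      proof -
        have z: "z ~= 0" using u[OF that] by auto
        have "m * (N - 2) = m * i + m * (N - 2 - i)" using i by (simp add: add_mult_distrib2[symmetric])
        then show ?thesis using z by (simp add: \<tau>_def power_add power_mult power_divide)
      qed
      then show "\<forall>u\<in>set us. (mons (map (%k. m * k) [0..<N - 1]) ! i) u =
          (map (%\<psi> z. z ^ (m * (N - 2)) * \<psi> z) (pows \<tau> (N - 1)) ! i) u"
        using i by (auto simp: mons_def pows_def rev_nth Suc_diff_Suc numeral_2_eq_2)
    qed simp
    have "z ^ l1 = z ^ (m * (N - 2)) * P [\<tau> z]" if "z \<in> set us" for z
    proof -
      have z: "0 < z" "1 < T * z ^ m" using u[OF that] by auto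
      have t: "0 < \<tau> z" "\<tau> z < T" using \<tau>S[OF that] by (auto simp: S_def)
      have "Phi sg [1 - \<tau> z / T] = (\<tau> z / T) powr (- sg)" using t by (subst Phi_single) auto
      then have "P [\<tau> z] = T powr (- sg) * (\<tau> z / T) powr (- sg)" by (simp add: P_def)
      also have "... = (T * (\<tau> z / T)) powr (- sg)" by (rule powr_mult[symmetric])
      also have "... = (z ^ m) powr sg" using t z T by (simp add: \<tau>_def powr_minus powr_divide inverse_eq_divide)
      also have "... = z powr (real m * sg)" using z by (simp add: powr_powr powr_realpow[symmetric])
      also have "... = z ^ (l1 - m * (N - 2))" using m z by (simp add: sg_def powr_realpow[symmetric] del: of_nat_diff)
      finally show ?thesis using l1 by (simp add: power_add[symmetric])
    qed
    then show "list_all2 (%f g. \<forall>u\<in>set us. f u = g u) [%z. z ^ l1] (map (%\<psi> z. z ^ (m * (N - 2)) * \<psi> z) [%z. P [\<tau> z]])" by simp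
  qed
  then have "alt us (mons (slist (V 1))) = alt us (map (%\<psi> z. z ^ (m * (N - 2)) * \<psi> z) (pows \<tau> (N - 1) @ [%z. P [\<tau> z]]))"
    by (rule alt_cong) simp
  also have "... = (\<Prod>u\<leftarrow>us. u ^ (m * (N - 2))) * alt us (pows \<tau> (N - 1) @ [%z. P (\<tau> z # [])])" by (rule alt_scale)
  also have "alt us (pows \<tau> (N - 1) @ [%z. P (\<tau> z # [])]) = vdm_sign (N - 1) (- 1 / T) * vdm (map \<tau> us) * P (map \<tau> us @ [])"
  proof (rule alt_divided_difference[where S = S])
    fix a b and l :: "real list" assume ab: "set (a # b # l) \<subseteq> S"
    have "Phi sg ((1 - a / T) # map (%t. 1 - t / T) l) - Phi sg ((1 - b / T) # map (%t. 1 - t / T) l)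
      = ((1 - a / T) - (1 - b / T)) * Phi sg ((1 - a / T) # (1 - b / T) # map (%t. 1 - t / T) l)"
    proof (rule Phi_diff[OF sg_pos])
      fix c assume "c \<in> set ((1 - a / T) # (1 - b / T) # map (%t. 1 - t / T) l)"
      then obtain t where "t \<in> S" "c = 1 - t / T" using ab by auto
      then have "0 < t / T" "t / T < 1" "c = 1 - t / T" using T by (auto simp: S_def)
      then show "norm c < 1" by simp
    qed
    also have "(1 - a / T) - (1 - b / T) = (- 1 / T) * (a - b)" using T by (simp add: field_simps)
    finally show "P (a # l) - P (b # l) = - 1 / T * (a - b) * P (a # b # l)" by (simp add: P_def right_diff_distrib[symmetric])
  next
    fix l l' :: "real list" assume "mset l = mset l'"
    then have "mset (map (%t. 1 - t / T) l) = mset (map (%t. 1 - t / T) l')" by simp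
    then show "P l = P l'" using Phi_mset unfolding P_def by metis
  qed (use assms(1) N \<tau>S in auto)
  also have "P (map \<tau> us @ []) = T powr (- sg) * Phi sg (map (eta T m) us)"
    by (simp add: P_def \<tau>_def eta_def[abs_def] o_def mult.commute)
  finally show ?thesis by (simp add: \<tau>_def mult_ac)
qed

end

text \<open>The quotient of \<open>u ^ m - w ^ m\<close> by \<open>u - w\<close> in polynomial form,
  which keeps its meaning at \<open>u = w\<close>.\<close>

definition geom_sum :: "nat => 'a::comm_ring_1 => 'a => 'a" where
  "geom_sum m w u = (\<Sum>k<m. u ^ k * w ^ (m - Suc k))"

lemma geom_sum_eq: "(u - w) * geom_sum m w u = u ^ m - w ^ m"
proof (cases m)
  case (Suc n)
  then show ?thesis using diff_power_eq_sum[of u n w] by (simp add: geom_sum_def)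
qed (simp add: geom_sum_def)

text \<open>The part of the closed form that depends on each variable separately. It is polymorphic
  because it is evaluated at real weights and then continued to complex points of the
  contours.\<close>

definition one_body :: "nat => nat => (nat => nat) => (nat => real) => (nat => real) => 'a => 'a::real_normed_field" where
  "one_body m s a x y u = 1 / u ^ m * (\<Prod>i\<in>{1..s}. geom_sum m (of_real (x i)) u)
     * (\<Prod>i\<in>{1..s}. if a i = 1 then 1 else 1 + of_real (y i) * u)"

locale weighted_staircase = weighted_contracting N \<Omega> a x y + staircase N \<Omega> a m l1 T
  for N \<Omega> a x y m l1 T +
  assumes pos: "!!i. i \<in> {1..N} ==> 0 < x i \<and> 0 < y i" and Tx: "!!i. i \<in> {1..N} ==> 1 < T * x i ^ m"
begin

definition nodes :: "nat => real list => real list" where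
  "nodes s us = map (eta T m) (map x [1..<Suc s] @ us)"

lemma row_factor_eq: "row_factor i us = (\<Prod>u\<leftarrow>us. if a i = 1 then 1 else 1 + y i * u)"
  by (auto simp: row_factor_def map_replicate_const)

lemma prod_list_mult: "(\<Prod>u\<leftarrow>us. f u * g u) = (\<Prod>u\<leftarrow>us. f u) * (\<Prod>u\<leftarrow>us. g u :: real)" by (induction us) auto

lemma prod_list_const: "(\<Prod>u\<leftarrow>us. c) = (c :: real) ^ length us" by (induction us) auto

text \<open>The Vandermonde product of lower weights and free variables splits into the lower part,
  a constant, the mixed part, which belongs to \<open>one_body\<close>, and the part in
  \<open>us\<close>. All constants go into \<open>K'\<close>, which cancels in ratios.\<close>

lemma closed_form:
  assumes inj: "inj_on x {1..N}" and s: "s < N" and K: "K ~= 0"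
    and \<Psi>: "!!us. length us = N - s ==> \<Psi> us * (\<Prod>i\<in>{1..s}. \<Prod>u\<leftarrow>us. u - x i)
        = K * (\<Prod>i\<in>{1..s}. row_factor i us) * alt_set (map x [1..<Suc s] @ us) (V 1)"
  obtains K' where "K' ~= 0"
    and "!!us. length us = N - s ==> (!!u. u \<in> set us ==> 0 < u \<and> 1 < T * u ^ m \<and> u \<notin> x ` {1..s}) ==>
      \<Psi> us = K' * vdm (map (%u. u ^ m) us) * (\<Prod>u\<leftarrow>us. one_body m s a x y u) * Phi sg (nodes s us)"
proof -
  define M where "M = N - s"
  define xs where "xs = map x [1..<Suc s]"
  define \<tau> where "\<tau> = (%u::real. 1 / u ^ m)"
  define c where "c = (\<Prod>i\<in>{1..s}. - \<tau> (x i))"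
  define C where "C = T powr (- sg) * vdm_sign (N - 1) (- 1 / T) * (\<Prod>u\<leftarrow>xs. u ^ (m * (N - 2))) * vdm (map \<tau> xs)
      * (\<Prod>i<M. (- 1) ^ i)"
  have xs: "set xs = x ` {1..s}" by (auto simp: xs_def)
  have xs_prod: "(\<Prod>z\<leftarrow>xs. f z) = (\<Prod>i\<in>{1..s}. f (x i))" for f :: "real => real"
    by (simp add: xs_def o_def prod.distinct_set_conv_list[symmetric] atLeastLessThanSuc_atLeastAtMost del: upt_Suc)
  have xpos: "0 < x i" if "i \<in> {1..s}" for i using pos[of i] that s by auto
  have c: "c ~= 0" using xpos by (force simp: c_def \<tau>_def)
  have C: "C ~= 0"
  proof -
    have "inj_on \<tau> (x ` {1..s})"
    proof (rule inj_onI)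
      fix u v assume uv: "u \<in> x ` {1..s}" "v \<in> x ` {1..s}" "\<tau> u = \<tau> v"
      then have "0 < u" "0 < v" using xpos by auto
      moreover have "u ^ m = v ^ m" using uv by (simp add: \<tau>_def)
      ultimately show "u = v" using m power_eq_imp_eq_base[of u m v] by auto
    qed
    moreover have "distinct xs"
    proof -
      have "inj_on x (set [1..<Suc s])" using s by (intro inj_on_subset[OF inj]) auto
      then show ?thesis unfolding xs_def distinct_map by simp
    qed
    ultimately have "distinct (map \<tau> xs)" by (simp add: distinct_map xs)
    then have "vdm (map \<tau> xs) ~= 0" by (rule vdm_nonzero)
    moreover have "(\<Prod>u\<leftarrow>xs. u ^ (m * (N - 2))) ~= 0" using xpos by (force simp: prod_list_zero_iff xs)
    moreover have "vdm_sign (N - 1) (- 1 / T) ~= 0" using T by (intro vdm_sign_nonzero) simp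
    ultimately show ?thesis using T by (simp add: C_def)
  qed
  show thesis
  proof (rule that[of "K * C * c ^ M"])
    show "K * C * c ^ M ~= 0" using K c C by simp
    fix us assume us: "length us = N - s"
      and u: "!!u. u \<in> set us ==> 0 < u \<and> 1 < T * u ^ m \<and> u \<notin> x ` {1..s}"
    have up: "0 < u" if "u \<in> set us" for u using u[OF that] by simp
    let ?G = "one_body m s a x y :: real => real"
    let ?rf = "%u. \<Prod>i\<in>{1..s}. if a i = 1 then 1 else 1 + y i * u"
    \<comment> \<open>Each mixed factor \<open>\<tau> u - \<tau> (x i)\<close> contains
      \<open>u - x i\<close>, which matches the product on the left of the recursion;
      \<open>geom_sum\<close> is what remains.\<close>
    have per_u: "?rf u * (u ^ (m * (N - 2)) * (\<Prod>z\<leftarrow>xs. \<tau> u - \<tau> z) * (1 / u ^ m) ^ (M - 1)) = c * ?G u * (\<Prod>i\<in>{1..s}. u - x i)"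
      if "u \<in> set us" for u
    proof -
      have u0: "0 < u" using up[OF that] .
      have "\<tau> u - \<tau> (x i) = - \<tau> (x i) * \<tau> u * ((u - x i) * geom_sum m (x i) u)" if "i \<in> {1..s}" for i
        using xpos[OF that] u0 by (simp add: geom_sum_eq \<tau>_def field_simps)
      then have "(\<Prod>z\<leftarrow>xs. \<tau> u - \<tau> z) = (\<Prod>i\<in>{1..s}. - \<tau> (x i) * \<tau> u * ((u - x i) * geom_sum m (x i) u))"
        unfolding xs_prod by (intro prod.cong refl)
      then have "(\<Prod>z\<leftarrow>xs. \<tau> u - \<tau> z) = c * \<tau> u ^ s * ((\<Prod>i\<in>{1..s}. u - x i) * (\<Prod>i\<in>{1..s}. geom_sum m (x i) u))"
        by (simp only: c_def prod.distrib prod_constant card_atLeastAtMost) simp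
      then have "?rf u * (u ^ (m * (N - 2)) * (\<Prod>z\<leftarrow>xs. \<tau> u - \<tau> z) * (1 / u ^ m) ^ (M - 1))
         = (u ^ (m * (N - 2)) * (\<tau> u ^ s * (1 / u ^ m) ^ (M - 1))) * (\<Prod>i\<in>{1..s}. geom_sum m (x i) u) * ?rf u * c * (\<Prod>i\<in>{1..s}. u - x i)"
        by (simp only: mult_ac)
      also have "u ^ (m * (N - 2)) * (\<tau> u ^ s * (1 / u ^ m) ^ (M - 1)) = 1 / u ^ m"
      proof -
        have "\<tau> u ^ s * (1 / u ^ m) ^ (M - 1) = (1 / u ^ m) ^ Suc (N - 2)"
        proof -
          \<comment> \<open>The powers of \<open>1 / u ^ m\<close> are \<open>s\<close> from the
            mixed factors and \<open>M - 1\<close> from inverting the Vandermonde product, against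
            \<open>N - 2\<close> pulled out of the columns; one is left over.\<close>
          have "s + (M - 1) = Suc (N - 2)" using s N by (auto simp: M_def)
          then show ?thesis by (simp only: \<tau>_def power_add[symmetric])
        qed
        then show ?thesis using u0 by (simp add: power_mult power_divide)
      qed
      also have "1 / u ^ m * (\<Prod>i\<in>{1..s}. geom_sum m (x i) u) * ?rf u = ?G u" by (simp add: one_body_def cong: if_cong)
      finally show ?thesis by (simp only: mult_ac)
    qed
    have len: "length (xs @ us) = N" using us s by (simp add: xs_def del: upt_Suc)
    have pos': "0 < z \<and> 1 < T * z ^ m" if z: "z \<in> set (xs @ us)" for z
    proof (cases "z \<in> set us")
      case False
      then obtain i where "i \<in> {1..s}" "z = x i" using z by (auto simp: xs)
      then show ?thesis using xpos[of i] Tx[of i] s by auto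
    qed (use u in auto)
    have taus: "map (%u. 1 / u ^ m) (xs @ us) = map \<tau> xs @ map \<tau> us" by (simp add: \<tau>_def)
    have vd: "vdm (map \<tau> us) = (\<Prod>i<M. (- 1) ^ i) * (\<Prod>u\<leftarrow>us. (1 / u ^ m) ^ (M - 1)) * vdm (map (%u. u ^ m) us)"
      using vdm_inverse[of "map (%u. u ^ m) us"] up us by (force simp: \<tau>_def o_def M_def)
    have ac: "alt (xs @ us) (mons (slist (V 1))) = T powr (- sg) * vdm_sign (N - 1) (- 1 / T) * (\<Prod>u\<leftarrow>xs @ us. u ^ (m * (N - 2)))
     * vdm (map (%u. 1 / u ^ m) (xs @ us)) * Phi sg (map (eta T m) (xs @ us))" by (rule alt_closed[OF len]) (rule pos')
    have "alt_set (xs @ us) (V 1) = C * ((\<Prod>u\<leftarrow>us. u ^ (m * (N - 2))) * (\<Prod>u\<leftarrow>us. \<Prod>z\<leftarrow>xs. \<tau> u - \<tau> z) * (\<Prod>u\<leftarrow>us. (1 / u ^ m) ^ (M - 1)))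
        * vdm (map (%u. u ^ m) us) * Phi sg (nodes s us)"
      unfolding alt_set_def ac taus vdm_append vd C_def nodes_def xs_def[symmetric] by (simp add: o_def mult_ac)
    then have ac': "alt_set (xs @ us) (V 1) = C * (\<Prod>u\<leftarrow>us. u ^ (m * (N - 2)) * (\<Prod>z\<leftarrow>xs. \<tau> u - \<tau> z) * (1 / u ^ m) ^ (M - 1))
        * vdm (map (%u. u ^ m) us) * Phi sg (nodes s us)" by (simp only: prod_list_mult)
    have rf: "(\<Prod>i\<in>{1..s}. row_factor i us) = (\<Prod>u\<leftarrow>us. ?rf u)" unfolding row_factor_eq by (rule prod_list_swap)
    have "\<Psi> us * (\<Prod>i\<in>{1..s}. \<Prod>u\<leftarrow>us. u - x i) = K * (\<Prod>i\<in>{1..s}. row_factor i us) * alt_set (xs @ us) (V 1)"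
      unfolding xs_def by (rule \<Psi>[OF us])
    also have "... = K * C * ((\<Prod>u\<leftarrow>us. ?rf u) * (\<Prod>u\<leftarrow>us. u ^ (m * (N - 2)) * (\<Prod>z\<leftarrow>xs. \<tau> u - \<tau> z) * (1 / u ^ m) ^ (M - 1)))
       * vdm (map (%u. u ^ m) us) * Phi sg (nodes s us)" unfolding ac' rf by (simp only: mult_ac)
    also have "(\<Prod>u\<leftarrow>us. ?rf u) * (\<Prod>u\<leftarrow>us. u ^ (m * (N - 2)) * (\<Prod>z\<leftarrow>xs. \<tau> u - \<tau> z) * (1 / u ^ m) ^ (M - 1))
       = (\<Prod>u\<leftarrow>us. ?rf u * (u ^ (m * (N - 2)) * (\<Prod>z\<leftarrow>xs. \<tau> u - \<tau> z) * (1 / u ^ m) ^ (M - 1)))" by (rule prod_list_mult[symmetric])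
    also have "(\<Prod>u\<leftarrow>us. ?rf u * (u ^ (m * (N - 2)) * (\<Prod>z\<leftarrow>xs. \<tau> u - \<tau> z) * (1 / u ^ m) ^ (M - 1)))
        = (\<Prod>u\<leftarrow>us. c * ?G u * (\<Prod>i\<in>{1..s}. u - x i))" by (intro arg_cong[of _ _ prod_list] map_cong refl per_u)
    also have "... = c ^ M * (\<Prod>u\<leftarrow>us. ?G u) * (\<Prod>i\<in>{1..s}. \<Prod>u\<leftarrow>us. u - x i)"
      by (simp add: prod_list_mult prod_list_const us M_def prod_list_swap)
    finally have "\<Psi> us * (\<Prod>i\<in>{1..s}. \<Prod>u\<leftarrow>us. u - x i)
       = (K * C * c ^ M * vdm (map (%u. u ^ m) us) * (\<Prod>u\<leftarrow>us. ?G u) * Phi sg (nodes s us)) * (\<Prod>i\<in>{1..s}. \<Prod>u\<leftarrow>us. u - x i)"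
      by (simp add: mult_ac)
    moreover have "(\<Prod>i\<in>{1..s}. \<Prod>u\<leftarrow>us. u - x i) ~= 0" by (auto simp: prod_list_zero_iff dest!: u)
    ultimately show "\<Psi> us = K * C * c ^ M * vdm (map (%u. u ^ m) us) * (\<Prod>u\<leftarrow>us. ?G u) * Phi sg (nodes s us)"
      by (simp only: mult_cancel_right simp_thms)
  qed
qed

end

section \<open>Dilations in the closed form\<close>

definition dilate :: "real => real list => nat => real list" where
  "dilate q us i = us[i := q * us ! i]"

text \<open>The quotient of the Vandermonde products in the \<open>m\<close>-th powers after and
  before the dilation of entry \<open>i\<close>.\<close>

definition kap :: "nat => real => real list => nat => real" where
  "kap m q us i = (\<Prod>j\<in>{..<length us} - {i}. ((q * us ! i) ^ m - us ! j ^ m) / (us ! i ^ m - us ! j ^ m))"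

lemma length_dilate [simp]: "length (dilate q us i) = length us" by (simp add: dilate_def)

context weighted_staircase
begin

definition valid :: "nat => real list => bool" where
  "valid s us \<longleftrightarrow> length us = N - s \<and> (\<forall>u\<in>set us. 0 < u \<and> 1 < T * u ^ m \<and> u \<notin> x ` {1..s})"

lemma eta_range: "0 < u ==> 1 < T * u ^ m ==> 0 < eta T m u \<and> eta T m u < 1" using T by (simp add: eta_def)

lemma nodes_range:
  assumes "valid s us" "s <= N" "z \<in> set (nodes s us)"
  shows "0 <= z \<and> z < 1"
proof -
  have "z \<in> eta T m ` (set us \<union> x ` {1..s})" using assms(3) by (auto simp: nodes_def simp del: upt_Suc)
  then obtain u where u: "u \<in> set us \<or> u \<in> x ` {1..s}" "z = eta T m u" by blast
  have "0 < u \<and> 1 < T * u ^ m" using u(1) assms(1,2) pos Tx by (auto simp: valid_def)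
  then show ?thesis using eta_range[of u] u(2) by auto
qed

lemma Phi_nodes_pos:
  assumes "valid s us" "s < N"
  shows "0 < Phi sg (nodes s us)"
proof (rule Phi_pos[OF sg_pos])
  show "nodes s us ~= []" using assms by (auto simp: nodes_def valid_def)
qed (use nodes_range[OF assms(1)] assms(2) in auto)

lemma one_body_pos:
  assumes "0 < u" "s <= N"
  shows "0 < (one_body m s a x y u :: real)"
proof -
  have "0 < geom_sum m (x i) u" if "i \<in> {1..s}" for i unfolding geom_sum_def using m assms pos[of i] that
    by (intro sum_pos mult_pos_pos zero_less_power) (auto simp: lessThan_empty_iff)
  moreover have "0 < 1 + y i * u" if "i \<in> {1..s}" for i using assms pos[of i] that by (simp add: add_pos_pos)
  ultimately have "0 < (\<Prod>i\<in>{1..s}. geom_sum m (x i) u)"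
    "0 < (\<Prod>i\<in>{1..s}. if a i = 1 then 1 else 1 + y i * u)" by (auto intro!: prod_pos)
  then show ?thesis using assms(1) by (simp add: one_body_def cong: if_cong)
qed

lemma ratio:
  assumes \<Psi>: "!!us. valid s us ==> \<Psi> us = K * vdm (map (%u. u ^ m) us) * (\<Prod>u\<leftarrow>us. one_body m s a x y u) * Phi sg (nodes s us)"
    and us: "valid s us" "valid s (dilate q us i)" "distinct us" and i: "i < N - s" and q: "1 < q" and s: "s < N"
  shows "\<Psi> (dilate q us i) = \<Psi> us * (kap m q us i * (one_body m s a x y (q * us ! i) / one_body m s a x y (us ! i))
       * (Phi sg (nodes s (dilate q us i)) / Phi sg (nodes s us)))"
proof -
  define w where "w = q * us ! i"
  define vs where "vs = map (%u. u ^ m) us"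
  have i': "i < length us" using us i by (simp add: valid_def)
  have u0: "0 < us ! i" using us(1) i' by (auto simp: valid_def)
  have inj: "us ! i ^ m - us ! j ^ m ~= 0" if "j < length us" "j ~= i" for j
  proof
    assume "us ! i ^ m - us ! j ^ m = 0"
    then have "us ! i = us ! j"
      using u0 us(1) that m power_eq_imp_eq_base[of "us ! i" m "us ! j"] by (auto simp: valid_def less_imp_le)
    then show False using us(3) that i' by (simp add: nth_eq_iff_index_eq)
  qed
  have "vdm (vs[i := w ^ m]) * (\<Prod>j\<in>{..<length us} - {i}. us ! i ^ m - us ! j ^ m)
     = vdm vs * (\<Prod>j\<in>{..<length us} - {i}. w ^ m - us ! j ^ m)"
  proof -
    have "(\<Prod>j\<in>{..<length vs} - {i}. z - vs ! j) = (\<Prod>j\<in>{..<length us} - {i}. z - us ! j ^ m)" for z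
      by (intro prod.cong) (auto simp: vs_def)
    then show ?thesis using vdm_update[of i vs "w ^ m"] i' by (simp add: vs_def)
  qed
  moreover have "(\<Prod>j\<in>{..<length us} - {i}. us ! i ^ m - us ! j ^ m) ~= 0" using inj by simp
  ultimately have 1: "vdm (vs[i := w ^ m]) = vdm vs * kap m q us i" by (simp add: kap_def w_def prod_dividef field_simps)
  have "(\<Prod>u\<leftarrow>us[i := w]. one_body m s a x y u) * one_body m s a x y (us ! i) = (\<Prod>u\<leftarrow>us. one_body m s a x y u) * one_body m s a x y w"
    by (rule prod_list_update[OF i'])
  moreover have "0 < (one_body m s a x y (us ! i) :: real)" using u0 s by (intro one_body_pos) auto
  ultimately have 2: "(\<Prod>u\<leftarrow>us[i := w]. one_body m s a x y u) = (\<Prod>u\<leftarrow>us. one_body m s a x y u) * (one_body m s a x y w / one_body m s a x y (us ! i))"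
    by (simp add: field_simps)
  have 3: "Phi sg (nodes s us) ~= 0" using Phi_nodes_pos[OF us(1) s] by simp
  show ?thesis unfolding \<Psi>[OF us(1)] \<Psi>[OF us(2)]
    unfolding dilate_def w_def[symmetric] 2 map_update[of "%u. u ^ m"] vs_def[symmetric] 1 using 3 by simp
qed

lemma \<Psi>_nonzero:
  assumes \<Psi>: "!!us. valid s us ==> \<Psi> us = K * vdm (map (%u. u ^ m) us) * (\<Prod>u\<leftarrow>us. one_body m s a x y u) * Phi sg (nodes s us)"
    and us: "valid s us" "distinct us" and s: "s < N" and K: "K ~= 0"
  shows "\<Psi> us ~= 0"
proof -
  have "inj_on (%u. u ^ m) (set us)"
  proof (rule inj_onI)
    fix u v assume "u \<in> set us" "v \<in> set us" "u ^ m = v ^ m"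
    then show "u = v" using us(1) m power_eq_imp_eq_base[of u m v] by (auto simp: valid_def less_imp_le)
  qed
  then have "vdm (map (%u. u ^ m) us) ~= 0" using us(2) by (intro vdm_nonzero) (simp add: distinct_map)
  moreover have "one_body m s a x y u ~= (0::real)" if "u \<in> set us" for u
    using one_body_pos[of u s] us(1) that s by (auto simp: valid_def)
  ultimately show ?thesis using K Phi_nodes_pos[OF us(1) s] by (auto simp: \<Psi>[OF us(1)] prod_list_zero_iff)
qed

definition upper :: "nat => real list" where
  "upper s = map x [Suc s..<Suc N]"

lemma length_upper [simp]: "length (upper s) = N - s" by (simp add: upper_def del: upt_Suc)

lemma nth_upper: "i < N - s ==> upper s ! i = x (Suc (s + i))" by (simp add: upper_def del: upt_Suc)

lemma set_upper: "set (upper s) = x ` {Suc s..N}" by (auto simp: upper_def simp del: upt_Suc)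

definition shift1 :: "real => nat => nat => real" where
  "shift1 q s i = kap m q (upper s) i * (one_body m s a x y (q * upper s ! i) / one_body m s a x y (upper s ! i))"

definition shift2 :: "real => nat => nat => nat => real" where
  "shift2 q s i k = (let us = dilate q (upper s) i in
     kap m q us k * (one_body m s a x y (q * us ! k) / one_body m s a x y (us ! k)))"

text \<open>The genericity hypothesis keeps dilated points apart from each other and from all
  weights, so every Vandermonde product in a denominator is nonzero; \<open>e = 2\<close> arises
  when one variable is dilated twice. In the second moment the intermediate value of
  \<open>Phi\<close> cancels between the two ratios.\<close>

theorem shift_moments:
  assumes q: "1 < q" and s: "1 <= s" "s < N"
    and gen: "!!i j e. i \<in> {1..N} ==> j \<in> {1..N} ==> e <= 2 ==> q ^ e * x i = x j ==> i = j \<and> e = 0"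
  obtains Z where "Z ~= 0" and "(\<Sum>D\<in>configs (2 * N + 1). weight D) = Z"
    and "(\<Sum>D\<in>configs (2 * N + 1). weight D * (\<Sum>l\<in>ups (2 * s + 1) D. q ^ l))
       = Z * (\<Sum>i<N - s. shift1 q s i * (Phi sg (nodes s (dilate q (upper s) i)) / Phi sg (nodes s (upper s))))"
    and "(\<Sum>D\<in>configs (2 * N + 1). weight D * (\<Sum>l\<in>ups (2 * s + 1) D. q ^ l)\<^sup>2)
       = Z * (\<Sum>i<N - s. shift1 q s i * (\<Sum>k<N - s. shift2 q s i k *
             (Phi sg (nodes s (dilate q (dilate q (upper s) i) k)) / Phi sg (nodes s (upper s)))))"
proof -
  have inj: "inj_on x {1..N}" using gen[of _ _ 0] by (auto simp: inj_on_def)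
  obtain c K0 \<Psi> where c: "c ~= 0" and K0: "K0 ~= 0"
    and \<Psi>0: "!!us. length us = N - s ==> \<Psi> us * (\<Prod>i\<in>{1..s}. \<Prod>u\<leftarrow>us. u - x i)
        = K0 * (\<Prod>i\<in>{1..s}. row_factor i us) * alt_set (map x [1..<Suc s] @ us) (V 1)"
    and S0: "(\<Sum>D\<in>configs (2 * N + 1). weight D) = c * \<Psi> (upper s)"
    and S1: "!!q. (\<Sum>D\<in>configs (2 * N + 1). weight D * (\<Sum>l\<in>ups (2 * s + 1) D. q ^ l))
       = c * (\<Sum>i<N - s. \<Psi> (dilate q (upper s) i))"
    and S2: "!!q. (\<Sum>D\<in>configs (2 * N + 1). weight D * (\<Sum>l\<in>ups (2 * s + 1) D. q ^ l)\<^sup>2)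
       = c * (\<Sum>i<N - s. \<Sum>k<N - s. \<Psi> (dilate q (dilate q (upper s) i) k))"
    using dimer_sums[OF inj pos s] unfolding upper_def[symmetric] dilate_def[symmetric] Let_def by blast
  obtain K where K: "K ~= 0"
    and \<Psi>1: "!!us. length us = N - s ==> (!!u. u \<in> set us ==> 0 < u \<and> 1 < T * u ^ m \<and> u \<notin> x ` {1..s}) ==>
      \<Psi> us = K * vdm (map (%u. u ^ m) us) * (\<Prod>u\<leftarrow>us. one_body m s a x y u) * Phi sg (nodes s us)"
    using closed_form[OF inj s(2) K0 \<Psi>0] by blast
  have \<Psi>: "\<Psi> us = K * vdm (map (%u. u ^ m) us) * (\<Prod>u\<leftarrow>us. one_body m s a x y u) * Phi sg (nodes s us)"
    if "valid s us" for us using \<Psi>1[of us] that by (simp add: valid_def)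
  have pw: "0 < q ^ e * x j \<and> 1 < T * (q ^ e * x j) ^ m \<and> q ^ e * x j \<notin> x ` {1..s}"
    if j: "j \<in> {Suc s..N}" and e: "e <= 2" for j e
  proof -
    have xj: "0 < x j" "1 < T * x j ^ m" using pos[of j] Tx[of j] j by auto
    have q1: "1 <= q ^ e" using q by simp
    have "x j <= q ^ e * x j" using q1 xj by simp
    then have "x j ^ m <= (q ^ e * x j) ^ m" using xj by (intro power_mono) auto
    then have "T * x j ^ m <= T * (q ^ e * x j) ^ m" using T by simp
    moreover have "q ^ e * x j \<notin> x ` {1..s}"
    proof
      assume "q ^ e * x j \<in> x ` {1..s}"
      then obtain i where i: "i \<in> {1..s}" "q ^ e * x j = x i" by blast
      then show False using gen[of j i e] j e s by auto
    qed
    ultimately show ?thesis using xj q by (auto intro!: mult_pos_pos)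
  qed
  define U where "U = upper s"
  have U0: "valid s U" using pw[of _ 0] by (auto simp: valid_def U_def set_upper)
  have nU: "U ! i = x (Suc (s + i))" "Suc (s + i) \<in> {Suc s..N}" if "i < N - s" for i using that by (auto simp: U_def nth_upper)
  have dU: "distinct U"
  proof -
    have "inj_on x (set [Suc s..<Suc N])" by (rule inj_on_subset[OF inj]) auto
    then show ?thesis unfolding U_def upper_def distinct_map by simp
  qed
  have U1: "valid s (dilate q U i) \<and> distinct (dilate q U i)" if i: "i < N - s" for i
  proof
    have "set (dilate q U i) \<subseteq> insert (q * U ! i) (set U)" unfolding dilate_def by (rule set_update_subset_insert)
    moreover have "0 < u \<and> 1 < T * u ^ m \<and> u \<notin> x ` {1..s}" if "u \<in> insert (q * U ! i) (set U)" for u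
    proof (cases "u = q * U ! i")
      case True
      then show ?thesis using pw[of "Suc (s + i)" 1] nU[OF i] by simp
    next
      case False
      then show ?thesis using U0 that by (simp add: valid_def)
    qed
    ultimately show "valid s (dilate q U i)" using U0 unfolding valid_def by (metis length_dilate subsetD)
    have "q * U ! i \<notin> set U"
    proof
      assume "q * U ! i \<in> set U"
      then obtain j where "j \<in> {Suc s..N}" "q * x (Suc (s + i)) = x j" using nU[OF i] by (auto simp: U_def set_upper)
      then show False using gen[of "Suc (s + i)" j 1] nU[OF i] by auto
    qed
    then show "distinct (dilate q U i)" unfolding dilate_def using dU by (intro distinct_list_update) auto
  qed
  have U2: "valid s (dilate q (dilate q U i) k)" if i: "i < N - s" and k: "k < N - s" for i k
  proof -
    have "set (dilate q (dilate q U i) k) \<subseteq> insert (q * dilate q U i ! k) (set (dilate q U i))"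
      unfolding dilate_def[of q "dilate q U i"] by (rule set_update_subset_insert)
    moreover have "q * dilate q U i ! k = q ^ (if k = i then 2 else 1) * x (Suc (s + k))"
      using nU[OF i] nU[OF k] i k U0 by (auto simp: dilate_def valid_def power2_eq_square)
    moreover have "0 < u \<and> 1 < T * u ^ m \<and> u \<notin> x ` {1..s}"
      if "u \<in> insert (q ^ (if k = i then 2 else 1) * x (Suc (s + k))) (set (dilate q U i))" for u
    proof (cases "u = q ^ (if k = i then 2 else 1) * x (Suc (s + k))")
      case True
      then show ?thesis using pw[of "Suc (s + k)" "if k = i then 2 else 1"] nU[OF k] by (simp only:) simp
    next
      case False
      then show ?thesis using U1[OF i] that by (simp add: valid_def)
    qed
    ultimately show ?thesis using U1[OF i] unfolding valid_def by (metis length_dilate subsetD)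
  qed
  note rat = ratio[where s = s and \<Psi> = \<Psi> and K = K, OF \<Psi>]
  have P0: "Phi sg (nodes s U) ~= 0" using Phi_nodes_pos[OF U0 s(2)] by simp
  have e1: "\<Psi> (dilate q U i) = \<Psi> U * (shift1 q s i * (Phi sg (nodes s (dilate q U i)) / Phi sg (nodes s U)))"
    if i: "i < N - s" for i using rat[of U q i] U0 U1[OF i] dU i q s by (simp add: shift1_def U_def)
  have e2: "\<Psi> (dilate q (dilate q U i) k) = \<Psi> U * (shift1 q s i * (shift2 q s i k *
      (Phi sg (nodes s (dilate q (dilate q U i) k)) / Phi sg (nodes s U))))"
    if i: "i < N - s" and k: "k < N - s" for i k
  proof -
    have "\<Psi> (dilate q (dilate q U i) k) = \<Psi> (dilate q U i) * (shift2 q s i k * (Phi sg (nodes s (dilate q (dilate q U i) k)) / Phi sg (nodes s (dilate q U i))))"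
      using rat[of "dilate q U i" q k] U1[OF i] U2[OF i k] k q s by (simp add: shift2_def U_def Let_def)
    moreover have "Phi sg (nodes s (dilate q U i)) ~= 0" using Phi_nodes_pos[OF _ s(2)] U1[OF i] by force
    ultimately show ?thesis unfolding e1[OF i] using P0 by simp
  qed
  show thesis
  proof (rule that[of "c * \<Psi> U"])
    show "c * \<Psi> U ~= 0" using c \<Psi>_nonzero[where \<Psi> = \<Psi> and s = s and K = K, OF \<Psi> U0 dU s(2) K] by simp
    show "(\<Sum>D\<in>configs (2 * N + 1). weight D) = c * \<Psi> U" using S0 by (simp add: U_def)
    show "(\<Sum>D\<in>configs (2 * N + 1). weight D * (\<Sum>l\<in>ups (2 * s + 1) D. q ^ l))
       = c * \<Psi> U * (\<Sum>i<N - s. shift1 q s i * (Phi sg (nodes s (dilate q (upper s) i)) / Phi sg (nodes s (upper s))))"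
      unfolding S1 U_def[symmetric] using e1 by (simp add: sum_distrib_left mult.assoc)
    show "(\<Sum>D\<in>configs (2 * N + 1). weight D * (\<Sum>l\<in>ups (2 * s + 1) D. q ^ l)\<^sup>2)
       = c * \<Psi> U * (\<Sum>i<N - s. shift1 q s i * (\<Sum>k<N - s. shift2 q s i k *
             (Phi sg (nodes s (dilate q (dilate q (upper s) i) k)) / Phi sg (nodes s (upper s)))))"
      unfolding S2 U_def[symmetric] using e2 by (simp add: sum_distrib_left mult.assoc)
  qed
qed

end

section \<open>Contour integrals around the points of the period\<close>

text \<open>The residue at \<open>us ! i\<close> is \<open>kap m q us i\<close>: the factors with
  \<open>j ~= i\<close> give the product, and the last factor is chosen so that the factor with
  \<open>j = i\<close> contributes exactly \<open>1\<close>.\<close>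

definition ker :: "nat => real => real list => complex => complex" where
  "ker m q us z = (\<Prod>j<length us. ((of_real q * z) ^ m - of_real (us ! j) ^ m) / (z ^ m - of_real (us ! j) ^ m))
     * (of_nat m / ((of_real q ^ m - 1) * z))"

lemma geom_sum_same: "geom_sum m w w = of_nat m * w ^ (m - 1)"
proof -
  have "w ^ k * w ^ (m - Suc k) = w ^ (m - 1)" if "k < m" for k using that by (simp add: power_add[symmetric])
  then show ?thesis by (simp add: geom_sum_def)
qed

lemma geom_sum_holomorphic [holomorphic_intros]: "f holomorphic_on S ==> (%z. geom_sum m w (f z)) holomorphic_on S"
  unfolding geom_sum_def by (intro holomorphic_intros)

text \<open>Injectivity of the \<open>m\<close>-th power on the union of the discs guarantees that
  \<open>z ^ m - u ^ m\<close> vanishes there at \<open>u\<close> only. The half plane condition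
  keeps the discs away from the origin and from the poles \<open>- 1 / y i\<close>.\<close>

locale discs =
  fixes m n :: nat and c :: "nat => real" and \<rho> :: real
  assumes m1: "1 <= m" and \<rho>: "0 < \<rho>"
    and disj: "!!k l. k \<in> {1..n} ==> l \<in> {1..n} ==> k ~= l ==> ball (complex_of_real (c k)) \<rho> \<inter> ball (complex_of_real (c l)) \<rho> = {}"
    and Re_pos: "!!k z. k \<in> {1..n} ==> z \<in> ball (complex_of_real (c k)) \<rho> ==> 0 < Re z"
    and pow_inj: "!!k l z w. k \<in> {1..n} ==> l \<in> {1..n} ==> z \<in> ball (complex_of_real (c k)) \<rho> ==>
       w \<in> ball (complex_of_real (c l)) \<rho> ==> z ^ m = w ^ m ==> z = w"
begin

definition Disc :: "real => complex set" where
  "Disc r = (\<Union>k\<in>{1..n}. ball (complex_of_real (c k)) r)"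

definition circ :: "real => (complex => complex) => complex" where
  "circ r f = (\<Sum>k\<in>{1..n}. 1 / (2 * of_real pi * \<i>) * contour_integral (circlepath (of_real (c k)) r) f)"

lemma Disc_mono: "r <= r' ==> Disc r \<subseteq> Disc r'" by (auto simp: Disc_def)

lemma Disc_nonzero: "z \<in> Disc \<rho> ==> z ~= 0"
proof -
  assume "z \<in> Disc \<rho>"
  then obtain k where "k \<in> {1..n}" "z \<in> ball (complex_of_real (c k)) \<rho>" by (auto simp: Disc_def)
  then have "0 < Re z" by (rule Re_pos)
  then show "z ~= 0" by auto
qed

lemma Disc_inj: "z \<in> Disc \<rho> ==> w \<in> Disc \<rho> ==> z ^ m = w ^ m ==> z = w" using pow_inj by (auto simp: Disc_def)

lemma open_Disc: "open (Disc r)" by (auto simp: Disc_def)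

lemma geom_sum_nonzero:
  assumes "z \<in> Disc \<rho>" "w \<in> Disc \<rho>"
  shows "geom_sum m w z ~= 0"
proof (cases "z = w")
  case True
  then show ?thesis using m1 Disc_nonzero[OF assms(2)] by (simp add: geom_sum_same)
next
  case False
  then have "z ^ m - w ^ m ~= 0" using Disc_inj[OF assms] by auto
  then show ?thesis using geom_sum_eq[of z w m] by auto
qed

lemma of_real_power_minus_one:
  assumes "1 < q"
  shows "complex_of_real q ^ m - 1 ~= 0"
proof
  assume "complex_of_real q ^ m - 1 = 0"
  then have "complex_of_real (q ^ m) = of_real 1" by simp
  then have "q ^ m = 1" by (simp only: of_real_eq_iff)
  moreover have "1 < q ^ m" using assms m1 by (intro one_less_power) auto
  ultimately show False by simp
qed

lemma ker_holomorphic: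
  assumes "S \<subseteq> Disc \<rho>" and "!!u. u \<in> set us ==> complex_of_real u \<in> Disc \<rho> \<and> complex_of_real u \<notin> S" and "1 < q"
  shows "ker m q us holomorphic_on S"
proof -
  have "z ^ m - complex_of_real (us ! j) ^ m ~= 0" if z: "z \<in> S" and j: "j < length us" for z j
  proof
    assume "z ^ m - complex_of_real (us ! j) ^ m = 0"
    then have "z = complex_of_real (us ! j)" using assms(2)[OF nth_mem[OF j]] z assms(1) by - (rule Disc_inj, auto)
    then show False using assms(2)[OF nth_mem[OF j]] z by simp
  qed
  moreover have "z ~= 0" if "z \<in> S" for z using Disc_nonzero assms(1) that by blast
  moreover have "complex_of_real q ^ m - 1 ~= 0" by (rule of_real_power_minus_one[OF assms(3)])
  ultimately show ?thesis unfolding ker_def[abs_def] by (intro holomorphic_intros) auto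
qed

text \<open>The pole is simple: \<open>geom_sum\<close> splits off \<open>z - u\<close> from
  \<open>z ^ m - u ^ m\<close> and is nonzero on the discs, so the residue is the value of the
  cofactor \<open>g\<close> at the point.\<close>

lemma residue_ker:
  assumes q: "1 < q" and us: "!!u. u \<in> set us ==> complex_of_real u \<in> Disc \<rho>" "distinct us"
    and h: "h holomorphic_on Disc \<rho>" and i: "i < length us"
  shows "residue (%z. ker m q us z * h z) (of_real (us ! i)) = of_real (kap m q us i) * h (of_real (us ! i))"
proof -
  define u where "u = complex_of_real (us ! i)"
  define S where "S = Disc \<rho> - complex_of_real ` set us \<union> {u}"
  have uD: "u \<in> Disc \<rho>" using us(1) i by (simp add: u_def)
  have S: "open S"
  proof -
    have "S = Disc \<rho> - complex_of_real ` (set us - {us ! i})" using uD by (auto simp: S_def u_def)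
    then show ?thesis by (simp add: open_Disc open_Diff finite_imp_closed)
  qed
  have SD: "S \<subseteq> Disc \<rho>" using uD by (auto simp: S_def)
  have uS: "u \<in> S" by (simp add: S_def)
  have Q: "complex_of_real q ^ m - 1 ~= 0" by (rule of_real_power_minus_one[OF q])
  define g where "g = (%z. (\<Prod>j\<in>{..<length us} - {i}. ((of_real q * z) ^ m - of_real (us ! j) ^ m) / (z ^ m - of_real (us ! j) ^ m))
     * (((of_real q * z) ^ m - u ^ m) / geom_sum m u z) * (of_nat m / ((of_real q ^ m - 1) * z)) * h z)"
  have "ker m q us z * h z = g z / (z - u)" for z
  proof -
    have "(\<Prod>j<length us. ((of_real q * z) ^ m - of_real (us ! j) ^ m) / (z ^ m - of_real (us ! j) ^ m))
      = (((of_real q * z) ^ m - u ^ m) / (z ^ m - u ^ m))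
       * (\<Prod>j\<in>{..<length us} - {i}. ((of_real q * z) ^ m - of_real (us ! j) ^ m) / (z ^ m - of_real (us ! j) ^ m))"
      unfolding u_def using i by (intro prod.remove) auto
    moreover have "z ^ m - u ^ m = (z - u) * geom_sum m u z" by (simp add: geom_sum_eq)
    ultimately show ?thesis by (simp add: ker_def g_def mult_ac)
  qed
  then have "residue (%z. ker m q us z * h z) u = residue (%z. g z / (z - u)) u" by presburger
  also have "... = g u"
  proof (rule residue_simple[OF S uS])
    have nz: "z ^ m - complex_of_real (us ! j) ^ m ~= 0" if z: "z \<in> S" and j: "j \<in> {..<length us} - {i}" for z j
    proof
      assume "z ^ m - complex_of_real (us ! j) ^ m = 0"
      then have "z = complex_of_real (us ! j)" using us(1) j z SD by - (rule Disc_inj, auto)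
      then show False using z j us(2) i by (auto simp: S_def u_def nth_eq_iff_index_eq)
    qed
    have "h holomorphic_on S" using h SD by (rule holomorphic_on_subset)
    then show "g holomorphic_on S"
    proof -
      have gz: "geom_sum m u z ~= 0" if "z \<in> S" for z using that SD uD by (intro geom_sum_nonzero) auto
      have "z ~= 0" if "z \<in> S" for z using that SD Disc_nonzero by blast
      then show ?thesis unfolding g_def using \<open>h holomorphic_on S\<close>
        by (intro holomorphic_intros) (use nz gz Q in auto)
    qed
  qed
  also have "g u = of_real (kap m q us i) * h u"
  proof -
    have "((of_real q * u) ^ m - u ^ m) / geom_sum m u u * (of_nat m / ((of_real q ^ m - 1) * u)) = 1"
    proof -
      have "u * u ^ (m - 1) = u ^ m" using m1 by (cases m) auto
      then have "((of_real q * u) ^ m - u ^ m) = (of_real q ^ m - 1) * u * u ^ (m - 1)"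
        by (simp add: power_mult_distrib algebra_simps)
      then show ?thesis using Disc_nonzero[OF uD] Q m1 by (simp add: geom_sum_same)
    qed
    moreover have "(\<Prod>j\<in>{..<length us} - {i}. ((of_real q * u) ^ m - of_real (us ! j) ^ m) / (u ^ m - of_real (us ! j) ^ m)) = of_real (kap m q us i)"
      by (simp add: kap_def u_def)
    moreover have "g u = (\<Prod>j\<in>{..<length us} - {i}. ((of_real q * u) ^ m - of_real (us ! j) ^ m) / (u ^ m - of_real (us ! j) ^ m))
        * (((of_real q * u) ^ m - u ^ m) / geom_sum m u u * (of_nat m / ((of_real q ^ m - 1) * u))) * h u"
      by (simp only: g_def mult.assoc)
    ultimately show ?thesis by simp
  qed
  finally show ?thesis by (simp add: u_def)
qed

text \<open>Residue theorem in each disc. The kernel has no poles there but the points of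
  \<open>us\<close>, all of them enclosed, and \<open>h\<close> adds none.\<close>

theorem circ_ker:
  assumes q: "1 < q" and r: "0 < r" "r < \<rho>" and us: "!!u. u \<in> set us ==> complex_of_real u \<in> Disc r" "distinct us"
    and h: "h holomorphic_on Disc \<rho>"
  shows "(\<Sum>i<length us. of_real (kap m q us i) * h (of_real (us ! i))) = circ r (%z. ker m q us z * h z)"
proof -
  define F where "F = (%i. of_real (kap m q us i) * h (of_real (us ! i)))"
  define B where "B = (%k. {i. i < length us \<and> complex_of_real (us ! i) \<in> ball (complex_of_real (c k)) r})"
  have us': "complex_of_real u \<in> Disc \<rho>" if "u \<in> set us" for u using us(1)[OF that] Disc_mono[of r \<rho>] r by auto
  have int: "contour_integral (circlepath (of_real (c k)) r) (%z. ker m q us z * h z) = 2 * pi * \<i> * (\<Sum>i\<in>B k. F i)"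
    if k: "k \<in> {1..n}" for k
  proof -
    let ?C = "complex_of_real (c k)"
    let ?pts = "(%i. complex_of_real (us ! i)) ` B k"
    have D: "ball ?C \<rho> \<subseteq> Disc \<rho>" using k by (auto simp: Disc_def)
    \<comment> \<open>A point of \<open>us\<close> lies in some small disc; since the large discs
      are disjoint, this can only be the small disc with the same centre.\<close>
    have pts: "complex_of_real u \<in> ?pts" if u: "u \<in> set us" "complex_of_real u \<in> ball ?C \<rho>" for u
    proof -
      obtain l where l: "l \<in> {1..n}" "complex_of_real u \<in> ball (complex_of_real (c l)) r"
        using us(1)[OF u(1)] by (auto simp: Disc_def)
      have "complex_of_real u \<in> ball (complex_of_real (c l)) \<rho>" using l r by auto
      then have "l = k" using disj[OF l(1) k] u(2) by blast
      then show ?thesis using l u(1) by (auto simp: B_def in_set_conv_nth)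
    qed
    have "contour_integral (circlepath ?C r) (%z. ker m q us z * h z)
      = 2 * pi * \<i> * (\<Sum>p\<in>?pts. winding_number (circlepath ?C r) p * residue (%z. ker m q us z * h z) p)"
    proof (rule Residue_theorem[where S = "ball ?C \<rho>"])
      show "(%z. ker m q us z * h z) holomorphic_on ball ?C \<rho> - ?pts"
      proof (intro holomorphic_on_mult ker_holomorphic q)
        show "h holomorphic_on ball ?C \<rho> - ?pts" using h D by (auto intro: holomorphic_on_subset)
        show "complex_of_real u \<in> Disc \<rho> \<and> complex_of_real u \<notin> ball ?C \<rho> - ?pts" if "u \<in> set us" for u
          using us'[OF that] pts[OF that] by auto
      qed (use D in auto)
      show "path_image (circlepath ?C r) \<subseteq> ball ?C \<rho> - ?pts" using r by (auto simp: B_def sphere_def)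
      show "\<forall>z. z \<notin> ball ?C \<rho> --> winding_number (circlepath ?C r) z = 0"
      proof (intro allI impI)
        fix z assume "z \<notin> ball ?C \<rho>"
        then show "winding_number (circlepath ?C r) z = 0" using r by (intro winding_number_zero_outside[of _ "cball ?C r"]) auto
      qed
    qed (auto simp: B_def)
    also have "(\<Sum>p\<in>?pts. winding_number (circlepath ?C r) p * residue (%z. ker m q us z * h z) p)
        = (\<Sum>i\<in>B k. winding_number (circlepath ?C r) (of_real (us ! i)) * residue (%z. ker m q us z * h z) (of_real (us ! i)))"
      using us(2) by (subst sum.reindex) (auto simp: inj_on_def B_def nth_eq_iff_index_eq)
    also have "... = (\<Sum>i\<in>B k. F i)"
    proof (rule sum.cong)
      fix i assume i: "i \<in> B k"
      then have "winding_number (circlepath ?C r) (of_real (us ! i)) = 1"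
        by (intro winding_number_circlepath) (auto simp: B_def dist_norm norm_minus_commute)
      moreover have "residue (%z. ker m q us z * h z) (of_real (us ! i)) = F i"
        unfolding F_def using i us' us(2) by (intro residue_ker q h) (auto simp: B_def)
      ultimately show "winding_number (circlepath ?C r) (of_real (us ! i)) * residue (%z. ker m q us z * h z) (of_real (us ! i)) = F i"
        by simp
    qed simp
    finally show ?thesis .
  qed
  have "circ r (%z. ker m q us z * h z) = (\<Sum>k\<in>{1..n}. \<Sum>i\<in>B k. F i)" unfolding circ_def by (intro sum.cong refl) (simp add: int)
  also have "... = (\<Sum>i\<in>(\<Union>k\<in>{1..n}. B k). F i)"
  proof (rule sum.UNION_disjoint[symmetric])
    show "\<forall>k\<in>{1..n}. \<forall>l\<in>{1..n}. k ~= l --> B k \<inter> B l = {}"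
    proof (intro ballI impI)
      fix k l assume kl: "k \<in> {1..n}" "l \<in> {1..n}" "k ~= l"
      have "ball (complex_of_real (c k)) r \<inter> ball (complex_of_real (c l)) r = {}"
        using disj[OF kl] r subset_ball[of r \<rho>] by (meson disjoint_iff less_imp_le subsetD)
      then show "B k \<inter> B l = {}" unfolding B_def by blast
    qed
  qed (auto simp: B_def)
  also have "(\<Union>k\<in>{1..n}. B k) = {..<length us}" using us(1) by (fastforce simp: B_def Disc_def)
  finally show ?thesis by (simp add: F_def)
qed

end

section \<open>Products close to exponentials\<close>

lemma norm_prod_one_plus_le: "norm (\<Prod>j\<in>I. 1 + b j) <= exp (\<Sum>j\<in>I. norm (b j))" for b :: "'a => complex"
proof (cases "finite I")
  case True
  then show ?thesis
  proof (induction I)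
    case (insert i I)
    have "norm (1 + b i) <= 1 + norm (b i)" by (metis norm_one norm_triangle_ineq)
    also have "... <= exp (norm (b i))" by (rule exp_ge_add_one_self)
    finally have "norm (1 + b i) * norm (\<Prod>j\<in>I. 1 + b j) <= exp (norm (b i)) * exp (\<Sum>j\<in>I. norm (b j))"
      using insert.IH by (intro mult_mono) auto
    then show ?case using insert by (simp add: norm_mult exp_add)
  qed simp
qed simp

lemma norm_exp_sub_le:
  fixes b :: complex
  assumes "norm b <= 1"
  shows "norm (1 + b - exp b) <= 3 * (norm b)\<^sup>2"
proof -
  have "norm (exp b - (\<Sum>i\<le>1. b ^ i / fact i)) <= exp \<bar>Re b\<bar> * norm b ^ Suc 1 / fact 1" by (rule Taylor_exp)
  also have "... = exp \<bar>Re b\<bar> * (norm b)\<^sup>2" by (simp add: power2_eq_square)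
  also have "... <= 3 * (norm b)\<^sup>2"
  proof (intro mult_right_mono)
    have "exp \<bar>Re b\<bar> <= exp 1" using abs_Re_le_cmod[of b] assms by simp
    then show "exp \<bar>Re b\<bar> <= 3" using exp_le by linarith
  qed simp
  finally show ?thesis by (simp add: norm_minus_commute algebra_simps)
qed

text \<open>Factors are replaced by exponentials one at a time; each replacement costs a term of
  second order, and all other factors stay below the exponential of the sum of norms.\<close>

lemma norm_prod_exp_diff:
  fixes b :: "'a => complex"
  assumes "finite I" "!!j. j \<in> I ==> norm (b j) <= 1"
  shows "norm ((\<Prod>j\<in>I. 1 + b j) - exp (\<Sum>j\<in>I. b j)) <= 3 * exp (\<Sum>j\<in>I. norm (b j)) * (\<Sum>j\<in>I. (norm (b j))\<^sup>2)"
  using assms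
proof (induction I)
  case (insert i I)
  let ?P = "\<Prod>j\<in>I. 1 + b j" and ?S = "\<Sum>j\<in>I. b j"
  let ?E = "exp (\<Sum>j\<in>I. norm (b j))" and ?V = "\<Sum>j\<in>I. (norm (b j))\<^sup>2"
  have "(1 + b i) * ?P - exp (b i) * exp ?S = (1 + b i) * (?P - exp ?S) + (1 + b i - exp (b i)) * exp ?S"
    by (simp add: algebra_simps)
  then have "norm ((1 + b i) * ?P - exp (b i) * exp ?S) <= norm (1 + b i) * norm (?P - exp ?S) + norm (1 + b i - exp (b i)) * norm (exp ?S)"
    by (metis norm_mult norm_triangle_ineq)
  also have "... <= exp (norm (b i)) * (3 * ?E * ?V) + 3 * (norm (b i))\<^sup>2 * ?E"
  proof (intro add_mono mult_mono)
    show "norm (1 + b i) <= exp (norm (b i))" using norm_prod_one_plus_le[of b "{i}"] by simp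
    show "norm (exp ?S) <= ?E" by (rule order_trans[OF norm_exp]) (simp add: norm_sum)
  qed (use insert in \<open>auto intro!: norm_exp_sub_le mult_nonneg_nonneg sum_nonneg\<close>)
  also have "... <= exp (norm (b i)) * (3 * ?E * ?V) + exp (norm (b i)) * (3 * (norm (b i))\<^sup>2 * ?E)"
  proof -
    have "1 * (3 * (norm (b i))\<^sup>2 * ?E) <= exp (norm (b i)) * (3 * (norm (b i))\<^sup>2 * ?E)" by (intro mult_right_mono) auto
    then show ?thesis by simp
  qed
  finally show ?case using insert by (simp add: exp_add algebra_simps)
qed simp

text \<open>About \<open>N\<close> factors that differ from \<open>1\<close> by order
  \<open>1 / N\<close>: the sum of the squares is at most \<open>C * e N\<close>, so only the linear
  term survives.\<close>

lemma prod_one_plus_tendsto: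
  fixes b :: "nat => 'a => complex"
  assumes fin: "!!N. finite (I N)"
    and sum: "(%N. \<Sum>j\<in>I N. b N j) \<longlonglongrightarrow> L"
    and bd: "\<forall>\<^sub>F N in sequentially. (\<forall>j\<in>I N. norm (b N j) <= e N) \<and> real (card (I N)) * e N <= C"
    and e: "e \<longlonglongrightarrow> 0"
  shows "(%N. \<Prod>j\<in>I N. 1 + b N j) \<longlonglongrightarrow> exp L"
proof -
  have "(%N. (\<Prod>j\<in>I N. 1 + b N j) - exp (\<Sum>j\<in>I N. b N j)) \<longlonglongrightarrow> 0"
  proof (rule Lim_null_comparison)
    have "\<forall>\<^sub>F N in sequentially. \<bar>e N\<bar> < 1" using order_tendstoD(2)[OF tendsto_rabs[OF e], of 1] by simp
    with bd show "\<forall>\<^sub>F N in sequentially. norm ((\<Prod>j\<in>I N. 1 + b N j) - exp (\<Sum>j\<in>I N. b N j)) <= 3 * exp C * (C * \<bar>e N\<bar>)"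
    proof eventually_elim
      case (elim N)
      have s1: "(\<Sum>j\<in>I N. norm (b N j)) <= C" using sum_bounded_above[of "I N" "%j. norm (b N j)" "e N"] elim by auto
      have "(\<Sum>j\<in>I N. (norm (b N j))\<^sup>2) <= (\<Sum>j\<in>I N. norm (b N j) * \<bar>e N\<bar>)"
        unfolding power2_eq_square using elim by (intro sum_mono mult_left_mono) force+
      also have "... = (\<Sum>j\<in>I N. norm (b N j)) * \<bar>e N\<bar>" by (simp add: sum_distrib_right)
      also have "... <= C * \<bar>e N\<bar>" using s1 by (intro mult_right_mono) auto
      finally have s2: "(\<Sum>j\<in>I N. (norm (b N j))\<^sup>2) <= C * \<bar>e N\<bar>" .
      have "norm ((\<Prod>j\<in>I N. 1 + b N j) - exp (\<Sum>j\<in>I N. b N j))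
         <= 3 * exp (\<Sum>j\<in>I N. norm (b N j)) * (\<Sum>j\<in>I N. (norm (b N j))\<^sup>2)" using elim by (intro norm_prod_exp_diff fin) force
      also have "... <= 3 * exp C * (C * \<bar>e N\<bar>)" using s1 s2 by (intro mult_mono) (auto intro: sum_nonneg)
      finally show ?case .
    qed
    have "(%N. 3 * exp C * (C * \<bar>e N\<bar>)) \<longlonglongrightarrow> 3 * exp C * (C * \<bar>0\<bar>)" by (intro tendsto_intros e)
    then show "(%N. 3 * exp C * (C * \<bar>e N\<bar>)) \<longlonglongrightarrow> 0" by simp
  qed
  moreover have "(%N. exp (\<Sum>j\<in>I N. b N j)) \<longlonglongrightarrow> exp L" by (intro tendsto_intros sum)
  ultimately show ?thesis by (rule Lim_transform[rotated])
qed

text \<open>Removing a full period subtracts the same amount from both terms, so only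
  \<open>k < n\<close> has to be estimated.\<close>

lemma periodic_sum_bound:
  fixes f :: "nat => complex"
  assumes n: "1 <= n" and per: "!!i j. 1 <= i ==> 1 <= j ==> i mod n = j mod n ==> f i = f j"
  shows "norm ((\<Sum>j\<in>{1..k}. f j) - of_nat k / of_nat n * (\<Sum>j\<in>{1..n}. f j)) <= 2 * (\<Sum>j\<in>{1..n}. norm (f j))"
proof (induction k rule: less_induct)
  case (less k)
  let ?S = "\<Sum>j\<in>{1..n}. f j" and ?B = "\<Sum>j\<in>{1..n}. norm (f j)"
  have B: "norm ?S <= ?B" by (rule norm_sum)
  show ?case
  proof (cases "k < n")
    case True
    have "norm (\<Sum>j\<in>{1..k}. f j) <= (\<Sum>j\<in>{1..k}. norm (f j))" by (rule norm_sum)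
    also have "... <= ?B" using True by (intro sum_mono2) auto
    finally have 1: "norm (\<Sum>j\<in>{1..k}. f j) <= ?B" .
    have "norm (of_nat k / of_nat n * ?S) = real k / real n * norm ?S" by (simp add: norm_mult norm_divide)
    also have "... <= 1 * ?B" using True B by (intro mult_mono) auto
    finally have 2: "norm (of_nat k / of_nat n * ?S) <= ?B" by simp
    show ?thesis using norm_triangle_ineq4[of "\<Sum>j\<in>{1..k}. f j" "of_nat k / of_nat n * ?S"] 1 2 by linarith
  next
    case False
    have "(\<Sum>j\<in>{1..k}. f j) = (\<Sum>j\<in>{1..k - n}. f j) + (\<Sum>j\<in>{k - n + 1..k}. f j)"
      using False by (subst sum.union_disjoint[symmetric]) (auto intro!: sum.cong)
    also have "(\<Sum>j\<in>{k - n + 1..k}. f j) = ?S"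
    proof -
      have "(\<Sum>j\<in>{d + 1..d + n}. f j) = ?S" for d
      proof (induction d)
        case (Suc d)
        have "{d + 1..d + n} = insert (d + 1) {Suc d + 1..d + n}" using n by auto
        moreover have "{Suc d + 1..Suc d + n} = insert (Suc d + n) {Suc d + 1..d + n}" using n by auto
        moreover have "f (Suc d + n) = f (d + 1)"
        proof (rule per)
          show "(Suc d + n) mod n = (d + 1) mod n" unfolding Suc_eq_plus1[symmetric] by (rule mod_add_self2)
        qed auto
        ultimately show ?case using Suc by simp
      qed simp
      from this[of "k - n"] show ?thesis using False by simp
    qed
    finally have "(\<Sum>j\<in>{1..k}. f j) - of_nat k / of_nat n * ?S = (\<Sum>j\<in>{1..k - n}. f j) - of_nat (k - n) / of_nat n * ?S"
      using False n by (simp add: of_nat_diff field_simps)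
    then show ?thesis using less.IH[of "k - n"] False n by simp
  qed
qed

text \<open>Three pieces: the uniform error between \<open>B\<close> and \<open>f\<close>, the
  incomplete period, which is bounded and divided by \<open>w\<close>, and the average over a period
  times the density \<open>k / w\<close>.\<close>

lemma periodic_average:
  fixes f :: "nat => complex" and B :: "nat => nat => complex" and k :: "nat => nat" and w :: "nat => real"
  assumes n: "1 <= n" and per: "!!i j. 1 <= i ==> 1 <= j ==> i mod n = j mod n ==> f i = f j"
    and k: "(%N. real (k N) / w N) \<longlonglongrightarrow> \<theta>" and w: "filterlim w at_top sequentially"
    and B: "!!\<epsilon>. 0 < \<epsilon> ==> \<forall>\<^sub>F N in sequentially. \<forall>j\<in>{1..k N}. norm (B N j - f j) <= \<epsilon>"
  shows "(%N. (\<Sum>j\<in>{1..k N}. B N j) / of_real (w N)) \<longlonglongrightarrow> of_real \<theta> / of_nat n * (\<Sum>j\<in>{1..n}. f j)"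
proof -
  let ?S = "\<Sum>j\<in>{1..n}. f j" and ?C = "2 * (\<Sum>j\<in>{1..n}. norm (f j))"
  have w0: "\<forall>\<^sub>F N in sequentially. 0 < w N" using w by (simp add: filterlim_at_top_dense)
  have "(%N. (\<Sum>j\<in>{1..k N}. B N j - f j) / of_real (w N)) \<longlonglongrightarrow> 0"
  proof (rule tendstoI)
    fix \<epsilon> :: real assume \<epsilon>: "0 < \<epsilon>"
    define \<delta> where "\<delta> = \<epsilon> / (2 * (\<bar>\<theta>\<bar> + 1))"
    have \<delta>: "0 < \<delta>" using \<epsilon> by (simp add: \<delta>_def add_nonneg_pos)
    have "\<forall>\<^sub>F N in sequentially. real (k N) / w N < \<bar>\<theta>\<bar> + 1" by (rule order_tendstoD(2)[OF k]) simp
    then show "\<forall>\<^sub>F N in sequentially. dist ((\<Sum>j\<in>{1..k N}. B N j - f j) / of_real (w N)) 0 < \<epsilon>" using B[OF \<delta>] w0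
    proof eventually_elim
      case (elim N)
      have "norm (\<Sum>j\<in>{1..k N}. B N j - f j) <= (\<Sum>j\<in>{1..k N}. \<delta>)" using elim by (intro sum_norm_le) auto
      then have "norm ((\<Sum>j\<in>{1..k N}. B N j - f j) / of_real (w N)) <= real (k N) / w N * \<delta>"
        using elim by (simp add: norm_divide divide_right_mono)
      also have "... <= (\<bar>\<theta>\<bar> + 1) * \<delta>" using elim \<delta> by (intro mult_right_mono) auto
      also have "... = \<epsilon> / 2"
      proof -
        have "\<bar>\<theta>\<bar> + 1 ~= 0" by linarith
        then show ?thesis by (simp only: \<delta>_def mult_2 times_divide_eq_right) (simp add: field_simps)
      qed
      also have "... < \<epsilon>" using \<epsilon> by simp
      finally show ?case by (simp add: dist_norm)
    qed
  qed
  moreover have "(%N. ((\<Sum>j\<in>{1..k N}. f j) - of_nat (k N) / of_nat n * ?S) / of_real (w N)) \<longlonglongrightarrow> 0"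
  proof (rule Lim_null_comparison)
    show "\<forall>\<^sub>F N in sequentially. norm (((\<Sum>j\<in>{1..k N}. f j) - of_nat (k N) / of_nat n * ?S) / of_real (w N)) <= ?C / w N" using w0
    proof eventually_elim
      case (elim N)
      have pb: "norm ((\<Sum>j\<in>{1..k N}. f j) - of_nat (k N) / of_nat n * ?S) <= ?C" by (rule periodic_sum_bound[OF n per])
      have "norm (complex_of_real (w N)) = w N" using elim by simp
      then show ?case using divide_right_mono[OF pb, of "w N"] elim by (simp only: norm_divide less_imp_le simp_thms)
    qed
    show "(%N. ?C / w N) \<longlonglongrightarrow> 0" by (rule real_tendsto_divide_at_top[OF tendsto_const w])
  qed
  moreover have "(%N. of_real (real (k N) / w N) / of_nat n * ?S) \<longlonglongrightarrow> of_real \<theta> / of_nat n * ?S"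
    by (intro tendsto_intros k) (use n in auto)
  ultimately have "(%N. (\<Sum>j\<in>{1..k N}. B N j - f j) / of_real (w N) +
      ((\<Sum>j\<in>{1..k N}. f j) - of_nat (k N) / of_nat n * ?S) / of_real (w N) + of_real (real (k N) / w N) / of_nat n * ?S)
      \<longlonglongrightarrow> 0 + 0 + of_real \<theta> / of_nat n * ?S" by (intro tendsto_add)
  moreover have "(\<Sum>j\<in>{1..k N}. B N j - f j) / of_real (w N) +
      ((\<Sum>j\<in>{1..k N}. f j) - of_nat (k N) / of_nat n * ?S) / of_real (w N) + of_real (real (k N) / w N) / of_nat n * ?S
      = (\<Sum>j\<in>{1..k N}. B N j) / of_real (w N)" for N by (simp add: sum_subtractf diff_divide_distrib)
  ultimately show ?thesis by simp
qed

text \<open>The unperturbed weights take finitely many values, so continuity at these values is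
  already uniform in \<open>j\<close>.\<close>

lemma perturbed_uniformly:
  fixes \<phi> :: "real => complex" and x :: "nat => real" and xp :: "nat => nat => real"
  assumes n: "1 <= n" and per: "!!i j. 1 <= i ==> 1 <= j ==> i mod n = j mod n ==> x i = x j"
    and xp: "!!N i. 1 <= i ==> i <= N ==> \<bar>xp N i - x i\<bar> <= 1 / real N"
    and cont: "!!k. k \<in> {1..n} ==> isCont \<phi> (x k)" and \<epsilon>: "0 < \<epsilon>"
  shows "\<forall>\<^sub>F N in sequentially. \<forall>j\<in>{1..N}. norm (\<phi> (xp N j) - \<phi> (x j)) <= \<epsilon>"
proof -
  have "\<forall>k\<in>{1..n}. \<exists>d>0. \<forall>w. dist w (x k) < d --> dist (\<phi> w) (\<phi> (x k)) < \<epsilon>" using cont \<epsilon> unfolding continuous_at_eps_delta by blast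
  then obtain d where d: "!!k. k \<in> {1..n} ==> 0 < d k"
    "!!k w. k \<in> {1..n} ==> dist w (x k) < d k ==> dist (\<phi> w) (\<phi> (x k)) < \<epsilon>" by metis
  have "\<forall>k\<in>{1..n}. \<forall>\<^sub>F N in sequentially. 1 / real N < d k" using order_tendstoD(2)[OF lim_1_over_n[where 'a = real] d(1)] by simp
  then have "\<forall>\<^sub>F N in sequentially. \<forall>k\<in>{1..n}. 1 / real N < d k" by (simp add: eventually_ball_finite_distrib)
  then show ?thesis
  proof eventually_elim
    case (elim N)
    show ?case
    proof
      fix j assume j: "j \<in> {1..N}"
      define k where "k = (if j mod n = 0 then n else j mod n)"
      have k: "k \<in> {1..n}" "k mod n = j mod n" using n by (auto simp: k_def less_imp_le)
      have xk: "x j = x k" using per[of j k] j k by auto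
      have "dist (xp N j) (x k) < d k" using xp[of j N] j elim k by (force simp: dist_norm xk)
      then show "norm (\<phi> (xp N j) - \<phi> (x j)) <= \<epsilon>" using d(2)[OF k(1)] by (force simp: dist_norm xk)
    qed
  qed
qed

section \<open>Moments at finite size as contour integrals\<close>

definition etac :: "real => nat => complex => complex" where
  "etac T m z = 1 - 1 / (of_real T * z ^ m)"

lemma etac_of_real: "etac T m (of_real u) = of_real (eta T m u)" by (simp add: etac_def eta_def)

lemma geom_sum_of_real: "geom_sum m (complex_of_real w) (of_real u) = of_real (geom_sum m w u)" by (simp add: geom_sum_def)

lemma one_body_of_real: "one_body m s a x y (complex_of_real u) = of_real (one_body m s a x y u)"
  by (simp add: one_body_def geom_sum_of_real if_distrib[of of_real] cong: if_cong)

context discs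
begin

lemma discs_smaller:
  assumes r: "0 < r" "r <= \<rho>"
  shows "discs m n c r"
proof
  have sub: "z \<in> ball b \<rho>" if "z \<in> ball b r" for b z :: complex using that r by auto
  show "ball (complex_of_real (c k)) r \<inter> ball (complex_of_real (c l)) r = {}"
    if kl: "k \<in> {1..n}" "l \<in> {1..n}" "k ~= l" for k l using disj[OF kl] sub by blast
  show "0 < Re z" if "k \<in> {1..n}" "z \<in> ball (complex_of_real (c k)) r" for k z using Re_pos[OF that(1) sub[OF that(2)]] .
  show "z = w" if "k \<in> {1..n}" "l \<in> {1..n}" "z \<in> ball (complex_of_real (c k)) r"
    "w \<in> ball (complex_of_real (c l)) r" "z ^ m = w ^ m" for k l z w
    using pow_inj[OF that(1,2) sub[OF that(3)] sub[OF that(4)] that(5)] .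
qed (use m1 r in auto)

section \<open>Calculus of the sums of contour integrals\<close>

definition Sph :: "real => complex set" where
  "Sph r = (\<Union>k\<in>{1..n}. sphere (complex_of_real (c k)) r)"

lemma Sph_subset: "r < r' ==> Sph r \<subseteq> Disc r'" by (auto simp: Sph_def Disc_def)

lemma path_image_Sph: "0 < r ==> k \<in> {1..n} ==> path_image (circlepath (of_real (c k)) r) \<subseteq> Sph r"
  unfolding Sph_def by (rule UN_upper[THEN subset_trans[rotated]]) auto

lemma circ_cong: "0 < r ==> (!!z. z \<in> Sph r ==> f z = g z) ==> circ r f = circ r g" unfolding circ_def
  by (intro sum.cong refl arg_cong2[where f = "(*)"] contour_integral_eq) (use path_image_Sph in blast)

lemma circ_integrable:
  "0 < r ==> continuous_on (Sph r) f ==> k \<in> {1..n} ==> f contour_integrable_on circlepath (of_real (c k)) r"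
  by (rule contour_integrable_continuous_circlepath) (rule continuous_on_subset[OF _ path_image_Sph])

lemma circ_sum:
  assumes "0 < r" "finite I" "!!i. i \<in> I ==> continuous_on (Sph r) (f i)"
  shows "circ r (%z. \<Sum>i\<in>I. f i z) = (\<Sum>i\<in>I. circ r (f i))"
proof -
  have "circ r (%z. \<Sum>i\<in>I. f i z) = (\<Sum>k\<in>{1..n}. \<Sum>i\<in>I. 1 / (2 * of_real pi * \<i>) * contour_integral (circlepath (of_real (c k)) r) (f i))"
    unfolding circ_def by (intro sum.cong refl) (simp add: contour_integral_sum assms circ_integrable sum_divide_distrib)
  then show ?thesis unfolding circ_def by (subst sum.swap) simp
qed

lemma circ_bound:
  assumes "0 < r" "0 <= B" "!!z. z \<in> Sph r ==> norm (f z) <= B"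
  shows "norm (circ r f) <= real n * r * B"
proof -
  have "norm (1 / (2 * of_real pi * \<i>) * contour_integral (circlepath (of_real (c k)) r) f) <= r * B" if k: "k \<in> {1..n}" for k
  proof -
    have "norm (contour_integral (circlepath (of_real (c k)) r) f) <= B * (2 * pi * r)"
    proof (cases "f contour_integrable_on circlepath (of_real (c k)) r")
      case True
      have "norm (f z) <= B" if "norm (z - of_real (c k)) = r" for z
        using k that by (intro assms(3)) (auto simp: Sph_def dist_norm norm_minus_commute)
      then show ?thesis using assms by (intro has_contour_integral_bound_circlepath[OF has_contour_integral_integral[OF True]])
    next
      case False
      then show ?thesis using assms by (simp add: not_integrable_contour_integral)
    qed
    then show ?thesis by (simp add: norm_mult norm_divide field_simps)
  qed
  then have "norm (circ r f) <= (\<Sum>k\<in>{1..n}. r * B)" unfolding circ_def by (intro sum_norm_le) auto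
  then show ?thesis by (simp add: mult.assoc)
qed

lemma circ_diff:
  assumes "0 < r" "continuous_on (Sph r) f" "continuous_on (Sph r) g"
  shows "circ r (%z. f z - g z) = circ r f - circ r g"
  unfolding circ_def sum_subtractf[symmetric]
  by (intro sum.cong refl) (simp add: contour_integral_diff circ_integrable assms diff_divide_distrib)

lemma circ_mult:
  assumes "0 < r" "continuous_on (Sph r) f"
  shows "circ r (%z. b * f z) = b * circ r f"
  unfolding circ_def sum_distrib_left by (intro sum.cong refl) (simp add: contour_integral_lmul circ_integrable assms)

lemma Sph_Disc_disjoint:
  assumes "w \<in> Sph r" "r < \<rho>" "u \<in> Disc r"
  shows "w ~= u"
proof
  assume "w = u"
  obtain k l where k: "k \<in> {1..n}" "w \<in> sphere (complex_of_real (c k)) r"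
    and l: "l \<in> {1..n}" "u \<in> ball (complex_of_real (c l)) r"
    using assms by (auto simp: Sph_def Disc_def)
  show False
  proof (cases "k = l")
    case True
    then show ?thesis using k l \<open>w = u\<close> by auto
  next
    case False
    have "w \<in> ball (complex_of_real (c k)) \<rho>" using k assms(2) by simp
    moreover have "w \<in> ball (complex_of_real (c l)) \<rho>" using l assms(2) \<open>w = u\<close> by simp
    ultimately show ?thesis using disj[OF k(1) l(1) False] by blast
  qed
qed

end

text \<open>The radii are staggered. The weights lie within \<open>\<rho> / 8\<close> of the centres
  and the points dilated once within \<open>\<rho> / 4\<close>; the contours have radii
  \<open>\<rho> / 4\<close> and \<open>\<rho> / 2\<close>; integrands are holomorphic up to
  \<open>3 * \<rho> / 8\<close> for the inner contour and \<open>5 * \<rho> / 8\<close> for the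
  outer one, where dilation still stays within \<open>\<rho>\<close>. The condition
  \<open>sep\<close> keeps the poles of \<open>cross\<close> out of the inner discs.\<close>

locale disc_staircase = weighted_staircase N \<Omega> a x y m l1 T + discs m n c \<rho>
  for N \<Omega> a x y m l1 T n c \<rho> +
  fixes s :: nat and q R :: real
  assumes s: "1 <= s" "s < N" and q: "1 < q"
    and gen: "!!i j e. i \<in> {1..N} ==> j \<in> {1..N} ==> e <= 2 ==> q ^ e * x i = x j ==> i = j \<and> e = 0"
    and x_in: "!!i. i \<in> {1..N} ==> complex_of_real (x i) \<in> Disc (\<rho> / 8)"
    and qx_in: "!!i. i \<in> {1..N} ==> complex_of_real (q * x i) \<in> Disc (\<rho> / 4)"
    and q_in: "!!z. z \<in> Disc (5 * \<rho> / 8) ==> of_real q * z \<in> Disc \<rho>"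
    and eta_in: "!!z. z \<in> Disc (5 * \<rho> / 8) ==> norm (etac T m (of_real q * z)) <= R" and R: "R < 1"
    and sep: "!!z w. z \<in> Disc (3 * \<rho> / 8) ==> w \<in> Sph (\<rho> / 2) ==>
        w ^ m ~= (of_real q * z) ^ m \<and> (of_real q * w) ^ m ~= z ^ m"
begin

text \<open>\<open>circ_ker\<close> asks for holomorphy on the discs of its locale, which the
  integrands of the outer and the inner contour satisfy on these smaller discs only.\<close>

sublocale mid: discs m n c "5 * \<rho> / 8" by (rule discs_smaller) (use \<rho> in auto)

sublocale inner: discs m n c "3 * \<rho> / 8" by (rule discs_smaller) (use \<rho> in auto)

definition U :: "real list" where "U = upper s"

definition cN :: "complex list" where "cN = map of_real (nodes s U)"

definition rr :: "complex => complex" where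
  "rr z = one_body m s a x y (of_real q * z) / one_body m s a x y z"

definition dl :: "complex => complex" where
  "dl z = etac T m (of_real q * z) - etac T m z"

definition P1 :: "complex => complex" where
  "P1 z = Phi sg (etac T m (of_real q * z) # cN) / Phi sg cN"

definition P2 :: "complex => complex => complex" where
  "P2 z w = Phi sg (etac T m (of_real q * z) # etac T m (of_real q * w) # cN) / Phi sg cN"

text \<open>At a point of \<open>U\<close> this is the change of \<open>Phi\<close> under the
  dilation of that point. Replacing a node is written as its displacement times \<open>Phi\<close>
  with one inserted node; in this form the ratio extends holomorphically to the discs.\<close>

definition J1 :: "complex => complex" where
  "J1 z = 1 + dl z * P1 z"

text \<open>The same rule applied twice and expanded. It covers the case that the second dilation
  hits the point just dilated, because \<open>w\<close> is then the dilated value.\<close>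

definition J2 :: "complex => complex => complex" where
  "J2 z w = 1 + dl z * P1 z + dl w * (P1 w + dl z * P2 z w)"

definition cross :: "complex => complex => complex" where
  "cross z w = ((of_real q * w) ^ m - (of_real q * z) ^ m) * (w ^ m - z ^ m) /
     ((w ^ m - (of_real q * z) ^ m) * ((of_real q * w) ^ m - z ^ m))"

lemma pw:
  assumes j: "j \<in> {Suc s..N}" and e: "e <= 2"
  shows "0 < q ^ e * x j \<and> 1 < T * (q ^ e * x j) ^ m \<and> q ^ e * x j \<notin> x ` {1..s}"
proof -
  have xj: "0 < x j" "1 < T * x j ^ m" using pos[of j] Tx[of j] j by auto
  have q1: "1 <= q ^ e" using q by simp
  have "x j <= q ^ e * x j" using q1 xj by simp
  then have "x j ^ m <= (q ^ e * x j) ^ m" using xj by (intro power_mono) auto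
  then have "T * x j ^ m <= T * (q ^ e * x j) ^ m" using T by simp
  moreover have "q ^ e * x j \<notin> x ` {1..s}"
  proof
    assume "q ^ e * x j \<in> x ` {1..s}"
    then obtain i where i: "i \<in> {1..s}" "q ^ e * x j = x i" by blast
    then show False using gen[of j i e] j e s by auto
  qed
  ultimately show ?thesis using xj q by (auto intro!: mult_pos_pos)
qed

lemma U_valid: "valid s U" using pw[of _ 0] by (auto simp: valid_def U_def set_upper)

lemma length_U: "length U = N - s" by (simp add: U_def)

lemma U_nth: "i < N - s ==> U ! i = x (Suc (s + i)) \<and> Suc (s + i) \<in> {Suc s..N}" by (simp add: U_def nth_upper)

lemma U_distinct: "distinct U"
proof -
  have "inj_on x {Suc s..N}" using gen[of _ _ 0] by (auto simp: inj_on_def)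
  then have "inj_on x (set [Suc s..<Suc N])" by (rule inj_on_subset) auto
  then show ?thesis unfolding U_def upper_def distinct_map by simp
qed

lemma Phi_dilate:
  assumes us: "length us = N - s" "i < N - s"
    and sub: "!!z. z \<in> set (ns @ nodes s us) \<union> {eta T m (q * us ! i)} ==> 0 <= z \<and> z < 1"
  shows "Phi sg (ns @ nodes s (dilate q us i)) = Phi sg (ns @ nodes s us)
     + (eta T m (q * us ! i) - eta T m (us ! i)) * Phi sg (eta T m (q * us ! i) # ns @ nodes s us)"
proof -
  define b where "b = eta T m (q * us ! i)"
  define d where "d = eta T m (us ! i)"
  define L where "L = ns @ map (eta T m) (map x [1..<Suc s] @ take i us @ drop (Suc i) us)"
  have i: "i < length us" using us by simp
  have "us = take i us @ us ! i # drop (Suc i) us" using i by (rule id_take_nth_drop)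
  then have "mset us = mset (us ! i # take i us @ drop (Suc i) us)" by (metis mset_append mset.simps(2) union_mset_add_mset_right append_Cons)
  then have "mset (map (eta T m) us) = mset (map (eta T m) (us ! i # take i us @ drop (Suc i) us))" by (simp only: mset_map)
  then have 1: "mset (ns @ nodes s us) = mset (d # L)" by (simp add: nodes_def L_def d_def del: upt_Suc)
  have "dilate q us i = take i us @ (q * us ! i) # drop (Suc i) us" unfolding dilate_def using i by (rule upd_conv_take_nth_drop)
  then have 2: "mset (ns @ nodes s (dilate q us i)) = mset (b # L)" by (simp add: nodes_def L_def b_def del: upt_Suc)
  have "set (d # L) = set (ns @ nodes s us)" using 1 by (metis set_mset_mset)
  then have rng: "0 <= z \<and> z < 1" if "z \<in> set (b # d # L)" for z using sub[of z] that by (auto simp: b_def)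
  have "Phi sg (b # L) - Phi sg (d # L) = (b - d) * Phi sg (b # d # L)"
  proof (rule Phi_diff[OF sg_pos])
    show "norm z < 1" if "z \<in> set (b # d # L)" for z using rng[OF that] by simp
  qed
  moreover have "Phi sg (b # d # L) = Phi sg (b # ns @ nodes s us)" by (rule Phi_mset) (use 1 in simp)
  ultimately show ?thesis using Phi_mset[OF 1, of sg] Phi_mset[OF 2, of sg] by (simp add: b_def d_def)
qed

lemma nodes_U_range: "z \<in> set (nodes s U) ==> 0 <= z \<and> z < 1" using nodes_range[OF U_valid] s by auto

lemma nodes_U_nonempty: "nodes s U ~= []" using s by (auto simp: nodes_def length_U simp flip: length_0_conv)

lemma PhiU_pos: "0 < Phi sg (nodes s U)" by (rule Phi_nodes_pos[OF U_valid s(2)])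

lemma Phi_cN: "Phi sg cN = of_real (Phi sg (nodes s U))"
  unfolding cN_def by (rule Phi_of_real[OF sg_pos]) (use nodes_U_range nodes_U_nonempty in force)+

lemma cN_range: "z \<in> set cN ==> norm z < 1" using nodes_U_range by (fastforce simp: cN_def)

lemma eta_pw: "j \<in> {Suc s..N} ==> e <= 2 ==> 0 <= eta T m (q ^ e * x j) \<and> eta T m (q ^ e * x j) < 1"
  using eta_range pw[of j e] by (simp add: less_imp_le)

lemma P1_real:
  assumes "0 <= eta T m (q * u) \<and> eta T m (q * u) < 1"
  shows "P1 (of_real u) = of_real (Phi sg (eta T m (q * u) # nodes s U) / Phi sg (nodes s U))"
proof -
  have "Phi sg (map complex_of_real (eta T m (q * u) # nodes s U)) = of_real (Phi sg (eta T m (q * u) # nodes s U))"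
    by (rule Phi_of_real[OF sg_pos]) (use assms nodes_U_range in force)+
  moreover have "etac T m (of_real q * of_real u) = of_real (eta T m (q * u))" using etac_of_real[of T m "q * u"] by simp
  ultimately show ?thesis by (simp add: P1_def Phi_cN cN_def[symmetric])
qed

lemma P2_real:
  assumes "0 <= eta T m (q * u) \<and> eta T m (q * u) < 1" "0 <= eta T m (q * v) \<and> eta T m (q * v) < 1"
  shows "P2 (of_real u) (of_real v) = of_real (Phi sg (eta T m (q * u) # eta T m (q * v) # nodes s U) / Phi sg (nodes s U))"
proof -
  have "Phi sg (map complex_of_real (eta T m (q * u) # eta T m (q * v) # nodes s U)) = of_real (Phi sg (eta T m (q * u) # eta T m (q * v) # nodes s U))"
    by (rule Phi_of_real[OF sg_pos]) (use assms nodes_U_range in force)+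
  moreover have "etac T m (of_real q * of_real u) = of_real (eta T m (q * u))" for u using etac_of_real[of T m "q * u"] by simp
  ultimately show ?thesis by (simp add: P2_def Phi_cN cN_def[symmetric])
qed

lemma dl_real: "dl (of_real u) = of_real (eta T m (q * u) - eta T m u)"
  using etac_of_real[of T m "q * u"] by (simp add: dl_def etac_of_real)

lemma J1_real:
  assumes i: "i < N - s"
  shows "of_real (Phi sg (nodes s (dilate q U i)) / Phi sg (nodes s U)) = J1 (of_real (U ! i))"
proof -
  have e: "0 <= eta T m (q * U ! i) \<and> eta T m (q * U ! i) < 1" using eta_pw[of "Suc (s + i)" 1] U_nth[OF i] by simp
  have "Phi sg (nodes s (dilate q U i)) = Phi sg (nodes s U)
     + (eta T m (q * U ! i) - eta T m (U ! i)) * Phi sg (eta T m (q * U ! i) # nodes s U)"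
    using Phi_dilate[of U i "[]"] length_U i e nodes_U_range by auto
  then show ?thesis using PhiU_pos by (simp add: J1_def P1_real[OF e] dl_real add_divide_distrib)
qed

lemma J2_real:
  assumes i: "i < N - s" and k: "k < N - s"
  shows "of_real (Phi sg (nodes s (dilate q (dilate q U i) k)) / Phi sg (nodes s U)) = J2 (of_real (U ! i)) (of_real (dilate q U i ! k))"
proof -
  define v where "v = dilate q U i ! k"
  have e: "0 <= eta T m (q * U ! i) \<and> eta T m (q * U ! i) < 1" using eta_pw[of "Suc (s + i)" 1] U_nth[OF i] by simp
  have "q * v = q ^ (if k = i then 2 else 1) * x (Suc (s + k))"
    using U_nth[OF i] U_nth[OF k] i k length_U by (auto simp: v_def dilate_def power2_eq_square)
  then have f: "0 <= eta T m (q * v) \<and> eta T m (q * v) < 1"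
    using eta_pw[of "Suc (s + k)" "if k = i then 2 else 1"] U_nth[OF k] by auto
  have "set (dilate q U i) \<subseteq> insert (q * U ! i) (set U)" unfolding dilate_def by (rule set_update_subset_insert)
  then have "set (nodes s (dilate q U i)) \<subseteq> insert (eta T m (q * U ! i)) (set (nodes s U))"
    by (auto simp: nodes_def simp del: upt_Suc)
  then have r: "0 <= z \<and> z < 1" if "z \<in> set (nodes s (dilate q U i))" for z using that e nodes_U_range by auto
  have A: "Phi sg (nodes s (dilate q U i)) = Phi sg (nodes s U)
     + (eta T m (q * U ! i) - eta T m (U ! i)) * Phi sg (eta T m (q * U ! i) # nodes s U)"
    using Phi_dilate[of U i "[]"] length_U i e nodes_U_range by auto
  have B: "Phi sg (eta T m (q * v) # nodes s (dilate q U i)) = Phi sg (eta T m (q * v) # nodes s U)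
     + (eta T m (q * U ! i) - eta T m (U ! i)) * Phi sg (eta T m (q * U ! i) # eta T m (q * v) # nodes s U)"
    using Phi_dilate[of U i "[eta T m (q * v)]"] length_U i e f nodes_U_range by auto
  have C: "Phi sg (nodes s (dilate q (dilate q U i) k)) = Phi sg (nodes s (dilate q U i))
     + (eta T m (q * v) - eta T m v) * Phi sg (eta T m (q * v) # nodes s (dilate q U i))"
    using Phi_dilate[of "dilate q U i" k "[]"] length_U k f r unfolding v_def[symmetric] by auto
  show ?thesis unfolding C A B v_def[symmetric] J2_def P1_real[OF e] P1_real[OF f] P2_real[OF e f] dl_real
    using PhiU_pos by (simp add: field_simps)
qed

lemma mid_Disc_subset: "r <= r' ==> z \<in> Disc r ==> z \<in> Disc r'" using Disc_mono by blast

lemma one_body_nonzero: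
  assumes z: "z \<in> Disc \<rho>"
  shows "one_body m s a x y z ~= 0"
proof -
  have "geom_sum m (of_real (x i)) z ~= 0" if "i \<in> {1..s}" for i
  proof -
    have "complex_of_real (x i) \<in> Disc \<rho>" by (rule mid_Disc_subset[OF _ x_in]) (use that s \<rho> in auto)
    then show ?thesis by (rule geom_sum_nonzero[OF z])
  qed
  moreover have "1 + of_real (y i) * z ~= 0" if "i \<in> {1..s}" for i
  proof -
    have "0 < Re z" using z Re_pos by (auto simp: Disc_def)
    then have "0 < 1 + y i * Re z" using pos[of i] that s by (simp add: add_pos_pos)
    then have "Re (1 + of_real (y i) * z) ~= 0" by simp
    then show ?thesis by force
  qed
  ultimately show ?thesis using Disc_nonzero[OF z] by (auto simp: one_body_def)
qed

lemma one_body_holomorphic: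
  assumes "f holomorphic_on S" "!!z. z \<in> S ==> f z \<in> Disc \<rho>"
  shows "(%z. one_body m s a x y (f z)) holomorphic_on S"
proof -
  have "f z ~= 0" if "z \<in> S" for z using Disc_nonzero assms(2) that by blast
  moreover have "(%z. if a i = 1 then 1 else 1 + of_real (y i) * f z) holomorphic_on S" for i
    using assms(1) by (cases "a i = 1") (auto intro!: holomorphic_intros)
  ultimately show ?thesis unfolding one_body_def using assms(1) by (intro holomorphic_intros) auto
qed

lemma rr_holomorphic: "rr holomorphic_on Disc (5 * \<rho> / 8)" unfolding rr_def[abs_def]
proof (rule holomorphic_on_divide)
  have sub: "z \<in> Disc \<rho>" if "z \<in> Disc (5 * \<rho> / 8)" for z using that \<rho> by (rule_tac mid_Disc_subset[rotated]) auto
  show "(%z. one_body m s a x y (of_real q * z)) holomorphic_on Disc (5 * \<rho> / 8)"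
    by (rule one_body_holomorphic) (auto intro!: holomorphic_intros q_in)
  show "(%z. one_body m s a x y z) holomorphic_on Disc (5 * \<rho> / 8)"
    by (rule one_body_holomorphic) (auto intro!: holomorphic_intros sub)
  show "one_body m s a x y z ~= 0" if "z \<in> Disc (5 * \<rho> / 8)" for z by (rule one_body_nonzero[OF sub[OF that]])
qed

lemma etac_holomorphic: "etac T m holomorphic_on Disc (5 * \<rho> / 8)"
  "(%z. etac T m (of_real q * z)) holomorphic_on Disc (5 * \<rho> / 8)" unfolding etac_def[abs_def] using T q mid.Disc_nonzero
  by (auto intro!: holomorphic_intros)

lemma Phi_compose_holomorphic:
  assumes "!!a. a \<in> set l ==> norm a < 1"
  shows "(%z. Phi sg (etac T m (of_real q * z) # l)) holomorphic_on Disc (5 * \<rho> / 8)"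
proof -
  have "((%z. Phi sg (z # l)) \<circ> (%z. etac T m (of_real q * z))) holomorphic_on Disc (5 * \<rho> / 8)"
  proof (rule holomorphic_on_compose_gen[OF etac_holomorphic(2) Phi_holomorphic[OF sg_pos assms]])
    show "(%z. etac T m (of_real q * z)) ` Disc (5 * \<rho> / 8) \<subseteq> ball 0 1" using eta_in R by fastforce
  qed
  then show ?thesis by (simp add: o_def)
qed

lemma Phi_cN_nonzero: "Phi sg cN ~= 0" using PhiU_pos by (simp add: Phi_cN)

lemma P1_holomorphic: "P1 holomorphic_on Disc (5 * \<rho> / 8)" unfolding P1_def[abs_def] using Phi_cN_nonzero cN_range
  by (intro holomorphic_on_divide Phi_compose_holomorphic) auto

lemma P2_commute: "P2 z w = P2 w z" unfolding P2_def by (intro arg_cong2[where f = "(/)"] Phi_mset refl) simp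

lemma P2_holomorphic:
  assumes w: "w \<in> Disc (5 * \<rho> / 8)"
  shows "P2 w holomorphic_on Disc (5 * \<rho> / 8)" "(%z. P2 z w) holomorphic_on Disc (5 * \<rho> / 8)"
proof -
  have "norm a < 1" if "a \<in> set (etac T m (of_real q * w) # cN)" for a using that cN_range eta_in[OF w] R by auto
  then show 1: "(%z. P2 z w) holomorphic_on Disc (5 * \<rho> / 8)" unfolding P2_def using Phi_cN_nonzero
    by (intro holomorphic_on_divide Phi_compose_holomorphic) auto
  show "P2 w holomorphic_on Disc (5 * \<rho> / 8)" using 1 by (simp only: P2_commute[of _ w] eta_contract_eq)
qed

lemma dl_holomorphic: "dl holomorphic_on Disc (5 * \<rho> / 8)"
  unfolding dl_def[abs_def] by (intro holomorphic_intros etac_holomorphic)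

lemma J1_holomorphic: "J1 holomorphic_on Disc (5 * \<rho> / 8)"
  unfolding J1_def[abs_def] by (intro holomorphic_intros dl_holomorphic P1_holomorphic)

lemma J2_holomorphic:
  assumes "w \<in> Disc (5 * \<rho> / 8)"
  shows "J2 w holomorphic_on Disc (5 * \<rho> / 8)" "(%z. J2 z w) holomorphic_on Disc (5 * \<rho> / 8)"
  unfolding J2_def[abs_def] by (intro holomorphic_intros dl_holomorphic P1_holomorphic P2_holomorphic[OF assms])+

lemma U_in:
  assumes "i < N - s"
  shows "complex_of_real (U ! i) \<in> Disc (\<rho> / 8)" "complex_of_real (q * U ! i) \<in> Disc (\<rho> / 4)"
  using U_nth[OF assms] x_in[of "Suc (s + i)"] qx_in[of "Suc (s + i)"] by auto

lemma U_set_in: "u \<in> set U ==> complex_of_real u \<in> Disc (\<rho> / 8)" using U_in(1) by (auto simp: in_set_conv_nth length_U)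

lemma shift1_eq:
  "complex_of_real (shift1 q s i) = of_real (kap m q U i) * rr (of_real (U ! i))" using one_body_of_real[of m s a x y "q * U ! i"]
  by (simp add: shift1_def U_def[symmetric] rr_def one_body_of_real)

theorem first_moment:
  assumes r: "\<rho> / 8 <= r" "r < 5 * \<rho> / 8"
  shows "complex_of_real (\<Sum>i<N - s. shift1 q s i * (Phi sg (nodes s (dilate q (upper s) i)) / Phi sg (nodes s (upper s))))
     = circ r (%z. ker m q U z * (rr z * J1 z))"
proof -
  have "complex_of_real (\<Sum>i<N - s. shift1 q s i * (Phi sg (nodes s (dilate q U i)) / Phi sg (nodes s U)))
    = (\<Sum>i<length U. of_real (kap m q U i) * (rr (of_real (U ! i)) * J1 (of_real (U ! i))))"
    unfolding of_real_sum of_real_mult length_U by (intro sum.cong refl) (simp only: J1_real lessThan_iff shift1_eq mult.assoc)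
  also have "... = circ r (%z. ker m q U z * (rr z * J1 z))"
  proof (rule mid.circ_ker[OF q])
    show "complex_of_real u \<in> Disc r" if "u \<in> set U" for u using mid_Disc_subset[OF r(1) U_set_in[OF that]] .
    show "(%z. rr z * J1 z) holomorphic_on Disc (5 * \<rho> / 8)" by (intro holomorphic_intros rr_holomorphic J1_holomorphic)
  qed (use r \<rho> U_distinct in auto)
  finally show ?thesis by (simp add: U_def)
qed

text \<open>A dilation of \<open>U ! i\<close> replaces one factor of the kernel, and
  \<open>cross\<close> is the quotient of the new factor by the old one. It is all that couples the
  two kernels of the second moment.\<close>

lemma ker_dilate:
  assumes i: "i < N - s" and w: "w \<in> Sph (\<rho> / 2)"
  shows "ker m q (dilate q U i) w = ker m q U w * cross (of_real (U ! i)) w"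
proof -
  let ?u = "complex_of_real (U ! i)"
  have w': "w \<in> Disc \<rho>" using Sph_subset[of "\<rho> / 2" \<rho>] w \<rho> by auto
  have 1: "w ^ m ~= ?u ^ m"
  proof
    assume eq: "w ^ m = ?u ^ m"
    have "?u \<in> Disc \<rho>" "?u \<in> Disc (\<rho> / 2)" using U_in(1)[OF i] \<rho> by (auto elim!: mid_Disc_subset[rotated])
    then show False using Disc_inj[OF w' _ eq] Sph_Disc_disjoint[OF w] \<rho> by force
  qed
  have 2: "w ^ m ~= (of_real q * ?u) ^ m" "(of_real q * w) ^ m ~= ?u ^ m"
  proof -
    have "?u \<in> Disc (3 * \<rho> / 8)" using U_in(1)[OF i] \<rho> by (auto elim!: mid_Disc_subset[rotated])
    then show "w ^ m ~= (of_real q * ?u) ^ m" "(of_real q * w) ^ m ~= ?u ^ m" using sep w by auto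
  qed
  let ?f = "%v. ((of_real q * w) ^ m - complex_of_real v ^ m) / (w ^ m - complex_of_real v ^ m)"
  have "(\<Prod>j<length U. ?f (dilate q U i ! j)) = ?f (q * U ! i) * (\<Prod>j\<in>{..<length U} - {i}. ?f (U ! j))"
  proof -
    have "(\<Prod>j<length U. ?f (dilate q U i ! j)) = ?f (dilate q U i ! i) * (\<Prod>j\<in>{..<length U} - {i}. ?f (dilate q U i ! j))"
      using i by (intro prod.remove) (auto simp: length_U)
    then show ?thesis using i by (simp add: dilate_def length_U)
  qed
  also have "... = (\<Prod>j<length U. ?f (U ! j)) * cross ?u w"
  proof -
    have "(\<Prod>j<length U. ?f (U ! j)) = ?f (U ! i) * (\<Prod>j\<in>{..<length U} - {i}. ?f (U ! j))"
      using i by (intro prod.remove) (auto simp: length_U)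
    moreover have "?f (q * U ! i) = ?f (U ! i) * cross ?u w" using 1 2 by (simp add: cross_def)
    ultimately show ?thesis by simp
  qed
  finally show ?thesis by (simp add: ker_def)
qed

lemma cross_holomorphic:
  assumes w: "w \<in> Sph (\<rho> / 2)"
  shows "(%z. cross z w) holomorphic_on Disc (3 * \<rho> / 8)"
  unfolding cross_def using sep[OF _ w] by (intro holomorphic_intros) auto

text \<open>Two contours: the variable dilated first runs over the inner one, so that the points dilated once
  stay inside the outer one.\<close>

theorem second_moment:
  "complex_of_real (\<Sum>i<N - s. shift1 q s i * (\<Sum>k<N - s. shift2 q s i k *
        (Phi sg (nodes s (dilate q (dilate q (upper s) i) k)) / Phi sg (nodes s (upper s)))))
     = circ (\<rho> / 2) (%w. ker m q U w * rr w * circ (\<rho> / 4) (%z. ker m q U z * (rr z * cross z w * J2 z w)))" (is ?thesis1)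
  and second_moment_continuous:
    "continuous_on (Sph (\<rho> / 2)) (%w. ker m q U w * rr w * circ (\<rho> / 4) (%z. ker m q U z * (rr z * cross z w * J2 z w)))" (is ?thesis2)
proof -
  define cf where "cf = (%i. complex_of_real (kap m q U i) * rr (of_real (U ! i)))"
  define f where "f = (%i w. ker m q (dilate q U i) w * (rr w * J2 (of_real (U ! i)) w))"
  have U5: "complex_of_real (U ! i) \<in> Disc (5 * \<rho> / 8)" if "i < N - s" for i
    using U_in(1)[OF that] \<rho> by (auto elim!: mid_Disc_subset[rotated])
  have us': "complex_of_real v \<in> Disc (\<rho> / 2) \<and> v \<in> insert (q * U ! i) (set U)" if i: "i < N - s" and v: "v \<in> set (dilate q U i)" for i v
  proof -
    have "v \<in> insert (q * U ! i) (set U)" using v set_update_subset_insert[of U i "q * U ! i"] unfolding dilate_def by blast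
    then show ?thesis using U_set_in[of v] U_in(2)[OF i] \<rho> by (auto elim!: mid_Disc_subset[rotated])
  qed
  have dist': "distinct (dilate q U i)" if i: "i < N - s" for i
  proof -
    have "q * U ! i \<notin> set U"
    proof
      assume "q * U ! i \<in> set U"
      then obtain j where "j \<in> {Suc s..N}" "q * x (Suc (s + i)) = x j" using U_nth[OF i] by (auto simp: U_def set_upper)
      then show False using gen[of "Suc (s + i)" j 1] U_nth[OF i] by auto
    qed
    then show ?thesis unfolding dilate_def using U_distinct by (intro distinct_list_update) auto
  qed
  have hol: "(%w. rr w * J2 (of_real (U ! i)) w) holomorphic_on Disc (5 * \<rho> / 8)" if "i < N - s" for i
    by (intro holomorphic_intros rr_holomorphic J2_holomorphic U5 that)
  have cont: "continuous_on (Sph (\<rho> / 2)) (f i)" if i: "i < N - s" for i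
  proof -
    have sub: "Sph (\<rho> / 2) \<subseteq> Disc (5 * \<rho> / 8)" using \<rho> by (intro Sph_subset) auto
    have "ker m q (dilate q U i) holomorphic_on Sph (\<rho> / 2)"
    proof (rule mid.ker_holomorphic[OF sub _ q])
      fix v assume "v \<in> set (dilate q U i)"
      then have v: "complex_of_real v \<in> Disc (\<rho> / 2)" using us'[OF i] by blast
      then show "complex_of_real v \<in> Disc (5 * \<rho> / 8) \<and> complex_of_real v \<notin> Sph (\<rho> / 2)"
        using Sph_Disc_disjoint[of _ "\<rho> / 2"] \<rho> by (auto elim!: mid_Disc_subset[rotated])
    qed
    then have "f i holomorphic_on Sph (\<rho> / 2)"
      unfolding f_def by (rule holomorphic_on_mult[OF _ holomorphic_on_subset[OF hol[OF i] sub]])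
    then show ?thesis by (rule holomorphic_on_imp_continuous_on)
  qed
  have inner: "complex_of_real (\<Sum>k<N - s. shift2 q s i k *
        (Phi sg (nodes s (dilate q (dilate q U i) k)) / Phi sg (nodes s U))) = circ (\<rho> / 2) (f i)" if i: "i < N - s" for i
  proof -
    have "complex_of_real (shift2 q s i k) = of_real (kap m q (dilate q U i) k) * rr (of_real (dilate q U i ! k))" for k
      using one_body_of_real[of m s a x y "q * dilate q U i ! k"]
      by (simp add: shift2_def U_def[symmetric] rr_def one_body_of_real Let_def)
    then have "complex_of_real (\<Sum>k<N - s. shift2 q s i k *
        (Phi sg (nodes s (dilate q (dilate q U i) k)) / Phi sg (nodes s U)))
      = (\<Sum>k<length (dilate q U i). of_real (kap m q (dilate q U i) k) *
           (rr (of_real (dilate q U i ! k)) * J2 (of_real (U ! i)) (of_real (dilate q U i ! k))))"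
      unfolding of_real_sum of_real_mult length_dilate length_U
      by (intro sum.cong refl) (simp only: J2_real[OF i] lessThan_iff mult.assoc)
    also have "... = circ (\<rho> / 2) (f i)" unfolding f_def
      by (rule mid.circ_ker[OF q]) (use \<rho> us'[OF i] dist'[OF i] hol[OF i] in auto)
    finally show ?thesis .
  qed
  \<comment> \<open>For fixed \<open>w\<close> on the outer circle, the sum over the variable
    dilated first is again a residue sum, now over the inner circles.\<close>
  have eqw: "(\<Sum>i<N - s. cf i * f i w) = ker m q U w * rr w * circ (\<rho> / 4) (%z. ker m q U z * (rr z * cross z w * J2 z w))"
    if w: "w \<in> Sph (\<rho> / 2)" for w
  proof -
    have w5: "w \<in> Disc (5 * \<rho> / 8)" using Sph_subset[of "\<rho> / 2" "5 * \<rho> / 8"] w \<rho> by auto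
    have "(\<Sum>i<N - s. cf i * f i w) = ker m q U w * rr w * (\<Sum>i<length U. of_real (kap m q U i) *
        (rr (of_real (U ! i)) * cross (of_real (U ! i)) w * J2 (of_real (U ! i)) w))" unfolding sum_distrib_left length_U
      by (intro sum.cong refl) (simp add: cf_def f_def ker_dilate w mult_ac)
    also have "(\<Sum>i<length U. of_real (kap m q U i) *
        (rr (of_real (U ! i)) * cross (of_real (U ! i)) w * J2 (of_real (U ! i)) w))
      = circ (\<rho> / 4) (%z. ker m q U z * (rr z * cross z w * J2 z w))"
    proof (rule inner.circ_ker[OF q])
      show "complex_of_real u \<in> Disc (\<rho> / 4)" if "u \<in> set U" for u
        using U_set_in[OF that] \<rho> by (auto elim!: mid_Disc_subset[rotated])
      have sub: "Disc (3 * \<rho> / 8) \<subseteq> Disc (5 * \<rho> / 8)" using \<rho> by (intro Disc_mono) auto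
      show "(%z. rr z * cross z w * J2 z w) holomorphic_on Disc (3 * \<rho> / 8)" by (intro holomorphic_on_mult cross_holomorphic[OF w]
            holomorphic_on_subset[OF rr_holomorphic sub] holomorphic_on_subset[OF J2_holomorphic(2)[OF w5] sub])
    qed (use \<rho> U_distinct in auto)
    finally show "(\<Sum>i<N - s. cf i * f i w) = ker m q U w * rr w * circ (\<rho> / 4) (%z. ker m q U z * (rr z * cross z w * J2 z w))" .
  qed
  have "complex_of_real (\<Sum>i<N - s. shift1 q s i * (\<Sum>k<N - s. shift2 q s i k *
        (Phi sg (nodes s (dilate q (dilate q U i) k)) / Phi sg (nodes s U))))
     = (\<Sum>i<N - s. cf i * circ (\<rho> / 2) (f i))"
    unfolding of_real_sum[of "%i. shift1 q s i * _ i"] of_real_mult[of "shift1 q s _"] cf_def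
    by (intro sum.cong refl) (simp only: inner lessThan_iff shift1_eq)
  also have "... = (\<Sum>i<N - s. circ (\<rho> / 2) (%w. cf i * f i w))" using \<rho> by (intro sum.cong refl circ_mult[symmetric] cont) auto
  also have "... = circ (\<rho> / 2) (%w. \<Sum>i<N - s. cf i * f i w)" using \<rho> by (intro circ_sum[symmetric] continuous_intros cont) auto
  also have "... = circ (\<rho> / 2) (%w. ker m q U w * rr w * circ (\<rho> / 4) (%z. ker m q U z * (rr z * cross z w * J2 z w)))"
    by (rule circ_cong) (use \<rho> eqw in auto)
  finally show ?thesis1 by (simp add: U_def)
  have "continuous_on (Sph (\<rho> / 2)) (%w. \<Sum>i<N - s. cf i * f i w)" by (intro continuous_intros cont) auto
  then show ?thesis2 using eqw by (simp cong: continuous_on_cong)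
qed

lemma ker_rr_continuous:
  assumes r: "\<rho> / 8 <= r" "r < 5 * \<rho> / 8"
  shows "continuous_on (Sph r) (%z. ker m q U z * rr z)"
    and "continuous_on (Sph r) (%z. ker m q U z * (rr z * J1 z))"
    and "w \<in> Sph (\<rho> / 2) ==> r < 3 * \<rho> / 8 ==> continuous_on (Sph r) (%z. ker m q U z * (rr z * cross z w * J2 z w))"
proof -
  have sub: "Sph r \<subseteq> Disc (5 * \<rho> / 8)" using r by (intro Sph_subset) auto
  have k: "ker m q U holomorphic_on Sph r"
  proof (rule mid.ker_holomorphic[OF sub _ q])
    fix v assume "v \<in> set U"
    then have v: "complex_of_real v \<in> Disc r" by (intro mid_Disc_subset[OF r(1) U_set_in])
    then show "complex_of_real v \<in> Disc (5 * \<rho> / 8) \<and> complex_of_real v \<notin> Sph r"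
      using Sph_Disc_disjoint[of _ r] \<rho> r by (auto elim!: mid_Disc_subset[rotated])
  qed
  have rj: "rr holomorphic_on Sph r" "J1 holomorphic_on Sph r"
    using sub rr_holomorphic J1_holomorphic by (auto intro: holomorphic_on_subset)
  show "continuous_on (Sph r) (%z. ker m q U z * rr z)" by (intro holomorphic_on_imp_continuous_on holomorphic_on_mult k rj)
  show "continuous_on (Sph r) (%z. ker m q U z * (rr z * J1 z))"
    by (intro holomorphic_on_imp_continuous_on holomorphic_on_mult k rj)
  show "continuous_on (Sph r) (%z. ker m q U z * (rr z * cross z w * J2 z w))"
    if w: "w \<in> Sph (\<rho> / 2)" and r3: "r < 3 * \<rho> / 8"
  proof -
    have w5: "w \<in> Disc (5 * \<rho> / 8)" using Sph_subset[of "\<rho> / 2" "5 * \<rho> / 8"] w \<rho> by auto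
    have "(%z. cross z w) holomorphic_on Sph r" "(%z. J2 z w) holomorphic_on Sph r"
      using cross_holomorphic[OF w] J2_holomorphic(2)[OF w5] Sph_subset[OF r3] sub by (auto intro: holomorphic_on_subset)
    then show ?thesis by (intro holomorphic_on_imp_continuous_on holomorphic_on_mult k rj)
  qed
qed

lemma first_bound:
  assumes r: "\<rho> / 8 <= r" "r < 5 * \<rho> / 8"
    and A: "!!z. z \<in> Sph r ==> norm (ker m q U z * rr z) <= CA"
    and J: "!!z. z \<in> Sph r ==> norm (J1 z - 1) <= \<epsilon>" and pos: "0 <= CA" "0 <= \<epsilon>"
  shows "norm (circ r (%z. ker m q U z * (rr z * J1 z)) - circ r (%z. ker m q U z * rr z)) <= real n * r * (CA * \<epsilon>)"
proof -
  have r0: "0 < r" using r \<rho> by linarith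
  have "circ r (%z. ker m q U z * (rr z * J1 z)) - circ r (%z. ker m q U z * rr z)
    = circ r (%z. ker m q U z * (rr z * J1 z) - ker m q U z * rr z)"
    by (rule circ_diff[OF r0 ker_rr_continuous(2)[OF r] ker_rr_continuous(1)[OF r], symmetric])
  also have "norm ... <= real n * r * (CA * \<epsilon>)"
  proof (rule circ_bound[OF r0])
    fix z assume z: "z \<in> Sph r"
    have "ker m q U z * (rr z * J1 z) - ker m q U z * rr z = ker m q U z * rr z * (J1 z - 1)" by (simp add: algebra_simps)
    then show "norm (ker m q U z * (rr z * J1 z) - ker m q U z * rr z) <= CA * \<epsilon>"
      using A[OF z] J[OF z] pos by (simp only: norm_mult) (intro mult_mono, auto)
  qed (use pos in simp)
  finally show ?thesis .
qed

text \<open>If \<open>cross * J2\<close> is uniformly near \<open>1\<close>, the double integral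
  factorises up to a small error. This is the source of concentration.\<close>

lemma second_bound:
  assumes A: "!!z. z \<in> Sph (\<rho> / 4) \<union> Sph (\<rho> / 2) ==> norm (ker m q U z * rr z) <= CA"
    and J: "!!z w. z \<in> Sph (\<rho> / 4) ==> w \<in> Sph (\<rho> / 2) ==> norm (cross z w * J2 z w - 1) <= \<epsilon>"
    and pos: "0 <= CA" "0 <= \<epsilon>"
  shows "norm (circ (\<rho> / 2) (%w. ker m q U w * rr w * circ (\<rho> / 4) (%z. ker m q U z * (rr z * cross z w * J2 z w)))
      - circ (\<rho> / 2) (%z. ker m q U z * rr z) * circ (\<rho> / 4) (%z. ker m q U z * rr z))
    <= real n * (\<rho> / 2) * (CA * (real n * (\<rho> / 4) * (CA * \<epsilon>)))"
proof -
  let ?f = "%z. ker m q U z * rr z"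
  let ?g = "%w. circ (\<rho> / 4) (%z. ker m q U z * (rr z * cross z w * J2 z w))"
  have r: "\<rho> / 8 <= \<rho> / 4" "\<rho> / 4 < 5 * \<rho> / 8" "\<rho> / 4 < 3 * \<rho> / 8" "\<rho> / 8 <= \<rho> / 2" "\<rho> / 2 < 5 * \<rho> / 8"
    "0 < \<rho> / 4" "0 < \<rho> / 2" using \<rho> by auto
  have "circ (\<rho> / 2) (%w. ?f w * ?g w) - circ (\<rho> / 2) ?f * circ (\<rho> / 4) ?f
    = circ (\<rho> / 2) (%w. ?f w * ?g w) - circ (\<rho> / 2) (%w. circ (\<rho> / 4) ?f * ?f w)"
    unfolding circ_mult[OF r(7) ker_rr_continuous(1)[OF r(4,5)]] by (simp only: mult.commute)
  also have "... = circ (\<rho> / 2) (%w. ?f w * ?g w - circ (\<rho> / 4) ?f * ?f w)"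
    by (intro circ_diff[symmetric] r second_moment_continuous continuous_intros ker_rr_continuous(1))
  also have "norm ... <= real n * (\<rho> / 2) * (CA * (real n * (\<rho> / 4) * (CA * \<epsilon>)))"
  proof (rule circ_bound[OF r(7)])
    fix w assume w: "w \<in> Sph (\<rho> / 2)"
    have "?g w - circ (\<rho> / 4) ?f = circ (\<rho> / 4) (%z. ker m q U z * (rr z * cross z w * J2 z w) - ?f z)"
      by (intro circ_diff[symmetric] r ker_rr_continuous w)
    also have "norm ... <= real n * (\<rho> / 4) * (CA * \<epsilon>)"
    proof (rule circ_bound[OF r(6)])
      fix z assume z: "z \<in> Sph (\<rho> / 4)"
      have "ker m q U z * (rr z * cross z w * J2 z w) - ?f z = ?f z * (cross z w * J2 z w - 1)" by (simp add: algebra_simps)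
      then show "norm (ker m q U z * (rr z * cross z w * J2 z w) - ?f z) <= CA * \<epsilon>"
        using A[of z] z J[OF z w] pos by (simp only: norm_mult) (intro mult_mono, auto)
    qed (use pos in simp)
    finally have 1: "norm (?g w - circ (\<rho> / 4) ?f) <= real n * (\<rho> / 4) * (CA * \<epsilon>)" .
    have "?f w * ?g w - circ (\<rho> / 4) ?f * ?f w = ?f w * (?g w - circ (\<rho> / 4) ?f)" by (simp add: algebra_simps)
    then show "norm (?f w * ?g w - circ (\<rho> / 4) ?f * ?f w) <= CA * (real n * (\<rho> / 4) * (CA * \<epsilon>))"
      using A[of w] w 1 pos by (simp only: norm_mult) (intro mult_mono, auto)
  qed (use pos \<rho> in simp)
  finally show ?thesis .
qed

text \<open>Upper weights enter through \<open>ker\<close> and lower weights through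
  \<open>geom_sum\<close>. Writing \<open>geom_sum\<close> as a quotient merges both into one
  product over all \<open>N\<close> rows, at the price of the simple factors in the denominator;
  \<open>ne\<close> excludes the point where that quotient is undefined.\<close>

lemma A_product:
  assumes z: "z \<in> Sph r" and r: "\<rho> / 8 <= r" "r < 5 * \<rho> / 8"
    and ne: "!!i. i \<in> {1..N} ==> of_real q * z ~= of_real (x i)"
  shows "ker m q U z * rr z = of_nat m / ((of_real q ^ m - 1) * z) * (1 / of_real q ^ m)
     * (\<Prod>j\<in>{1..N}. 1 + (of_real q ^ m - 1) * z ^ m / (z ^ m - of_real (x j) ^ m))
     * (\<Prod>i\<in>{1..s}. 1 + (if a i = 1 then 0 else (of_real q - 1) * of_real (y i) * z / (1 + of_real (y i) * z)))
     / (\<Prod>i\<in>{1..s}. 1 + (of_real q - 1) * z / (z - of_real (x i)))"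
proof -
  let ?Q = "complex_of_real q ^ m"
  have z\<rho>: "z \<in> Disc \<rho>" using Sph_subset[of r \<rho>] z r \<rho> by auto
  have z0: "z ~= 0" by (rule Disc_nonzero[OF z\<rho>])
  have zx: "z ~= of_real (x i)" "z ^ m ~= of_real (x i) ^ m" if "i \<in> {1..N}" for i
  proof -
    have x1: "complex_of_real (x i) \<in> Disc r" "complex_of_real (x i) \<in> Disc \<rho>"
      using mid_Disc_subset[OF r(1) x_in[OF that]] mid_Disc_subset[OF _ x_in[OF that], of \<rho>] \<rho> by auto
    show "z ~= of_real (x i)" using Sph_Disc_disjoint[OF z _ x1(1)] r \<rho> by auto
    then show "z ^ m ~= of_real (x i) ^ m" using Disc_inj[OF z\<rho> x1(2)] by blast
  qed
  let ?b1 = "%j. 1 + (?Q - 1) * z ^ m / (z ^ m - of_real (x j) ^ m)"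
  let ?b2 = "%i. 1 + (of_real q - 1) * z / (z - of_real (x i))"
  let ?b3 = "%i. 1 + (if a i = 1 then 0 else (of_real q - 1) * of_real (y i) * z / (1 + of_real (y i) * z))"
  have b1: "((of_real q * z) ^ m - of_real (x j) ^ m) / (z ^ m - of_real (x j) ^ m) = ?b1 j" if "j \<in> {1..N}" for j
    using zx(2)[OF that] by (simp add: field_simps power_mult_distrib)
  have "(\<Prod>j<length U. ((of_real q * z) ^ m - of_real (U ! j) ^ m) / (z ^ m - of_real (U ! j) ^ m)) = (\<Prod>j\<in>{Suc s..N}. ?b1 j)"
  proof (rule prod.reindex_bij_witness[where i = "%j. j - Suc s" and j = "%j. Suc (s + j)"], goal_cases)
    case (5 j)
    then show ?case using U_nth[of j] b1[of "Suc (s + j)"] by (simp add: length_U)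
  qed (auto simp: length_U)
  then have k: "ker m q U z = (\<Prod>j\<in>{Suc s..N}. ?b1 j) * (of_nat m / ((?Q - 1) * z))" by (simp add: ker_def)
  have g: "geom_sum m (of_real (x i)) (of_real q * z) / geom_sum m (of_real (x i)) z = ?b1 i / ?b2 i" if i: "i \<in> {1..N}" for i
  proof -
    have e1: "geom_sum m (of_real (x i)) (of_real q * z) = ((of_real q * z) ^ m - of_real (x i) ^ m) / (of_real q * z - of_real (x i))"
      using geom_sum_eq[of "of_real q * z" "of_real (x i)" m] ne[OF i] by (simp add: field_simps)
    have e2: "geom_sum m (of_real (x i)) z = (z ^ m - of_real (x i) ^ m) / (z - of_real (x i))"
      using geom_sum_eq[of z "of_real (x i)" m] zx(1)[OF i] by (simp add: field_simps)
    have e3: "?b2 i = (of_real q * z - of_real (x i)) / (z - of_real (x i))" using zx(1)[OF i] by (simp add: field_simps)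
    have "(P / S) / (V / W) = (P / V) / (S / W)" for P S V W :: complex by (simp add: divide_inverse mult_ac)
    then show ?thesis unfolding b1[OF i, symmetric] e1 e2 e3 .
  qed
  have b3: "(if a i = 1 then 1 else 1 + of_real (y i) * (of_real q * z)) / (if a i = 1 then 1 else 1 + of_real (y i) * z) = ?b3 i"
    if i: "i \<in> {1..N}" for i
  proof -
    have "0 < Re z" using z\<rho> Re_pos by (auto simp: Disc_def)
    then have "0 < 1 + y i * Re z" using pos[OF i] by (simp add: add_pos_pos)
    then have "Re (1 + of_real (y i) * z) ~= 0" by simp
    then have "1 + of_real (y i) * z ~= 0" by force
    then show ?thesis by (simp add: field_simps)
  qed
  have "rr z = (z ^ m / (of_real q * z) ^ m) * (\<Prod>i\<in>{1..s}. geom_sum m (of_real (x i)) (of_real q * z) / geom_sum m (of_real (x i)) z)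
     * (\<Prod>i\<in>{1..s}. (if a i = 1 then 1 else 1 + of_real (y i) * (of_real q * z)) / (if a i = 1 then 1 else 1 + of_real (y i) * z))"
    unfolding rr_def one_body_def prod_dividef by (simp add: mult_ac cong: if_cong)
  also have "... = 1 / ?Q * (\<Prod>i\<in>{1..s}. ?b1 i / ?b2 i) * (\<Prod>i\<in>{1..s}. ?b3 i)"
    using s z0 by (intro arg_cong2[where f = "(*)"] prod.cong refl g b3) (auto simp: power_mult_distrib)
  finally have r: "rr z = 1 / ?Q * ((\<Prod>i\<in>{1..s}. ?b1 i) / (\<Prod>i\<in>{1..s}. ?b2 i)) * (\<Prod>i\<in>{1..s}. ?b3 i)" by (simp only: prod_dividef)
  have "{1..N} = {1..s} \<union> {Suc s..N}" using s by auto
  then have "(\<Prod>j\<in>{1..N}. ?b1 j) = (\<Prod>j\<in>{1..s}. ?b1 j) * (\<Prod>j\<in>{Suc s..N}. ?b1 j)" by (simp only:) (intro prod.union_disjoint, auto)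
  then show ?thesis unfolding k r by (simp only:) (simp add: mult_ac)
qed

end

section \<open>Uniform estimates on the contours\<close>

context discs
begin

lemma center_ge: "k \<in> {1..n} ==> \<rho> <= c k"
proof (rule dense_le_bounded[OF \<rho>])
  fix r assume k: "k \<in> {1..n}" and r: "0 < r" "r < \<rho>"
  have "complex_of_real (c k - r) \<in> ball (complex_of_real (c k)) \<rho>" using r by (simp add: dist_norm)
  from Re_pos[OF k this] show "r <= c k" by simp
qed

lemma Sph_norm:
  assumes "z \<in> Sph r" "r <= \<rho> / 2"
  shows "\<rho> / 2 <= norm z"
proof -
  obtain k where k: "k \<in> {1..n}" "dist (complex_of_real (c k)) z = r" using assms by (auto simp: Sph_def)
  have "norm (complex_of_real (c k)) <= norm z + dist (complex_of_real (c k)) z"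
    by (metis dist_norm norm_triangle_sub add.commute norm_minus_commute)
  moreover have "norm (complex_of_real (c k)) = c k" using center_ge[OF k(1)] \<rho> by simp
  ultimately show ?thesis using center_ge[OF k(1)] k(2) assms(2) by linarith
qed

lemma Disc_norm_le:
  assumes "z \<in> Disc r" and "!!k. k \<in> {1..n} ==> c k <= b"
  shows "norm z <= b + r"
proof -
  obtain k where k: "k \<in> {1..n}" "dist (complex_of_real (c k)) z < r" using assms by (auto simp: Disc_def)
  have "norm z <= norm (complex_of_real (c k)) + dist (complex_of_real (c k)) z"
    by (metis dist_norm norm_triangle_sub norm_minus_commute)
  moreover have "norm (complex_of_real (c k)) = c k" using center_ge[OF k(1)] \<rho> by simp
  ultimately show ?thesis using assms(2)[OF k(1)] k(2) by linarith
qed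

lemma Sph_Disc_dist:
  assumes w: "w \<in> Sph r" and z: "z \<in> Disc r'" and r: "r' <= r" "r <= \<rho> / 2"
  shows "r - r' <= norm (w - z)"
proof -
  obtain k where k: "k \<in> {1..n}" "dist (complex_of_real (c k)) w = r" using w by (auto simp: Sph_def)
  obtain l where l: "l \<in> {1..n}" "dist (complex_of_real (c l)) z < r'" using z by (auto simp: Disc_def)
  have r0: "0 < r'" using l by (meson dist_not_less_zero le_less_trans linorder_not_less zero_le_dist)
  show ?thesis
  proof (cases "k = l")
    case True
    have "dist (complex_of_real (c k)) w <= dist (complex_of_real (c k)) z + dist z w" by (rule dist_triangle)
    then show ?thesis using True k l by (simp add: dist_norm norm_minus_commute)
  next
    case False
    have "z \<in> ball (complex_of_real (c l)) \<rho>" using l r \<rho> by simp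
    then have "z \<notin> ball (complex_of_real (c k)) \<rho>" using disj[OF k(1) l(1) False] by blast
    moreover have "dist (complex_of_real (c k)) z <= dist (complex_of_real (c k)) w + dist w z" by (rule dist_triangle)
    ultimately show ?thesis using k r r0 \<rho> by (simp add: dist_norm)
  qed
qed

text \<open>\<open>geom_sum\<close> has no zero on the compact product of the closed half-size
  discs, so its norm has a positive minimum.\<close>

lemma pow_separation:
  obtains \<gamma> where "0 < \<gamma>" "!!z w r r'. z \<in> Sph r ==> r <= \<rho> / 2 ==> w \<in> Disc r' ==> r' <= \<rho> / 2 ==> \<gamma> * norm (z - w) <= norm (z ^ m - w ^ m)"
proof -
  define K where "K = (\<Union>k\<in>{1..n}. cball (complex_of_real (c k)) (\<rho> / 2))"
  have K: "compact K" unfolding K_def by (intro compact_UN) auto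
  have KD: "K \<subseteq> Disc \<rho>" using \<rho> by (force simp: K_def Disc_def)
  have "continuous_on (K \<times> K) (%p. norm (geom_sum m (snd p) (fst p)))" unfolding geom_sum_def by (intro continuous_intros)
  then obtain \<gamma> where \<gamma>: "0 < \<gamma>" "!!p. p \<in> K \<times> K ==> \<gamma> <= norm (geom_sum m (snd p) (fst p))"
  proof (cases "K = {}")
    case True
    then show thesis using that[of 1] by auto
  next
    case False
    assume cont: "continuous_on (K \<times> K) (%p. norm (geom_sum m (snd p) (fst p)))"
    have ne: "K \<times> K ~= {}" using False by auto
    obtain p where p1: "p \<in> K \<times> K"
      and p2: "\<forall>p'\<in>K \<times> K. norm (geom_sum m (snd p) (fst p)) <= norm (geom_sum m (snd p') (fst p'))"
      using continuous_attains_inf[OF compact_Times[OF K K] ne cont] by (rule bexE) (rule that)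
    have "geom_sum m (snd p) (fst p) ~= 0" using p1 KD by (intro geom_sum_nonzero) auto
    then show thesis using that[of "norm (geom_sum m (snd p) (fst p))"] p2 by simp
  qed
  show thesis
  proof (rule that[OF \<gamma>(1)])
    fix z w r r' assume zw: "z \<in> Sph r" "r <= \<rho> / 2" "w \<in> Disc r'" "r' <= \<rho> / 2"
    have "z \<in> K" using zw(1,2) by (force simp: K_def Sph_def)
    moreover have "w \<in> K" using zw(3,4) by (force simp: K_def Disc_def)
    ultimately have "(z, w) \<in> K \<times> K" by simp
    then have "\<gamma> <= norm (geom_sum m w z)" using \<gamma>(2)[of "(z, w)"] by simp
    then have "\<gamma> * norm (z - w) <= norm (geom_sum m w z) * norm (z - w)" by (intro mult_right_mono) auto
    also have "... = norm ((z - w) * geom_sum m w z)" by (simp add: norm_mult mult.commute)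
    finally show "\<gamma> * norm (z - w) <= norm (z ^ m - w ^ m)" by (simp only: geom_sum_eq)
  qed
qed

end

context disc_staircase
begin

text \<open>The inserted complex nodes are dominated by \<open>R\<close>, after which the real
  insertion bound applies once or twice. The \<open>+ 1\<close> in the condition on \<open>C\<close>
  pays for the node present at the second insertion.\<close>

lemma P_bounds:
  assumes e: "0 <= e" "e <= e'" "e' < 1" "e <= R" "(R - e) * C <= 1 / 2"
    and p: "0 < p" "p <= card {i \<in> {1..N}. e <= eta T m (x i) \<and> eta T m (x i) <= e'}"
    and C: "sg + real N + 1 <= C * (real p * (1 - e'))"
    and z: "z \<in> Disc (5 * \<rho> / 8)" and w: "w \<in> Disc (5 * \<rho> / 8)"
  shows "norm (P1 z) <= 2 * C" "norm (P2 z w) <= 4 * C\<^sup>2"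
proof -
  let ?l = "nodes s U"
  have nodes: "?l = map (%i. eta T m (x i)) [1..<Suc N]"
  proof -
    have "[1..<Suc s] @ [Suc s..<Suc N] = [1..<Suc N]" using s upt_add_eq_append[of 1 "Suc s" "N - s"] by (simp del: upt_Suc)
    then show ?thesis unfolding nodes_def U_def upper_def by (simp only: map_append[symmetric] map_map o_def)
  qed
  have len: "length ?l = N" by (simp add: nodes)
  have "length (filter (%a. e <= a \<and> a <= e') ?l) = length (filter (%i. e <= eta T m (x i) \<and> eta T m (x i) <= e') [1..<Suc N])"
    unfolding nodes filter_map length_map by (simp only: o_def)
  also have "... = card {i \<in> {1..N}. e <= eta T m (x i) \<and> eta T m (x i) <= e'}"
    by (subst distinct_card[symmetric]) (auto intro!: arg_cong[of _ _ card] simp del: upt_Suc)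
  finally have p': "p <= length (filter (%a. e <= a \<and> a <= e') ?l)" using p(2) by simp
  have C0: "0 <= C"
  proof -
    have "0 < sg + real N + 1" using sg_pos by simp
    then have "0 < C * (real p * (1 - e'))" using C by linarith
    moreover have "0 < real p * (1 - e')" using p e by simp
    ultimately show ?thesis by (simp add: zero_less_mult_iff)
  qed
  have R0: "0 <= R" using e by simp
  have F1: "Phi sg (R # ?l) <= 2 * C * Phi sg ?l"
    by (rule Phi_insert_le'[OF sg_pos nodes_U_range e(1,2,3,4) R e(5) p(1) p']) (use C len in auto)
  have F2: "Phi sg (R # R # ?l) <= 2 * C * Phi sg (R # ?l)"
  proof (rule Phi_insert_le'[OF sg_pos _ e(1,2,3,4) R e(5) p(1)])
    show "p <= length (filter (%a. e <= a \<and> a <= e') (R # ?l))" using p' by auto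
    show "sg + real (length (R # ?l)) <= C * (real p * (1 - e'))" using C len by simp
    show "0 <= a \<and> a < 1" if "a \<in> set (R # ?l)" for a using that nodes_U_range R R0 by auto
  qed
  have cN: "map norm cN = ?l" unfolding cN_def map_map by (rule map_idI) (use nodes_U_range in force)
  have b1: "norm (Phi sg (etac T m (of_real q * z) # cN)) <= Phi sg (R # ?l)"
    using Phi_Cons_bound[where l = cN, OF sg_pos eta_in[OF z] R cN_range] unfolding cN by blast
  show "norm (P1 z) <= 2 * C"
  proof -
    have "norm (P1 z) = norm (Phi sg (etac T m (of_real q * z) # cN)) / Phi sg ?l"
      using PhiU_pos by (simp add: P1_def Phi_cN norm_divide)
    also have "... <= (2 * C * Phi sg ?l) / Phi sg ?l" using b1 F1 PhiU_pos by (intro divide_right_mono) auto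
    finally show ?thesis using PhiU_pos by simp
  qed
  have "norm a < 1" if "a \<in> set (etac T m (of_real q * w) # cN)" for a using that cN_range eta_in[OF w] R by auto
  then have "norm (Phi sg (etac T m (of_real q * z) # etac T m (of_real q * w) # cN))
     <= Phi sg (R # map norm (etac T m (of_real q * w) # cN))" by (rule Phi_Cons_bound[OF sg_pos eta_in[OF z] R])
  also have "... = Phi sg (norm (etac T m (of_real q * w)) # R # ?l)" by (rule Phi_mset) (simp add: cN)
  also have "... <= Phi sg (R # R # ?l)" by (rule Phi_mono_Cons[OF sg_pos _ eta_in[OF w] R]) (use R R0 nodes_U_range in auto)
  also have "... <= 2 * C * (2 * C * Phi sg ?l)"
    using F2 F1 C0 by (meson mult_left_mono order_trans mult_nonneg_nonneg zero_le_numeral)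
  finally have b2: "norm (Phi sg (etac T m (of_real q * z) # etac T m (of_real q * w) # cN)) <= 4 * C\<^sup>2 * Phi sg ?l"
    by (simp add: power2_eq_square mult_ac)
  show "norm (P2 z w) <= 4 * C\<^sup>2"
  proof -
    have "norm (P2 z w) = norm (Phi sg (etac T m (of_real q * z) # etac T m (of_real q * w) # cN)) / Phi sg ?l"
      using PhiU_pos by (simp add: P2_def Phi_cN norm_divide)
    also have "... <= (4 * C\<^sup>2 * Phi sg ?l) / Phi sg ?l" using b2 PhiU_pos by (intro divide_right_mono) auto
    finally show ?thesis using PhiU_pos by simp
  qed
qed

lemma Q_gt_1: "1 < q ^ m" using q m1 by (intro one_less_power) auto

lemma norm_Q_minus_1: "norm (complex_of_real q ^ m - 1) = q ^ m - 1"
proof -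
  have "complex_of_real q ^ m - 1 = of_real (q ^ m - 1)" by simp
  then show ?thesis using Q_gt_1 by (simp only: norm_of_real)
qed

lemma dl_bound:
  assumes z: "z \<in> Sph r" "r <= \<rho> / 2"
  shows "norm (dl z) <= (q ^ m - 1) / (T * (\<rho> / 2) ^ m)"
proof -
  have nz: "\<rho> / 2 <= norm z" by (rule Sph_norm[OF z])
  then have z0: "z ~= 0" using \<rho> by auto
  have Q: "complex_of_real q ^ m ~= 0" using q by simp
  have "dl z = (complex_of_real q ^ m - 1) / (complex_of_real q ^ m * (of_real T * z ^ m))"
    using z0 Q T by (simp add: dl_def etac_def power_mult_distrib field_simps)
  then have "norm (dl z) = (q ^ m - 1) / (q ^ m * (T * norm z ^ m))"
    using q T by (simp add: norm_divide norm_mult norm_power norm_Q_minus_1)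
  also have "... <= (q ^ m - 1) / (1 * (T * (\<rho> / 2) ^ m))"
    using Q_gt_1 q T \<rho> nz by (intro divide_left_mono mult_mono power_mono mult_pos_pos zero_less_power) auto
  finally show ?thesis by simp
qed

text \<open>The first order cancels: numerator minus denominator of \<open>cross\<close> is
  \<open>(Q - 1)\<^sup>2 * (z ^ m * w ^ m)\<close> with \<open>Q\<close> the \<open>m\<close>-th
  power of \<open>q\<close>, while the denominator stays away from \<open>0\<close>.\<close>

lemma cross_bound:
  assumes d: "0 < d" "d <= norm (w ^ m - z ^ m)" and B: "norm z ^ m <= B" "norm w ^ m <= B"
    and Q: "(q ^ m - 1) * B <= d / 2"
  shows "norm (cross z w - 1) <= (q ^ m - 1)\<^sup>2 * (4 * B\<^sup>2 / d\<^sup>2)"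
proof -
  define Q where "Q = complex_of_real q ^ m"
  define D where "D = (w ^ m - Q * z ^ m) * (Q * w ^ m - z ^ m)"
  have Qn: "norm (Q - 1) = q ^ m - 1" using norm_Q_minus_1 by (simp add: Q_def)
  have B0: "0 <= B" using B(1) by (meson norm_ge_zero order_trans zero_le_power)
  have "norm ((Q - 1) * z ^ m) <= d / 2"
  proof -
    have "norm ((Q - 1) * z ^ m) <= (q ^ m - 1) * B"
      unfolding norm_mult Qn norm_power using Q_gt_1 B by (intro mult_left_mono) auto
    then show ?thesis using assms(5) by linarith
  qed
  moreover have "norm (w ^ m - z ^ m) <= norm (w ^ m - Q * z ^ m) + norm ((Q - 1) * z ^ m)"
    using norm_triangle_ineq[of "w ^ m - Q * z ^ m" "(Q - 1) * z ^ m"] by (simp add: algebra_simps)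
  ultimately have 1: "d / 2 <= norm (w ^ m - Q * z ^ m)" using d by linarith
  have "norm ((Q - 1) * w ^ m) <= d / 2"
  proof -
    have "norm ((Q - 1) * w ^ m) <= (q ^ m - 1) * B"
      unfolding norm_mult Qn norm_power using Q_gt_1 B by (intro mult_left_mono) auto
    then show ?thesis using assms(5) by linarith
  qed
  moreover have "norm (w ^ m - z ^ m) <= norm (Q * w ^ m - z ^ m) + norm ((Q - 1) * w ^ m)"
    using norm_triangle_ineq4[of "Q * w ^ m - z ^ m" "(Q - 1) * w ^ m"] by (simp add: algebra_simps)
  ultimately have 2: "d / 2 <= norm (Q * w ^ m - z ^ m)" using d by linarith
  have D: "d / 2 * (d / 2) <= norm D" unfolding D_def norm_mult using 1 2 d by (intro mult_mono) auto
  moreover have "0 < d / 2 * (d / 2)" using d by simp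
  ultimately have "0 < norm D" by linarith
  then have D0: "D ~= 0" by simp
  have "((of_real q * w) ^ m - (of_real q * z) ^ m) * (w ^ m - z ^ m) = Q * (w ^ m - z ^ m)\<^sup>2"
    by (simp add: Q_def power_mult_distrib power2_eq_square algebra_simps)
  then have "cross z w = Q * (w ^ m - z ^ m)\<^sup>2 / D" by (simp only: cross_def) (simp add: D_def Q_def power_mult_distrib)
  then have "cross z w - 1 = (Q * (w ^ m - z ^ m)\<^sup>2 - D) / D" using D0 by (simp add: field_simps)
  also have "Q * (w ^ m - z ^ m)\<^sup>2 - D = (Q - 1)\<^sup>2 * (z ^ m * w ^ m)" by (simp add: D_def power2_eq_square algebra_simps)
  finally have "norm (cross z w - 1) = (q ^ m - 1)\<^sup>2 * (norm z ^ m * norm w ^ m) / norm D"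
    by (simp only: norm_divide norm_mult norm_power Qn)
  also have "... <= (q ^ m - 1)\<^sup>2 * (B * B) / (d / 2 * (d / 2))" using D d B B0 by (intro frac_le mult_left_mono mult_mono) auto
  finally show ?thesis using d by (simp add: power2_eq_square field_simps)
qed

text \<open>Every factor is \<open>1\<close> plus a term of order \<open>q - 1\<close>, so the
  products are bounded by exponentials of \<open>N * (q - 1)\<close>; the growth is confined to the
  prefactor with \<open>q ^ m - 1\<close> in the denominator.\<close>

lemma ker_rr_bound:
  assumes z: "z \<in> Sph r" and r: "\<rho> / 4 <= r" "r <= \<rho> / 2"
    and K1: "!!j. j \<in> {1..N} ==> norm z ^ m <= K * norm (z ^ m - of_real (x j) ^ m)"
    and K2: "!!j. j \<in> {1..N} ==> norm z <= K * norm (z - of_real (x j))"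
    and small: "(q - 1) * K <= 1 / 2" and K: "0 <= K"
  shows "norm (ker m q U z * rr z) <= real m / ((q ^ m - 1) * (\<rho> / 2)) *
     exp (real N * (q ^ m - 1) * K + 2 * (real N * (q - 1)) + 2 * (real N * (q - 1) * K))"
proof -
  let ?Q = "complex_of_real q ^ m"
  define b1 where "b1 = (%j. (?Q - 1) * z ^ m / (z ^ m - of_real (x j) ^ m))"
  define b2 where "b2 = (%i. (of_real q - 1) * z / (z - of_real (x i)))"
  define b3 where "b3 = (%i. if a i = 1 then 0 else (of_real q - 1) * of_real (y i) * z / (1 + of_real (y i) * z))"
  have zr: "\<rho> / 2 <= norm z" by (rule Sph_norm[OF z r(2)])
  have z\<rho>: "z \<in> Disc \<rho>" using Sph_subset[of r \<rho>] z r \<rho> by auto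
  have nq: "norm (complex_of_real q - 1) = q - 1"
  proof -
    have "complex_of_real q - 1 = of_real (q - 1)" by simp
    then show ?thesis using q by (simp only: norm_of_real)
  qed
  have n1: "norm (b1 j) <= (q ^ m - 1) * K" if j: "j \<in> {1..N}" for j
  proof (cases "z ^ m - complex_of_real (x j) ^ m = 0")
    case False
    have "norm (b1 j) = (q ^ m - 1) * (norm z ^ m / norm (z ^ m - complex_of_real (x j) ^ m))"
      by (simp add: b1_def norm_divide norm_mult norm_power norm_Q_minus_1)
    also have "... <= (q ^ m - 1) * K" using K1[OF j] Q_gt_1 False by (intro mult_left_mono) (auto simp: divide_le_eq)
    finally show ?thesis .
  qed (use K Q_gt_1 in \<open>auto simp: b1_def\<close>)
  have n2: "norm (b2 j) <= (q - 1) * K" if j: "j \<in> {1..N}" for j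
  proof (cases "z - complex_of_real (x j) = 0")
    case False
    have "norm (b2 j) = (q - 1) * (norm z / norm (z - complex_of_real (x j)))" by (simp add: b2_def norm_divide norm_mult nq)
    also have "... <= (q - 1) * K" using K2[OF j] q False by (intro mult_left_mono) (auto simp: divide_le_eq)
    finally show ?thesis .
  qed (use K q in \<open>auto simp: b2_def\<close>)
  have n3: "norm (b3 j) <= 2 * (q - 1)" if j: "j \<in> {1..N}" for j
  proof (cases "a j = 1")
    case False
    have "0 < Re z" using z\<rho> Re_pos by (auto simp: Disc_def)
    then have "1 <= Re (1 + of_real (y j) * z)" using pos[OF j] by simp
    then have n: "1 <= norm (1 + of_real (y j) * z)" using complex_Re_le_cmod order_trans by blast
    then have n0: "1 + of_real (y j) * z ~= 0" by auto
    have "of_real (y j) * z / (1 + of_real (y j) * z) = 1 - 1 / (1 + of_real (y j) * z)" using n0 by (simp add: field_simps)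
    also have "norm ... <= norm (1::complex) + norm (1 / (1 + of_real (y j) * z))" by (rule norm_triangle_ineq4)
    also have "... <= 2" using n by (simp add: norm_divide divide_le_eq)
    finally have "norm (of_real (y j) * z / (1 + of_real (y j) * z)) <= 2" .
    then have "(q - 1) * norm (of_real (y j) * z / (1 + of_real (y j) * z)) <= (q - 1) * 2" using q by (intro mult_left_mono) auto
    moreover have "b3 j = (of_real q - 1) * (of_real (y j) * z / (1 + of_real (y j) * z))" using False by (simp add: b3_def)
    ultimately show ?thesis by (simp only: norm_mult nq mult.commute)
  qed (use q in \<open>simp add: b3_def\<close>)
  have zx: "z ~= complex_of_real (x j)" if "j \<in> {1..N}" for j
  proof -
    have "complex_of_real (x j) \<in> Disc r" using mid_Disc_subset[OF _ x_in[OF that], of r] r \<rho> by auto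
    then show ?thesis using Sph_Disc_disjoint[OF z] r \<rho> by auto
  qed
  have b2h: "norm (b2 j) <= 1 / 2" if "j \<in> {1..N}" for j using n2[OF that] small by linarith
  have b2ne: "1 + b2 j ~= 0" if "j \<in> {1..N}" for j
  proof
    assume "1 + b2 j = 0"
    then have "b2 j = - 1" by (simp add: add_eq_0_iff)
    then show False using b2h[OF that] by simp
  qed
  have ne: "of_real q * z ~= of_real (x i)" if "i \<in> {1..N}" for i
  proof
    assume eq: "of_real q * z = complex_of_real (x i)"
    have "(1 + b2 i) * (z - of_real (x i)) = of_real q * z - of_real (x i)" using zx[OF that] by (simp add: b2_def field_simps)
    then show False using eq b2ne[OF that] zx[OF that] by simp
  qed
  \<comment> \<open>Reciprocals of the simple factors are again of the form \<open>1 + b2'\<close>,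
    with twice the bound, because \<open>b2\<close> has norm at most \<open>1 / 2\<close>.\<close>
  define b2' where "b2' = (%i. - b2 i / (1 + b2 i))"
  have inv: "1 / (1 + b2 i) = 1 + b2' i" if "i \<in> {1..N}" for i using b2ne[OF that] by (simp add: b2'_def field_simps)
  have n2': "norm (b2' i) <= 2 * ((q - 1) * K)" if i: "i \<in> {1..N}" for i
  proof -
    have "1 - norm (b2 i) <= norm (1 + b2 i)" using norm_triangle_ineq4[of "1 + b2 i" "b2 i"] by simp
    then have "1 / 2 <= norm (1 + b2 i)" using b2h[OF i] by linarith
    then have "norm (b2' i) <= norm (b2 i) / (1 / 2)"
      unfolding b2'_def norm_divide norm_minus_cancel by (intro divide_left_mono) auto
    also have "... = 2 * norm (b2 i)" by simp
    also have "... <= 2 * ((q - 1) * K)" using n2[OF i] by (intro mult_left_mono) auto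
    finally show ?thesis .
  qed
  have P1: "norm (\<Prod>j\<in>{1..N}. 1 + b1 j) <= exp (real N * (q ^ m - 1) * K)"
  proof -
    have "(\<Sum>j\<in>{1..N}. norm (b1 j)) <= (\<Sum>j\<in>{1..N}. (q ^ m - 1) * K)" by (intro sum_mono n1)
    then show ?thesis using norm_prod_one_plus_le[of b1 "{1..N}"] by (simp add: mult.assoc) (meson exp_le_cancel_iff order_trans)
  qed
  have le: "real s * b <= real N * b" if "0 <= b" for b using s that by (intro mult_right_mono) auto
  have P3: "norm (\<Prod>j\<in>{1..s}. 1 + b3 j) <= exp (2 * (real N * (q - 1)))"
  proof -
    have "(\<Sum>j\<in>{1..s}. norm (b3 j)) <= (\<Sum>j\<in>{1..s}. 2 * (q - 1))" using s by (intro sum_mono n3) auto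
    also have "... <= 2 * (real N * (q - 1))" using le[of "2 * (q - 1)"] q by (simp add: mult.left_commute)
    finally show ?thesis using norm_prod_one_plus_le[of b3 "{1..s}"] by (meson exp_le_cancel_iff order_trans)
  qed
  have P2: "norm (\<Prod>j\<in>{1..s}. 1 + b2' j) <= exp (2 * (real N * (q - 1) * K))"
  proof -
    have "(\<Sum>j\<in>{1..s}. norm (b2' j)) <= (\<Sum>j\<in>{1..s}. 2 * ((q - 1) * K))" using s by (intro sum_mono n2') auto
    also have "... <= 2 * (real N * (q - 1) * K)" using le[of "2 * ((q - 1) * K)"] q K by (simp add: mult.assoc)
    finally show ?thesis using norm_prod_one_plus_le[of b2' "{1..s}"] by (meson exp_le_cancel_iff order_trans)
  qed
  have "(\<Prod>i\<in>{1..s}. 1 + b2' i) = (\<Prod>i\<in>{1..s}. 1 / (1 + b2 i))" using s by (intro prod.cong refl inv[symmetric]) auto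
  then have inv': "(\<Prod>i\<in>{1..s}. 1 + b2' i) = 1 / (\<Prod>i\<in>{1..s}. 1 + b2 i)" by (simp add: prod_dividef)
  have r8: "\<rho> / 8 <= r" "r < 5 * \<rho> / 8" using r \<rho> by auto
  have "ker m q U z * rr z = of_nat m / ((?Q - 1) * z) * (1 / ?Q) * (\<Prod>j\<in>{1..N}. 1 + b1 j)
     * (\<Prod>i\<in>{1..s}. 1 + b3 i) / (\<Prod>i\<in>{1..s}. 1 + b2 i)" unfolding b1_def b2_def b3_def by (rule A_product[OF z r8 ne])
  also have "... = of_nat m / ((?Q - 1) * z) * (1 / ?Q) * (\<Prod>j\<in>{1..N}. 1 + b1 j) * (\<Prod>i\<in>{1..s}. 1 + b3 i) * (\<Prod>i\<in>{1..s}. 1 + b2' i)"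
    unfolding inv' by (simp only: times_divide_eq_right mult_1_right)
  also have "norm ... = real m / ((q ^ m - 1) * norm z) * (1 / q ^ m) * norm (\<Prod>j\<in>{1..N}. 1 + b1 j)
      * norm (\<Prod>i\<in>{1..s}. 1 + b3 i) * norm (\<Prod>i\<in>{1..s}. 1 + b2' i)"
    using q by (simp only: norm_mult norm_divide norm_Q_minus_1 norm_of_nat norm_one norm_power norm_of_real)
  also have "... <= real m / ((q ^ m - 1) * (\<rho> / 2)) * 1 * exp (real N * (q ^ m - 1) * K)
      * exp (2 * (real N * (q - 1))) * exp (2 * (real N * (q - 1) * K))"
  proof (intro mult_mono P1 P2 P3)
    show "real m / ((q ^ m - 1) * norm z) <= real m / ((q ^ m - 1) * (\<rho> / 2))"
      using Q_gt_1 zr \<rho> by (intro divide_left_mono mult_left_mono mult_pos_pos) auto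
    show "1 / q ^ m <= 1" using Q_gt_1 by simp
  qed (use Q_gt_1 \<rho> in \<open>auto intro!: mult_nonneg_nonneg\<close>)
  finally show ?thesis by (simp add: exp_add mult_ac)
qed

end

section \<open>Periodic weights\<close>

lemma geom_sum_eventually_nonzero:
  fixes u v :: complex
  assumes "geom_sum m v u ~= 0"
  shows "\<forall>\<^sub>F \<rho> in at_right 0. \<forall>z\<in>ball u \<rho>. \<forall>w\<in>ball v \<rho>. geom_sum m w z ~= 0"
proof -
  let ?S = "{p. geom_sum m (snd p) (fst p) ~= (0::complex)}"
  have "open ?S" unfolding geom_sum_def by (intro open_Collect_neq continuous_intros)
  moreover have "(u, v) \<in> ?S" using assms by simp
  ultimately obtain A B where AB: "open A" "open B" "(u, v) \<in> A \<times> B" "A \<times> B \<subseteq> ?S" by (rule open_prod_elim)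
  obtain d1 where d1: "0 < d1" "ball u d1 \<subseteq> A" using AB by (auto elim: openE)
  obtain d2 where d2: "0 < d2" "ball v d2 \<subseteq> B" using AB by (auto elim: openE)
  have "\<forall>\<^sub>F \<rho> in at_right 0. \<rho> \<in> {0<..<min d1 d2}" using d1 d2 by (intro eventually_at_right_real) auto
  then show ?thesis
  proof eventually_elim
    case (elim \<rho>)
    show ?case
    proof (intro ballI)
      fix z w assume "z \<in> ball u \<rho>" "w \<in> ball v \<rho>"
      then have "(z, w) \<in> A \<times> B" using d1(2) d2(2) elim by auto
      then show "geom_sum m w z ~= 0" using AB(4) by auto
    qed
  qed
qed

text \<open>All conditions hold for small radii. Injectivity of the power map reduces to
  \<open>geom_sum\<close> being nonzero, an open condition that holds at any two positive centres,
  equal ones included.\<close>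

lemma discs_eventually:
  fixes c :: "nat => real"
  assumes m: "1 <= m" and pos: "!!k. k \<in> {1..n} ==> 0 < c k" and inj: "inj_on c {1..n}"
  shows "\<forall>\<^sub>F \<rho> in at_right 0. discs m n c \<rho>"
proof -
  have 1: "\<forall>\<^sub>F \<rho> :: real in at_right 0. 0 < \<rho>" by (rule eventually_at_right_less)
  have 2: "\<forall>\<^sub>F \<rho> in at_right 0. \<forall>k\<in>{1..n}. \<forall>l\<in>{1..n}. k ~= l --> \<rho> < \<bar>c k - c l\<bar> / 2"
  proof (intro eventually_ball_finite ballI finite_atLeastAtMost)
    fix k l assume kl: "k \<in> {1..n}" "l \<in> {1..n}"
    show "\<forall>\<^sub>F \<rho> in at_right 0. k ~= l --> \<rho> < \<bar>c k - c l\<bar> / 2"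
    proof (cases "k = l")
      case False
      then have "c k ~= c l" using inj_on_eq_iff[OF inj kl] by simp
      then have "0 < \<bar>c k - c l\<bar> / 2" by simp
      then show ?thesis using eventually_at_right_real[of 0 "\<bar>c k - c l\<bar> / 2"] by (auto elim: eventually_mono)
    qed simp
  qed
  have 3: "\<forall>\<^sub>F \<rho> in at_right 0. \<forall>k\<in>{1..n}. \<rho> < c k"
  proof (intro eventually_ball_finite ballI finite_atLeastAtMost)
    fix k assume "k \<in> {1..n}"
    then show "\<forall>\<^sub>F \<rho> in at_right 0. \<rho> < c k" by (intro eventually_mono[OF eventually_at_right_real[OF pos]]) auto
  qed
  have 4: "\<forall>\<^sub>F \<rho> in at_right 0. \<forall>k\<in>{1..n}. \<forall>l\<in>{1..n}. \<forall>z\<in>ball (complex_of_real (c k)) \<rho>.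
      \<forall>w\<in>ball (complex_of_real (c l)) \<rho>. geom_sum m w z ~= 0"
  proof (intro eventually_ball_finite ballI finite_atLeastAtMost geom_sum_eventually_nonzero)
    fix k l assume kl: "k \<in> {1..n}" "l \<in> {1..n}"
    have "0 < geom_sum m (c l) (c k)" unfolding geom_sum_def using m pos kl
      by (intro sum_pos mult_pos_pos zero_less_power) (auto simp: lessThan_empty_iff)
    moreover have "geom_sum m (complex_of_real (c l)) (complex_of_real (c k)) = of_real (geom_sum m (c l) (c k))"
      by (rule geom_sum_of_real)
    ultimately show "geom_sum m (complex_of_real (c l)) (complex_of_real (c k)) ~= 0" by simp
  qed
  show ?thesis using 1 2 3 4
  proof eventually_elim
    case (elim \<rho>)
    show ?case
    proof
      show "1 <= m" "0 < \<rho>" using m elim by auto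
    next
      fix k l assume kl: "k \<in> {1..n}" "l \<in> {1..n}" "k ~= l"
      then have "\<rho> < \<bar>c k - c l\<bar> / 2" using elim by blast
      moreover have "dist (complex_of_real (c k)) (of_real (c l)) = \<bar>c k - c l\<bar>"
        by (metis dist_norm norm_of_real of_real_diff real_norm_def)
      ultimately show "ball (complex_of_real (c k)) \<rho> \<inter> ball (complex_of_real (c l)) \<rho> = {}" by (intro disjoint_ballI) simp
    next
      fix k z assume k: "k \<in> {1..n}" "z \<in> ball (complex_of_real (c k)) \<rho>"
      then have "\<bar>Re (of_real (c k) - z)\<bar> < \<rho>" using abs_Re_le_cmod[of "of_real (c k) - z"] by (simp add: dist_norm)
      moreover have "\<rho> < c k" using elim k by blast
      ultimately show "0 < Re z" by simp
    next
      fix k l z w assume kl: "k \<in> {1..n}" "l \<in> {1..n}" "z \<in> ball (complex_of_real (c k)) \<rho>"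
        "w \<in> ball (complex_of_real (c l)) \<rho>" "z ^ m = w ^ m"
      then have "geom_sum m w z ~= 0" using elim by blast
      moreover have "(z - w) * geom_sum m w z = 0" using geom_sum_eq[of z w m] kl(5) by simp
      ultimately show "z = w" by simp
    qed
  qed
qed

lemma etac_eventually:
  assumes "0 < u" "0 < T" "\<bar>eta T m u\<bar> < R"
  shows "\<forall>\<^sub>F \<rho> in at_right 0. \<forall>z\<in>ball (complex_of_real u) \<rho>. norm (etac T m z) <= R"
proof -
  have "isCont (etac T m) (complex_of_real u)" unfolding etac_def[abs_def] using assms by (intro continuous_intros) auto
  then obtain d where d: "0 < d" "!!z. dist z (complex_of_real u) < d ==> dist (etac T m z) (etac T m (of_real u)) < R - \<bar>eta T m u\<bar>"
    using assms(3) unfolding continuous_at_eps_delta by (metis diff_gt_0_iff_gt)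
  have "\<forall>\<^sub>F \<rho> in at_right 0. \<rho> \<in> {0<..<d}" by (rule eventually_at_right_real[OF d(1)])
  then show ?thesis
  proof eventually_elim
    case (elim \<rho>)
    show ?case
    proof
      fix z assume "z \<in> ball (complex_of_real u) \<rho>"
      then have "dist (etac T m z) (etac T m (of_real u)) < R - \<bar>eta T m u\<bar>" using elim by (intro d(2)) (auto simp: dist_commute)
      moreover have "norm (etac T m (complex_of_real u)) = \<bar>eta T m u\<bar>" by (simp add: etac_of_real)
      ultimately show "norm (etac T m z) <= R"
        using norm_triangle_sub[of "etac T m z" "etac T m (of_real u)"] by (simp add: dist_norm)
    qed
  qed
qed

locale periodic_staircase =
  fixes m n :: nat and a :: "nat => nat" and x y :: "nat => real"
    and \<Omega> :: "nat => nat => nat" and lam1 :: "nat => nat" and \<alpha> \<kappa> :: real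
  assumes m_pos: "1 <= m" and n_pos: "1 <= n"
    and a01: "!!i. 1 <= i ==> a i \<in> {0, 1}"
    and xy_pos: "!!i. 1 <= i ==> 0 < x i \<and> 0 < y i"
    and periodic: "!!i j. 1 <= i ==> 1 <= j ==> i mod n = j mod n ==> x i = x j \<and> y i = y j \<and> a i = a j"
    and decreasing: "!!i j. 1 <= i ==> j <= n ==> i < j ==> x j < x i"
    and \<Omega>_start: "!!N. 2 <= N ==> \<Omega> N 1 = 1 \<and> strict_mono_on {1..N} (\<Omega> N)"
    and boundary: "!!N. 2 <= N ==> boundary_partition N (\<Omega> N) = lam1 N # map (%j. (m - 1) * (N - j)) [2..<N + 1]"
    and lam1_ge: "!!N. 2 <= N ==> (m - 1) * (N - 2) <= lam1 N"
    and \<alpha>: "1 < \<alpha>" and lam1_asymp: "(%N. real (lam1 N) - \<alpha> * real N) \<in> O(%_. 1)"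
    and \<kappa>: "0 < \<kappa>" "\<kappa> < 1"
begin

lemma representative:
  assumes "1 <= i"
  obtains k where "k \<in> {1..n}" "k mod n = i mod n" "x i = x k"
proof -
  define k where "k = (if i mod n = 0 then n else i mod n)"
  have k: "k \<in> {1..n}" "k mod n = i mod n" using n_pos by (auto simp: k_def less_imp_le)
  then have "x i = x k" using periodic[of i k] assms by auto
  then show thesis using that k by blast
qed

lemma x_bounds:
  assumes "1 <= i"
  shows "x n <= x i" "x i <= x 1"
proof -
  obtain k where k: "k \<in> {1..n}" "x i = x k" using representative[OF assms] by blast
  show "x n <= x i" using decreasing[of k n] k by (cases "k = n") auto
  show "x i <= x 1" using decreasing[of 1 k] k by (cases "k = 1") auto
qed

lemma inj_x: "inj_on x {1..n}"
proof (rule linorder_inj_onI')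
  fix i j assume "i \<in> {1..n}" "j \<in> {1..n}" "i < j"
  then show "x i ~= x j" using decreasing[of i j] by auto
qed

definition lev :: "nat => nat" where "lev N = nat \<lfloor>\<kappa> * real N\<rfloor>"

definition M :: "nat => nat" where "M N = N - lev N"

text \<open>The position of the rightmost vertex of row \<open>1\<close>, counted from
  \<open>0\<close>.\<close>

definition l1 :: "nat => nat" where "l1 N = lam1 N + N - 1"

text \<open>With this value \<open>T * u ^ m\<close> is at least \<open>2\<close> for every weight,
  perturbed upwards or not, so all nodes lie in \<open>[1 / 2, 1)\<close>.\<close>

definition T :: real where "T = 2 / x n ^ m"

lemma T_pos: "0 < T" using xy_pos[of n] n_pos by (simp add: T_def)

lemma contracting: "2 <= N ==> contracting N (\<Omega> N)" using \<Omega>_start by (intro contracting.intro) auto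

lemma \<Omega>_values:
  assumes N: "2 <= N"
  shows "1 <= i ==> i < N ==> \<Omega> N i = Suc (m * (i - 1))" "\<Omega> N N = lam1 N + N"
proof -
  interpret contracting N "\<Omega> N" by (rule contracting[OF N])
  have eq: "\<Omega> N (N - k) - (N - k) = (lam1 N # map (%j. (m - 1) * (N - j)) [2..<N + 1]) ! k" if "k < N" for k
  proof -
    have "boundary_partition N (\<Omega> N) ! k = \<Omega> N (rev [1..<N + 1] ! k) - rev [1..<N + 1] ! k"
      using that by (simp add: boundary_partition_def del: upt_Suc)
    also have "rev [1..<N + 1] ! k = N - k" using that by (simp add: rev_nth del: upt_Suc)
    finally show ?thesis using boundary[OF N] by simp
  qed
  show "\<Omega> N N = lam1 N + N" using eq[of 0] \<Omega>_ge[of N] N by simp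
  show "\<Omega> N i = Suc (m * (i - 1))" if i: "1 <= i" "i < N"
  proof -
    obtain j where j: "N - i = Suc j" using i by (cases "N - i") auto
    have "N - (N - i) = i" using i by simp
    then have "\<Omega> N i - i = (m - 1) * (N - [2..<N + 1] ! j)" using eq[of "N - i"] i j by (simp del: upt_Suc)
    also have "[2..<N + 1] ! j = 2 + j" using i j by (subst nth_upt) auto
    also have "N - (2 + j) = i - 1" using i j by auto
    finally have 1: "\<Omega> N i - i = (m - 1) * (i - 1)" by simp
    obtain m' where "m = Suc m'" using m_pos by (cases m) auto
    then show ?thesis using 1 \<Omega>_ge[of i] i by (cases i) auto
  qed
qed

lemma l1_gt:
  assumes "2 <= N"
  shows "m * (N - 2) < l1 N"
proof -
  obtain m' where "m = Suc m'" using m_pos by (cases m) auto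
  then show ?thesis using lam1_ge[OF assms] assms by (simp add: l1_def)
qed

lemma staircase_perturbed:
  assumes N: "2 <= N" and x': "!!i. i \<in> {1..N} ==> x i <= x' i"
  shows "weighted_staircase N (\<Omega> N) x' y m (l1 N) T"
proof -
  interpret contracting N "\<Omega> N" by (rule contracting[OF N])
  have x'': "x n <= x' i \<and> 0 < x n" if "i \<in> {1..N}" for i using x'[OF that] x_bounds(1)[of i] xy_pos[of n] n_pos that by auto
  show ?thesis
  proof unfold_locales
    fix i assume i: "i \<in> {1..N}"
    show "0 < x' i \<and> 0 < y i" using x''[OF i] xy_pos[of i] i by auto
    have "T * x n ^ m <= T * x' i ^ m" using x''[OF i] T_pos by (intro mult_left_mono power_mono) auto
    moreover have "T * x n ^ m = 2" using x''[OF i] by (simp add: T_def)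
    ultimately show "1 < T * x' i ^ m" by linarith
  next
    show "\<Omega> N N = Suc (l1 N)" using \<Omega>_values(2)[OF N] N by (simp add: l1_def)
  qed (use m_pos T_pos \<Omega>_values(1)[OF N] l1_gt[OF N] in auto)
qed

lemma lam1_le: "\<forall>\<^sub>F N in sequentially. real (lam1 N) <= (\<alpha> + 1) * real N"
proof -
  obtain b where "\<forall>\<^sub>F N in sequentially. norm (real (lam1 N) - \<alpha> * real N) <= b * norm (1::real)"
    using lam1_asymp by (auto elim: landau_o.bigE)
  moreover have "\<forall>\<^sub>F N in sequentially. b <= real N" using filterlim_real_sequentially by (simp add: filterlim_at_top)
  ultimately show ?thesis by eventually_elim (auto simp: algebra_simps abs_le_iff)
qed

text \<open>The node of the largest weight, and in \<open>e1\<close> the node of its double.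
  Slightly enlarged copies of \<open>x 1\<close> have their nodes in between; they form a fixed
  fraction of all nodes, as \<open>Phi_insert_le\<close> demands.\<close>

definition e0 :: real where "e0 = eta T m (x 1)"
definition e1 :: real where "e1 = eta T m (2 * x 1)"
text \<open>\<open>\<alpha> + 5\<close> bounds the numerator of Euler's relation per row,
  \<open>2 * real n\<close> compensates the fraction \<open>1 / n\<close> of good nodes with
  rounding, and \<open>1 - e1\<close> is the distance of these nodes from \<open>1\<close>.\<close>

definition C :: real where "C = (\<alpha> + 5) * (2 * real n) / (1 - e1)"
text \<open>Above the nodes of all weights and below \<open>1\<close>, yet so close to
  \<open>e0\<close> that the absorption in \<open>Phi_insert_le'\<close> works.\<close>

definition R :: real where "R = e0 + min (1 / (2 * C)) ((1 - e0) / 2)"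

lemma Tx_ge: "x n <= u ==> 2 <= T * u ^ m"
proof -
  assume u: "x n <= u"
  have x0: "0 < x n" using xy_pos[of n] n_pos by simp
  then have "T * x n ^ m <= T * u ^ m" using u T_pos by (intro mult_left_mono power_mono) auto
  then show ?thesis using x0 by (simp add: T_def)
qed

lemma eta_mono: "x n <= u ==> u <= v ==> eta T m u <= eta T m v"
proof -
  assume u: "x n <= u" "u <= v"
  have x0: "0 < x n" using xy_pos[of n] n_pos by simp
  have "0 < T * u ^ m" using Tx_ge[OF u(1)] by linarith
  moreover have "T * u ^ m <= T * v ^ m" using u x0 T_pos by (intro mult_left_mono power_mono) auto
  ultimately show ?thesis by (simp add: eta_def frac_le)
qed

lemma eta_bounds: "x n <= u ==> 0 <= eta T m u" "x n <= u ==> eta T m u < 1" using Tx_ge[of u] by (auto simp: eta_def divide_le_eq)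

lemma constants: "0 <= e0" "e0 <= e1" "e1 < 1" "0 < C" "e0 < R" "R < 1" "(R - e0) * C <= 1 / 2"
proof -
  have x1: "x n <= x 1" "0 < x 1" using x_bounds(1)[of 1] xy_pos[of 1] by auto
  show e: "0 <= e0" "e0 <= e1" "e1 < 1" unfolding e0_def e1_def using x1 by (auto intro!: eta_mono eta_bounds)
  show C: "0 < C" unfolding C_def using e \<alpha> n_pos by (intro divide_pos_pos mult_pos_pos) auto
  have "R <= e0 + (1 - e0) / 2" unfolding R_def by (intro add_left_mono min.cobounded2)
  then show "R < 1" using e by argo
  show "e0 < R" using e C by (simp add: R_def)
  have "(R - e0) * C <= (1 / (2 * C)) * C" using C by (intro mult_right_mono) (auto simp: R_def)
  then show "(R - e0) * C <= 1 / 2" using C by simp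
qed

lemma radius_exists:
  obtains \<rho> where "discs m n x \<rho>" "!!k z. k \<in> {1..n} ==> z \<in> ball (complex_of_real (x k)) \<rho> ==> norm (etac T m z) <= R"
proof -
  have "\<forall>\<^sub>F \<rho> in at_right 0. discs m n x \<rho>" by (rule discs_eventually[OF m_pos _ inj_x]) (use xy_pos in auto)
  moreover have "\<forall>\<^sub>F \<rho> in at_right 0. \<forall>k\<in>{1..n}. \<forall>z\<in>ball (complex_of_real (x k)) \<rho>. norm (etac T m z) <= R"
  proof (intro eventually_ball_finite ballI finite_atLeastAtMost etac_eventually T_pos)
    fix k assume k: "k \<in> {1..n}"
    then show "0 < x k" using xy_pos by auto
    have "0 <= eta T m (x k)" "eta T m (x k) <= e0" unfolding e0_def using k x_bounds[of k] by (auto intro!: eta_mono eta_bounds)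
    then show "\<bar>eta T m (x k)\<bar> < R" using constants by simp
  qed
  ultimately have ev: "\<forall>\<^sub>F \<rho> in at_right 0. discs m n x \<rho> \<and> (\<forall>k\<in>{1..n}. \<forall>z\<in>ball (complex_of_real (x k)) \<rho>. norm (etac T m z) <= R)"
    by eventually_elim blast
  from eventually_happens'[OF trivial_limit_at_right_real ev] show thesis using that by blast
qed

lemma card_high:
  assumes x': "!!i. i \<in> {1..N} ==> x i <= x' i \<and> x' i <= 2 * x i"
  shows "N div n <= card {i \<in> {1..N}. e0 <= eta T m (x' i) \<and> eta T m (x' i) <= e1}"
proof -
  \<comment> \<open>Indices congruent to \<open>1\<close> modulo \<open>n\<close> carry the largest
    weight.\<close>
  have "(%k. Suc (n * k)) ` {..<N div n} \<subseteq> {i \<in> {1..N}. e0 <= eta T m (x' i) \<and> eta T m (x' i) <= e1}"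
  proof safe
    fix k assume k: "k < N div n"
    have "n * Suc k <= n * (N div n)" using k by (intro mult_left_mono) auto
    also have "... <= N" by simp
    finally have le: "Suc (n * k) <= N" using n_pos by simp
    then show i: "Suc (n * k) \<in> {1..N}" by auto
    have eq: "x (Suc (n * k)) = x 1" using periodic[of "Suc (n * k)" 1] by (simp add: mod_Suc)
    have "x n <= x 1" "x 1 <= x' (Suc (n * k))" "x' (Suc (n * k)) <= 2 * x 1" using x'[OF i] eq x_bounds(1)[of 1] by auto
    then show "e0 <= eta T m (x' (Suc (n * k)))" "eta T m (x' (Suc (n * k))) <= e1"
      unfolding e0_def e1_def by (auto intro!: eta_mono)
  qed
  then have "card ((%k. Suc (n * k)) ` {..<N div n}) <= card {i \<in> {1..N}. e0 <= eta T m (x' i) \<and> eta T m (x' i) <= e1}"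
    by (intro card_mono) auto
  moreover have "inj_on (%k. Suc (n * k)) {..<N div n}" using n_pos by (auto simp: inj_on_def)
  ultimately show ?thesis by (simp add: card_image)
qed

lemma C_bound:
  "\<forall>\<^sub>F N in sequentially. 0 < N div n \<and> real (l1 N - m * (N - 2)) / real m + real N + 1 <= C * (real (N div n) * (1 - e1))"
  using lam1_le eventually_ge_at_top[of "n + 2"]
proof eventually_elim
  case (elim N)
  have p: "0 < N div n" using elim n_pos by (simp add: div_greater_zero_iff)
  have "n * 1 <= n * (N div n)" using p by (intro mult_le_mono) auto
  moreover have "N mod n < n" using n_pos by simp
  moreover have "n * (N div n) + N mod n = N" by simp
  \<comment> \<open>Rounding loses at most a factor \<open>2\<close> as soon as one full period
    fits.\<close>
  ultimately have "N <= 2 * n * (N div n)" by linarith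
  then have "real N <= real (2 * n * (N div n))" by (rule of_nat_mono)
  then have 1: "real N <= 2 * real n * real (N div n)" by simp
  have "real (l1 N - m * (N - 2)) / real m <= real (l1 N - m * (N - 2)) / 1" using m_pos by (intro divide_left_mono) auto
  also have "... <= real (lam1 N) + real N" by (simp add: l1_def)
  finally have "real (l1 N - m * (N - 2)) / real m + real N + 1 <= (\<alpha> + 5) * real N" using elim by (simp add: algebra_simps)
  also have "... <= (\<alpha> + 5) * (2 * real n * real (N div n))" using 1 \<alpha> by (intro mult_left_mono) auto
  also have "... = C * (real (N div n) * (1 - e1))" using constants(3) by (simp add: C_def field_simps)
  finally show ?case using p by blast
qed

section \<open>Asymptotics of the level\<close>

lemma lev_bounds:
  "\<forall>\<^sub>F N in sequentially. 2 <= N \<and> 1 <= lev N \<and> lev N < N"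
proof -
  have "\<forall>\<^sub>F N in sequentially. 1 / \<kappa> <= real N" using filterlim_real_sequentially by (simp add: filterlim_at_top)
  with eventually_ge_at_top[of 2] show ?thesis
  proof eventually_elim
    case (elim N)
    have "1 <= \<kappa> * real N" using elim \<kappa> by (simp add: divide_le_eq mult.commute)
    then have f: "1 <= \<lfloor>\<kappa> * real N\<rfloor>" by simp
    have "\<kappa> * real N < real N" using elim \<kappa> by simp
    then have "\<lfloor>\<kappa> * real N\<rfloor> < int N" by (simp add: floor_less_iff)
    then show ?case using f elim by (auto simp: lev_def nat_less_iff le_nat_iff)
  qed
qed

lemma lev_tendsto: "(%N. real (lev N) / real N) \<longlonglongrightarrow> \<kappa>"
proof -
  have "(%N. real_of_int \<lfloor>\<kappa> * real N\<rfloor> / real N) \<longlonglongrightarrow> \<kappa>"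
  proof (rule tendsto_sandwich[of "%N. \<kappa> - 1 / real N" _ _ "%N. \<kappa>"])
    show "\<forall>\<^sub>F N in sequentially. \<kappa> - 1 / real N <= real_of_int \<lfloor>\<kappa> * real N\<rfloor> / real N" using eventually_gt_at_top[of 0]
    proof eventually_elim
      case (elim N)
      have "\<kappa> * real N - 1 <= real_of_int \<lfloor>\<kappa> * real N\<rfloor>" by linarith
      then have "(\<kappa> * real N - 1) / real N <= real_of_int \<lfloor>\<kappa> * real N\<rfloor> / real N" by (intro divide_right_mono) auto
      then show ?case using elim by (simp add: diff_divide_distrib)
    qed
    show "\<forall>\<^sub>F N in sequentially. real_of_int \<lfloor>\<kappa> * real N\<rfloor> / real N <= \<kappa>" using eventually_gt_at_top[of 0]
    proof eventually_elim
      case (elim N)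
      have "real_of_int \<lfloor>\<kappa> * real N\<rfloor> <= \<kappa> * real N" by linarith
      then show ?case using elim by (simp add: field_simps)
    qed
    show "(%N. \<kappa> - 1 / real N) \<longlonglongrightarrow> \<kappa>" using tendsto_diff[OF tendsto_const lim_1_over_n, of \<kappa>] by simp
  qed simp
  moreover have "real (lev N) = real_of_int \<lfloor>\<kappa> * real N\<rfloor>" for N using \<kappa> by (simp add: lev_def)
  ultimately show ?thesis by simp
qed

lemma M_ratio: "(%N. real (M N) / real N) \<longlonglongrightarrow> 1 - \<kappa>"
proof (rule Lim_transform_eventually)
  show "(%N. 1 - real (lev N) / real N) \<longlonglongrightarrow> 1 - \<kappa>" by (intro tendsto_intros lev_tendsto)
  show "\<forall>\<^sub>F N in sequentially. 1 - real (lev N) / real N = real (M N) / real N"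
    using lev_bounds by eventually_elim (auto simp: M_def of_nat_diff field_simps)
qed

lemma N_over_M: "(%N. real N / real (M N)) \<longlonglongrightarrow> 1 / (1 - \<kappa>)" using tendsto_inverse[OF M_ratio] \<kappa> by (simp add: inverse_eq_divide)

lemma lev_over_M: "(%N. real (lev N) / real (M N)) \<longlonglongrightarrow> \<kappa> / (1 - \<kappa>)"
proof (rule Lim_transform_eventually)
  show "(%N. real (lev N) / real N * (real N / real (M N))) \<longlonglongrightarrow> \<kappa> / (1 - \<kappa>)" using tendsto_mult[OF lev_tendsto N_over_M] by simp
  show "\<forall>\<^sub>F N in sequentially. real (lev N) / real N * (real N / real (M N)) = real (lev N) / real (M N)"
    using lev_bounds by eventually_elim auto
qed

lemma M_at_top: "filterlim (%N. real (M N)) at_top sequentially"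
proof -
  have "filterlim (%N. real (M N) / real N * real N) at_top sequentially"
    by (rule filterlim_tendsto_pos_mult_at_top[OF M_ratio _ filterlim_real_sequentially]) (use \<kappa> in simp)
  moreover have "\<forall>\<^sub>F N in sequentially. real (M N) / real N * real N = real (M N)"
    using eventually_gt_at_top[of 0] by eventually_elim simp
  ultimately show ?thesis by (simp cong: filterlim_cong)
qed

end

context discs
begin

text \<open>Dominated convergence for the pulled back integrals; a uniform bound together with
  pointwise convergence on the circles is enough.\<close>

lemma circ_tendsto:
  assumes r: "0 < r" and cont: "\<forall>\<^sub>F N in sequentially. continuous_on (Sph r) (f N)"
    and bd: "\<forall>\<^sub>F N in sequentially. \<forall>z\<in>Sph r. norm (f N z) <= B"
    and lim: "!!z. z \<in> Sph r ==> (%N. f N z) \<longlonglongrightarrow> g z"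
  shows "(%N. circ r (f N)) \<longlonglongrightarrow> circ r g"
proof -
  obtain N0 where N0: "!!N. N0 <= N ==> continuous_on (Sph r) (f N)" "!!N z. N0 <= N ==> z \<in> Sph r ==> norm (f N z) <= B"
    using eventually_conj[OF cont bd] unfolding eventually_sequentially by blast
  have "(%N. contour_integral (circlepath (of_real (c k)) r) (f (N + N0))) \<longlonglongrightarrow> contour_integral (circlepath (of_real (c k)) r) g"
    if k: "k \<in> {1..n}" for k
  proof -
    let ?\<gamma> = "circlepath (complex_of_real (c k)) r"
    let ?d = "%t. vector_derivative ?\<gamma> (at t)"
    have in_S: "?\<gamma> t \<in> Sph r" if "t \<in> {0..1}" for t using path_image_Sph[OF r k] that by (auto simp: path_image_def)
    have nd: "norm (?d t) = 2 * pi * r" if "t \<in> {0..1}" for t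
      using that r by (simp add: vector_derivative_circlepath norm_mult norm_exp_eq_Re)
    show ?thesis unfolding contour_integral_integral
    proof (rule dominated_convergence(2))
      show "(%t. f (N + N0) (?\<gamma> t) * ?d t) integrable_on {0..1}" for N
        using circ_integrable[OF r N0(1)[of "N + N0"] k] by (simp add: contour_integrable_on)
      show "(%t. B * (2 * pi * r)) integrable_on {0..1::real}" by (rule integrable_const_ivl)
      show "norm (f (N + N0) (?\<gamma> t) * ?d t) <= B * (2 * pi * r)" if "t \<in> {0..1}" for N t
        unfolding norm_mult nd[OF that] using N0(2)[OF _ in_S[OF that], of "N + N0"] r by (intro mult_right_mono) auto
      show "(%N. f (N + N0) (?\<gamma> t) * ?d t) \<longlonglongrightarrow> g (?\<gamma> t) * ?d t" if "t \<in> {0..1}" for t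
        by (intro tendsto_mult_right LIMSEQ_ignore_initial_segment lim in_S that)
    qed
  qed
  then have "(%N. circ r (f (N + N0))) \<longlonglongrightarrow> circ r g" unfolding circ_def by (intro tendsto_sum tendsto_mult_left) auto
  then show ?thesis by (rule LIMSEQ_offset)
qed

end

text \<open>Bounds \<open>cross * J2 - 1\<close>: \<open>x\<close> bounds \<open>cross - 1\<close>,
  \<open>d\<close> the displacement of a node, and \<open>2 * C\<close> and
  \<open>4 * C\<^sup>2\<close> the quotients of \<open>Phi\<close> with one and two inserted
  nodes.\<close>

definition err2 :: "real => real => real => real" where
  "err2 d x C = x * (1 + (4 * d * C + 4 * d\<^sup>2 * C\<^sup>2)) + (4 * d * C + 4 * d\<^sup>2 * C\<^sup>2)"

context disc_staircase
begin

definition S1 :: real where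
  "S1 = (\<Sum>i<N - s. shift1 q s i * (Phi sg (nodes s (dilate q (upper s) i)) / Phi sg (nodes s (upper s))))"

definition S2 :: real where
  "S2 = (\<Sum>i<N - s. shift1 q s i * (\<Sum>k<N - s. shift2 q s i k *
        (Phi sg (nodes s (dilate q (dilate q (upper s) i) k)) / Phi sg (nodes s (upper s)))))"

lemma dimer_moments:
  assumes qt: "q = exp (t / real (N - s))"
  defines "X \<equiv> %D. integral\<^sup>L (counting_measure (level_partition N \<Omega> a s D)) (%v. exp (t * v))"
    and "W \<equiv> dimer_weight x y"
  shows "(\<Sum>D\<in>dimer_configs N \<Omega> a. W D) ~= 0"
    and "(\<Sum>D\<in>dimer_configs N \<Omega> a. W D * X D) / (\<Sum>D\<in>dimer_configs N \<Omega> a. W D) = S1 / real (N - s)"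
    and "(\<Sum>D\<in>dimer_configs N \<Omega> a. W D * (X D)\<^sup>2) / (\<Sum>D\<in>dimer_configs N \<Omega> a. W D) = S2 / (real (N - s))\<^sup>2"
proof -
  obtain Z where Z: "Z ~= 0" "(\<Sum>D\<in>configs (2 * N + 1). weight D) = Z"
    "(\<Sum>D\<in>configs (2 * N + 1). weight D * (\<Sum>l\<in>ups (2 * s + 1) D. q ^ l)) = Z * S1"
    "(\<Sum>D\<in>configs (2 * N + 1). weight D * (\<Sum>l\<in>ups (2 * s + 1) D. q ^ l)\<^sup>2) = Z * S2"
    unfolding S1_def S2_def by (rule shift_moments[OF q s gen])
  have X: "X (link_edge a ` D) = (\<Sum>l\<in>ups (2 * s + 1) D. q ^ l) / real (N - s)" if D: "D \<in> configs (2 * N + 1)" for D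
  proof -
    have "exp (t * (real l / real (N - s))) = q ^ l" for l unfolding qt by (simp add: exp_of_nat_mult[symmetric] mult_ac)
    then show ?thesis unfolding X_def by (subst integral_counting_measure[OF D s]) auto
  qed
  have W: "(\<Sum>D\<in>dimer_configs N \<Omega> a. W D) = Z" using sum_dimers[of "%_. 1"] Z(2) by (simp add: W_def)
  show "(\<Sum>D\<in>dimer_configs N \<Omega> a. W D) ~= 0" using W Z by simp
  have "(\<Sum>D\<in>dimer_configs N \<Omega> a. W D * X D) = (\<Sum>D\<in>configs (2 * N + 1). weight D * (\<Sum>l\<in>ups (2 * s + 1) D. q ^ l)) / real (N - s)"
    unfolding W_def sum_dimers[of X] sum_divide_distrib by (intro sum.cong refl) (simp add: X)
  then show "(\<Sum>D\<in>dimer_configs N \<Omega> a. W D * X D) / (\<Sum>D\<in>dimer_configs N \<Omega> a. W D) = S1 / real (N - s)" using Z W by simp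
  have "(\<Sum>D\<in>dimer_configs N \<Omega> a. W D * (X D)\<^sup>2) = (\<Sum>D\<in>configs (2 * N + 1). weight D * (\<Sum>l\<in>ups (2 * s + 1) D. q ^ l)\<^sup>2) / (real (N - s))\<^sup>2"
    unfolding W_def sum_dimers[of "%D. (X D)\<^sup>2"] sum_divide_distrib by (intro sum.cong refl) (simp add: X power_divide)
  then show "(\<Sum>D\<in>dimer_configs N \<Omega> a. W D * (X D)\<^sup>2) / (\<Sum>D\<in>dimer_configs N \<Omega> a. W D) = S2 / (real (N - s))\<^sup>2" using Z W by simp
qed

text \<open>Every constant is explicit in \<open>N\<close> and \<open>q\<close>, so that the
  estimates can be made uniform when the configuration space varies with \<open>N\<close>.\<close>

lemma moment_bounds:
  fixes K B d C p e e' :: real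
  defines "CA \<equiv> real m / ((q ^ m - 1) * (\<rho> / 2)) * exp (real N * (q ^ m - 1) * K + 2 * (real N * (q - 1)) + 2 * (real N * (q - 1) * K))"
    and "dd \<equiv> (q ^ m - 1) / (T * (\<rho> / 2) ^ m)"
    and "xx \<equiv> (q ^ m - 1)\<^sup>2 * (4 * B\<^sup>2 / d\<^sup>2)"
  assumes P1: "!!z. z \<in> Disc (5 * \<rho> / 8) ==> norm (P1 z) <= 2 * C"
    and P2: "!!z w. z \<in> Disc (5 * \<rho> / 8) ==> w \<in> Disc (5 * \<rho> / 8) ==> norm (P2 z w) <= 4 * C\<^sup>2" and C: "0 < C"
    and d: "0 < d" "!!z w. z \<in> Sph (\<rho> / 4) ==> w \<in> Sph (\<rho> / 2) ==> d <= norm (w ^ m - z ^ m)"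
    and B: "!!z. z \<in> Sph (\<rho> / 4) \<union> Sph (\<rho> / 2) ==> norm z ^ m <= B"
    and Q: "(q ^ m - 1) * B <= d / 2"
    and K1: "!!z j. z \<in> Sph (\<rho> / 4) \<union> Sph (\<rho> / 2) ==> j \<in> {1..N} ==> norm z ^ m <= K * norm (z ^ m - of_real (x j) ^ m)"
    and K2: "!!z j. z \<in> Sph (\<rho> / 4) \<union> Sph (\<rho> / 2) ==> j \<in> {1..N} ==> norm z <= K * norm (z - of_real (x j))"
    and small: "(q - 1) * K <= 1 / 2" and K: "0 <= K"
  shows "z \<in> Sph (\<rho> / 4) \<union> Sph (\<rho> / 2) ==> norm (ker m q U z * rr z) <= CA"
    and "r = \<rho> / 4 \<or> r = \<rho> / 2 ==> norm (of_real S1 - circ r (%z. ker m q U z * rr z)) <= real n * r * (CA * (dd * (2 * C)))"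
    and "norm (of_real S2 - circ (\<rho> / 2) (%z. ker m q U z * rr z) * circ (\<rho> / 4) (%z. ker m q U z * rr z))
      <= real n * (\<rho> / 2) * (CA * (real n * (\<rho> / 4) * (CA * err2 dd xx C)))" (is ?second)
proof -
  let ?S = "Sph (\<rho> / 4) \<union> Sph (\<rho> / 2)"
  have sub: "?S \<subseteq> Disc (5 * \<rho> / 8)" using \<rho> Sph_subset[of "\<rho> / 4" "5 * \<rho> / 8"] Sph_subset[of "\<rho> / 2" "5 * \<rho> / 8"] by auto
  have A: "norm (ker m q U z * rr z) <= CA" if z: "z \<in> ?S" for z unfolding CA_def using z
    by (rule UnE; intro ker_rr_bound[OF _ _ _ K1[OF z] K2[OF z] small K]) (use \<rho> in auto)
  then show "z \<in> ?S ==> norm (ker m q U z * rr z) <= CA" .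
  have CA0: "0 <= CA" unfolding CA_def using Q_gt_1 \<rho> by (intro mult_nonneg_nonneg divide_nonneg_nonneg) auto
  have dd0: "0 <= dd" unfolding dd_def using Q_gt_1 T \<rho> by (intro divide_nonneg_nonneg mult_nonneg_nonneg) auto
  have dl: "norm (dl z) <= dd" if "z \<in> ?S" for z
    unfolding dd_def using that dl_bound[of z "\<rho> / 4"] dl_bound[of z "\<rho> / 2"] \<rho> by auto
  have dP: "norm (dl z * P1 w) <= dd * (2 * C)" if "z \<in> ?S" "w \<in> ?S" for z w
    unfolding norm_mult using that dl[OF that(1)] P1[of w] sub C dd0 by (intro mult_mono) auto
  show "norm (of_real S1 - circ r (%z. ker m q U z * rr z)) <= real n * r * (CA * (dd * (2 * C)))"
    if r: "r = \<rho> / 4 \<or> r = \<rho> / 2"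
  proof -
    have rS: "z \<in> ?S" if "z \<in> Sph r" for z using r that by auto
    have "\<rho> / 8 <= r" "r < 5 * \<rho> / 8" using r \<rho> by auto
    then show ?thesis unfolding S1_def first_moment[OF \<open>\<rho> / 8 <= r\<close> \<open>r < 5 * \<rho> / 8\<close>]
      by (rule first_bound) (use A rS dP CA0 dd0 C in \<open>auto simp: J1_def\<close>)
  qed
  define E where "E = 4 * dd * C + 4 * dd\<^sup>2 * C\<^sup>2"
  have E: "xx * (1 + E) + E = err2 dd xx C" by (simp add: E_def err2_def)
  have E0: "0 <= E" using dd0 C by (simp add: E_def)
  have "norm (cross z w * J2 z w - 1) <= xx * (1 + E) + E" if z: "z \<in> Sph (\<rho> / 4)" and w: "w \<in> Sph (\<rho> / 2)" for z w
  proof -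
    have zw: "z \<in> ?S" "w \<in> ?S" using z w by auto
    have x0: "0 <= xx" by (simp add: xx_def)
    have cr: "norm (cross z w - 1) <= xx" unfolding xx_def by (rule cross_bound[OF d(1) d(2)[OF z w] B[OF zw(1)] B[OF zw(2)] Q])
    have "J2 z w - 1 = dl z * P1 z + dl w * P1 w + dl w * dl z * P2 z w" by (simp add: J2_def algebra_simps)
    also have "norm ... <= norm (dl z * P1 z) + norm (dl w * P1 w) + norm (dl w * dl z * P2 z w)"
      by (intro norm_triangle_le add_mono order_refl norm_triangle_ineq)
    also have "... <= dd * (2 * C) + dd * (2 * C) + dd * dd * (4 * C\<^sup>2)"
    proof (intro add_mono dP zw)
      show "norm (dl w * dl z * P2 z w) <= dd * dd * (4 * C\<^sup>2)"
        unfolding norm_mult using dl zw P2[of z w] sub dd0 by (intro mult_mono mult_nonneg_nonneg) auto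
    qed
    finally have J: "norm (J2 z w - 1) <= E" by (simp add: E_def power2_eq_square mult_ac)
    have J2: "norm (J2 z w) <= 1 + E" using J norm_triangle_sub[of "J2 z w" 1] by simp
    have "cross z w * J2 z w - 1 = (cross z w - 1) * J2 z w + (J2 z w - 1)" by (simp add: algebra_simps)
    also have "norm ... <= norm (cross z w - 1) * norm (J2 z w) + norm (J2 z w - 1)" by (metis norm_mult norm_triangle_ineq)
    also have "... <= xx * (1 + E) + E" using cr J J2 x0 by (intro add_mono mult_mono) auto
    finally show ?thesis .
  qed
  moreover have "0 <= xx * (1 + E) + E" using E0 by (simp add: xx_def)
  ultimately show ?second unfolding S2_def second_moment E[symmetric] by (intro second_bound A CA0) auto
qed

end

section \<open>Exponential moments and their scaling\<close>

context periodic_staircase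
begin

definition cm :: "nat => edge set => real measure" where
  "cm N D = counting_measure (level_partition N (\<Omega> N) a (lev N) D)"

definition X :: "real => nat => edge set => real" where
  "X t N D = integral\<^sup>L (cm N D) (%v. exp (t * v))"

definition avg :: "nat => (nat => real) => (edge set => real) => real" where
  "avg N x' f = (\<Sum>D\<in>dimer_configs N (\<Omega> N) a. dimer_weight x' y D * f D) / (\<Sum>D\<in>dimer_configs N (\<Omega> N) a. dimer_weight x' y D)"

definition F :: "complex => complex" where
  "F z = z * Q_deriv m n a x y \<kappa> z + (\<Sum>j = 1..n. z / (of_nat n * (z - of_real (x j))))"

text \<open>This dilation turns \<open>q ^ l\<close> into the exponential of \<open>t\<close> times
  the rescaled position \<open>l / M\<close>.\<close>

definition q :: "real => nat => real" where "q t N = exp (t / real (M N))"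

lemma Mq: "(%N. real (M N) * (q t N - 1)) \<longlonglongrightarrow> t"
proof -
  have "((%u::real. u * (exp (t / u) - 1)) \<longlongrightarrow> t) at_top" by real_asymp
  from filterlim_compose[OF this M_at_top] show ?thesis by (simp add: q_def)
qed

lemma q_power: "q t N ^ k = q (real k * t) N" by (simp add: q_def exp_of_nat_mult[symmetric])

lemma MQ: "(%N. real (M N) * (q t N ^ m - 1)) \<longlonglongrightarrow> real m * t" unfolding q_power by (rule Mq)

lemma N_times: "(%N. real (M N) * b N) \<longlonglongrightarrow> l ==> (%N. real N * b N) \<longlonglongrightarrow> l / (1 - \<kappa>)"
proof -
  assume "(%N. real (M N) * b N) \<longlonglongrightarrow> l"
  then have "(%N. real N / real (M N) * (real (M N) * b N)) \<longlonglongrightarrow> 1 / (1 - \<kappa>) * l" by (intro tendsto_mult N_over_M)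
  moreover have "\<forall>\<^sub>F N in sequentially. real N / real (M N) * (real (M N) * b N) = real N * b N"
    using lev_bounds by eventually_elim (auto simp: M_def)
  ultimately show ?thesis by (simp add: Lim_transform_eventually)
qed

lemma null_times: "(%N. real (M N) * b N) \<longlonglongrightarrow> l ==> b \<longlonglongrightarrow> 0"
proof -
  assume "(%N. real (M N) * b N) \<longlonglongrightarrow> l"
  from real_tendsto_divide_at_top[OF this M_at_top]
  have "(%N. real (M N) * b N / real (M N)) \<longlonglongrightarrow> 0" .
  moreover have "\<forall>\<^sub>F N in sequentially. real (M N) * b N / real (M N) = b N"
    using lev_bounds by eventually_elim (auto simp: M_def)
  ultimately show ?thesis by (simp add: Lim_transform_eventually)
qed

end

locale perturbed_staircase = periodic_staircase m n a x y \<Omega> lam1 \<alpha> \<kappa> + discs m n x \<rho>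
  for m n a x y \<Omega> lam1 \<alpha> \<kappa> \<rho> +
  fixes t :: real and xp :: "nat => nat => real"
  assumes eta_disc: "!!k z. k \<in> {1..n} ==> z \<in> ball (complex_of_real (x k)) \<rho> ==> norm (etac T m z) <= R"
    and t: "0 < t"
    and xp: "!!N i. i \<in> {1..N} ==> x i <= xp N i \<and> xp N i <= x i + 1 / real N"
    and xp_gen: "\<forall>\<^sub>F N in sequentially. \<forall>i\<in>{1..N}. \<forall>j\<in>{1..N}. \<forall>e\<le>2. q t N ^ e * xp N i = xp N j --> i = j \<and> e = 0"
begin

text \<open>\<open>pow_separation\<close> provides an anonymous constant; choosing it once allows
  the further constants of this locale to be definitions that refer to it.\<close>

definition gam :: real where
  "gam = (SOME \<gamma>. 0 < \<gamma> \<and> (\<forall>z w r r'. z \<in> Sph r --> r <= \<rho> / 2 --> w \<in> Disc r' --> r' <= \<rho> / 2 --> \<gamma> * norm (z - w) <= norm (z ^ m - w ^ m)))"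

lemma gam: "0 < gam" "z \<in> Sph r ==> r <= \<rho> / 2 ==> w \<in> Disc r' ==> r' <= \<rho> / 2 ==> gam * norm (z - w) <= norm (z ^ m - w ^ m)"
proof -
  have "\<exists>\<gamma>. 0 < \<gamma> \<and> (\<forall>z w r r'. z \<in> Sph r --> r <= \<rho> / 2 --> w \<in> Disc r' --> r' <= \<rho> / 2 --> \<gamma> * norm (z - w) <= norm (z ^ m - w ^ m))"
    by (rule pow_separation) (intro exI conjI allI impI)
  from someI_ex[OF this, folded gam_def]
  show "0 < gam" "z \<in> Sph r ==> r <= \<rho> / 2 ==> w \<in> Disc r' ==> r' <= \<rho> / 2 ==> gam * norm (z - w) <= norm (z ^ m - w ^ m)" by blast+
qed

abbreviation qq :: "nat => real" where "qq \<equiv> q t"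

text \<open>\<open>b\<close> bounds the points of the discs, \<open>d\<close> separates
  \<open>m\<close>-th powers across a gap of \<open>\<rho> / 8\<close>, and \<open>K\<close> bounds
  the quotients that occur in the factors of the integrand.\<close>

definition b :: real where "b = x 1 + \<rho>"
definition d :: real where "d = gam * (\<rho> / 8)"
definition K :: real where "K = b ^ m / d + b / (\<rho> / 8)"

lemma b_pos: "0 < b" "0 < d" "0 < K"
proof -
  show b: "0 < b" using xy_pos[of 1] \<rho> by (simp add: b_def)
  show d: "0 < d" using gam(1) \<rho> by (simp add: d_def)
  show "0 < K" unfolding K_def using b d \<rho> by (intro add_pos_pos divide_pos_pos) auto
qed

lemma norm_le_b: "z \<in> Disc r ==> r <= \<rho> ==> norm z <= b" using Disc_norm_le[of z r "x 1"] x_bounds(2) by (fastforce simp: b_def)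

lemma Sph_le_b: "z \<in> Sph r ==> r < \<rho> ==> norm z <= b" using Sph_subset[of r \<rho>] norm_le_b[of z \<rho>] by auto

text \<open>Collects all requirements that \<open>N\<close> be large, so that the finite-size locale
  can be entered under a single hypothesis.\<close>

definition good :: "nat => bool" where
  "good N \<longleftrightarrow> 2 <= N \<and> 1 <= lev N \<and> lev N < N \<and> 1 / real N < \<rho> / 16 \<and> (qq N - 1) * b < \<rho> / 16 \<and>
     (qq N ^ m - 1) * b ^ m <= d / 2 \<and> (qq N - 1) * K <= 1 / 2 \<and>
     (\<forall>i\<in>{1..N}. \<forall>j\<in>{1..N}. \<forall>e\<le>2. qq N ^ e * xp N i = xp N j --> i = j \<and> e = 0) \<and>
     0 < N div n \<and> real (l1 N - m * (N - 2)) / real m + real N + 1 <= C * (real (N div n) * (1 - e1))"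

lemma eventually_good: "\<forall>\<^sub>F N in sequentially. good N"
proof -
  have q0: "(%N. qq N - 1) \<longlonglongrightarrow> 0" by (rule null_times[OF Mq])
  have Q0: "(%N. qq N ^ m - 1) \<longlonglongrightarrow> 0" by (rule null_times[OF MQ])
  have 1: "\<forall>\<^sub>F N in sequentially. 1 / real N < \<rho> / 16"
    using order_tendstoD(2)[OF lim_1_over_n[where 'a = real], of "\<rho> / 16"] \<rho> by simp
  have 2: "\<forall>\<^sub>F N in sequentially. (qq N - 1) * b < \<rho> / 16"
    using order_tendstoD(2)[OF tendsto_mult_left_zero[OF q0], of "\<rho> / 16"] \<rho> by simp
  have 3: "\<forall>\<^sub>F N in sequentially. (qq N ^ m - 1) * b ^ m < d / 2"
    using order_tendstoD(2)[OF tendsto_mult_left_zero[OF Q0], of "d / 2"] b_pos by simp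
  have 4: "\<forall>\<^sub>F N in sequentially. (qq N - 1) * K < 1 / 2"
    using order_tendstoD(2)[OF tendsto_mult_left_zero[OF q0], of "1 / 2"] by simp
  show ?thesis using lev_bounds 1 2 3 4 xp_gen C_bound unfolding good_def by eventually_elim (intro conjI; (assumption | simp))
qed

lemma good_disc_staircase:
  assumes "good N"
  shows "disc_staircase N (\<Omega> N) (xp N) y m (l1 N) T n x \<rho> (lev N) (qq N) R"
proof -
  have g: "2 <= N" "1 <= lev N" "lev N < N" "1 / real N < \<rho> / 16" "(qq N - 1) * b < \<rho> / 16"
     "(qq N ^ m - 1) * b ^ m <= d / 2"
     "!!i j e. i \<in> {1..N} ==> j \<in> {1..N} ==> e <= 2 ==> qq N ^ e * xp N i = xp N j ==> i = j \<and> e = 0"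
    using assms unfolding good_def by blast+
  interpret S: weighted_staircase N "\<Omega> N" a "xp N" y m "l1 N" T
  proof (rule staircase_perturbed[OF g(1)])
    show "x i <= xp N i" if "i \<in> {1..N}" for i using xp[OF that] by blast
  qed
  have q1: "1 < qq N" using g t by (simp add: q_def M_def)
  have Q1: "1 < qq N ^ m" using q1 m_pos by (intro one_less_power) auto
  have xb: "xp N i <= b" "0 < xp N i" if "i \<in> {1..N}" for i
    using xp[OF that] x_bounds(2)[of i] xy_pos[of i] that g(4) \<rho> by (auto simp: b_def)
  have near: "\<exists>k\<in>{1..n}. dist (complex_of_real (x k)) (of_real (xp N i)) < \<rho> / 16" if i: "i \<in> {1..N}" for i
  proof -
    obtain k where k: "k \<in> {1..n}" "x i = x k" using representative[of i] i by auto
    have "dist (complex_of_real (x k)) (of_real (xp N i)) = \<bar>x k - xp N i\<bar>"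
      by (metis dist_norm norm_of_real of_real_diff real_norm_def)
    also have "... < \<rho> / 16" using xp[OF i] k g(4) by auto
    finally show ?thesis using k by blast
  qed
  have qz: "norm (of_real (qq N) * z - z) < \<rho> / 16" if "norm z <= b" for z :: complex
  proof -
    have "norm (of_real (qq N) * z - z) = norm (complex_of_real (qq N - 1) * z)" by (simp add: algebra_simps)
    also have "... = (qq N - 1) * norm z" unfolding norm_mult norm_of_real using q1 by simp
    also have "... <= (qq N - 1) * b" using that q1 by (intro mult_left_mono) auto
    finally show ?thesis using g(5) by linarith
  qed
  show ?thesis
  proof (intro disc_staircase.intro disc_staircase_axioms.intro)
    show "weighted_staircase N (\<Omega> N) (xp N) y m (l1 N) T" by (rule S.weighted_staircase_axioms)
    show "discs m n x \<rho>" by (rule discs_axioms)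
    show "1 <= lev N" "lev N < N" "1 < qq N" "R < 1" using g q1 constants by auto
    show "i = j \<and> e = 0" if "i \<in> {1..N}" "j \<in> {1..N}" "e <= 2" "qq N ^ e * xp N i = xp N j" for i j e by (rule g(7)[OF that])
    show "complex_of_real (xp N i) \<in> Disc (\<rho> / 8)" if i: "i \<in> {1..N}" for i using near[OF i] \<rho> by (force simp: Disc_def)
    show "complex_of_real (qq N * xp N i) \<in> Disc (\<rho> / 4)" if i: "i \<in> {1..N}" for i
    proof -
      obtain k where k: "k \<in> {1..n}" "dist (complex_of_real (x k)) (of_real (xp N i)) < \<rho> / 16" using near[OF i] by blast
      have "dist (complex_of_real (xp N i)) (of_real (qq N * xp N i)) < \<rho> / 16"
        using qz[of "of_real (xp N i)"] xb[OF i] by (simp add: dist_norm norm_minus_commute)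
      moreover have "dist (complex_of_real (x k)) (of_real (qq N * xp N i))
         <= dist (complex_of_real (x k)) (of_real (xp N i)) + dist (complex_of_real (xp N i)) (of_real (qq N * xp N i))"
        by (rule dist_triangle)
      ultimately have "dist (complex_of_real (x k)) (of_real (qq N * xp N i)) < \<rho> / 4" using k \<rho> by linarith
      then show ?thesis using k unfolding Disc_def by auto
    qed
    have in_disc: "of_real (qq N) * z \<in> Disc \<rho>" if z: "z \<in> Disc (5 * \<rho> / 8)" for z
    proof -
      obtain k where k: "k \<in> {1..n}" "dist (complex_of_real (x k)) z < 5 * \<rho> / 8" using z by (auto simp: Disc_def)
      have "norm z <= b" by (rule norm_le_b[OF z]) (use \<rho> in simp)
      then have "dist z (of_real (qq N) * z) < \<rho> / 16" using qz by (simp add: dist_norm norm_minus_commute)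
      then have "dist (complex_of_real (x k)) (of_real (qq N) * z) < \<rho>"
        using dist_triangle[of "complex_of_real (x k)" "of_real (qq N) * z" z] k \<rho> by linarith
      then show ?thesis using k unfolding Disc_def by auto
    qed
    then show "z \<in> Disc (5 * \<rho> / 8) ==> of_real (qq N) * z \<in> Disc \<rho>" for z .
    show "norm (etac T m (of_real (qq N) * z)) <= R" if "z \<in> Disc (5 * \<rho> / 8)" for z
      using in_disc[OF that] eta_disc by (auto simp: Disc_def)
    show "w ^ m ~= (of_real (qq N) * z) ^ m \<and> (of_real (qq N) * w) ^ m ~= z ^ m"
      if z: "z \<in> Disc (3 * \<rho> / 8)" and w: "w \<in> Sph (\<rho> / 2)" for z w
    proof -
      have "\<rho> / 2 - 3 * \<rho> / 8 <= norm (w - z)" by (rule Sph_Disc_dist[OF w z]) (use \<rho> in auto)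
      then have "gam * (\<rho> / 8) <= gam * norm (w - z)" using gam(1) by (intro mult_left_mono) auto
      also have "... <= norm (w ^ m - z ^ m)" by (rule gam(2)[OF w _ z]) (use \<rho> in auto)
      finally have dw: "d <= norm (w ^ m - z ^ m)" by (simp add: d_def)
      have sm: "norm ((of_real (qq N) * u) ^ m - u ^ m) < d" if "norm u <= b" for u :: complex
      proof -
        have "(of_real (qq N) * u) ^ m - u ^ m = complex_of_real (qq N ^ m - 1) * u ^ m"
          by (simp add: power_mult_distrib algebra_simps)
        then have "norm ((of_real (qq N) * u) ^ m - u ^ m) = (qq N ^ m - 1) * norm u ^ m"
          using Q1 by (simp only: norm_mult norm_of_real norm_power)
        also have "... <= (qq N ^ m - 1) * b ^ m" using Q1 that by (intro mult_left_mono power_mono) auto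
        also have "... < d" using g(6) b_pos by linarith
        finally show ?thesis .
      qed
      have "norm z <= b" "norm w <= b" using norm_le_b[OF z] Sph_le_b[OF w] \<rho> by auto
      then show ?thesis using dw sm[of z] sm[of w] by (auto simp: norm_minus_commute)
    qed
  qed
qed

definition A :: "nat => complex => complex" where
  "A N z = of_nat m / ((of_real (qq N) ^ m - 1) * z) * (1 / of_real (qq N) ^ m)
     * (\<Prod>j\<in>{1..N}. 1 + (of_real (qq N) ^ m - 1) * z ^ m / (z ^ m - of_real (xp N j) ^ m))
     * (\<Prod>i\<in>{1..lev N}. 1 + (if a i = 1 then 0 else (of_real (qq N) - 1) * of_real (y i) * z / (1 + of_real (y i) * z)))
     / (\<Prod>i\<in>{1..lev N}. 1 + (of_real (qq N) - 1) * z / (z - of_real (xp N i)))"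

definition CA :: "nat => real" where
  "CA N = real m / ((qq N ^ m - 1) * (\<rho> / 2)) * exp (real N * (qq N ^ m - 1) * K + 2 * (real N * (qq N - 1)) + 2 * (real N * (qq N - 1) * K))"

definition dd :: "nat => real" where "dd N = (qq N ^ m - 1) / (T * (\<rho> / 2) ^ m)"

definition xx :: "nat => real" where "xx N = (qq N ^ m - 1)\<^sup>2 * (4 * (b ^ m)\<^sup>2 / d\<^sup>2)"

text \<open>Both contours have radius at least \<open>\<rho> / 4\<close>, and the perturbed weights
  lie within \<open>\<rho> / 8\<close> of the centres; the gap of \<open>\<rho> / 8\<close> gives
  all four claims.\<close>

lemma xp_distance:
  assumes "good N" and z: "z \<in> Sph r" and r: "r = \<rho> / 4 \<or> r = \<rho> / 2" and j: "j \<in> {1..N}"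
  shows "\<rho> / 8 <= norm (z - of_real (xp N j))"
    and "norm z ^ m <= K * norm (z ^ m - of_real (xp N j) ^ m)" and "norm z <= K * norm (z - of_real (xp N j))"
    and "complex_of_real (qq N) * z ~= of_real (xp N j)"
proof -
  interpret P: disc_staircase N "\<Omega> N" a "xp N" y m "l1 N" T n x \<rho> "lev N" "qq N" R by (rule good_disc_staircase[OF assms(1)])
  have xD: "complex_of_real (xp N j) \<in> Disc (\<rho> / 8)" by (rule P.x_in[OF j])
  have "r - \<rho> / 8 <= norm (z - of_real (xp N j))" by (rule Sph_Disc_dist[OF z xD]) (use r \<rho> in auto)
  then show 1: "\<rho> / 8 <= norm (z - of_real (xp N j))" using r \<rho> by auto
  have "d <= gam * norm (z - of_real (xp N j))" unfolding d_def using 1 gam(1) by (intro mult_left_mono) auto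
  also have "... <= norm (z ^ m - of_real (xp N j) ^ m)" by (rule gam(2)[OF z _ xD]) (use r \<rho> in auto)
  finally have 2: "d <= norm (z ^ m - of_real (xp N j) ^ m)" .
  have zb: "norm z <= b" by (rule Sph_le_b[OF z]) (use r \<rho> in auto)
  have "norm z ^ m <= b ^ m / d * d" using zb b_pos by (simp add: power_mono)
  also have "... <= K * norm (z ^ m - of_real (xp N j) ^ m)" unfolding K_def using 2 b_pos \<rho> by (intro mult_mono) auto
  finally show "norm z ^ m <= K * norm (z ^ m - of_real (xp N j) ^ m)" .
  have "norm z <= b / (\<rho> / 8) * (\<rho> / 8)" using zb \<rho> by simp
  also have "... <= K * norm (z - of_real (xp N j))" unfolding K_def using 1 b_pos \<rho> by (intro mult_mono) auto
  finally show "norm z <= K * norm (z - of_real (xp N j))" .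
  show "complex_of_real (qq N) * z ~= of_real (xp N j)"
  proof
    assume eq: "complex_of_real (qq N) * z = of_real (xp N j)"
    have "norm (z - of_real (xp N j)) = norm (complex_of_real (qq N - 1) * z)"
      unfolding eq[symmetric] by (simp add: algebra_simps norm_minus_commute)
    also have "... = (qq N - 1) * norm z" unfolding norm_mult norm_of_real using P.q by simp
    also have "... <= (qq N - 1) * b" using zb P.q by (intro mult_left_mono) auto
    also have "... < \<rho> / 16" using assms(1) by (simp add: good_def)
    finally show False using 1 \<rho> by linarith
  qed
qed

lemma moments_close:
  assumes g: "good N"
  shows "r = \<rho> / 4 \<or> r = \<rho> / 2 ==> continuous_on (Sph r) (A N)"
    and "z \<in> Sph (\<rho> / 4) \<union> Sph (\<rho> / 2) ==> norm (A N z) <= CA N"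
    and "r = \<rho> / 4 \<or> r = \<rho> / 2 ==>
      norm (of_real (real (M N) * avg N (xp N) (X t N)) - circ r (A N)) <= real n * r * (CA N * (dd N * (2 * C)))"
    and "norm (of_real ((real (M N))\<^sup>2 * avg N (xp N) (%D. (X t N D)\<^sup>2)) - circ (\<rho> / 2) (A N) * circ (\<rho> / 4) (A N))
      <= real n * (\<rho> / 2) * (CA N * (real n * (\<rho> / 4) * (CA N * err2 (dd N) (xx N) C)))" (is ?second)
proof -
  interpret P: disc_staircase N "\<Omega> N" a "xp N" y m "l1 N" T n x \<rho> "lev N" "qq N" R by (rule good_disc_staircase[OF g])
  have gN: "0 < N div n" "real (l1 N - m * (N - 2)) / real m + real N + 1 <= C * (real (N div n) * (1 - e1))"
    "1 / real N < \<rho> / 16" "(qq N - 1) * K <= 1 / 2" "(qq N ^ m - 1) * b ^ m <= d / 2" "lev N < N"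
    using g unfolding good_def by blast+
  have A: "ker m (qq N) P.U z * P.rr z = A N z" if "z \<in> Sph r" "r = \<rho> / 4 \<or> r = \<rho> / 2" for z r
    unfolding A_def by (rule P.A_product[OF that(1)]) (use that \<rho> xp_distance(4)[OF g that] in auto)
  have card: "N div n <= card {i \<in> {1..N}. e0 <= eta T m (xp N i) \<and> eta T m (xp N i) <= e1}"
  proof (rule card_high)
    fix i assume i: "i \<in> {1..N}"
    obtain k where k: "k \<in> {1..n}" "x i = x k" using representative[of i] i by auto
    then have "\<rho> <= x i" using center_ge by simp
    then show "x i <= xp N i \<and> xp N i <= 2 * x i" using xp[OF i] gN(3) \<rho> by auto
  qed
  have e: "0 <= e0" "e0 <= e1" "e1 < 1" "e0 <= R" "(R - e0) * C <= 1 / 2" using constants by auto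
  have Cb: "P.sg + real N + 1 <= C * (real (N div n) * (1 - e1))" using gN(2) by (simp add: P.sg_def)
  have P1: "norm (P.P1 z) <= 2 * C" if "z \<in> Disc (5 * \<rho> / 8)" for z by (rule P.P_bounds(1)[OF e gN(1) card Cb that that])
  have P2: "norm (P.P2 z w) <= 4 * C\<^sup>2" if "z \<in> Disc (5 * \<rho> / 8)" "w \<in> Disc (5 * \<rho> / 8)" for z w
    by (rule P.P_bounds(2)[OF e gN(1) card Cb that])
  have d': "d <= norm (w ^ m - z ^ m)" if z: "z \<in> Sph (\<rho> / 4)" and w: "w \<in> Sph (\<rho> / 2)" for z w
  proof -
    have z': "z \<in> Disc (3 * \<rho> / 8)" using Sph_subset[of "\<rho> / 4" "3 * \<rho> / 8"] z \<rho> by auto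
    have "\<rho> / 2 - 3 * \<rho> / 8 <= norm (w - z)" by (rule Sph_Disc_dist[OF w z']) (use \<rho> in auto)
    then have "gam * (\<rho> / 8) <= gam * norm (w - z)" using gam(1) by (intro mult_left_mono) auto
    also have "... <= norm (w ^ m - z ^ m)" by (rule gam(2)[OF w _ z']) (use \<rho> in auto)
    finally show ?thesis by (simp add: d_def)
  qed
  have B: "norm z ^ m <= b ^ m" if "z \<in> Sph (\<rho> / 4) \<union> Sph (\<rho> / 2)" for z
    using that Sph_le_b[of z "\<rho> / 4"] Sph_le_b[of z "\<rho> / 2"] \<rho> by (auto intro!: power_mono)
  have K1: "norm z ^ m <= K * norm (z ^ m - of_real (xp N j) ^ m)" and K2: "norm z <= K * norm (z - of_real (xp N j))"
    if "z \<in> Sph (\<rho> / 4) \<union> Sph (\<rho> / 2)" "j \<in> {1..N}" for z j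
    using that xp_distance(2,3)[OF g, of z "\<rho> / 4" j] xp_distance(2,3)[OF g, of z "\<rho> / 2" j] by auto
  have K0: "0 <= K" using b_pos by simp
  note mb = P.moment_bounds[where K = K and B = "b ^ m" and d = d and C = C, folded CA_def dd_def xx_def]
  note facts = P1 P2 constants(4) b_pos(2) d' B gN(5) K1 K2 gN(4) K0
  have circA: "circ r (%z. ker m (qq N) P.U z * P.rr z) = circ r (A N)" if "r = \<rho> / 4 \<or> r = \<rho> / 2" for r
    by (rule circ_cong) (use that \<rho> A in auto)
  show "continuous_on (Sph r) (A N)" if r: "r = \<rho> / 4 \<or> r = \<rho> / 2"
  proof -
    have "continuous_on (Sph r) (%z. ker m (qq N) P.U z * P.rr z)" by (rule P.ker_rr_continuous(1)) (use r \<rho> in auto)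
    then show ?thesis using A r by (simp cong: continuous_on_cong)
  qed
  have mb1: "norm (ker m (qq N) P.U z * P.rr z) <= CA N" if z: "z \<in> Sph (\<rho> / 4) \<union> Sph (\<rho> / 2)" for z
    by (rule mb(1)) (fact facts z)+
  show "norm (A N z) <= CA N" if z: "z \<in> Sph (\<rho> / 4) \<union> Sph (\<rho> / 2)" using mb1[OF z] A[of z "\<rho> / 4"] A[of z "\<rho> / 2"] z by auto
  have Mpos: "real (N - lev N) ~= 0" using gN(6) by simp
  have E1: "P.S1 = real (M N) * avg N (xp N) (X t N)" using P.dimer_moments(2)[OF q_def[unfolded M_def]] Mpos
    by (simp add: avg_def X_def[abs_def] cm_def M_def)
  have E2: "P.S2 = (real (M N))\<^sup>2 * avg N (xp N) (%D. (X t N D)\<^sup>2)" using P.dimer_moments(3)[OF q_def[unfolded M_def]] Mpos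
    by (simp add: avg_def X_def[abs_def] cm_def M_def)
  show "norm (of_real (real (M N) * avg N (xp N) (X t N)) - circ r (A N)) <= real n * r * (CA N * (dd N * (2 * C)))"
    if r: "r = \<rho> / 4 \<or> r = \<rho> / 2" unfolding E1[symmetric] circA[OF r, symmetric] by (rule mb(2)) (fact facts r)+
  show ?second
    unfolding E2[symmetric] circA[OF disjI1[OF refl], symmetric] circA[OF disjI2[OF refl], symmetric] by (rule mb(3)) (fact facts)+
qed

end

section \<open>Pointwise limit of the integrand\<close>

context periodic_staircase
begin

text \<open>The simple poles occur with coefficient \<open>1 / n\<close> outside
  \<open>Q_deriv\<close> and \<open>- 1 / (n * (1 - \<kappa>))\<close> inside. Their sum is
  \<open>- \<kappa> / (n * (1 - \<kappa>))\<close>, the density of the lower rows, matching the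
  denominator of the finite-size product.\<close>

lemma F_eq:
  "F z = of_nat m / (of_nat n * (1 - of_real \<kappa>)) * (\<Sum>j = 1..n. z ^ m / (z ^ m - of_real (x j) ^ m))
     + of_real \<kappa> / (of_nat n * (1 - of_real \<kappa>)) * (\<Sum>j = 1..n. if a j = 1 then 0 else of_real (y j) * z / (1 + of_real (y j) * z))
     - of_real \<kappa> / (of_nat n * (1 - of_real \<kappa>)) * (\<Sum>j = 1..n. z / (z - of_real (x j)))"
proof -
  let ?S1 = "\<Sum>j = 1..n. z ^ m / (z ^ m - complex_of_real (x j) ^ m)" and ?S2 = "\<Sum>j = 1..n. z / (z - complex_of_real (x j))"
  let ?S3 = "\<Sum>j = 1..n. if a j = 1 then 0 else complex_of_real (y j) * z / (1 + of_real (y j) * z)"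
  have zm: "z * z ^ (m - 1) = z ^ m" using m_pos by (cases m) auto
  have 1: "z * (\<Sum>j = 1..n. of_nat m * z ^ (m - 1) / (z ^ m - of_real (x j) ^ m) - 1 / (z - of_real (x j))) = of_nat m * ?S1 - ?S2"
    unfolding sum_distrib_left sum_subtractf[symmetric] zm[symmetric]
    by (intro sum.cong refl) (simp add: right_diff_distrib mult_ac)
  have "z * (\<Sum>i\<in>{i \<in> {1..n}. a i = 0}. complex_of_real (y i) / (1 + of_real (y i) * z))
      = (\<Sum>i\<in>{i \<in> {1..n}. a i = 0}. complex_of_real (y i) * z / (1 + of_real (y i) * z))"
    unfolding sum_distrib_left by (intro sum.cong refl) (simp add: mult_ac)
  also have "... = (\<Sum>i\<in>{1..n}. if a i = 0 then complex_of_real (y i) * z / (1 + of_real (y i) * z) else 0)"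
    by (rule sum.inter_filter) simp
  also have "... = ?S3" using a01 by (intro sum.cong refl) force
  finally have 2: "z * (\<Sum>i\<in>{i \<in> {1..n}. a i = 0}. complex_of_real (y i) / (1 + of_real (y i) * z)) = ?S3" .
  have 3: "(\<Sum>j = 1..n. z / (of_nat n * (z - of_real (x j)))) = ?S2 / of_nat n"
    unfolding sum_divide_distrib by (intro sum.cong refl) simp
  have "F z = 1 / (of_nat n * (1 - of_real \<kappa>)) * (z * (\<Sum>j = 1..n. of_nat m * z ^ (m - 1) / (z ^ m - of_real (x j) ^ m) - 1 / (z - of_real (x j))))
     + of_real \<kappa> / (of_nat n * (1 - of_real \<kappa>)) * (z * (\<Sum>i\<in>{i \<in> {1..n}. a i = 0}. of_real (y i) / (1 + of_real (y i) * z))) + ?S2 / of_nat n"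
    unfolding F_def Q_deriv_def 3 by (simp only: distrib_left mult.left_commute)
  also have "... = 1 / (of_nat n * (1 - of_real \<kappa>)) * (of_nat m * ?S1 - ?S2) + of_real \<kappa> / (of_nat n * (1 - of_real \<kappa>)) * ?S3 + ?S2 / of_nat n"
    unfolding 1 2 ..
  also have "... = of_nat m / (of_nat n * (1 - of_real \<kappa>)) * ?S1 + of_real \<kappa> / (of_nat n * (1 - of_real \<kappa>)) * ?S3
     - of_real \<kappa> / (of_nat n * (1 - of_real \<kappa>)) * ?S2"
  proof -
    have nz: "complex_of_nat n ~= 0" "1 - complex_of_real \<kappa> ~= 0" using n_pos \<kappa> by (auto simp: of_real_eq_1_iff)
    have "1 / (N * k) * (u * S - S') + l / (N * k) * S'' + S' / N = u / (N * k) * S + l / (N * k) * S'' - l / (N * k) * S'"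
      if "N ~= 0" "k ~= 0" "l = 1 - k" for N k u l S S' S'' :: complex unfolding that(3) using that(1,2) by (simp add: field_simps)
    from this[OF nz] show ?thesis by simp
  qed
  finally show ?thesis .
qed

text \<open>\<open>c N\<close> is of order \<open>1 / M N\<close> and the number of factors is of
  order \<open>M N\<close>, so the product tends to the exponential of a density times the average
  over one period.\<close>

lemma product_limit:
  fixes c :: "nat => real" and B :: "nat => nat => complex" and f :: "nat => complex"
  assumes c: "(%N. real (M N) * c N) \<longlonglongrightarrow> l" and k: "(%N. real (k N) / real (M N)) \<longlonglongrightarrow> \<theta>"
    and per: "!!i j. 1 <= i ==> 1 <= j ==> i mod n = j mod n ==> f i = f j"
    and B: "!!\<epsilon>. 0 < \<epsilon> ==> \<forall>\<^sub>F N in sequentially. \<forall>j\<in>{1..k N}. norm (B N j - f j) <= \<epsilon>"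
  shows "(%N. \<Prod>j\<in>{1..k N}. 1 + of_real (c N) * B N j) \<longlonglongrightarrow> exp (of_real l * (of_real \<theta> / of_nat n * (\<Sum>j\<in>{1..n}. f j)))"
proof -
  define Kf where "Kf = (\<Sum>j\<in>{1..n}. norm (f j)) + 1"
  have f: "norm (f i) <= Kf - 1" if i: "1 <= i" for i
  proof -
    obtain j where j: "j \<in> {1..n}" "j mod n = i mod n" using representative[OF i] by metis
    have "f i = f j" using per[of i j] i j by auto
    then show ?thesis using member_le_sum[of j "{1..n}" "%j. norm (f j)"] j by (simp add: Kf_def)
  qed
  have M0: "\<forall>\<^sub>F N in sequentially. real (M N) ~= 0" using lev_bounds by eventually_elim (auto simp: M_def)
  show ?thesis
  proof (rule prod_one_plus_tendsto[where e = "%N. \<bar>c N\<bar> * Kf" and C = "\<bar>\<theta> * l\<bar> * Kf + 1"])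
    have "(%N. of_real (real (M N) * c N) * ((\<Sum>j\<in>{1..k N}. B N j) / of_real (real (M N)))) \<longlonglongrightarrow> of_real l * (of_real \<theta> / of_nat n * (\<Sum>j\<in>{1..n}. f j))"
      by (intro tendsto_mult tendsto_of_real c periodic_average[OF n_pos per k M_at_top B])
    moreover have "\<forall>\<^sub>F N in sequentially. complex_of_real (real (M N) * c N) * ((\<Sum>j\<in>{1..k N}. B N j) / of_real (real (M N))) = (\<Sum>j\<in>{1..k N}. of_real (c N) * B N j)"
      using M0 by eventually_elim (simp add: sum_distrib_left[symmetric])
    ultimately show "(%N. \<Sum>j\<in>{1..k N}. of_real (c N) * B N j) \<longlonglongrightarrow> of_real l * (of_real \<theta> / of_nat n * (\<Sum>j\<in>{1..n}. f j))"
      by (rule Lim_transform_eventually)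
    have "(%N. \<bar>real (k N) / real (M N) * (real (M N) * c N)\<bar> * Kf) \<longlonglongrightarrow> \<bar>\<theta> * l\<bar> * Kf" by (intro tendsto_intros k c)
    then have "\<forall>\<^sub>F N in sequentially. \<bar>real (k N) / real (M N) * (real (M N) * c N)\<bar> * Kf < \<bar>\<theta> * l\<bar> * Kf + 1"
      by (rule order_tendstoD(2)) simp
    then show "\<forall>\<^sub>F N in sequentially. (\<forall>j\<in>{1..k N}. norm (of_real (c N) * B N j) <= \<bar>c N\<bar> * Kf) \<and> real (card {1..k N}) * (\<bar>c N\<bar> * Kf) <= \<bar>\<theta> * l\<bar> * Kf + 1"
      using B[OF zero_less_one] M0
    proof eventually_elim
      case (elim N)
      have "norm (B N j) <= Kf" if j: "j \<in> {1..k N}" for j using elim(2) j f[of j] norm_triangle_sub[of "B N j" "f j"] by force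
      then have "norm (of_real (c N) * B N j) <= \<bar>c N\<bar> * Kf" if "j \<in> {1..k N}" for j
        unfolding norm_mult norm_of_real using that by (intro mult_left_mono) auto
      moreover have "real (card {1..k N}) * (\<bar>c N\<bar> * Kf) <= \<bar>\<theta> * l\<bar> * Kf + 1" using elim(1,3) by (simp add: abs_mult mult_ac)
      ultimately show ?case by blast
    qed
    show "(%N. \<bar>c N\<bar> * Kf) \<longlonglongrightarrow> 0" using tendsto_mult_left_zero[OF tendsto_rabs_zero[OF null_times[OF c]]] .
  qed simp
qed

end

context perturbed_staircase
begin

text \<open>The three products tend to exponentials whose exponents add up to
  \<open>t * F z\<close>; in the prefactor \<open>M * (q ^ m - 1)\<close> tends to
  \<open>m * t\<close>, which leaves \<open>1 / (t * z)\<close>.\<close>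

lemma A_limit:
  assumes z: "z \<in> Sph r" and r: "r = \<rho> / 4 \<or> r = \<rho> / 2"
  shows "(%N. A N z / of_real (real (M N))) \<longlonglongrightarrow> exp (of_real t * F z) / (of_real t * z)"
proof -
  have z\<rho>: "z \<in> Disc \<rho>" using Sph_subset[of r \<rho>] z r \<rho> by auto
  then have z0: "z ~= 0" by (rule Disc_nonzero)
  have zx: "z ~= of_real (x k)" "z ^ m ~= of_real (x k) ^ m" if k: "k \<in> {1..n}" for k
  proof -
    have xk: "complex_of_real (x k) \<in> Disc r" "complex_of_real (x k) \<in> Disc \<rho>" using k r \<rho> by (auto simp: Disc_def intro!: bexI[of _ k])
    show "z ~= of_real (x k)" using Sph_Disc_disjoint[OF z _ xk(1)] r \<rho> by auto
    then show "z ^ m ~= of_real (x k) ^ m" using Disc_inj[OF z\<rho> xk(2)] by blast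
  qed
  have xpx: "\<bar>xp N i - x i\<bar> <= 1 / real N" if "1 <= i" "i <= N" for N i using xp[of i N] that by auto
  have xper: "x i = x j" if "1 <= i" "1 <= j" "i mod n = j mod n" for i j using periodic[OF that] by blast
  have levN: "\<forall>\<^sub>F N in sequentially. lev N <= N" using lev_bounds by eventually_elim auto
  let ?\<phi> = "%u::real. z ^ m / (z ^ m - of_real u ^ m)" and ?\<psi> = "%u::real. z / (z - of_real u)"
  have u1: "\<forall>\<^sub>F N in sequentially. \<forall>j\<in>{1..N}. norm (?\<phi> (xp N j) - ?\<phi> (x j)) <= \<epsilon>" if "0 < \<epsilon>" for \<epsilon>
    by (rule perturbed_uniformly[OF n_pos xper xpx _ that]) (use zx in \<open>auto intro!: continuous_intros\<close>)
  have u2: "\<forall>\<^sub>F N in sequentially. \<forall>j\<in>{1..N}. norm (?\<psi> (xp N j) - ?\<psi> (x j)) <= \<epsilon>" if "0 < \<epsilon>" for \<epsilon>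
    by (rule perturbed_uniformly[OF n_pos xper xpx _ that]) (use zx in \<open>auto intro!: continuous_intros\<close>)
  have u2': "\<forall>\<^sub>F N in sequentially. \<forall>j\<in>{1..lev N}. norm (?\<psi> (xp N j) - ?\<psi> (x j)) <= \<epsilon>" if "0 < \<epsilon>" for \<epsilon>
    using u2[OF that] levN by eventually_elim auto
  let ?f3 = "%i. if a i = 1 then 0 else complex_of_real (y i) * z / (1 + of_real (y i) * z)"
  define p1 where "p1 N = (\<Prod>j\<in>{1..N}. 1 + of_real (qq N ^ m - 1) * ?\<phi> (xp N j))" for N
  define p2 where "p2 N = (\<Prod>j\<in>{1..lev N}. 1 + of_real (qq N - 1) * ?\<psi> (xp N j))" for N
  define p3 where "p3 N = (\<Prod>j\<in>{1..lev N}. 1 + of_real (qq N - 1) * ?f3 j)" for N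
  let ?u1 = "\<Sum>j\<in>{1..n}. ?\<phi> (x j)" and ?u2 = "\<Sum>j\<in>{1..n}. ?\<psi> (x j)" and ?u3 = "\<Sum>j\<in>{1..n}. ?f3 j"
  have L1: "(%N. p1 N) \<longlonglongrightarrow> exp (of_real (real m * t) * (of_real (1 / (1 - \<kappa>)) / of_nat n * ?u1))"
    unfolding p1_def by (rule product_limit[OF MQ N_over_M _ u1]) (drule (2) xper, simp)
  have L2: "(%N. p2 N) \<longlonglongrightarrow> exp (of_real t * (of_real (\<kappa> / (1 - \<kappa>)) / of_nat n * ?u2))"
    unfolding p2_def by (rule product_limit[OF Mq lev_over_M _ u2']) (drule (2) xper, simp)
  have L3: "(%N. p3 N) \<longlonglongrightarrow> exp (of_real t * (of_real (\<kappa> / (1 - \<kappa>)) / of_nat n * ?u3))"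
    unfolding p3_def by (rule product_limit[OF Mq lev_over_M]) (drule (2) periodic, simp, simp)
  have Q0: "(%N. complex_of_real (qq N ^ m)) \<longlonglongrightarrow> of_real 1"
  proof (intro tendsto_of_real)
    show "(%N. qq N ^ m) \<longlonglongrightarrow> 1" using tendsto_add[OF null_times[OF MQ] tendsto_const[of 1]] by simp
  qed
  let ?lim = "of_nat m / (of_real (real m * t) * z) * (1 / of_real 1)
      * exp (of_real (real m * t) * (of_real (1 / (1 - \<kappa>)) / of_nat n * ?u1))
      * exp (of_real t * (of_real (\<kappa> / (1 - \<kappa>)) / of_nat n * ?u3))
      / exp (of_real t * (of_real (\<kappa> / (1 - \<kappa>)) / of_nat n * ?u2))"
  have "(%N. of_nat m / (of_real (real (M N) * (qq N ^ m - 1)) * z) * (1 / of_real (qq N ^ m)) * p1 N * p3 N / p2 N)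
    \<longlonglongrightarrow> ?lim" by (intro tendsto_intros L1 L2 L3 MQ Q0) (use t m_pos z0 in auto)
  also have "?lim = exp (of_real t * F z) / (of_real t * z)"
  proof -
    have "of_real (real m * t) * (of_real (1 / (1 - \<kappa>)) / of_nat n * ?u1) + of_real t * (of_real (\<kappa> / (1 - \<kappa>)) / of_nat n * ?u3)
       - of_real t * (of_real (\<kappa> / (1 - \<kappa>)) / of_nat n * ?u2) = of_real t * F z"
      unfolding F_eq by (simp add: right_diff_distrib distrib_left mult_ac)
    moreover have "of_nat m / (of_real (real m * t) * z) * (1 / of_real 1) = 1 / (of_real t * z)" using m_pos by simp
    ultimately show ?thesis by (simp only: exp_add[symmetric] exp_diff[symmetric] mult.assoc times_divide_eq_right[symmetric]) simp
  qed
  finally have lim: "(%N. of_nat m / (of_real (real (M N) * (qq N ^ m - 1)) * z) * (1 / of_real (qq N ^ m)) * p1 N * p3 N / p2 N)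
    \<longlonglongrightarrow> exp (of_real t * F z) / (of_real t * z)" .
  have "A N z / of_real (real (M N)) = of_nat m / (of_real (real (M N) * (qq N ^ m - 1)) * z) * (1 / of_real (qq N ^ m)) * p1 N * p3 N / p2 N" for N
  proof -
    have e1: "(\<Prod>j\<in>{1..N}. 1 + (complex_of_real (qq N) ^ m - 1) * z ^ m / (z ^ m - of_real (xp N j) ^ m)) = p1 N"
      unfolding p1_def by (intro prod.cong refl) simp
    have e2: "(\<Prod>i\<in>{1..lev N}. 1 + (complex_of_real (qq N) - 1) * z / (z - of_real (xp N i))) = p2 N"
      unfolding p2_def by (intro prod.cong refl) simp
    have e3: "(\<Prod>i\<in>{1..lev N}. 1 + (if a i = 1 then 0 else (complex_of_real (qq N) - 1) * of_real (y i) * z / (1 + of_real (y i) * z))) = p3 N"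
      unfolding p3_def by (intro prod.cong refl) (simp add: mult.assoc)
    have "of_nat m / ((Q - 1) * z) * (1 / Q) * p * p' / p'' / M' = of_nat m / (M' * (Q - 1) * z) * (1 / Q) * p * p' / p''" for Q p p' p'' M' :: complex
      by (simp add: mult_ac)
    then show ?thesis unfolding A_def e1 e2 e3 of_real_mult[of "real (M N)"] of_real_diff[of "qq N ^ m"] of_real_power of_real_1 .
  qed
  then show ?thesis using lim by (simp only:)
qed

definition CL :: real where
  "CL = real m / (real m * t * (\<rho> / 2)) *
   exp (real m * t / (1 - \<kappa>) * K + 2 * (t / (1 - \<kappa>)) + 2 * (t / (1 - \<kappa>) * K))"

lemma CA_limit: "(%N. CA N / real (M N)) \<longlonglongrightarrow> CL"
proof -
  have "(%N. real m / (real (M N) * (qq N ^ m - 1) * (\<rho> / 2)) *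
      exp (real N * (qq N ^ m - 1) * K + 2 * (real N * (qq N - 1)) + 2 * (real N * (qq N - 1) * K)))
    \<longlonglongrightarrow> real m / (real m * t * (\<rho> / 2)) * exp (real m * t / (1 - \<kappa>) * K + 2 * (t / (1 - \<kappa>)) + 2 * (t / (1 - \<kappa>) * K))"
    by (intro tendsto_intros MQ N_times[OF MQ] N_times[OF Mq]) (use t m_pos \<rho> in auto)
  then show ?thesis by (simp add: CA_def CL_def mult_ac)
qed

definition Lc :: "real => complex" where
  "Lc r = circ r (%z. exp (of_real t * F z) / (of_real t * z))"

lemma circ_A_limit:
  assumes r: "r = \<rho> / 4 \<or> r = \<rho> / 2"
  shows "(%N. circ r (A N) / of_real (real (M N))) \<longlonglongrightarrow> Lc r"
proof -
  have r0: "0 < r" using r \<rho> by auto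
  define B where "B = CL + 1"
  have "(%N. circ r (%z. A N z / of_real (real (M N)))) \<longlonglongrightarrow> circ r (%z. exp (of_real t * F z) / (of_real t * z))"
  proof (rule circ_tendsto[OF r0])
    show "\<forall>\<^sub>F N in sequentially. continuous_on (Sph r) (%z. A N z / of_real (real (M N)))" using eventually_good lev_bounds
      by eventually_elim (auto simp: M_def intro!: continuous_intros moments_close(1)[OF _ r])
    have "\<forall>\<^sub>F N in sequentially. CA N / real (M N) < B" by (rule order_tendstoD(2)[OF CA_limit]) (simp add: B_def)
    with eventually_good lev_bounds show "\<forall>\<^sub>F N in sequentially. \<forall>z\<in>Sph r. norm (A N z / of_real (real (M N))) <= B"
    proof eventually_elim
      case (elim N)
      show ?case
      proof
        fix z assume "z \<in> Sph r"
        then have "norm (A N z) <= CA N" using moments_close(2)[OF elim(1)] r by auto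
        then have "norm (A N z) / real (M N) <= CA N / real (M N)" by (intro divide_right_mono) auto
        then show "norm (A N z / of_real (real (M N))) <= B" using elim(3) by (simp add: norm_divide)
      qed
    qed
  qed (rule A_limit[OF _ r])
  moreover have "\<forall>\<^sub>F N in sequentially. circ r (%z. A N z / of_real (real (M N))) = circ r (A N) / of_real (real (M N))"
    using eventually_good
  proof eventually_elim
    case (elim N)
    show ?case using circ_mult[OF r0 moments_close(1)[OF elim r], of "1 / of_real (real (M N))"] by simp
  qed
  ultimately show ?thesis unfolding Lc_def by (rule Lim_transform_eventually)
qed

lemma dd_limit: "dd \<longlonglongrightarrow> 0" "xx \<longlonglongrightarrow> 0"
proof -
  have Q0: "(%N. qq N ^ m - 1) \<longlonglongrightarrow> 0" by (rule null_times[OF MQ])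
  show "dd \<longlonglongrightarrow> 0" unfolding dd_def[abs_def] by (rule tendsto_divide_zero[OF Q0])
  show "xx \<longlonglongrightarrow> 0" unfolding xx_def[abs_def] by (intro tendsto_mult_left_zero tendsto_null_power Q0) simp
qed

text \<open>Here \<open>Phi\<close> disappears: it contributes at most a multiple of
  \<open>CA * dd\<close>, where \<open>CA\<close> is of order \<open>M\<close> and \<open>dd\<close>
  tends to \<open>0\<close>, and the moment is divided by \<open>M\<close>.\<close>

theorem expectation_limit:
  assumes r: "r = \<rho> / 4 \<or> r = \<rho> / 2"
  shows "(%N. complex_of_real (avg N (xp N) (X t N))) \<longlonglongrightarrow> Lc r"
proof -
  have "(%N. of_real (avg N (xp N) (X t N)) - circ r (A N) / of_real (real (M N))) \<longlonglongrightarrow> 0"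
  proof (rule Lim_null_comparison)
    show "\<forall>\<^sub>F N in sequentially. norm (of_real (avg N (xp N) (X t N)) - circ r (A N) / of_real (real (M N)))
       <= real n * r * (CA N / real (M N) * (dd N * (2 * C)))" using eventually_good lev_bounds
    proof eventually_elim
      case (elim N)
      have M0: "0 < real (M N)" using elim(2) by (auto simp: M_def)
      have "of_real (avg N (xp N) (X t N)) - circ r (A N) / of_real (real (M N))
         = (of_real (real (M N) * avg N (xp N) (X t N)) - circ r (A N)) / of_real (real (M N))"
        using M0 by (simp add: diff_divide_distrib)
      then have "norm (of_real (avg N (xp N) (X t N)) - circ r (A N) / of_real (real (M N)))
         = norm (of_real (real (M N) * avg N (xp N) (X t N)) - circ r (A N)) / real (M N)"
        by (simp only: norm_divide norm_of_real abs_of_nat)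
      also have "... <= real n * r * (CA N * (dd N * (2 * C))) / real (M N)"
        by (intro divide_right_mono moments_close(3)[OF elim(1) r]) simp
      finally show ?case by simp
    qed
    have "(%N. real n * r * (CA N / real (M N) * (dd N * (2 * C)))) \<longlonglongrightarrow> real n * r * (CL * (0 * (2 * C)))"
      by (intro tendsto_intros CA_limit dd_limit)
    then show "(%N. real n * r * (CA N / real (M N) * (dd N * (2 * C)))) \<longlonglongrightarrow> 0" by simp
  qed
  from tendsto_add[OF this circ_A_limit[OF r]] show ?thesis by simp
qed

theorem second_moment_limit:
  "(%N. complex_of_real (avg N (xp N) (%D. (X t N D)\<^sup>2))) \<longlonglongrightarrow> Lc (\<rho> / 2) * Lc (\<rho> / 4)"
proof -
  let ?D = "%N. complex_of_real (avg N (xp N) (%D. (X t N D)\<^sup>2)) - circ (\<rho> / 2) (A N) / of_real (real (M N)) * (circ (\<rho> / 4) (A N) / of_real (real (M N)))"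
  let ?E = "%N. err2 (dd N) (xx N) C"
  let ?B = "%N. real n * (\<rho> / 2) * (CA N / real (M N) * (real n * (\<rho> / 4) * (CA N / real (M N) * ?E N)))"
  have "(%N. ?D N) \<longlonglongrightarrow> 0"
  proof (rule Lim_null_comparison)
    show "\<forall>\<^sub>F N in sequentially. norm (?D N)
       <= ?B N" using eventually_good lev_bounds
    proof eventually_elim
      case (elim N)
      have M0: "0 < real (M N)" using elim(2) by (auto simp: M_def)
      have "?D N
         = (of_real ((real (M N))\<^sup>2 * avg N (xp N) (%D. (X t N D)\<^sup>2)) - circ (\<rho> / 2) (A N) * circ (\<rho> / 4) (A N)) / of_real ((real (M N))\<^sup>2)"
        using M0 by (simp add: diff_divide_distrib power2_eq_square)
      then have "norm (?D N)
         = norm (of_real ((real (M N))\<^sup>2 * avg N (xp N) (%D. (X t N D)\<^sup>2)) - circ (\<rho> / 2) (A N) * circ (\<rho> / 4) (A N)) / (real (M N))\<^sup>2"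
        by (simp only: norm_divide norm_of_real abs_power2)
      also have "... <= real n * (\<rho> / 2) * (CA N * (real n * (\<rho> / 4) * (CA N * ?E N))) / (real (M N))\<^sup>2"
        by (intro divide_right_mono moments_close(4)[OF elim(1)]) simp
      also have "... = ?B N" by (simp add: power2_eq_square)
      finally show ?case .
    qed
    have "(%N. ?B N) \<longlonglongrightarrow>
       real n * (\<rho> / 2) * (CL * (real n * (\<rho> / 4) * (CL * err2 0 0 C)))"
      unfolding err2_def by (intro tendsto_intros CA_limit dd_limit)
    then show "(%N. ?B N) \<longlonglongrightarrow> 0" by (simp add: err2_def)
  qed
  from tendsto_add[OF this tendsto_mult[OF circ_A_limit[of "\<rho> / 2"] circ_A_limit[of "\<rho> / 4"]]]
  show ?thesis by simp
qed

end

section \<open>Removing the genericity of the weights\<close>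

lemma affine_eventually_nonzero:
  fixes A B :: real
  assumes "A ~= 0 \<or> B ~= 0"
  shows "\<forall>\<^sub>F \<delta> in at_right 0. A + \<delta> * B ~= 0"
proof (cases "A = 0")
  case False
  have "((%\<delta>. A + \<delta> * B) \<longlongrightarrow> A + 0 * B) (at_right 0)" by (intro tendsto_intros)
  then show ?thesis using False by (intro tendsto_imp_eventually_ne) auto
next
  case True
  then show ?thesis using assms by (intro eventually_mono[OF eventually_at_right_less[of 0]]) auto
qed

context periodic_staircase
begin

text \<open>A perturbation by factors \<open>1 + \<delta> i\<close>: for \<open>q > 1\<close> the equation \<open>q ^ e * pert \<delta> i = pert \<delta> j\<close> is affine in
  \<open>\<delta>\<close> and does not hold identically, unless \<open>i = j\<close> and \<open>e = 0\<close>.\<close>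

definition pert :: "real => nat => real" where "pert \<delta> i = x i * (1 + \<delta> * real i)"

lemma pert_tendsto: "((%\<delta>. pert \<delta> i) \<longlongrightarrow> x i) (at_right 0)" unfolding pert_def by (auto intro!: tendsto_eq_intros)

lemma pert_generic:
  assumes N: "lev N < N" and t: "0 < t"
  shows "\<forall>\<^sub>F \<delta> in at_right 0. \<forall>i\<in>{1..N}. \<forall>j\<in>{1..N}. \<forall>e\<in>{..2}. q t N ^ e * pert \<delta> i = pert \<delta> j --> i = j \<and> e = 0"
proof (intro eventually_ball_finite ballI finite_atLeastAtMost finite_atMost)
  fix i j e assume ij: "i \<in> {1..N}" "j \<in> {1..N}"
  show "\<forall>\<^sub>F \<delta> in at_right 0. q t N ^ e * pert \<delta> i = pert \<delta> j --> i = j \<and> e = 0"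
  proof (cases "i = j \<and> e = 0")
    case False
    have q1: "1 < q t N" using N t by (simp add: q_def M_def)
    define A where "A = q t N ^ e * x i - x j"
    define B where "B = q t N ^ e * x i * real i - x j * real j"
    have "A ~= 0 \<or> B ~= 0"
    proof (rule ccontr)
      assume "\<not> (A ~= 0 \<or> B ~= 0)"
      then have eq: "q t N ^ e * x i = x j" "x j * real i = x j * real j" by (auto simp: A_def B_def)
      have "0 < x j" using xy_pos[of j] ij by simp
      then have "i = j" using eq(2) by simp
      then have "q t N ^ e = 1" using eq(1) \<open>0 < x j\<close> by simp
      then have "e = 0" using one_less_power[OF q1, of e] by (cases "e = 0") auto
      then show False using \<open>i = j\<close> False by simp
    qed
    from affine_eventually_nonzero[OF this] show ?thesis
    proof eventually_elim
      case (elim \<delta>)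
      have "q t N ^ e * pert \<delta> i - pert \<delta> j = A + \<delta> * B" by (simp add: A_def B_def pert_def algebra_simps)
      then show ?case using elim by auto
    qed
  qed simp
qed

lemma finite_dimer_configs: "2 <= N ==> finite (dimer_configs N (\<Omega> N) a)"
proof -
  assume N: "2 <= N"
  interpret contracting N "\<Omega> N" a by (rule contracting[OF N])
  interpret weighted_contracting N "\<Omega> N" a x y by unfold_locales
  show ?thesis using bij_betw_finite[OF bij_betw_link_edge] finite_configs by blast
qed

lemma dimer_weight_pos:
  assumes "D \<in> dimer_configs N (\<Omega> N) a"
  shows "0 < dimer_weight x y D"
  unfolding dimer_weight_def
proof (rule prod_pos)
  fix e assume "e \<in> D"
  then have "e \<in> SH_edges a" using assms by (auto simp: dimer_configs_def R_edges_def)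
  then obtain r u v where e: "e = ((r, u), (Suc r, v))" "1 <= r" by (auto simp: SH_edges_def)
  have "even r ==> 1 <= r div 2" "1 <= Suc r div 2" using e(2) by auto
  then show "0 < edge_weight x y e" using xy_pos by (auto simp: e(1))
qed

lemma partition_function_pos:
  assumes "2 <= N" "dimer_configs N (\<Omega> N) a ~= {}"
  shows "0 < (\<Sum>D\<in>dimer_configs N (\<Omega> N) a. dimer_weight x y D)"
  using assms by (intro sum_pos finite_dimer_configs dimer_weight_pos)

text \<open>At fixed \<open>N\<close> the average is a quotient of polynomials in the weights, with
  a positive denominator.\<close>

lemma avg_tendsto:
  assumes "2 <= N" "dimer_configs N (\<Omega> N) a ~= {}"
  shows "((%\<delta>. avg N (pert \<delta>) f) \<longlongrightarrow> avg N x f) (at_right 0)"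
proof -
  have e: "((%\<delta>. edge_weight (pert \<delta>) y e) \<longlongrightarrow> edge_weight x y e) (at_right 0)" for e
  proof -
    obtain r u r' v where "e = ((r, u), (r', v))" by (metis surj_pair)
    then show ?thesis using pert_tendsto by simp
  qed
  show ?thesis unfolding avg_def dimer_weight_def using partition_function_pos[OF assms]
    by (intro tendsto_intros e) (simp add: dimer_weight_def)
qed

text \<open>For each single \<open>N\<close> these are finitely many conditions, each true for all
  small \<open>\<delta>\<close>, so one \<open>\<delta>\<close> serves them all. No uniformity in
  \<open>N\<close> is asked for.\<close>

lemma perturbation_exists:
  assumes t: "0 < t"
  obtains xp where "!!N i. i \<in> {1..N} ==> x i <= xp N i \<and> xp N i <= x i + 1 / real N"
    and "!!N. lev N < N ==> \<forall>i\<in>{1..N}. \<forall>j\<in>{1..N}. \<forall>e\<le>2. q t N ^ e * xp N i = xp N j --> i = j \<and> e = 0"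
    and "!!N. 2 <= N ==> dimer_configs N (\<Omega> N) a ~= {} ==>
      \<bar>avg N (xp N) (X t N) - avg N x (X t N)\<bar> < 1 / real N \<and>
      \<bar>avg N (xp N) (%D. (X t N D)\<^sup>2) - avg N x (%D. (X t N D)\<^sup>2)\<bar> < 1 / real N"
proof -
  define A where "A N \<delta> \<longleftrightarrow> (\<forall>i\<in>{1..N}. x i <= pert \<delta> i \<and> pert \<delta> i <= x i + 1 / real N)" for N \<delta>
  define B where "B N \<delta> \<longleftrightarrow> lev N < N -->
    (\<forall>i\<in>{1..N}. \<forall>j\<in>{1..N}. \<forall>e\<in>{..2}. q t N ^ e * pert \<delta> i = pert \<delta> j --> i = j \<and> e = 0)" for N \<delta>
  define C where "C N \<delta> \<longleftrightarrow> 2 <= N \<and> dimer_configs N (\<Omega> N) a ~= {} -->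
       \<bar>avg N (pert \<delta>) (X t N) - avg N x (X t N)\<bar> < 1 / real N \<and>
       \<bar>avg N (pert \<delta>) (%D. (X t N D)\<^sup>2) - avg N x (%D. (X t N D)\<^sup>2)\<bar> < 1 / real N" for N \<delta>
  have "\<exists>\<delta>. A N \<delta> \<and> B N \<delta> \<and> C N \<delta>" for N
  proof -
    have "\<forall>\<^sub>F \<delta> in at_right 0. A N \<delta>" unfolding A_def
    proof (intro eventually_ball_finite ballI finite_atLeastAtMost)
      fix i assume i: "i \<in> {1..N}"
      have "\<forall>\<^sub>F \<delta> in at_right 0. pert \<delta> i < x i + 1 / real N" by (rule order_tendstoD(2)[OF pert_tendsto]) (use i in simp)
      with eventually_at_right_less[of 0] show "\<forall>\<^sub>F \<delta> in at_right 0. x i <= pert \<delta> i \<and> pert \<delta> i <= x i + 1 / real N"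
      proof eventually_elim
        case (elim \<delta>)
        have "0 <= x i * (\<delta> * real i)" using xy_pos[of i] i elim(1) by (intro mult_nonneg_nonneg) auto
        then show ?case using elim(2) by (simp add: pert_def algebra_simps)
      qed
    qed
    moreover have "\<forall>\<^sub>F \<delta> in at_right 0. B N \<delta>" unfolding B_def using pert_generic[OF _ t, of N] by (cases "lev N < N") auto
    moreover have "\<forall>\<^sub>F \<delta> in at_right 0. C N \<delta>"
    proof (cases "2 <= N \<and> dimer_configs N (\<Omega> N) a ~= {}")
      case True
      then have N: "2 <= N" "dimer_configs N (\<Omega> N) a ~= {}" by auto
      have "\<forall>\<^sub>F \<delta> in at_right 0. dist (avg N (pert \<delta>) f) (avg N x f) < 1 / real N" for f
        by (rule tendstoD[OF avg_tendsto[OF N]]) (use N in simp)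
      from eventually_conj[OF this[of "X t N"] this[of "%D. (X t N D)\<^sup>2"]] show ?thesis
        by eventually_elim (simp add: dist_real_def C_def)
    next
      case False
      then show ?thesis unfolding C_def by (intro always_eventually allI) blast
    qed
    ultimately have "\<forall>\<^sub>F \<delta> in at_right 0. A N \<delta> \<and> B N \<delta> \<and> C N \<delta>" by (intro eventually_conj)
    from eventually_happens'[OF trivial_limit_at_right_real this] show ?thesis .
  qed
  then obtain \<delta> where \<delta>: "!!N. A N (\<delta> N)" "!!N. B N (\<delta> N)" "!!N. C N (\<delta> N)" by metis
  show thesis
  proof (rule that[of "%N. pert (\<delta> N)"])
    show "x i <= pert (\<delta> N) i \<and> pert (\<delta> N) i <= x i + 1 / real N" if "i \<in> {1..N}" for N i
      using \<delta>(1)[of N] that unfolding A_def by blast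
    show "\<forall>i\<in>{1..N}. \<forall>j\<in>{1..N}. \<forall>e\<le>2. q t N ^ e * pert (\<delta> N) i = pert (\<delta> N) j --> i = j \<and> e = 0" if "lev N < N" for N
      using \<delta>(2)[of N] that unfolding B_def by (simp add: atMost_iff Ball_def)
  qed (use \<delta>(3) in \<open>unfold C_def, blast\<close>)
qed

end

locale limit_staircase = periodic_staircase m n a x y \<Omega> lam1 \<alpha> \<kappa> + discs m n x \<rho>
  for m n a x y \<Omega> lam1 \<alpha> \<kappa> \<rho> +
  assumes eta_disc: "!!k z. k \<in> {1..n} ==> z \<in> ball (complex_of_real (x k)) \<rho> ==> norm (etac T m z) <= R"
begin

definition Lt :: "real => complex" where
  "Lt t = circ (\<rho> / 4) (%z. exp (of_real t * F z) / (of_real t * z))"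

lemma original_limits:
  assumes t: "0 < t"
  shows "\<forall>\<^sub>F N in sequentially. dimer_configs N (\<Omega> N) a ~= {}"
    and "(%N. complex_of_real (avg N x (X t N))) \<longlonglongrightarrow> Lt t"
    and "(%N. complex_of_real (avg N x (%D. (X t N D)\<^sup>2))) \<longlonglongrightarrow> Lt t * Lt t"
proof -
  obtain xp where xp: "!!N i. i \<in> {1..N} ==> x i <= xp N i \<and> xp N i <= x i + 1 / real N"
    and gen: "!!N. lev N < N ==> \<forall>i\<in>{1..N}. \<forall>j\<in>{1..N}. \<forall>e\<le>2. q t N ^ e * xp N i = xp N j --> i = j \<and> e = 0"
    and close: "!!N. 2 <= N ==> dimer_configs N (\<Omega> N) a ~= {} ==>
      \<bar>avg N (xp N) (X t N) - avg N x (X t N)\<bar> < 1 / real N \<and>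
      \<bar>avg N (xp N) (%D. (X t N D)\<^sup>2) - avg N x (%D. (X t N D)\<^sup>2)\<bar> < 1 / real N" using perturbation_exists[OF t] by metis
  interpret P: perturbed_staircase m n a x y \<Omega> lam1 \<alpha> \<kappa> \<rho> t xp
  proof unfold_locales
    show "\<forall>\<^sub>F N in sequentially. \<forall>i\<in>{1..N}. \<forall>j\<in>{1..N}. \<forall>e\<le>2. q t N ^ e * xp N i = xp N j --> i = j \<and> e = 0"
      using lev_bounds by eventually_elim (rule gen, blast)
  qed (use eta_disc t xp in auto)
  have Lc: "P.Lc (\<rho> / 4) = Lt t" by (simp add: P.Lc_def Lt_def)
  \<comment> \<open>Both radii represent the limit of the same expectation, so the two contour
    integrals agree without deforming one contour into the other.\<close>
  have Lc2: "P.Lc (\<rho> / 2) = Lt t"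
    using LIMSEQ_unique[OF P.expectation_limit[of "\<rho> / 2"] P.expectation_limit[of "\<rho> / 4"]] Lc by simp
  \<comment> \<open>The alternant formula gives a nonzero partition function, which proves that
    configurations exist.\<close>
  show ne: "\<forall>\<^sub>F N in sequentially. dimer_configs N (\<Omega> N) a ~= {}" using P.eventually_good
  proof eventually_elim
    case (elim N)
    interpret Q: disc_staircase N "\<Omega> N" a "xp N" y m "l1 N" T n x \<rho> "lev N" "q t N" R by (rule P.good_disc_staircase[OF elim])
    show ?case using Q.dimer_moments(1)[OF q_def[unfolded M_def]] by auto
  qed
  have transfer: "(%N. complex_of_real (avg N x (f N))) \<longlonglongrightarrow> l"
    if lim: "(%N. complex_of_real (avg N (xp N) (f N))) \<longlonglongrightarrow> l"
      and cl: "!!N. 2 <= N ==> dimer_configs N (\<Omega> N) a ~= {} ==> \<bar>avg N (xp N) (f N) - avg N x (f N)\<bar> < 1 / real N" for f l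
  proof -
    have "(%N. complex_of_real (avg N (xp N) (f N)) - of_real (avg N x (f N))) \<longlonglongrightarrow> 0"
    proof (rule Lim_null_comparison)
      show "\<forall>\<^sub>F N in sequentially. norm (complex_of_real (avg N (xp N) (f N)) - of_real (avg N x (f N))) <= 1 / real N"
        using ne eventually_ge_at_top[of 2]
      proof eventually_elim
        case (elim N)
        have "norm (complex_of_real (avg N (xp N) (f N)) - of_real (avg N x (f N))) = \<bar>avg N (xp N) (f N) - avg N x (f N)\<bar>"
          by (metis norm_of_real of_real_diff real_norm_def)
        then show ?case using cl[OF elim(2,1)] by simp
      qed
      show "(%N. 1 / real N) \<longlonglongrightarrow> 0" by (rule lim_1_over_n)
    qed
    from tendsto_diff[OF lim this] show ?thesis by simp
  qed
  show "(%N. complex_of_real (avg N x (X t N))) \<longlonglongrightarrow> Lt t" by (rule transfer) (use P.expectation_limit[of "\<rho> / 4"] close Lc in auto)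
  show "(%N. complex_of_real (avg N x (%D. (X t N D)\<^sup>2))) \<longlonglongrightarrow> Lt t * Lt t"
    by (rule transfer) (use P.second_moment_limit close Lc Lc2 in auto)
qed

end

section \<open>The limit measure\<close>

text \<open>Weierstrass in the variable \<open>exp v\<close>: the exponents that occur are
  nonnegative integers, whose exponential moments are under control.\<close>

lemma exp_polynomial_approximation:
  fixes f :: "real => real"
  assumes f: "continuous_on UNIV f" and e: "0 < \<epsilon>" and b: "0 <= b"
  obtains c d where "!!v. v \<in> {0..b} ==> \<bar>f v - (\<Sum>i\<le>d. c i * exp (real i * v))\<bar> <= \<epsilon>"
proof -
  have cont: "continuous_on {1..exp b} (%u. f (ln u))" by (rule continuous_on_compose2[OF f]) (auto intro!: continuous_intros)
  obtain g where g: "real_polynomial_function g" "!!u. u \<in> {1..exp b} ==> \<bar>f (ln u) - g u\<bar> < \<epsilon>"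
    by (rule Stone_Weierstrass_real_polynomial_function[OF compact_Icc cont e]) (rule that)
  obtain c d where cd: "g = (%u. \<Sum>i\<le>d. c i * u ^ i)" using g(1) unfolding real_polynomial_function_iff_sum by blast
  show thesis
  proof (rule that)
    fix v assume v: "v \<in> {0..b}"
    then have "exp v \<in> {1..exp b}" by auto
    from g(2)[OF this] have "\<bar>f v - g (exp v)\<bar> < \<epsilon>" by simp
    moreover have "g (exp v) = (\<Sum>i\<le>d. c i * exp (real i * v))" by (simp add: cd exp_of_nat_mult)
    ultimately show "\<bar>f v - (\<Sum>i\<le>d. c i * exp (real i * v))\<bar> <= \<epsilon>" by simp
  qed
qed

lemma (in real_distribution) integrable_AE_interval:
  fixes f :: "real => real"
  assumes ae: "AE v in M. v \<in> {a..b}" and f: "continuous_on UNIV f"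
  shows "integrable M f"
proof -
  have "compact (f ` {a..b})" by (intro compact_continuous_image continuous_on_subset[OF f]) auto
  then obtain B where B: "!!v. v \<in> {a..b} ==> norm (f v) <= B" using compact_imp_bounded bounded_iff by (metis imageI)
  show ?thesis
  proof (rule integrable_const_bound)
    show "AE v in M. norm (f v) <= B" using ae by eventually_elim (rule B)
    show "f \<in> borel_measurable M" using borel_measurable_continuous_onI[OF f] by simp
  qed
qed

lemma (in real_distribution) integral_close:
  fixes f g :: "real => real"
  assumes ae: "AE v in M. v \<in> {a..b}"
    and f: "continuous_on UNIV f" and g: "continuous_on UNIV g"
    and close: "!!v. v \<in> {a..b} ==> \<bar>f v - g v\<bar> <= \<epsilon>"
  shows "\<bar>integral\<^sup>L M f - integral\<^sup>L M g\<bar> <= \<epsilon>"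
proof -
  note int = integrable_AE_interval[OF ae f] integrable_AE_interval[OF ae g]
  have "integral\<^sup>L M f - integral\<^sup>L M g = (\<integral>v. f v - g v \<partial>M)" using int by simp
  also have "\<bar>...\<bar> <= (\<integral>v. \<bar>f v - g v\<bar> \<partial>M)" by (rule integral_abs_bound)
  also have "... <= (\<integral>v. \<epsilon> \<partial>M)"
  proof (rule integral_mono_AE)
    show "AE v in M. \<bar>f v - g v\<bar> <= \<epsilon>" using ae by eventually_elim (rule close)
  qed (use int in auto)
  also have "... = \<epsilon>" using prob_space by simp
  finally show ?thesis .
qed

lemma (in real_distribution) integral_exp_sum:
  assumes ae: "AE v in M. v \<in> {a..b}"
  shows "(\<integral>v. (\<Sum>i\<le>d. c i * exp (real i * v)) \<partial>M) = (\<Sum>i\<le>d. c i * (\<integral>v. exp (real i * v) \<partial>M))"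
proof -
  have "integrable M (%v. exp (real i * v))" for i by (rule integrable_AE_interval[OF ae]) (intro continuous_intros)
  then show ?thesis by simp
qed

section \<open>Averages over configurations and a common support\<close>

context periodic_staircase
begin

abbreviation configs_of :: "nat => edge set set" where "configs_of N \<equiv> dimer_configs N (\<Omega> N) a"

lemma avg_linear:
  "avg N x (%D. f D + g D) = avg N x f + avg N x g" "avg N x (%D. c * f D) = c * avg N x f"
  "avg N x (%D. \<Sum>i\<in>I. h i D) = (\<Sum>i\<in>I. avg N x (h i))"
proof -
  show "avg N x (%D. f D + g D) = avg N x f + avg N x g" by (simp add: avg_def distrib_left sum.distrib add_divide_distrib)
  show "avg N x (%D. c * f D) = c * avg N x f" by (simp add: avg_def sum_distrib_left mult.left_commute)
  have "(\<Sum>D\<in>configs_of N. dimer_weight x y D * (\<Sum>i\<in>I. h i D)) = (\<Sum>i\<in>I. \<Sum>D\<in>configs_of N. dimer_weight x y D * h i D)"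
    unfolding sum_distrib_left by (rule sum.swap)
  then show "avg N x (%D. \<Sum>i\<in>I. h i D) = (\<Sum>i\<in>I. avg N x (h i))" by (simp add: avg_def sum_divide_distrib)
qed

lemma avg_const: "2 <= N ==> configs_of N ~= {} ==> avg N x (%D. c) = c"
  using partition_function_pos[of N] by (simp add: avg_def sum_distrib_right[symmetric])

lemma avg_mono:
  assumes "2 <= N" "configs_of N ~= {}" "!!D. D \<in> configs_of N ==> f D <= g D"
  shows "avg N x f <= avg N x g"
  unfolding avg_def using partition_function_pos[OF assms(1,2)] dimer_weight_pos[of _ N] assms(3)
  by (intro divide_right_mono sum_mono mult_left_mono) (auto simp: less_imp_le)

lemma avg_cong: "(!!D. D \<in> configs_of N ==> f D = g D) ==> avg N x f = avg N x g"
  unfolding avg_def by (intro arg_cong2[where f = "(/)"] sum.cong refl) simp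

abbreviation prb :: "nat => (edge set => bool) => real" where
  "prb N P \<equiv> measure (dimer_measure N (\<Omega> N) a x y) {D \<in> space (dimer_measure N (\<Omega> N) a x y). P D}"

lemma measure_eq_avg:
  assumes "2 <= N" "configs_of N ~= {}"
  shows "prb N P = avg N x (%D. if P D then 1 else 0)"
proof -
  let ?Z = "\<Sum>D\<in>configs_of N. dimer_weight x y D"
  have sp: "space (dimer_measure N (\<Omega> N) a x y) = configs_of N" by (simp add: dimer_measure_def space_point_measure)
  have "emeasure (dimer_measure N (\<Omega> N) a x y) {D \<in> configs_of N. P D} = (\<Sum>D\<in>{D \<in> configs_of N. P D}. ennreal (dimer_weight x y D / ?Z))"
    unfolding dimer_measure_def by (rule emeasure_point_measure_finite[OF finite_dimer_configs[OF assms(1)]]) auto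
  also have "... = ennreal (\<Sum>D\<in>{D \<in> configs_of N. P D}. dimer_weight x y D / ?Z)"
    using partition_function_pos[OF assms] dimer_weight_pos[of _ N] by (intro sum_ennreal) (auto simp: less_imp_le)
  finally have "measure (dimer_measure N (\<Omega> N) a x y) {D \<in> configs_of N. P D} = (\<Sum>D\<in>{D \<in> configs_of N. P D}. dimer_weight x y D / ?Z)"
    unfolding Sigma_Algebra.measure_def using partition_function_pos[OF assms] dimer_weight_pos[of _ N]
    by (auto intro!: enn2real_ennreal sum_nonneg simp: less_imp_le)
  also have "... = (\<Sum>D\<in>configs_of N. if P D then dimer_weight x y D / ?Z else 0)"
    by (rule sum.inter_filter[OF finite_dimer_configs[OF assms(1)]])
  also have "... = avg N x (%D. if P D then 1 else 0)" unfolding avg_def sum_divide_distrib by (intro sum.cong refl) simp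
  finally show ?thesis unfolding sp .
qed

text \<open>Positions are below \<open>lam1 N + 2 * N\<close>, hence eventually at most
  \<open>(\<alpha> + 3) * N\<close>, and the other factor eventually bounds
  \<open>N / M\<close>.\<close>

definition S0 :: real where "S0 = (\<alpha> + 3) * (1 / (1 - \<kappa>) + 1)"

lemma S0_nonneg: "0 <= S0" using \<alpha> \<kappa> by (simp add: S0_def)

definition supported :: "nat => edge set => bool" where
  "supported N D \<longleftrightarrow> real_distribution (cm N D) \<and> (AE v in cm N D. v \<in> {0..S0})"

lemma eventually_supported: "\<forall>\<^sub>F N in sequentially. \<forall>D\<in>configs_of N. supported N D"
proof -
  have "\<forall>\<^sub>F N in sequentially. real N / real (M N) < 1 / (1 - \<kappa>) + 1" by (rule order_tendstoD(2)[OF N_over_M]) simp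
  with lev_bounds lam1_le show ?thesis
  proof eventually_elim
    case (elim N)
    interpret contracting N "\<Omega> N" a by (rule contracting) (use elim in auto)
    interpret weighted_contracting N "\<Omega> N" a x y by unfold_locales
    show ?case
    proof
      fix D assume "D \<in> configs_of N"
      then obtain D' where D': "D' \<in> configs (2 * N + 1)" "D = link_edge a ` D'"
        using bij_betw_imp_surj_on[OF bij_betw_link_edge] by blast
      define S where "S = ups (2 * lev N + 1) D'"
      have s: "1 <= lev N" "lev N < N" "0 < M N" using elim by (auto simp: M_def)
      have card: "card S = M N" unfolding S_def M_def by (rule card_ups[OF D'(1) s(2)])
      have int: "integral\<^sup>L (cm N D) f = (\<Sum>l\<in>S. f (real l / real (M N))) / real (M N)" if "f \<in> borel_measurable borel" for f
        unfolding cm_def D'(2) S_def M_def by (rule integral_counting_measure[OF D'(1) s(1,2) that])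
      have bound: "real l / real (M N) \<in> {0..S0}" if "l \<in> S" for l
      proof -
        have "l < \<Omega> N N + N" using ups_bound[OF D'(1) that[unfolded S_def]] by simp
        then have "real l <= real (lam1 N) + 2 * real N" using \<Omega>_values(2)[of N] elim by simp
        also have "... <= (\<alpha> + 3) * real N" using elim by (simp add: algebra_simps)
        finally have "real l / real (M N) <= (\<alpha> + 3) * real N / real (M N)" by (intro divide_right_mono) auto
        also have "... = (\<alpha> + 3) * (real N / real (M N))" by simp
        also have "... <= S0" unfolding S0_def using elim \<alpha> by (intro mult_left_mono) auto
        finally show ?thesis by simp
      qed
      define \<mu> where "\<mu> = level_partition N (\<Omega> N) a (lev N) D"
      have one: "integral\<^sup>L (cm N D) (%_. 1) = (1::real)" using int[of "%_. 1"] card s by simp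
      \<comment> \<open>An empty index set would give total mass \<open>0\<close>, whereas the
        integral of \<open>1\<close> has just been found to be \<open>1\<close>; this spares
        computing the length of the partition.\<close>
      have ne: "{1..length \<mu>} ~= {}"
      proof
        assume e: "{1..length \<mu>} = {}"
        have "cm N D = distr (uniform_count_measure {}) borel (%i. (real (\<mu> ! (i - 1)) + real (length \<mu>) - real i) / real (length \<mu>))"
          unfolding cm_def counting_measure_def \<mu>_def[symmetric] e ..
        moreover have "(%i. (real (\<mu> ! (i - 1)) + real (length \<mu>) - real i) / real (length \<mu>)) \<in> borel_measurable (uniform_count_measure {})"
          by (simp add: measurable_def space_uniform_count_measure sets_uniform_count_measure)
        ultimately have "integral\<^sup>L (cm N D) (%_. 1) = integral\<^sup>L (uniform_count_measure ({} :: nat set)) (%_. 1 :: real)"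
          by (simp only: integral_distr borel_measurable_const)
        also have "... = 0" by (simp add: space_uniform_count_measure)
        finally have "integral\<^sup>L (cm N D) (%_. 1) = (0::real)" .
        then show False using one by simp
      qed
      have rd: "real_distribution (cm N D)" unfolding cm_def counting_measure_def \<mu>_def[symmetric]
      proof (rule prob_space.real_distribution_distr)
        show "prob_space (uniform_count_measure {1..length \<mu>})" by (rule prob_space_uniform_count_measure[OF finite_atLeastAtMost ne])
      qed (auto simp: measurable_def space_uniform_count_measure sets_uniform_count_measure)
      then interpret C: real_distribution "cm N D" .
      have "measure (cm N D) (- {0..S0}) = integral\<^sup>L (cm N D) (indicator (- {0..S0}))" by simp
      also have "... = 0" using bound int[of "indicator (- {0..S0})"] by (auto intro!: sum.neutral simp: indicator_def)
      finally have "emeasure (cm N D) (- {0..S0}) = 0" by (simp add: C.emeasure_eq_measure)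
      then have "AE v in cm N D. v \<in> {0..S0}" by (intro AE_I[of _ _ "- {0..S0}"]) auto
      then show "supported N D" using rd by (simp add: supported_def)
    qed
  qed
qed

end

section \<open>Concentration and existence of the limit measure\<close>

context limit_staircase
begin

definition Lr :: "real => real" where "Lr t = Re (Lt t)"

text \<open>The limits of the exponential moments at integer times. Time \<open>0\<close> is
  separate because \<open>Lt\<close> divides by \<open>t\<close>; there the moment is the total
  mass.\<close>

definition ell :: "nat => real" where "ell i = (if i = 0 then 1 else Lr (real i))"

lemma Lt_real:
  assumes "0 < t"
  shows "Lt t = of_real (Lr t)"
proof -
  have "(%N. 0) \<longlonglongrightarrow> Im (Lt t)" using tendsto_Im[OF original_limits(2)[OF assms]] by simp
  then have "Im (Lt t) = 0" using LIMSEQ_unique tendsto_const by blast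
  then show ?thesis by (simp add: complex_eq_iff Lr_def)
qed

definition usable :: "nat => bool" where
  "usable N \<longleftrightarrow> 2 <= N \<and> configs_of N ~= {} \<and> (\<forall>D\<in>configs_of N. supported N D)"

lemma eventually_usable: "\<forall>\<^sub>F N in sequentially. usable N"
  using original_limits(1)[OF zero_less_one] eventually_supported eventually_ge_at_top[of 2]
  by eventually_elim (simp add: usable_def)

text \<open>The second moment tends to the square of the limit of the mean, so the variance tends to
  \<open>0\<close>.\<close>

lemma X_L2:
  assumes t: "0 < t"
  shows "(%N. avg N x (%D. (X t N D - Lr t)\<^sup>2)) \<longlonglongrightarrow> 0"
proof -
  have 1: "(%N. avg N x (X t N)) \<longlonglongrightarrow> Lr t" using original_limits(2)[OF t] unfolding Lt_real[OF t] tendsto_of_real_iff .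
  have 2: "(%N. avg N x (%D. (X t N D)\<^sup>2)) \<longlonglongrightarrow> Lr t * Lr t"
    using original_limits(3)[OF t] unfolding Lt_real[OF t] of_real_mult[symmetric] tendsto_of_real_iff .
  have "(%N. avg N x (%D. (X t N D)\<^sup>2) + (- 2 * Lr t) * avg N x (X t N) + (Lr t)\<^sup>2) \<longlonglongrightarrow> Lr t * Lr t + (- 2 * Lr t) * Lr t + (Lr t)\<^sup>2"
    by (intro tendsto_intros 1 2)
  then have "(%N. avg N x (%D. (X t N D)\<^sup>2) + (- 2 * Lr t) * avg N x (X t N) + (Lr t)\<^sup>2) \<longlonglongrightarrow> 0" by (simp add: power2_eq_square)
  moreover have "\<forall>\<^sub>F N in sequentially. avg N x (%D. (X t N D)\<^sup>2) + (- 2 * Lr t) * avg N x (X t N) + (Lr t)\<^sup>2 = avg N x (%D. (X t N D - Lr t)\<^sup>2)"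
    using eventually_usable
  proof eventually_elim
    case (elim N)
    have "avg N x (%D. (X t N D - Lr t)\<^sup>2) = avg N x (%D. ((X t N D)\<^sup>2 + (- 2 * Lr t) * X t N D) + (Lr t)\<^sup>2)"
      by (intro avg_cong) (simp add: power2_diff)
    also have "... = avg N x (%D. (X t N D)\<^sup>2) + (- 2 * Lr t) * avg N x (X t N) + (Lr t)\<^sup>2"
      unfolding avg_linear using elim avg_const[of N "(Lr t)\<^sup>2"] by (simp add: usable_def)
    finally show ?case by simp
  qed
  ultimately show ?thesis by (rule Lim_transform_eventually)
qed

lemma ell_L2: "(%N. avg N x (%D. (X (real i) N D - ell i)\<^sup>2)) \<longlonglongrightarrow> 0"
proof (cases "i = 0")
  case True
  have "\<forall>\<^sub>F N in sequentially. 0 = avg N x (%D. (X (real i) N D - ell i)\<^sup>2)" using eventually_usable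
  proof eventually_elim
    case (elim N)
    have "X 0 N D = 1" if D: "D \<in> configs_of N" for D
    proof -
      interpret C: real_distribution "cm N D" using elim D by (simp add: usable_def supported_def)
      show ?thesis using C.prob_space by (simp add: X_def)
    qed
    then have "avg N x (%D. (X (real i) N D - ell i)\<^sup>2) = avg N x (%D. 0)" using True by (intro avg_cong) (simp add: ell_def)
    then show ?case using elim avg_const[of N 0] by (simp add: usable_def)
  qed
  from Lim_transform_eventually[OF tendsto_const this] show ?thesis .
next
  case False
  then show ?thesis using X_L2[of "real i"] by (simp add: ell_def)
qed

lemma sum_L2: "(%N. avg N x (%D. \<Sum>i\<le>d. c i * (X (real i) N D - ell i)\<^sup>2)) \<longlonglongrightarrow> 0"
proof -
  have "(%N. \<Sum>i\<le>d. c i * avg N x (%D. (X (real i) N D - ell i)\<^sup>2)) \<longlonglongrightarrow> (\<Sum>i\<le>d. c i * 0)" by (intro tendsto_intros ell_L2)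
  then show ?thesis by (simp add: avg_linear)
qed

lemma combination_L2:
  "(%N. avg N x (%D. ((\<Sum>i\<le>d. c i * X (real i) N D) - (\<Sum>i\<le>d. c i * ell i))\<^sup>2)) \<longlonglongrightarrow> 0"
proof (rule tendsto_sandwich[OF _ _ tendsto_const])
  show "\<forall>\<^sub>F N in sequentially. 0 <= avg N x (%D. ((\<Sum>i\<le>d. c i * X (real i) N D) - (\<Sum>i\<le>d. c i * ell i))\<^sup>2)" using eventually_usable
  proof eventually_elim
    case (elim N)
    then have "avg N x (%D. 0) <= avg N x (%D. ((\<Sum>i\<le>d. c i * X (real i) N D) - (\<Sum>i\<le>d. c i * ell i))\<^sup>2)"
      by (intro avg_mono) (auto simp: usable_def)
    then show ?case using elim by (simp add: usable_def avg_const)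
  qed
  show "\<forall>\<^sub>F N in sequentially. avg N x (%D. ((\<Sum>i\<le>d. c i * X (real i) N D) - (\<Sum>i\<le>d. c i * ell i))\<^sup>2)
      <= avg N x (%D. \<Sum>i\<le>d. (real (Suc d) * (c i)\<^sup>2) * (X (real i) N D - ell i)\<^sup>2)" using eventually_usable
  proof eventually_elim
    case (elim N)
    show ?case
    proof (rule avg_mono)
      fix D
      have "((\<Sum>i\<le>d. c i * X (real i) N D) - (\<Sum>i\<le>d. c i * ell i))\<^sup>2 = (\<Sum>i\<le>d. c i * (X (real i) N D - ell i))\<^sup>2"
        by (simp add: sum_subtractf[symmetric] right_diff_distrib)
      also have "... <= (\<Sum>i\<le>d. (c i * (X (real i) N D - ell i))\<^sup>2) * real (card {..d})" by (rule sum_squared_le_sum_of_squares)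
      also have "... = (\<Sum>i\<le>d. (real (Suc d) * (c i)\<^sup>2) * (X (real i) N D - ell i)\<^sup>2)"
        unfolding sum_distrib_right by (intro sum.cong refl) (simp add: power_mult_distrib mult_ac)
      finally show "((\<Sum>i\<le>d. c i * X (real i) N D) - (\<Sum>i\<le>d. c i * ell i))\<^sup>2
        <= (\<Sum>i\<le>d. (real (Suc d) * (c i)\<^sup>2) * (X (real i) N D - ell i)\<^sup>2)" .
    qed (use elim in \<open>auto simp: usable_def\<close>)
  qed
  show "(%N. avg N x (%D. \<Sum>i\<le>d. (real (Suc d) * (c i)\<^sup>2) * (X (real i) N D - ell i)\<^sup>2)) \<longlonglongrightarrow> 0" by (rule sum_L2)
qed

lemma integral_near:
  assumes D: "supported N D" and f: "continuous_on UNIV f"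
    and close: "!!v. v \<in> {0..S0} ==> \<bar>f v - (\<Sum>i\<le>d. c i * exp (real i * v))\<bar> <= \<epsilon>"
  shows "\<bar>integral\<^sup>L (cm N D) f - (\<Sum>i\<le>d. c i * X (real i) N D)\<bar> <= \<epsilon>"
proof -
  interpret C: real_distribution "cm N D" using D by (simp add: supported_def)
  have ae: "AE v in cm N D. v \<in> {0..S0}" using D by (simp add: supported_def)
  have "\<bar>integral\<^sup>L (cm N D) f - integral\<^sup>L (cm N D) (%v. \<Sum>i\<le>d. c i * exp (real i * v))\<bar> <= \<epsilon>"
    by (rule C.integral_close[OF ae f _ close]) (auto intro!: continuous_intros)
  then show ?thesis unfolding C.integral_exp_sum[OF ae] X_def .
qed

lemma chebyshev:
  assumes N: "usable N" and \<eta>: "0 < \<eta>" and imp: "!!D. D \<in> configs_of N ==> P D ==> \<eta> <= \<bar>Y D - c\<bar>"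
  shows "avg N x (%D. if P D then 1 else 0) <= 1 / \<eta>\<^sup>2 * avg N x (%D. (Y D - c)\<^sup>2)"
proof -
  have "avg N x (%D. if P D then 1 else 0) <= avg N x (%D. 1 / \<eta>\<^sup>2 * (Y D - c)\<^sup>2)"
  proof (rule avg_mono)
    fix D assume D: "D \<in> configs_of N"
    show "(if P D then 1 else 0) <= 1 / \<eta>\<^sup>2 * (Y D - c)\<^sup>2"
    proof (cases "P D")
      case True
      have "\<eta>\<^sup>2 <= (Y D - c)\<^sup>2" using imp[OF D True] \<eta> by (simp add: abs_le_square_iff[symmetric])
      then show ?thesis using True \<eta> by (simp add: le_divide_eq)
    qed simp
  qed (use N in \<open>auto simp: usable_def\<close>)
  then show ?thesis by (simp only: avg_linear)
qed

text \<open>A small average forces a small value somewhere. Picking such configurations replaces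
  random measures by deterministic ones, to which tightness applies.\<close>

lemma typical_configuration:
  "\<exists>N D. usable N \<and> D \<in> configs_of N \<and> (\<Sum>i\<le>K. (X (real i) N D - ell i)\<^sup>2) < 1 / real (Suc K)"
proof -
  have "(%N. avg N x (%D. \<Sum>i\<le>K. 1 * (X (real i) N D - ell i)\<^sup>2)) \<longlonglongrightarrow> 0" by (rule sum_L2)
  then have "\<forall>\<^sub>F N in sequentially. avg N x (%D. \<Sum>i\<le>K. 1 * (X (real i) N D - ell i)\<^sup>2) < 1 / real (Suc K)"
    by (rule order_tendstoD(2)) simp
  from eventually_happens'[OF sequentially_bot eventually_conj[OF this eventually_usable]]
  obtain N where N: "avg N x (%D. \<Sum>i\<le>K. (X (real i) N D - ell i)\<^sup>2) < 1 / real (Suc K)" "usable N" by auto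
  have "\<exists>D\<in>configs_of N. (\<Sum>i\<le>K. (X (real i) N D - ell i)\<^sup>2) < 1 / real (Suc K)"
  proof (rule ccontr)
    assume "\<not> ?thesis"
    then have "1 / real (Suc K) <= (\<Sum>i\<le>K. (X (real i) N D - ell i)\<^sup>2)" if "D \<in> configs_of N" for D using that by (meson not_less)
    then have "avg N x (%D. 1 / real (Suc K)) <= avg N x (%D. \<Sum>i\<le>K. (X (real i) N D - ell i)\<^sup>2)"
      using N(2) by (intro avg_mono) (auto simp: usable_def)
    then show False using N avg_const[of N "1 / real (Suc K)"] by (simp add: usable_def)
  qed
  then show ?thesis using N(2) by blast
qed

text \<open>The limit measure arises by compactness along configurations whose exponential moments are close to
  their limits.\<close>

theorem limit_exists: "\<exists>\<mu>. level_limit_measure \<Omega> a x y \<kappa> \<mu>"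
proof -
  have "\<forall>K. \<exists>N D. usable N \<and> D \<in> configs_of N \<and> (\<Sum>i\<le>K. (X (real i) N D - ell i)\<^sup>2) < 1 / real (Suc K)"
    using typical_configuration by blast
  from choice[OF this] obtain NN where
    "\<forall>K. \<exists>D. usable (NN K) \<and> D \<in> configs_of (NN K) \<and> (\<Sum>i\<le>K. (X (real i) (NN K) D - ell i)\<^sup>2) < 1 / real (Suc K)" by blast
  from choice[OF this] obtain DD where ND: "!!K. usable (NN K)" "!!K. DD K \<in> configs_of (NN K)"
    "!!K. (\<Sum>i\<le>K. (X (real i) (NN K) (DD K) - ell i)\<^sup>2) < 1 / real (Suc K)" by blast
  define \<nu> where "\<nu> = (%K. cm (NN K) (DD K))"
  have sup: "supported (NN K) (DD K)" for K using ND(1,2)[of K] by (simp add: usable_def)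
  then have rd: "real_distribution (\<nu> K)" for K by (simp add: \<nu>_def supported_def)
  have "tight \<nu>" unfolding tight_def
  proof (intro conjI allI impI rd)
    fix \<epsilon> :: real assume \<epsilon>: "0 < \<epsilon>"
    show "\<exists>a b. a < b \<and> (\<forall>K. 1 - \<epsilon> < measure (\<nu> K) {a<..b})"
    proof (intro exI conjI allI)
      show "- 1 < S0" using S0_nonneg by simp
      fix K
      interpret C: real_distribution "\<nu> K" by (rule rd)
      have "AE v in \<nu> K. v \<in> {-1<..S0}" using sup[of K] unfolding supported_def \<nu>_def by (auto elim!: eventually_mono)
      then have "measure (\<nu> K) {-1<..S0} = 1" by (intro C.prob_eq_1[THEN iffD2]) auto
      then show "1 - \<epsilon> < measure (\<nu> K) {-1<..S0}" using \<epsilon> by simp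
    qed
  qed
  from tight_imp_convergent_subsubsequence[OF this strict_mono_id]
  obtain r \<mu> where r: "strict_mono (r :: nat => nat)" and \<mu>: "real_distribution \<mu>" and w: "weak_conv_m (%k. \<nu> (r k)) \<mu>"
    by (auto simp: o_def)
  have X_lim: "(%k. X (real i) (NN (r k)) (DD (r k))) \<longlonglongrightarrow> ell i" for i
  proof -
    have "(%K. (X (real i) (NN K) (DD K) - ell i)\<^sup>2) \<longlonglongrightarrow> 0"
    proof (rule tendsto_sandwich[OF _ _ tendsto_const])
      show "\<forall>\<^sub>F K in sequentially. (X (real i) (NN K) (DD K) - ell i)\<^sup>2 <= 1 / real (Suc K)" using eventually_ge_at_top[of i]
      proof eventually_elim
        case (elim K)
        have "(X (real i) (NN K) (DD K) - ell i)\<^sup>2 <= (\<Sum>i\<le>K. (X (real i) (NN K) (DD K) - ell i)\<^sup>2)"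
          using elim by (intro member_le_sum[of i "{..K}" "%i. (X (real i) (NN K) (DD K) - ell i)\<^sup>2"]) auto
        then show ?case using ND(3)[of K] by linarith
      qed
      show "(%K. 1 / real (Suc K)) \<longlonglongrightarrow> 0" using LIMSEQ_inverse_real_of_nat by (simp add: inverse_eq_divide)
    qed simp
    then have "(%K. sqrt ((X (real i) (NN K) (DD K) - ell i)\<^sup>2)) \<longlonglongrightarrow> sqrt 0" by (rule tendsto_real_sqrt)
    then have "(%K. X (real i) (NN K) (DD K) - ell i) \<longlonglongrightarrow> 0" by (simp add: tendsto_rabs_zero_iff)
    then have "(%K. X (real i) (NN K) (DD K)) \<longlonglongrightarrow> ell i" by (simp only: LIM_zero_iff)
    from LIMSEQ_subseq_LIMSEQ[OF this r] show ?thesis by (simp add: o_def)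
  qed
  have "level_limit_measure \<Omega> a x y \<kappa> \<mu>"
    unfolding level_limit_measure_def weak_limit_in_prob_def lev_def[symmetric] cm_def[symmetric]
  proof (intro conjI \<mu> allI impI)
    fix f :: "real => real" and \<epsilon> :: real
    assume f: "continuous_on UNIV f \<and> bounded (range f)" and \<epsilon>: "0 < \<epsilon>"
    obtain B where B: "!!v. norm (f v) <= B" using f by (auto simp: bounded_iff)
    obtain c d where cd: "!!v. v \<in> {0..S0} ==> \<bar>f v - (\<Sum>i\<le>d. c i * exp (real i * v))\<bar> <= \<epsilon> / 4"
      by (rule exp_polynomial_approximation[of f "\<epsilon> / 4" S0]) (use f \<epsilon> S0_nonneg in auto)
    let ?G = "\<Sum>i\<le>d. c i * ell i"
    have fl: "(%k. integral\<^sup>L (\<nu> (r k)) f) \<longlonglongrightarrow> integral\<^sup>L \<mu> f"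
      using f B by (intro weak_conv_imp_integral_bdd_continuous_conv[OF rd \<mu> w])
        (auto simp: continuous_on_eq_continuous_at)
    have sl: "(%k. \<Sum>i\<le>d. c i * X (real i) (NN (r k)) (DD (r k))) \<longlonglongrightarrow> ?G" by (intro tendsto_intros X_lim)
    have "(%k. \<bar>integral\<^sup>L (\<nu> (r k)) f - (\<Sum>i\<le>d. c i * X (real i) (NN (r k)) (DD (r k)))\<bar>) \<longlonglongrightarrow> \<bar>integral\<^sup>L \<mu> f - ?G\<bar>"
      by (intro tendsto_rabs tendsto_diff fl sl)
    \<comment> \<open>Along the subsequence the integrals of \<open>f\<close> converge by weak
      convergence and the exponential sums by the choice of configurations, so \<open>\<mu>\<close>
      inherits the estimate.\<close>
    then have mu: "\<bar>integral\<^sup>L \<mu> f - ?G\<bar> <= \<epsilon> / 4"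
      by (rule LIMSEQ_le_const2) (use integral_near[OF sup _ cd] f in \<open>auto simp: \<nu>_def\<close>)
    show "(%N. prb N (%D. \<epsilon> < \<bar>integral\<^sup>L (cm N D) f - integral\<^sup>L \<mu> f\<bar>)) \<longlonglongrightarrow> 0"
    proof (rule tendsto_sandwich[OF _ _ tendsto_const])
      show "\<forall>\<^sub>F N in sequentially. prb N (%D. \<epsilon> < \<bar>integral\<^sup>L (cm N D) f - integral\<^sup>L \<mu> f\<bar>)
        <= 1 / (\<epsilon> / 2)\<^sup>2 * avg N x (%D. ((\<Sum>i\<le>d. c i * X (real i) N D) - ?G)\<^sup>2)" using eventually_usable
      proof eventually_elim
        case (elim N)
        \<comment> \<open>A quarter of \<open>\<epsilon>\<close> is lost in approximating by
          exponentials under the random measure and a quarter under \<open>\<mu>\<close>; the rest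
          is left for Chebyshev's inequality.\<close>
        have imp: "\<epsilon> / 2 <= \<bar>(\<Sum>i\<le>d. c i * X (real i) N D) - ?G\<bar>"
          if "D \<in> configs_of N" "\<epsilon> < \<bar>integral\<^sup>L (cm N D) f - integral\<^sup>L \<mu> f\<bar>" for D
        proof -
          have "\<bar>integral\<^sup>L (cm N D) f - (\<Sum>i\<le>d. c i * X (real i) N D)\<bar> <= \<epsilon> / 4"
            by (rule integral_near[OF _ _ cd]) (use elim that f in \<open>auto simp: usable_def\<close>)
          then show ?thesis using mu that(2) by linarith
        qed
        have "prb N (%D. \<epsilon> < \<bar>integral\<^sup>L (cm N D) f - integral\<^sup>L \<mu> f\<bar>) = avg N x (%D. if \<epsilon> < \<bar>integral\<^sup>L (cm N D) f - integral\<^sup>L \<mu> f\<bar> then 1 else 0)"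
          using elim by (intro measure_eq_avg) (auto simp: usable_def)
        also have "... <= 1 / (\<epsilon> / 2)\<^sup>2 * avg N x (%D. ((\<Sum>i\<le>d. c i * X (real i) N D) - ?G)\<^sup>2)"
          by (rule chebyshev[OF elim _ imp]) (use \<epsilon> in auto)
        finally show ?case .
      qed
      show "(%N. 1 / (\<epsilon> / 2)\<^sup>2 * avg N x (%D. ((\<Sum>i\<le>d. c i * X (real i) N D) - ?G)\<^sup>2)) \<longlonglongrightarrow> 0"
        by (rule tendsto_mult_right_zero[OF combination_L2])
    qed simp
  qed
  then show ?thesis by blast
qed

text \<open>Limits in probability are unique: if the values differed, deviations by a third of their
  distance from either of them could not both be rare.\<close>

lemma limit_integral:
  assumes \<mu>: "level_limit_measure \<Omega> a x y \<kappa> \<mu>" and f: "continuous_on UNIV f" "bounded (range f)"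
    and Y: "!!N D. usable N ==> D \<in> configs_of N ==> integral\<^sup>L (cm N D) f = Y N D"
    and L2: "(%N. avg N x (%D. (Y N D - c)\<^sup>2)) \<longlonglongrightarrow> 0"
  shows "integral\<^sup>L \<mu> f = c"
proof (rule ccontr)
  assume ne: "integral\<^sup>L \<mu> f ~= c"
  define \<eta> where "\<eta> = \<bar>integral\<^sup>L \<mu> f - c\<bar> / 3"
  have \<eta>: "0 < \<eta>" using ne by (simp add: \<eta>_def)
  have "(%N. prb N (%D. \<eta> < \<bar>integral\<^sup>L (cm N D) f - integral\<^sup>L \<mu> f\<bar>)) \<longlonglongrightarrow> 0"
    using \<mu> f \<eta> unfolding level_limit_measure_def weak_limit_in_prob_def lev_def[symmetric] cm_def[symmetric] by blast
  then have "(%N. prb N (%D. \<eta> < \<bar>integral\<^sup>L (cm N D) f - integral\<^sup>L \<mu> f\<bar>) + 1 / \<eta>\<^sup>2 * avg N x (%D. (Y N D - c)\<^sup>2)) \<longlonglongrightarrow> 0 + 1 / \<eta>\<^sup>2 * 0"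
    by (intro tendsto_intros L2)
  then have "\<forall>\<^sub>F N in sequentially. prb N (%D. \<eta> < \<bar>integral\<^sup>L (cm N D) f - integral\<^sup>L \<mu> f\<bar>) + 1 / \<eta>\<^sup>2 * avg N x (%D. (Y N D - c)\<^sup>2) < 1"
    by (rule order_tendstoD(2)) simp
  from eventually_happens'[OF sequentially_bot eventually_conj[OF this eventually_usable]]
  obtain N where N: "usable N" "prb N (%D. \<eta> < \<bar>integral\<^sup>L (cm N D) f - integral\<^sup>L \<mu> f\<bar>) + 1 / \<eta>\<^sup>2 * avg N x (%D. (Y N D - c)\<^sup>2) < 1" by blast
  have uN: "2 <= N" "configs_of N ~= {}" using N(1) by (auto simp: usable_def)
  let ?P = "%D. \<eta> < \<bar>integral\<^sup>L (cm N D) f - integral\<^sup>L \<mu> f\<bar>"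
  have "1 = avg N x (%D. 1)" by (rule avg_const[OF uN, symmetric])
  also have "... = avg N x (%D. (if ?P D then 1 else 0) + (if \<not> ?P D then 1 else 0))" by (rule avg_cong) simp
  also have "... = avg N x (%D. if ?P D then 1 else 0) + avg N x (%D. if \<not> ?P D then 1 else 0)" by (rule avg_linear)
  also have "... <= avg N x (%D. if ?P D then 1 else 0) + 1 / \<eta>\<^sup>2 * avg N x (%D. (Y N D - c)\<^sup>2)"
  proof (intro add_left_mono chebyshev[OF N(1) \<eta>])
    fix D assume "D \<in> configs_of N" "\<not> ?P D"
    then have "\<bar>Y N D - integral\<^sup>L \<mu> f\<bar> <= \<eta>" using Y[OF N(1)] by simp
    moreover have "\<bar>integral\<^sup>L \<mu> f - c\<bar> <= \<bar>Y N D - integral\<^sup>L \<mu> f\<bar> + \<bar>Y N D - c\<bar>" by arith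
    moreover have "\<bar>integral\<^sup>L \<mu> f - c\<bar> = 3 * \<eta>" by (simp add: \<eta>_def)
    ultimately show "\<eta> <= \<bar>Y N D - c\<bar>" using \<eta> by linarith
  qed
  also have "avg N x (%D. if ?P D then 1 else 0) = prb N ?P" by (rule measure_eq_avg[OF uN, symmetric])
  finally show False using N(2) by simp
qed

text \<open>The bounded test function \<open>f\<close> vanishes exactly on \<open>[0, S0]\<close>,
  where all measures with large \<open>N\<close> live, so its integral against the limit is
  \<open>0\<close>.\<close>

lemma limit_support:
  assumes \<mu>: "level_limit_measure \<Omega> a x y \<kappa> \<mu>"
  shows "AE v in \<mu>. v \<in> {0..S0}"
proof -
  interpret real_distribution \<mu> using \<mu> by (simp add: level_limit_measure_def weak_limit_in_prob_def)
  define f :: "real => real" where "f = (%v. min 1 (max 0 (max (- v) (v - S0))))"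
  have f: "continuous_on UNIV f" unfolding f_def by (intro continuous_intros)
  have fb: "0 <= f v \<and> f v <= 1" for v by (auto simp: f_def)
  have "bounded (range f)" using fb by (intro boundedI[of _ 1]) auto
  moreover have "integral\<^sup>L (cm N D) f = 0" if "usable N" "D \<in> configs_of N" for N D
  proof (rule integral_eq_zero_AE)
    have "AE v in cm N D. v \<in> {0..S0}" using that by (auto simp: usable_def supported_def)
    then show "AE v in cm N D. f v = 0" by eventually_elim (auto simp: f_def)
  qed
  moreover have "(%N. avg N x (%D. (0 - 0)\<^sup>2)) \<longlonglongrightarrow> 0" by (simp add: avg_def)
  ultimately have "integral\<^sup>L \<mu> f = 0" using limit_integral[OF \<mu> f, of "%_ _. 0" 0] by blast
  moreover have "integrable \<mu> f" using fb borel_measurable_continuous_onI[OF f] by (intro integrable_const_bound[of _ 1]) auto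
  ultimately have "AE v in \<mu>. f v = 0" using fb by (subst integral_nonneg_eq_0_iff_AE[symmetric]) auto
  then show ?thesis by eventually_elim (auto simp: f_def min_def max_def split: if_splits)
qed

text \<open>The exponential is unbounded, so it is frozen outside \<open>[0, S0]\<close>; on the
  common support nothing changes.\<close>

lemma limit_exponential_moment:
  assumes \<mu>: "level_limit_measure \<Omega> a x y \<kappa> \<mu>" and t: "0 < t"
  shows "(\<integral>v. exp (t * v) \<partial>\<mu>) = Lr t"
proof -
  interpret real_distribution \<mu> using \<mu> by (simp add: level_limit_measure_def weak_limit_in_prob_def)
  define f :: "real => real" where "f = (%v. exp (t * min S0 (max 0 v)))"
  have f: "continuous_on UNIV f" unfolding f_def by (intro continuous_intros)
  have "0 <= f v \<and> f v <= exp (t * S0)" for v using t by (auto simp: f_def)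
  then have b: "bounded (range f)" by (intro boundedI[of _ "exp (t * S0)"]) auto
  have cut: "f v = exp (t * v)" if "v \<in> {0..S0}" for v using that by (simp add: f_def)
  have "integral\<^sup>L (cm N D) f = X t N D" if "usable N" "D \<in> configs_of N" for N D
  proof -
    interpret C: real_distribution "cm N D" using that by (simp add: usable_def supported_def)
    have "AE v in cm N D. v \<in> {0..S0}" using that by (auto simp: usable_def supported_def)
    then have "AE v in cm N D. f v = exp (t * v)" by eventually_elim (rule cut)
    then show ?thesis unfolding X_def using borel_measurable_continuous_onI[OF f] by (intro integral_cong_AE) auto
  qed
  from limit_integral[OF \<mu> f b this X_L2[OF t]] have "integral\<^sup>L \<mu> f = Lr t" .
  moreover have "integral\<^sup>L \<mu> f = (\<integral>v. exp (t * v) \<partial>\<mu>)"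
  proof (rule integral_cong_AE)
    show "AE v in \<mu>. f v = exp (t * v)" using limit_support[OF \<mu>] by eventually_elim (rule cut)
  qed (use borel_measurable_continuous_onI[OF f] in auto)
  ultimately show ?thesis by simp
qed

end

section \<open>Moments of the limit\<close>

text \<open>A power series that vanishes at \<open>0\<close> and has a nonzero coefficient has an
  isolated zero there, but this one vanishes at all small positive reals.\<close>

lemma powser_eq_0_on_positive:
  fixes c :: "nat => complex"
  assumes c0: "c 0 = 0" and sums: "!!t. 0 < t ==> (%p. c p * of_real t ^ p) sums 0"
  shows "c p = 0"
proof (rule ccontr)
  assume cp: "c p ~= 0"
  then have p: "0 < p" using c0 by (cases p) auto
  have s1: "summable (%p. c p * 1 ^ p)" using sums_summable[OF sums[of 1]] by simp
  define f where "f w = (\<Sum>p. c p * w ^ p)" for w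
  have ps: "(%p. c p * (w - 0) ^ p) sums f w" if "norm (w - 0) < 1" for w
    using powser_inside[OF s1, of w] that by (simp add: f_def summable_sums)
  have f0: "f 0 = 0" using c0 by (simp add: f_def powser_zero)
  obtain s where s: "0 < s" "!!z. z \<in> cball 0 s - {0} ==> f z ~= 0"
    by (rule powser_0_nonzero[OF zero_less_one ps f0 cp p]) (assumption | rule that)+
  have "f (of_real s) = 0" unfolding f_def using sums[OF s(1)] by (rule sums_unique[symmetric])
  moreover have "complex_of_real s \<in> cball 0 s - {0}" using s(1) by simp
  ultimately show False using s(2) by blast
qed

lemma exp_partial_sum_le: "0 <= u ==> (\<Sum>p<K. u ^ p / fact p) <= exp (u::real)"
  using sum_le_suminf[OF summable_exp_generic[of u], of "{..<K}"]
  by (simp add: exp_def divide_inverse mult.commute scaleR_conv_of_real)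

section \<open>Taylor coefficients and residues\<close>

context limit_staircase
begin

abbreviation rad :: real where "rad \<equiv> \<rho> / 4"

text \<open>The bracket \<open>F\<close> divided by \<open>z\<close>. It shows the integrand to be
  \<open>z ^ p * H z ^ (p + 1)\<close>, which is regular at the origin for
  \<open>p >= 1\<close>.\<close>

definition H :: "complex => complex" where
  "H z = Q_deriv m n a x y \<kappa> z + (\<Sum>j = 1..n. 1 / (of_nat n * (z - of_real (x j))))"

lemma F_H: "F z = z * H z" by (simp add: F_def H_def distrib_left sum_distrib_left)

lemma moment_integrand_F: "moment_integrand m n a x y \<kappa> p z = F z ^ (p + 1) / z" by (simp add: moment_integrand_def F_def)

lemma moment_integrand_H: "1 <= p ==> moment_integrand m n a x y \<kappa> p z = z ^ p * H z ^ (p + 1)"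
  by (cases "z = 0") (auto simp: moment_integrand_F F_H power_mult_distrib)

lemma H_holomorphic: "H holomorphic_on - (x_poles n x \<union> other_poles m n a x y)"
proof -
  have 1: "z ^ m - complex_of_real (x j) ^ m ~= 0" "z - of_real (x j) ~= 0"
    if "z \<in> - (x_poles n x \<union> other_poles m n a x y)" "j \<in> {1..n}" for z j using that by (auto simp: x_poles_def other_poles_def)
  have 2: "1 + complex_of_real (y i) * z ~= 0"
    if "z \<in> - (x_poles n x \<union> other_poles m n a x y)" "i \<in> {i \<in> {1..n}. a i = 0}" for z i
  proof
    assume eq: "1 + complex_of_real (y i) * z = 0"
    have "0 < y i" using that(2) xy_pos by auto
    then have "z = - 1 / of_real (y i)" using eq by (simp add: field_simps add_eq_0_iff)
    then show False using that by (auto simp: other_poles_def)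
  qed
  have n0: "complex_of_nat n ~= 0" using n_pos by simp
  show ?thesis unfolding H_def[abs_def] Q_deriv_def by (intro holomorphic_intros) (use 1 2 n0 in auto)
qed

lemma other_poles_Disc: "z \<in> Disc \<rho> ==> z \<notin> other_poles m n a x y"
proof
  assume z: "z \<in> Disc \<rho>" and "z \<in> other_poles m n a x y"
  then consider j where "j \<in> {1..n}" "z ^ m = of_real (x j) ^ m" "z \<notin> x_poles n x"
    | i where "i \<in> {1..n}" "z = - 1 / of_real (y i)" by (auto simp: other_poles_def)
  then show False
  proof cases
    case 1
    have "complex_of_real (x j) \<in> Disc \<rho>" using 1(1) \<rho> by (auto simp: Disc_def intro!: bexI[of _ j])
    then have "z = of_real (x j)" using Disc_inj[OF z] 1(2) by blast
    then show False using 1 by (auto simp: x_poles_def)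
  next
    case 2
    have "0 < Re z" using z Re_pos by (auto simp: Disc_def)
    moreover have "Re z = - 1 / y i" unfolding 2(2) by (simp add: Re_divide_of_real)
    ultimately show False using xy_pos[of i] 2(1) by (auto simp: zero_less_divide_iff)
  qed
qed

lemma Sph_poles: "Sph rad \<subseteq> - (x_poles n x \<union> other_poles m n a x y)"
proof
  fix z assume z: "z \<in> Sph rad"
  have "z \<in> Disc \<rho>" using Sph_subset[of rad \<rho>] z \<rho> by auto
  moreover have "z ~= of_real (x k)" if "k \<in> {1..n}" for k
    by (rule Sph_Disc_disjoint[OF z]) (use that \<rho> in \<open>auto simp: Disc_def intro!: bexI[of _ k]\<close>)
  ultimately show "z \<in> - (x_poles n x \<union> other_poles m n a x y)" using other_poles_Disc by (auto simp: x_poles_def)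
qed

lemma F_continuous: "continuous_on (Sph rad) F"
proof -
  have "H holomorphic_on Sph rad" by (rule holomorphic_on_subset[OF H_holomorphic Sph_poles])
  then show ?thesis unfolding F_H[abs_def] by (intro continuous_intros holomorphic_on_imp_continuous_on)
qed

lemma Sph_nonzero: "z \<in> Sph rad ==> z ~= 0" using Sph_norm[of z rad] \<rho> by auto

text \<open>The exponential series is integrated term by term; \<open>F\<close> is bounded on the
  circles, so the partial sums have a common bound.\<close>

lemma series_circ:
  assumes t: "0 < t"
  shows "(%p. circ rad (%z. F z ^ p / z) / fact p * of_real t ^ p) sums (of_real t * Lt t)"
proof -
  have rad: "0 < rad" using \<rho> by simp
  have "compact (Sph rad)" unfolding Sph_def by (intro compact_UN) auto
  then have "compact (F ` Sph rad)" by (intro compact_continuous_image F_continuous)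
  then obtain B where B: "!!z. z \<in> Sph rad ==> norm (F z) <= B" using compact_imp_bounded bounded_iff by (metis imageI)
  have cont: "continuous_on (Sph rad) (%z. F z ^ p / z)" for p using Sph_nonzero by (intro continuous_intros F_continuous) auto
  have "(%K. circ rad (%z. \<Sum>p<K. of_real t ^ p / fact p * (F z ^ p / z))) \<longlonglongrightarrow> circ rad (%z. exp (of_real t * F z) / z)"
  proof (rule circ_tendsto[OF rad, of _ "exp (t * \<bar>B\<bar>) / (\<rho> / 2)"])
    show "\<forall>\<^sub>F K in sequentially. continuous_on (Sph rad) (%z. \<Sum>p<K. of_real t ^ p / fact p * (F z ^ p / z))"
      by (intro always_eventually allI continuous_intros cont)
    have eq: "(\<Sum>p<K. of_real t ^ p / fact p * (F z ^ p / z)) = (\<Sum>p<K. (of_real t * F z) ^ p / fact p) / z" for K z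
      unfolding sum_divide_distrib by (intro sum.cong refl) (simp add: power_mult_distrib)
    show "\<forall>\<^sub>F K in sequentially. \<forall>z\<in>Sph rad. norm (\<Sum>p<K. of_real t ^ p / fact p * (F z ^ p / z)) <= exp (t * \<bar>B\<bar>) / (\<rho> / 2)"
    proof (intro always_eventually allI ballI)
      fix K z assume z: "z \<in> Sph rad"
      have "norm (\<Sum>p<K. (of_real t * F z) ^ p / fact p) <= (\<Sum>p<K. norm ((of_real t * F z) ^ p / fact p))" by (rule norm_sum)
      also have "... = (\<Sum>p<K. (t * norm (F z)) ^ p / fact p)" using t by (simp add: norm_divide norm_power norm_mult)
      also have "... <= exp (t * norm (F z))" using t by (intro exp_partial_sum_le) simp
      also have "... <= exp (t * \<bar>B\<bar>)" using B[OF z] t by simp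
      finally have "norm (\<Sum>p<K. (of_real t * F z) ^ p / fact p) / norm z <= exp (t * \<bar>B\<bar>) / (\<rho> / 2)"
        using Sph_norm[OF z] \<rho> by (intro frac_le) auto
      then show "norm (\<Sum>p<K. of_real t ^ p / fact p * (F z ^ p / z)) <= exp (t * \<bar>B\<bar>) / (\<rho> / 2)" unfolding eq norm_divide .
    qed
    show "(%K. \<Sum>p<K. of_real t ^ p / fact p * (F z ^ p / z)) \<longlonglongrightarrow> exp (of_real t * F z) / z" if z: "z \<in> Sph rad" for z
    proof -
      have "(%K. \<Sum>p<K. (of_real t * F z) ^ p / fact p) \<longlonglongrightarrow> exp (of_real t * F z)"
        using exp_converges[of "of_real t * F z"] by (simp add: sums_def scaleR_conv_of_real divide_inverse mult.commute)
      then show ?thesis unfolding eq using Sph_nonzero[OF z] by (intro tendsto_intros)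
    qed
  qed
  moreover have "circ rad (%z. \<Sum>p<K. of_real t ^ p / fact p * (F z ^ p / z)) = (\<Sum>p<K. circ rad (%z. F z ^ p / z) / fact p * of_real t ^ p)" for K
  proof -
    have "circ rad (%z. \<Sum>p<K. of_real t ^ p / fact p * (F z ^ p / z)) = (\<Sum>p<K. circ rad (%z. of_real t ^ p / fact p * (F z ^ p / z)))"
      by (intro circ_sum rad continuous_intros cont) auto
    also have "... = (\<Sum>p<K. circ rad (%z. F z ^ p / z) / fact p * of_real t ^ p)"
      by (intro sum.cong refl) (subst circ_mult[OF rad cont], simp)
    finally show ?thesis .
  qed
  moreover have "circ rad (%z. exp (of_real t * F z) / z) = of_real t * Lt t"
  proof -
    have c: "continuous_on (Sph rad) (%z. exp (of_real t * F z) / (of_real t * z))"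
      using Sph_nonzero t by (intro continuous_intros F_continuous) auto
    have "circ rad (%z. exp (of_real t * F z) / z) = circ rad (%z. of_real t * (exp (of_real t * F z) / (of_real t * z)))"
      using t by simp
    then show ?thesis unfolding Lt_def circ_mult[OF rad c] .
  qed
  ultimately show ?thesis by (simp add: sums_def)
qed

lemma series_moments:
  assumes \<mu>: "level_limit_measure \<Omega> a x y \<kappa> \<mu>" and t: "0 < t"
  shows "(%p. (\<integral>v. v ^ p \<partial>\<mu>) / fact p * t ^ p) sums Lr t"
proof -
  interpret real_distribution \<mu> using \<mu> by (simp add: level_limit_measure_def weak_limit_in_prob_def)
  note ae = limit_support[OF \<mu>]
  have int: "integrable \<mu> (%v. v ^ p)" for p by (rule integrable_AE_interval[OF ae]) (intro continuous_intros)
  have "(%K. \<integral>v. (\<Sum>p<K. (t * v) ^ p / fact p) \<partial>\<mu>) \<longlonglongrightarrow> (\<integral>v. exp (t * v) \<partial>\<mu>)"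
  proof (rule integral_dominated_convergence[where w = "%_. exp (t * S0)"])
    show "AE v in \<mu>. (%K. \<Sum>p<K. (t * v) ^ p / fact p) \<longlonglongrightarrow> exp (t * v)"
    proof (rule AE_I2)
      fix v :: real
      show "(%K. \<Sum>p<K. (t * v) ^ p / fact p) \<longlonglongrightarrow> exp (t * v)"
        using exp_converges[of "t * v"] by (simp add: sums_def divide_inverse mult.commute)
    qed
    show "AE v in \<mu>. norm (\<Sum>p<K. (t * v) ^ p / fact p) <= exp (t * S0)" for K using ae
    proof eventually_elim
      case (elim v)
      have "0 <= (\<Sum>p<K. (t * v) ^ p / fact p)" using elim t by (intro sum_nonneg) auto
      moreover have "(\<Sum>p<K. (t * v) ^ p / fact p) <= exp (t * v)" using elim t by (intro exp_partial_sum_le) auto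
      moreover have "exp (t * v) <= exp (t * S0)" using elim t by simp
      ultimately show ?case unfolding real_norm_def by linarith
    qed
  qed auto
  moreover have "(\<integral>v. (\<Sum>p<K. (t * v) ^ p / fact p) \<partial>\<mu>) = (\<Sum>p<K. (\<integral>v. v ^ p \<partial>\<mu>) / fact p * t ^ p)" for K
    using int by (simp add: power_mult_distrib mult.commute)
  ultimately show ?thesis unfolding limit_exponential_moment[OF \<mu> t] by (simp add: sums_def)
qed

text \<open>Both sides expand \<open>t * Lr t\<close> in powers of \<open>t\<close>. The factor
  \<open>t\<close> shifts the moments by one index against the contour integrals, and the quotient
  of the two factorials is \<open>p + 1\<close>.\<close>

lemma moment_formula:
  assumes \<mu>: "level_limit_measure \<Omega> a x y \<kappa> \<mu>"
  shows "complex_of_real (\<integral>v. v ^ p \<partial>\<mu>) = circ rad (%z. F z ^ (p + 1) / z) / (of_nat p + 1)"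
proof -
  define A where "A p = (if p = 0 then 0 else complex_of_real (\<integral>v. v ^ (p - 1) \<partial>\<mu>) / fact (p - 1))" for p
  define b where "b p = circ rad (%z. F z ^ p / z) / fact p" for p
  \<comment> \<open>The constant term vanishes because the discs avoid the origin.\<close>
  have "contour_integral (circlepath (of_real (x k)) rad) (%z. 1 / z) = 0" if k: "k \<in> {1..n}" for k
  proof (rule contour_integral_unique[OF Cauchy_theorem_convex_simple])
    have "z ~= 0" if "z \<in> ball (complex_of_real (x k)) \<rho>" for z using Re_pos[OF k that] by auto
    then show "(%z. 1 / z) holomorphic_on ball (complex_of_real (x k)) \<rho>" by (intro holomorphic_intros) auto
    show "path_image (circlepath (of_real (x k)) rad) \<subseteq> ball (complex_of_real (x k)) \<rho>" using \<rho> by auto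
  qed auto
  then have "circ rad (%z. 1 / z) = 0" by (simp add: circ_def)
  then have b0: "A 0 - b 0 = 0" by (simp add: A_def b_def)
  have "(%p. (A p - b p) * of_real t ^ p) sums 0" if t: "0 < t" for t
  proof -
    have "(%p. complex_of_real ((\<integral>v. v ^ p \<partial>\<mu>) / fact p * t ^ p)) sums of_real (Lr t)"
      by (rule sums_of_real[OF series_moments[OF \<mu> t]])
    then have "(%p. of_real t * complex_of_real ((\<integral>v. v ^ p \<partial>\<mu>) / fact p * t ^ p)) sums (of_real t * of_real (Lr t))"
      by (rule sums_mult)
    moreover have "of_real t * complex_of_real ((\<integral>v. v ^ p \<partial>\<mu>) / fact p * t ^ p) = A (Suc p) * of_real t ^ Suc p" for p
      by (simp add: A_def)
    ultimately have "(%p. A (Suc p) * of_real t ^ Suc p) sums (of_real t * Lt t)" by (simp only: Lt_real[OF t])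
    from sums_Suc[OF this] have "(%p. A p * of_real t ^ p) sums (of_real t * Lt t)" by (simp add: A_def)
    from sums_diff[OF this series_circ[OF t]] show ?thesis by (simp add: b_def left_diff_distrib)
  qed
  from powser_eq_0_on_positive[of "%p. A p - b p", OF b0 this, of "Suc p"] have "A (Suc p) = b (Suc p)" by simp
  then have eq: "complex_of_real (\<integral>v. v ^ p \<partial>\<mu>) / fact p = circ rad (%z. F z ^ (p + 1) / z) / (fact p * (of_nat p + 1))"
    by (simp add: A_def b_def mult.commute add.commute)
  have "complex_of_real (\<integral>v. v ^ p \<partial>\<mu>) = fact p * (complex_of_real (\<integral>v. v ^ p \<partial>\<mu>) / fact p)" by simp
  then show ?thesis unfolding eq by (simp only: mult_divide_mult_cancel_left[OF fact_nonzero] times_divide_eq_right)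
qed

lemma circ_residues:
  assumes p: "1 <= p"
  shows "circ rad (moment_integrand m n a x y \<kappa> p) = (\<Sum>k\<in>{1..n}. residue (moment_integrand m n a x y \<kappa> p) (of_real (x k)))"
proof -
  have "contour_integral (circlepath (of_real (x k)) rad) (moment_integrand m n a x y \<kappa> p)
      = of_real (2 * pi) * \<i> * residue (moment_integrand m n a x y \<kappa> p) (of_real (x k))" if k: "k \<in> {1..n}" for k
  proof (rule contour_integral_unique[OF base_residue[of "ball (complex_of_real (x k)) \<rho>"]])
    have sub: "ball (complex_of_real (x k)) \<rho> - {of_real (x k)} \<subseteq> - (x_poles n x \<union> other_poles m n a x y)"
    proof
      fix z assume z: "z \<in> ball (complex_of_real (x k)) \<rho> - {of_real (x k)}"
      have "z \<in> Disc \<rho>" using z k by (auto simp: Disc_def)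
      moreover have "z ~= of_real (x l)" if l: "l \<in> {1..n}" for l
      proof (cases "k = l")
        case False
        have "complex_of_real (x l) \<in> ball (complex_of_real (x l)) \<rho>" using \<rho> by simp
        then show ?thesis using disj[OF k l False] z by blast
      qed (use z in auto)
      ultimately show "z \<in> - (x_poles n x \<union> other_poles m n a x y)" using other_poles_Disc by (auto simp: x_poles_def)
    qed
    show "moment_integrand m n a x y \<kappa> p holomorphic_on ball (complex_of_real (x k)) \<rho> - {of_real (x k)}"
      unfolding moment_integrand_H[OF p, abs_def] by (intro holomorphic_intros holomorphic_on_subset[OF H_holomorphic sub])
  qed (use \<rho> in auto)
  then show ?thesis unfolding circ_def by (intro sum.cong refl) simp
qed

text \<open>The contour and the small circles are both evaluated by residues at the weights, instead
  of deforming one into the other. Poles outside have winding number \<open>0\<close>, and the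
  origin is no pole by \<open>moment_integrand_H\<close>.\<close>

lemma contour_residues:
  assumes p: "1 <= p" and \<gamma>: "positive_contour_around \<gamma> (x_poles n x) (other_poles m n a x y)"
  shows "contour_integral \<gamma> (moment_integrand m n a x y \<kappa> p)
     = 2 * of_real pi * \<i> * (\<Sum>k\<in>{1..n}. residue (moment_integrand m n a x y \<kappa> p) (of_real (x k)))"
proof -
  let ?f = "moment_integrand m n a x y \<kappa> p" and ?P = "x_poles n x" and ?O = "other_poles m n a x y"
  have g: "valid_path \<gamma>" "pathfinish \<gamma> = pathstart \<gamma>" "?P \<subseteq> inside (path_image \<gamma>)" "?O \<subseteq> outside (path_image \<gamma>)"
    "!!z. z \<in> inside (path_image \<gamma>) ==> winding_number \<gamma> z = 1" using \<gamma> by (auto simp: positive_contour_around_def)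
  have P: "?P = (%k. complex_of_real (x k)) ` {1..n}" by (auto simp: x_poles_def)
  have finP: "finite ?P" unfolding P by simp
  have "finite {z. \<exists>j\<in>{1..n}. z ^ m = complex_of_real (x j) ^ m}"
  proof -
    have "{z. \<exists>j\<in>{1..n}. z ^ m = complex_of_real (x j) ^ m} = (\<Union>j\<in>{1..n}. {z. z ^ m = complex_of_real (x j) ^ m})" by auto
    then show ?thesis using m_pos by (simp add: finite_nth_roots)
  qed
  then have finO: "finite ?O" by (auto simp: other_poles_def)
  have disj: "?P \<inter> ?O = {}" using g(3,4) inside_Int_outside by blast
  have "contour_integral \<gamma> ?f = of_real (2 * pi) * \<i> * (\<Sum>z\<in>?P \<union> ?O. winding_number \<gamma> z * residue ?f z)"
  proof (rule Residue_theorem[of UNIV])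
    show "?f holomorphic_on UNIV - (?P \<union> ?O)" unfolding moment_integrand_H[OF p, abs_def] Compl_eq_Diff_UNIV[symmetric]
      by (intro holomorphic_intros H_holomorphic)
    show "path_image \<gamma> \<subseteq> UNIV - (?P \<union> ?O)"
      using g(3,4) inside_no_overlap[of "path_image \<gamma>"] outside_no_overlap[of "path_image \<gamma>"] by blast
  qed (use finP finO g in auto)
  also have "(\<Sum>z\<in>?P \<union> ?O. winding_number \<gamma> z * residue ?f z)
      = (\<Sum>z\<in>?P. winding_number \<gamma> z * residue ?f z) + (\<Sum>z\<in>?O. winding_number \<gamma> z * residue ?f z)"
    by (rule sum.union_disjoint[OF finP finO disj])
  also have "(\<Sum>z\<in>?O. winding_number \<gamma> z * residue ?f z) = 0"
    using g(1,2,4) by (intro sum.neutral) (auto simp: winding_number_zero_in_outside valid_path_imp_path subset_iff)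
  also have "(\<Sum>z\<in>?P. winding_number \<gamma> z * residue ?f z) = (\<Sum>z\<in>?P. residue ?f z)" using g(3,5) by (intro sum.cong refl) auto
  also have "... = (\<Sum>k\<in>{1..n}. residue ?f (of_real (x k)))"
  proof -
    have "inj_on (%k. complex_of_real (x k)) {1..n}"
    proof (rule inj_onI)
      fix j k assume "j \<in> {1..n}" "k \<in> {1..n}" "complex_of_real (x j) = of_real (x k)"
      then show "j = k" using inj_onD[OF inj_x, of j k] by simp
    qed
    then show ?thesis unfolding P by (simp only: sum.reindex o_def)
  qed
  finally show ?thesis by simp
qed

end

theorem theorem1p3:
  fixes m n :: nat
    and a :: "nat \<Rightarrow> nat"
    and x y :: "nat \<Rightarrow> real"
    and \<Omega> :: "nat \<Rightarrow> nat \<Rightarrow> nat"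
    and lam1 :: "nat \<Rightarrow> nat"
    and \<alpha> \<kappa> :: real
  assumes "m \<ge> 1" and "n \<ge> 1"
    and "\<forall>i\<ge>1. a i \<in> {0, 1}"
    and "\<forall>i\<ge>1. x i > 0 \<and> y i > 0"
    and "\<forall>i\<ge>1. \<forall>j\<ge>1. i mod n = j mod n \<longrightarrow> x i = x j \<and> y i = y j \<and> a i = a j"
    and "\<forall>i\<ge>1. \<forall>j\<le>n. i < j \<longrightarrow> x i > x j"
    and "\<forall>N\<ge>2. \<Omega> N 1 = 1 \<and> strict_mono_on {1..N} (\<Omega> N)"
    and "\<forall>N\<ge>2. boundary_partition N (\<Omega> N) = lam1 N # map (\<lambda>j. (m - 1) * (N - j)) [2..<N + 1]"
    and "\<forall>N\<ge>2. lam1 N \<ge> (m - 1) * (N - 2)"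
    and "\<alpha> > 1"
    and "(\<lambda>N. real (lam1 N) - \<alpha> * real N) \<in> O(\<lambda>_. 1)"
    and "0 < \<kappa>" and "\<kappa> < 1"
  shows "(\<exists>\<mu>. level_limit_measure \<Omega> a x y \<kappa> \<mu>) \<and>
    (\<forall>\<mu>. level_limit_measure \<Omega> a x y \<kappa> \<mu> \<longrightarrow>
      (\<forall>p\<ge>1. integrable \<mu> (\<lambda>t. t ^ p) \<and>
        (\<forall>\<gamma>. positive_contour_around \<gamma> (x_poles n x) (other_poles m n a x y) \<longrightarrow>
          complex_of_real (\<integral>t. t ^ p \<partial>\<mu>) =
            1 / (2 * (of_nat p + 1) * of_real pi * \<i>) *
              contour_integral \<gamma> (moment_integrand m n a x y \<kappa> p))))"
proof -
  interpret P: periodic_staircase m n a x y \<Omega> lam1 \<alpha> \<kappa> by (unfold_locales; use assms in blast)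
  obtain \<rho> where \<rho>: "discs m n x \<rho>"
    "!!k z. k \<in> {1..n} ==> z \<in> ball (complex_of_real (x k)) \<rho> ==> norm (etac P.T m z) <= P.R" by (rule P.radius_exists) (rule that)
  interpret D: discs m n x \<rho> by (rule \<rho>(1))
  interpret L: limit_staircase m n a x y \<Omega> lam1 \<alpha> \<kappa> \<rho> by unfold_locales (rule \<rho>(2))
  show ?thesis
  proof (intro conjI allI impI)
    show "\<exists>\<mu>. level_limit_measure \<Omega> a x y \<kappa> \<mu>" by (rule L.limit_exists)
  next
    fix \<mu> and p :: nat assume \<mu>: "level_limit_measure \<Omega> a x y \<kappa> \<mu>" and p: "1 <= p"
    interpret real_distribution \<mu> using \<mu> by (simp add: level_limit_measure_def weak_limit_in_prob_def)
    show "integrable \<mu> (%t. t ^ p)" by (rule integrable_AE_interval[OF L.limit_support[OF \<mu>]]) (intro continuous_intros)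
    fix \<gamma> assume \<gamma>: "positive_contour_around \<gamma> (x_poles n x) (other_poles m n a x y)"
    have "complex_of_real (\<integral>t. t ^ p \<partial>\<mu>) = D.circ (\<rho> / 4) (moment_integrand m n a x y \<kappa> p) / (of_nat p + 1)"
      unfolding L.moment_formula[OF \<mu>] L.moment_integrand_F[abs_def] ..
    moreover have "S / k = 1 / (2 * k * of_real pi * \<i>) * (2 * of_real pi * \<i> * S)" for S k :: complex by simp
    ultimately show "complex_of_real (\<integral>t. t ^ p \<partial>\<mu>) = 1 / (2 * (of_nat p + 1) * of_real pi * \<i>) *
              contour_integral \<gamma> (moment_integrand m n a x y \<kappa> p)"
      unfolding L.circ_residues[OF p] L.contour_residues[OF p \<gamma>] by metis
  qed
qed

end
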